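(* There exist a change of variables $a\leftrightarrow b$ of normal-form type transforming the Kuramoto--Sivashinsky ladder $$\dot a_k=k^2(1-\mu k^2)a_k-k\sum_{i=1}^{k-1}a_ia_{k-i}+2k\sum_{i=1}^\infty a_ia_{k+i},\qquad k=1,2,\dots$$ into a system $$\dot b_1=\lambda_1(\mu)b_1+\frac{4}{\lambda_2(\mu)}b_1^3+h_1(\mu,b),\qquad \dot b_k=\lambda_k(\mu)b_k+h_k(\mu,b),\quad k=2,3,\dots$$ (where $\lambda_k(\mu)=k^2(1-\mu k^2)$ and the $h_k$ satisfy the remainder bounds (RB) given in the context), and numbers $\frac12<\mu_+<1<\mu_-$, such that the system in the variables $b$, regarded as a family with parameter $\nu=\lambda_1(\mu)=1-\mu$, undergoes a pitchfork bifurcation on the interval $[\lambda_1(\mu_-),\lambda_1(\mu_+)]$.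
   Context: The ladder is the PDE $u_t=-\mu u_{xxxx}-u_{xx}+(u^2)_x$ with $u(t,x)=-u(t,-x)=u(t,x+2\pi)$, written via $u(t,x)=\sum_{k\ge1}-2a_k(t)\sin(kx)$. The phase space is $H=\ell^2$ (coordinates $a$, respectively $b$). Normal-form type change of variables: a composition of finitely many substitutions, each of which replaces a single coordinate $a_k$ by a new coordinate $b_k$ through $a_k=b_k+p(b)$, where $p$ is a polynomial in finitely many coordinates without constant or linear terms, with coefficients depending on $\mu$; it is used near the origin, where it is invertible and analytic. (RB): Let $S_C=[-\sqrt2\,C,\sqrt2\,C]\times\prod_{k\ge2}[-C^3/k^s,C^3/k^s]$, with $s$ a fixed sufficiently large exponent. There are $\bar C\in(0,1)$ and positive constants $\alpha_k,\beta_k$ ($k\ge1$), with $\alpha_k$ and $\beta_k$ independent of $k$ for all $k$ large, such that for all $\mu\ge\frac12$, $C\in(0,\bar C]$ we have on $S_C$: $|h_1|<\alpha_1C^5$; $|h_k|<\alpha_kC^4/k^{s-2}$ for $k\ge2$; $2|\partial h_1/\partial b_1|+\sum_{i\ne1}(|\partial h_1/\partial b_i|+|\partial h_i/\partial b_1|)<\beta_1C^3$; $2|\partial h_k/\partial b_k|+\sum_{i\neq k}(|\partial h_k/\partial b_i|+|\partial h_i/\partial b_k|)<\beta_k kC$ for $k\ge2$. Local semiflow: a continuous partial map $\varphi$ from $[0,\infty)\times H$ to $H$ such that $\varphi(\cdot,z)$ exists only on $[0,t_{\max}(z))$, $t_{\max}(z)\in[0,\infty]$, $\varphi(0,z)=z$,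 and $\varphi(t,\varphi(s,z))=\varphi(t+s,z)$ for $s,t>0$, $s+t<t_{\max}(z)$. The local semiflow $\varphi_\nu$ of a family $u'=F_\nu(u)$ is the one given by its solutions. Isolating cuboid: let $X_n\subset H$ be an $n$-dimensional subspace ($n\ge0$), $Y_n=X_n^\perp$, $P_n,P_n^\perp$ the orthogonal projections, $c_u:X_n\to\mathbb R^n$ a homeomorphism, $T\subset Y_n$ nonempty compact, $N=c_u^{-1}(\overline B(0,1))\oplus T$, $N^\varepsilon=c_u^{-1}(\overline B(0,1+\varepsilon))\oplus T$. $N$ is an $\varepsilon$-isolating cuboid for $\varphi$ if there is $t(\varepsilon)>0$ such that for every $s\in(0,t(\varepsilon)]$: (I0) if $z\in N^\varepsilon$ and $t_{\max}(z)<\infty$ then $\varphi(t,z)\notin N^\varepsilon$ for some $t>0$; (I1) $\varphi(s,N)\subset N^\varepsilon$; (I2) $\varphi(s,N^\varepsilon\setminus N)\cap N=\emptyset$. Trajectory in $N$ through $\bar z$: $z:I\to N$, $I\ni0$ an interval, $z(0)=\bar z$, $\varphi(s,z(t))=z(t+s)$ for $s\ge 0$, $t,t+s\in I$. It is full if $I=\mathbb R$. Hyperbolic fixed point: let $N$ be a product of compact nondegenerate coordinate intervals containing $z_0$ in the product of their interiors, $X_n$ ($0\le n<\infty$) a span of coordinate directions, $\mathcal Q(z)=\|P_nz\|^2-\|P_n^\perp z\|^2$, $z_0+Q^+=\{z\in N:\mathcal Q(z-z_0)>0\}$, $z_0+Q^-=\{z\in N:\mathcal Q(z-z_0)\le0\}$.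 A set $S\subset N$ is forward- (backward-) invariant relative to $N$ if for each trajectory $z$ in $N$ with $z(0)\in S$ and each $t>0$ ($t<0$) with $z([0,t])\subset N$ ($z([t,0])\subset N$), this piece lies in $S$. The fixed point $z_0$ is hyperbolic (with respect to $N$, $\mathcal Q$) if the sets $z_0+Q^+$ (when $n\geq 1$) and $z_0+Q^-$ are nonempty, $z_0+Q^{+}$ and $z_0+Q^-$ are respectively forward- and backward-invariant relative to $N$, and for some $A,B,\omega>0$: $\|P_n(\varphi(t,z)-z_0)\|\ge Ae^{\omega t}\|P_n(z-z_0)\|$ if $z\in z_0+Q^+$ and $\varphi([0,t],z)\subset N$; $\|P_n^\perp(\varphi(t,z)-z_0)\|\le Be^{-\omega t}\|P_n^\perp(z-z_0)\|$ if $\varphi([0,t],z)\subset z_0+Q^-$. "Hyperbolic" means hyperbolic for some such $N$, $n$. Maximal invariant set in $S$: the set $I\subset S$ such that $\bar z\in S$ belongs to $I$ iff there is a full trajectory in $S$ through $\bar z$ and every such full trajectory stays in $I$. A heteroclinic connection from $u$ to $v$ is a full trajectory tending to $u$ as $t\to-\infty$ and to $v$ as $t\to+\infty$. Pitchfork bifurcation: $u'=F_\nu(u)$ undergoes a pitchfork bifurcation on $[\nu_-,\nu_+]$, $\nu_-<0<\nu_+$, if there is a set $R$ that is an $\varepsilon$-isolating cuboid for $\varphi_\nu$ for each $\nu\in[\nu_-,\nu_+]$ such that: (P1) some $u_0\in R$ is a fixed point for all $\nu\in[\nu_-,\nu_+]$ and is hyperbolic for $\nu\ne0$; (P2) for $\nu\in[\nu_-,0]$,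 $\{u_0\}$ is the maximal invariant set in $R$; (P3) for $\nu\in(0,\nu_+]$ there are hyperbolic fixed points $u_-^\nu,u_+^\nu\in R$ different from $u_0$ and heteroclinic connections from $u_0$ to $u_-^\nu$ and to $u_+^\nu$ such that the set consisting of $u_0$, $u_\pm^\nu$ and the points of these connections is the maximal invariant set in $R$. *)

theory Defs
  imports "HOL-Analysis.Analysis" "HOL-Library.Multiset"
begin

section \<open>The phase space\<close>

text \<open>
  Sequences are indexed by \<open>k \<ge> 1\<close>; the dummy entry at index 0 is fixed to be 0, so that
  this is the usual space of square-summable sequences \<open>(a\<^sub>1, a\<^sub>2, \<dots>)\<close>.
\<close>

typedef ell2 = "{a :: nat \<Rightarrow> real. a 0 = 0 \<and> summable (\<lambda>k. (a k)\<^sup>2)}"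
  morphisms coord Abs_ell2
  by (rule exI[of _ "\<lambda>_. 0"]) simp

lemma coord_0 [simp]: "coord a 0 = 0"
  using coord[of a] by simp

lemma summable_coord_sq: "summable (\<lambda>k. (coord a k)\<^sup>2)"
  using coord[of a] by simp

lemma ell2_eqI: "(\<And>k. coord a k = coord b k) \<Longrightarrow> a = b"
  by (simp add: coord_inject[symmetric] fun_eq_iff)

lemma coord_Abs: "a 0 = 0 \<Longrightarrow> summable (\<lambda>k. (a k)\<^sup>2) \<Longrightarrow> coord (Abs_ell2 a) = a"
  by (simp add: Abs_ell2_inverse)

lemma summable_mult_of_squares:
  fixes x y :: "nat \<Rightarrow> real"
  assumes "summable (\<lambda>k. (x k)\<^sup>2)" "summable (\<lambda>k. (y k)\<^sup>2)"
  shows "summable (\<lambda>k. x k * y k)"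
proof (rule summable_comparison_test')
  show "summable (\<lambda>k. (x k)\<^sup>2 + (y k)\<^sup>2)" using assms by (rule summable_add)
  fix k
  have "0 \<le> (\<bar>x k\<bar> - \<bar>y k\<bar>)\<^sup>2" by simp
  then have "2 * (\<bar>x k\<bar> * \<bar>y k\<bar>) \<le> (x k)\<^sup>2 + (y k)\<^sup>2"
    by (simp add: power2_diff)
  moreover have "0 \<le> \<bar>x k\<bar> * \<bar>y k\<bar>" by simp
  ultimately show "norm (x k * y k) \<le> (x k)\<^sup>2 + (y k)\<^sup>2"
    unfolding real_norm_def abs_mult by linarith
qed

lemma summable_coord_mult: "summable (\<lambda>k. coord a k * coord b k)"
  by (intro summable_mult_of_squares summable_coord_sq)

lemma summable_square_add:
  fixes x y :: "nat \<Rightarrow> real"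
  assumes "summable (\<lambda>k. (x k)\<^sup>2)" "summable (\<lambda>k. (y k)\<^sup>2)"
  shows "summable (\<lambda>k. (x k + y k)\<^sup>2)"
proof -
  have "summable (\<lambda>k. (x k)\<^sup>2 + (y k)\<^sup>2 + 2 * (x k * y k))"
    by (intro summable_add summable_mult assms summable_mult_of_squares)
  then show ?thesis by (simp add: power2_sum mult.assoc)
qed

instantiation ell2 :: real_vector
begin

definition zero_ell2 :: ell2 where "0 = Abs_ell2 (\<lambda>_. 0)"
definition plus_ell2 :: "ell2 \<Rightarrow> ell2 \<Rightarrow> ell2"
  where "a + b = Abs_ell2 (\<lambda>k. coord a k + coord b k)"
definition uminus_ell2 :: "ell2 \<Rightarrow> ell2" where "- a = Abs_ell2 (\<lambda>k. - coord a k)"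
definition minus_ell2 :: "ell2 \<Rightarrow> ell2 \<Rightarrow> ell2"
  where "a - b = Abs_ell2 (\<lambda>k. coord a k - coord b k)"
definition scaleR_ell2 :: "real \<Rightarrow> ell2 \<Rightarrow> ell2"
  where "r *\<^sub>R a = Abs_ell2 (\<lambda>k. r * coord a k)"

lemma coord_zero [simp]: "coord 0 k = 0"
  by (simp add: zero_ell2_def coord_Abs)

lemma coord_plus [simp]: "coord (a + b) k = coord a k + coord b k"
  by (simp add: plus_ell2_def coord_Abs summable_square_add summable_coord_sq)

lemma coord_uminus [simp]: "coord (- a) k = - coord a k"
  by (simp add: uminus_ell2_def coord_Abs summable_coord_sq)

lemma coord_minus [simp]: "coord (a - b) k = coord a k - coord b k"
  using summable_square_add[OF summable_coord_sq[of a] summable_coord_sq[of "- b"]]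
  by (simp add: minus_ell2_def coord_Abs)

lemma coord_scaleR [simp]: "coord (r *\<^sub>R a) k = r * coord a k"
  by (simp add: scaleR_ell2_def coord_Abs power_mult_distrib summable_mult summable_coord_sq)

instance
proof
  fix a b c :: ell2 and r s :: real
  show "a + b + c = a + (b + c)" "a + b = b + a" "0 + a = a" "- a + a = 0" "a - b = a + - b"
    "r *\<^sub>R (a + b) = r *\<^sub>R a + r *\<^sub>R b" "(r + s) *\<^sub>R a = r *\<^sub>R a + s *\<^sub>R a"
    "r *\<^sub>R s *\<^sub>R a = (r * s) *\<^sub>R a" "1 *\<^sub>R a = a"
    by (auto intro!: ell2_eqI simp: algebra_simps)
qed

end

text \<open>
  Auxiliary names, since the overloaded constants cannot be used on the right-hand sides of their
  own defining equations in the instantiation.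
\<close>

definition ell2_norm :: "ell2 \<Rightarrow> real" where "ell2_norm a = sqrt (\<Sum>k. (coord a k)\<^sup>2)"
definition ell2_uniformity :: "(ell2 \<times> ell2) filter"
  where "ell2_uniformity = (INF e\<in>{0<..}. principal {(x, y). ell2_norm (x - y) < e})"

instantiation ell2 :: real_inner
begin

definition inner_ell2 :: "ell2 \<Rightarrow> ell2 \<Rightarrow> real"
  where "a \<bullet> b = (\<Sum>k. coord a k * coord b k)"
definition norm_ell2 :: "ell2 \<Rightarrow> real" where "norm a = ell2_norm a"
definition sgn_ell2 :: "ell2 \<Rightarrow> ell2" where "sgn a = inverse (ell2_norm a) *\<^sub>R a"
definition dist_ell2 :: "ell2 \<Rightarrow> ell2 \<Rightarrow> real" where "dist a b = ell2_norm (a - b)"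
definition uniformity_ell2 :: "(ell2 \<times> ell2) filter" where "uniformity = ell2_uniformity"
definition open_ell2 :: "ell2 set \<Rightarrow> bool"
  where "open U \<longleftrightarrow> (\<forall>x\<in>U. \<forall>\<^sub>F (x', y) in ell2_uniformity. x' = x \<longrightarrow> y \<in> U)"

instance
proof
  fix a b c :: ell2 and r :: real
  show "sgn a = inverse (norm a) *\<^sub>R a" by (simp add: sgn_ell2_def norm_ell2_def)
  show "dist a b = norm (a - b)" by (simp add: dist_ell2_def norm_ell2_def)
  show "(uniformity :: (ell2 \<times> ell2) filter) = (INF e\<in>{0<..}. principal {(x, y). dist x y < e})"
    by (simp add: uniformity_ell2_def ell2_uniformity_def dist_ell2_def)
  show "open U \<longleftrightarrow> (\<forall>x\<in>U. \<forall>\<^sub>F (x', y) in uniformity. x' = x \<longrightarrow> y \<in> U)" for U :: "ell2 set"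
    by (simp add: open_ell2_def uniformity_ell2_def)
  show "a \<bullet> b = b \<bullet> a" by (simp add: inner_ell2_def mult.commute)
  show "(a + b) \<bullet> c = a \<bullet> c + b \<bullet> c"
    by (simp add: inner_ell2_def distrib_right suminf_add[OF summable_coord_mult summable_coord_mult])
  show "(r *\<^sub>R a) \<bullet> b = r * (a \<bullet> b)"
    by (simp add: inner_ell2_def mult.assoc suminf_mult[OF summable_coord_mult])
  show "0 \<le> a \<bullet> a"
    unfolding inner_ell2_def by (rule suminf_nonneg[OF summable_coord_mult]) simp
  show "a \<bullet> a = 0 \<longleftrightarrow> a = 0"
  proof
    assume "a \<bullet> a = 0"
    then have "\<forall>k. coord a k * coord a k = 0"
      unfolding inner_ell2_def using suminf_eq_zero_iff[OF summable_coord_mult[of a a]] by simp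
    then show "a = 0" by (auto intro: ell2_eqI)
  qed (simp add: inner_ell2_def)
  show "norm a = sqrt (a \<bullet> a)" by (simp add: norm_ell2_def ell2_norm_def inner_ell2_def power2_eq_square)
qed

end

definition unit_vec :: "nat \<Rightarrow> ell2"
  where "unit_vec k = Abs_ell2 (\<lambda>i. if i = k \<and> 1 \<le> k then 1 else 0)"

text \<open>For \<open>J \<subseteq> {1..}\<close>, the orthogonal projection onto the (closed) span of the coordinate
  directions in \<open>J\<close>.\<close>

definition coord_proj :: "nat set \<Rightarrow> ell2 \<Rightarrow> ell2"
  where "coord_proj J z = Abs_ell2 (\<lambda>i. if i \<in> J then coord z i else 0)"

lemma coord_unit_vec: "coord (unit_vec k) i = (if i = k \<and> 1 \<le> k then 1 else 0)"
proof -
  have "summable (\<lambda>i. (if i = k \<and> 1 \<le> k then 1 else 0 :: real)\<^sup>2)"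
    by (rule summable_finite[of "{k}"]) auto
  then show ?thesis unfolding unit_vec_def by (subst coord_Abs) auto
qed

lemma coord_coord_proj: "coord (coord_proj J z) i = (if i \<in> J then coord z i else 0)"
proof -
  have "summable (\<lambda>i. (if i \<in> J then coord z i else 0)\<^sup>2)"
    by (rule summable_comparison_test'[OF summable_coord_sq[of z]]) auto
  then show ?thesis unfolding coord_proj_def by (subst coord_Abs) auto
qed

section \<open>Systems of ordinary differential equations on the phase space\<close>

text \<open>
  A right-hand side is a map \<open>F\<close> giving for each point the sequence of velocities of the
  coordinates \<open>k \<ge> 1\<close>. Its values need not be square-summable (the operators here are unbounded).
\<close>

type_synonym vfield = "ell2 \<Rightarrow> nat \<Rightarrow> real"

definition lam :: "nat \<Rightarrow> real \<Rightarrow> real"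
  where "lam k \<mu> = (real k)\<^sup>2 * (1 - \<mu> * (real k)\<^sup>2)"

definition KS_ladder :: "real \<Rightarrow> vfield"
  where "KS_ladder \<mu> a k =
    lam k \<mu> * coord a k
    - real k * (\<Sum>i=1..k-1. coord a i * coord a (k - i))
    + 2 * real k * (\<Sum>\<^sub>\<infinity>i\<in>{1..}. coord a i * coord a (k + i))"

definition normalized_system :: "(real \<Rightarrow> vfield) \<Rightarrow> real \<Rightarrow> vfield"
  where "normalized_system h \<mu> b k =
    lam k \<mu> * coord b k + (if k = 1 then 4 / lam 2 \<mu> * (coord b 1) ^ 3 else 0) + h \<mu> b k"

definition partial_deriv :: "(ell2 \<Rightarrow> real) \<Rightarrow> nat \<Rightarrow> ell2 \<Rightarrow> real"
  where "partial_deriv f i b = deriv (\<lambda>t. f (b + t *\<^sub>R unit_vec i)) 0"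

section \<open>Changes of variables of normal-form type\<close>

text \<open>
  A substitution \<open>(k, M, c)\<close> stands for \<open>a\<^sub>k = b\<^sub>k + p(b)\<close>, the other coordinates being
  unchanged. The polynomial \<open>p\<close> has the finite set \<open>M\<close> of monomials, with the coefficient
  \<open>c \<mu> m\<close> at the monomial \<open>m\<close>. A monomial is the multiset of the indices of its factors, so its
  degree is its size.
\<close>

type_synonym subst = "nat \<times> nat multiset set \<times> (real \<Rightarrow> nat multiset \<Rightarrow> real)"

fun nf_subst :: "subst \<Rightarrow> bool"
  where "nf_subst (k, M, c) \<longleftrightarrow> 1 \<le> k \<and> finite M \<and> (\<forall>m\<in>M. 2 \<le> size m \<and> 0 \<notin># m)"

fun subst_map :: "real \<Rightarrow> subst \<Rightarrow> ell2 \<Rightarrow> ell2"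
  where "subst_map \<mu> (k, M, c) b = b + (\<Sum>m\<in>M. c \<mu> m * (\<Prod>i\<in>#m. coord b i)) *\<^sub>R unit_vec k"

text \<open>The old variables \<open>a\<close> as a function of the new variables \<open>b\<close>.\<close>

definition nf_map :: "subst list \<Rightarrow> real \<Rightarrow> ell2 \<Rightarrow> ell2"
  where "nf_map \<sigma>s \<mu> = foldr (\<lambda>\<sigma> f. subst_map \<mu> \<sigma> \<circ> f) \<sigma>s id"

text \<open>
  Analyticity between normed spaces: locally, \<open>f (x + v)\<close> is the sum of \<open>M\<^sub>n(v, \<dots>, v)\<close> with
  bounded \<open>n\<close>-linear maps \<open>M\<^sub>n\<close> such that \<open>\<Sum> \<parallel>M\<^sub>n\<parallel> r\<^sup>n < \<infinity>\<close>. Here \<open>M\<^sub>n\<close> is \<open>M\<close> on lists of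
  length \<open>n\<close>.
\<close>

definition analytic_map_on ::
  "('a::real_normed_vector \<Rightarrow> 'b::real_normed_vector) \<Rightarrow> 'a set \<Rightarrow> bool"
  where "analytic_map_on f S \<longleftrightarrow>
    (\<forall>x\<in>S. \<exists>r>0. \<exists>(M :: 'a list \<Rightarrow> 'b) (K :: nat \<Rightarrow> real).
      (\<forall>vs i. i < length vs \<longrightarrow> linear (\<lambda>v. M (vs[i := v]))) \<and>
      (\<forall>vs. norm (M vs) \<le> K (length vs) * prod_list (map norm vs)) \<and>
      summable (\<lambda>n. K n * r ^ n) \<and>
      (\<forall>v. norm v < r \<longrightarrow> (\<lambda>n. M (replicate n v)) sums f (x + v)))"

definition analytic_diffeo_on ::
  "('a::real_normed_vector \<Rightarrow> 'b::real_normed_vector) \<Rightarrow> 'a set \<Rightarrow> bool"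
  where "analytic_diffeo_on f U \<longleftrightarrow>
    inj_on f U \<and> open (f ` U) \<and> analytic_map_on f U \<and> analytic_map_on (inv_into U f) (f ` U)"

text \<open>
  The change of variables \<open>a = \<Phi> b\<close>, \<open>b \<in> U\<close>, transforms \<open>a' = G(a)\<close> into \<open>b' = F(b)\<close>:
  \<open>D\<Phi>(b) F(b) = G(\<Phi>(b))\<close>. For a map \<open>\<Phi>\<close> of normal-form type, each component of \<open>\<Phi>\<close> depends on
  finitely many coordinates only, so only finitely many terms of the sum are nonzero.
\<close>

definition transforms_into :: "(ell2 \<Rightarrow> ell2) \<Rightarrow> ell2 set \<Rightarrow> vfield \<Rightarrow> vfield \<Rightarrow> bool"
  where "transforms_into \<Phi> U G F \<longleftrightarrow>
    (\<forall>b\<in>U. \<forall>k\<ge>1.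
      ((\<lambda>i. partial_deriv (\<lambda>x. coord (\<Phi> x) k) i b * F b i) has_sum G (\<Phi> b) k) {1..})"

section \<open>Remainder bounds\<close>

definition S_box :: "real \<Rightarrow> real \<Rightarrow> ell2 set"
  where "S_box s C = {b. \<bar>coord b 1\<bar> \<le> sqrt 2 * C \<and>
    (\<forall>k\<ge>2. \<bar>coord b k\<bar> \<le> C ^ 3 / real k powr s)}"

text \<open>\<open>2 |\<partial>h\<^sub>k/\<partial>b\<^sub>k| + \<Sum>\<^sub>i\<^sub>\<noteq>\<^sub>k (|\<partial>h\<^sub>k/\<partial>b\<^sub>i| + |\<partial>h\<^sub>i/\<partial>b\<^sub>k|) < B\<close>, including convergence of the series.\<close>

definition jacobian_bound :: "vfield \<Rightarrow> ell2 \<Rightarrow> nat \<Rightarrow> real \<Rightarrow> bool"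
  where "jacobian_bound g b k B \<longleftrightarrow>
    (let D = (\<lambda>j i. \<bar>partial_deriv (\<lambda>x. g x j) i b\<bar>) in
      (\<lambda>i. D k i + D i k) summable_on ({1..} - {k}) \<and>
      2 * D k k + (\<Sum>\<^sub>\<infinity>i\<in>{1..} - {k}. D k i + D i k) < B)"

text \<open>\<open>U\<close> is the open domain on which \<open>h\<close> is the remainder of the transformed system.\<close>

definition remainder_bounds :: "real \<Rightarrow> ell2 set \<Rightarrow> (real \<Rightarrow> vfield) \<Rightarrow> bool"
  where "remainder_bounds s U h \<longleftrightarrow>
    (\<exists>Cbar (\<alpha> :: nat \<Rightarrow> real) (\<beta> :: nat \<Rightarrow> real).
      0 < Cbar \<and> Cbar < 1 \<and>
      (\<forall>k\<ge>1. 0 < \<alpha> k \<and> 0 < \<beta> k) \<and>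
      (\<exists>K. \<forall>k\<ge>K. \<alpha> k = \<alpha> K \<and> \<beta> k = \<beta> K) \<and>
      (\<forall>\<mu> \<ge> 1/2. \<forall>C. 0 < C \<and> C \<le> Cbar \<longrightarrow>
        S_box s C \<subseteq> U \<and>
        (\<forall>b \<in> S_box s C.
          (\<forall>k\<ge>1. \<forall>i\<ge>1. (\<lambda>t. h \<mu> (b + t *\<^sub>R unit_vec i) k) differentiable (at 0)) \<and>
          \<bar>h \<mu> b 1\<bar> < \<alpha> 1 * C ^ 5 \<and>
          (\<forall>k\<ge>2. \<bar>h \<mu> b k\<bar> < \<alpha> k * C ^ 4 / real k powr (s - 2)) \<and>
          jacobian_bound (h \<mu>) b 1 (\<beta> 1 * C ^ 3) \<and>
          (\<forall>k\<ge>2. jacobian_bound (h \<mu>) b k (\<beta> k * real k * C)))))"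

section \<open>Local semiflows\<close>

text \<open>
  A partial map is given by a total map \<open>\<phi>\<close> and the existence time \<open>tmax\<close>; values of \<open>\<phi> t z\<close>
  with \<open>t \<ge> tmax z\<close> are meaningless. If \<open>tmax z = 0\<close> then \<open>\<phi> t z\<close> is undefined for all \<open>t\<close>.
\<close>

definition local_semiflow :: "(real \<Rightarrow> ell2 \<Rightarrow> ell2) \<Rightarrow> (ell2 \<Rightarrow> ereal) \<Rightarrow> bool"
  where "local_semiflow \<phi> tmax \<longleftrightarrow>
    (\<forall>z. 0 \<le> tmax z) \<and>
    continuous_on {(t, z). 0 \<le> t \<and> ereal t < tmax z} (\<lambda>(t, z). \<phi> t z) \<and>
    (\<forall>z. 0 < tmax z \<longrightarrow> \<phi> 0 z = z) \<and>
    (\<forall>z s t. 0 < s \<and> 0 < t \<and> ereal (s + t) < tmax z \<longrightarrow>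
      ereal t < tmax (\<phi> s z) \<and> \<phi> t (\<phi> s z) = \<phi> (t + s) z)"

definition solution_on :: "ell2 set \<Rightarrow> vfield \<Rightarrow> ereal \<Rightarrow> (real \<Rightarrow> ell2) \<Rightarrow> bool"
  where "solution_on U F T u \<longleftrightarrow>
    (let D = {t. 0 \<le> t \<and> ereal t < T} in
      continuous_on D u \<and> u ` D \<subseteq> U \<and>
      (\<forall>t\<in>D. \<forall>k\<ge>1. ((\<lambda>t. coord (u t) k) has_real_derivative F (u t) k) (at t within D)))"

text \<open>\<open>(\<phi>, tmax)\<close> consists of the maximal (unique) solutions of \<open>u' = F(u)\<close> in the domain \<open>U\<close>.\<close>

definition semiflow_of ::
  "ell2 set \<Rightarrow> vfield \<Rightarrow> (real \<Rightarrow> ell2 \<Rightarrow> ell2) \<Rightarrow> (ell2 \<Rightarrow> ereal) \<Rightarrow> bool"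
  where "semiflow_of U F \<phi> tmax \<longleftrightarrow>
    local_semiflow \<phi> tmax \<and>
    (\<forall>z. z \<notin> U \<longrightarrow> tmax z = 0) \<and>
    (\<forall>z\<in>U. solution_on U F (tmax z) (\<lambda>t. \<phi> t z) \<and>
      (\<forall>T u. 0 < T \<and> solution_on U F T u \<and> u 0 = z \<longrightarrow>
        T \<le> tmax z \<and> (\<forall>t. 0 \<le> t \<and> ereal t < T \<longrightarrow> u t = \<phi> t z)))"

definition fixed_point ::
  "(real \<Rightarrow> ell2 \<Rightarrow> ell2) \<Rightarrow> (ell2 \<Rightarrow> ereal) \<Rightarrow> ell2 \<Rightarrow> bool"
  where "fixed_point \<phi> tmax z \<longleftrightarrow> tmax z = \<infinity> \<and> (\<forall>t\<ge>0. \<phi> t z = z)"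

text \<open>\<open>z\<close> restricted to the interval \<open>I\<close> is a trajectory in \<open>N\<close> through \<open>z 0\<close>.\<close>

definition trajectory ::
  "(real \<Rightarrow> ell2 \<Rightarrow> ell2) \<Rightarrow> (ell2 \<Rightarrow> ereal) \<Rightarrow> ell2 set \<Rightarrow> real set \<Rightarrow> (real \<Rightarrow> ell2) \<Rightarrow> bool"
  where "trajectory \<phi> tmax N I z \<longleftrightarrow>
    is_interval I \<and> 0 \<in> I \<and> z ` I \<subseteq> N \<and>
    (\<forall>s t. 0 \<le> s \<and> t \<in> I \<and> t + s \<in> I \<longrightarrow> ereal s < tmax (z t) \<and> \<phi> s (z t) = z (t + s))"

text \<open>
  The defining condition of the maximal invariant set is also satisfied by smaller sets (for
  example by the empty set); the maximal invariant set is the largest set satisfying it.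
\<close>

definition invariant_in ::
  "(real \<Rightarrow> ell2 \<Rightarrow> ell2) \<Rightarrow> (ell2 \<Rightarrow> ereal) \<Rightarrow> ell2 set \<Rightarrow> ell2 set \<Rightarrow> bool"
  where "invariant_in \<phi> tmax S I \<longleftrightarrow>
    I \<subseteq> S \<and>
    (\<forall>x\<in>S. x \<in> I \<longleftrightarrow>
      (\<exists>z. trajectory \<phi> tmax S UNIV z \<and> z 0 = x) \<and>
      (\<forall>z. trajectory \<phi> tmax S UNIV z \<and> z 0 = x \<longrightarrow> range z \<subseteq> I))"

definition maximal_invariant_set ::
  "(real \<Rightarrow> ell2 \<Rightarrow> ell2) \<Rightarrow> (ell2 \<Rightarrow> ereal) \<Rightarrow> ell2 set \<Rightarrow> ell2 set \<Rightarrow> bool"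
  where "maximal_invariant_set \<phi> tmax S I \<longleftrightarrow>
    invariant_in \<phi> tmax S I \<and> (\<forall>J. invariant_in \<phi> tmax S J \<longrightarrow> J \<subseteq> I)"

definition heteroclinic ::
  "(real \<Rightarrow> ell2 \<Rightarrow> ell2) \<Rightarrow> (ell2 \<Rightarrow> ereal) \<Rightarrow> ell2 \<Rightarrow> ell2 \<Rightarrow> (real \<Rightarrow> ell2) \<Rightarrow> bool"
  where "heteroclinic \<phi> tmax u v z \<longleftrightarrow>
    trajectory \<phi> tmax UNIV UNIV z \<and> (z \<longlongrightarrow> u) at_bot \<and> (z \<longlongrightarrow> v) at_top"

section \<open>Isolating cuboids\<close>

text \<open>\<open>\<real>\<^sup>n\<close> is represented by the topology \<open>Euclidean_space n\<close> on functions vanishing from \<open>n\<close> on.\<close>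

definition cuboid_data :: "nat \<Rightarrow> ell2 set \<Rightarrow> (ell2 \<Rightarrow> nat \<Rightarrow> real) \<Rightarrow> ell2 set \<Rightarrow> bool"
  where "cuboid_data n X c T \<longleftrightarrow>
    (\<exists>B. finite B \<and> card B = n \<and> independent B \<and> span B = X) \<and>
    homeomorphic_map (top_of_set X) (Euclidean_space n) c \<and>
    T \<noteq> {} \<and> compact T \<and> T \<subseteq> orthogonal_comp X"

text \<open>The set \<open>c\<^sup>-\<^sup>1(B) \<oplus> T\<close> for the closed ball \<open>B\<close> of radius \<open>r\<close> around 0 in \<open>\<real>\<^sup>n\<close>.\<close>

definition cuboid :: "nat \<Rightarrow> ell2 set \<Rightarrow> (ell2 \<Rightarrow> nat \<Rightarrow> real) \<Rightarrow> ell2 set \<Rightarrow> real \<Rightarrow> ell2 set"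
  where "cuboid n X c T r = {x + y | x y. x \<in> X \<and> L2_set (c x) {..<n} \<le> r \<and> y \<in> T}"

definition isolating_cuboid ::
  "(real \<Rightarrow> ell2 \<Rightarrow> ell2) \<Rightarrow> (ell2 \<Rightarrow> ereal) \<Rightarrow> real \<Rightarrow>
    nat \<Rightarrow> ell2 set \<Rightarrow> (ell2 \<Rightarrow> nat \<Rightarrow> real) \<Rightarrow> ell2 set \<Rightarrow> bool"
  where "isolating_cuboid \<phi> tmax \<epsilon> n X c T \<longleftrightarrow>
    cuboid_data n X c T \<and>
    (let N = cuboid n X c T 1; N' = cuboid n X c T (1 + \<epsilon>) in
      (\<exists>t0>0. \<forall>s. 0 < s \<and> s \<le> t0 \<longrightarrow>
        (\<forall>z\<in>N'. tmax z < \<infinity> \<longrightarrow> (\<exists>t>0. ereal t < tmax z \<and> \<phi> t z \<notin> N')) \<and>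
        (\<forall>z\<in>N. ereal s < tmax z \<and> \<phi> s z \<in> N') \<and>
        (\<forall>z\<in>N' - N. ereal s < tmax z \<longrightarrow> \<phi> s z \<notin> N)))"

section \<open>Hyperbolic fixed points\<close>

definition forward_invariant ::
  "(real \<Rightarrow> ell2 \<Rightarrow> ell2) \<Rightarrow> (ell2 \<Rightarrow> ereal) \<Rightarrow> ell2 set \<Rightarrow> ell2 set \<Rightarrow> bool"
  where "forward_invariant \<phi> tmax N S \<longleftrightarrow>
    (\<forall>I z t. trajectory \<phi> tmax N I z \<and> z 0 \<in> S \<and> 0 < t \<and> {0..t} \<subseteq> I \<longrightarrow> z ` {0..t} \<subseteq> S)"

definition backward_invariant ::
  "(real \<Rightarrow> ell2 \<Rightarrow> ell2) \<Rightarrow> (ell2 \<Rightarrow> ereal) \<Rightarrow> ell2 set \<Rightarrow> ell2 set \<Rightarrow> bool"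
  where "backward_invariant \<phi> tmax N S \<longleftrightarrow>
    (\<forall>I z t. trajectory \<phi> tmax N I z \<and> z 0 \<in> S \<and> t < 0 \<and> {t..0} \<subseteq> I \<longrightarrow> z ` {t..0} \<subseteq> S)"

text \<open>
  \<open>N\<close> is a product of compact nondegenerate intervals, contained in the phase space, and \<open>z0\<close>
  lies in the product of their interiors.
\<close>

definition box_around :: "ell2 \<Rightarrow> ell2 set \<Rightarrow> bool"
  where "box_around z0 N \<longleftrightarrow>
    (\<exists>l r :: nat \<Rightarrow> real.
      (\<forall>k\<ge>1. l k < coord z0 k \<and> coord z0 k < r k) \<and>
      (\<forall>x. (\<forall>k\<ge>1. l k \<le> x k \<and> x k \<le> r k) \<longrightarrow> summable (\<lambda>k. (x k)\<^sup>2)) \<and>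
      N = {z. \<forall>k\<ge>1. l k \<le> coord z k \<and> coord z k \<le> r k})"

definition Qform :: "nat set \<Rightarrow> ell2 \<Rightarrow> real"
  where "Qform J z = (norm (coord_proj J z))\<^sup>2 - (norm (z - coord_proj J z))\<^sup>2"

text \<open>\<open>J\<close> is the finite set of coordinate directions spanning \<open>X\<^sub>n\<close>, with \<open>n = card J\<close>.\<close>

definition hyperbolic_wrt ::
  "(real \<Rightarrow> ell2 \<Rightarrow> ell2) \<Rightarrow> (ell2 \<Rightarrow> ereal) \<Rightarrow> ell2 set \<Rightarrow> nat set \<Rightarrow> ell2 \<Rightarrow> bool"
  where "hyperbolic_wrt \<phi> tmax N J z0 \<longleftrightarrow>
    (let Qp = {z\<in>N. Qform J (z - z0) > 0};
         Qm = {z\<in>N. Qform J (z - z0) \<le> 0};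
         P = coord_proj J; P' = (\<lambda>z. z - coord_proj J z)
     in
      (J \<noteq> {} \<longrightarrow> Qp \<noteq> {}) \<and> Qm \<noteq> {} \<and>
      forward_invariant \<phi> tmax N Qp \<and> backward_invariant \<phi> tmax N Qm \<and>
      (\<exists>A>0. \<exists>B>0. \<exists>\<omega>>0.
        (\<forall>z t. z \<in> Qp \<and> 0 \<le> t \<and> ereal t < tmax z \<and> (\<forall>s\<in>{0..t}. \<phi> s z \<in> N) \<longrightarrow>
          norm (P (\<phi> t z - z0)) \<ge> A * exp (\<omega> * t) * norm (P (z - z0))) \<and>
        (\<forall>z t. 0 \<le> t \<and> ereal t < tmax z \<and> (\<forall>s\<in>{0..t}. \<phi> s z \<in> Qm) \<longrightarrow>
          norm (P' (\<phi> t z - z0)) \<le> B * exp (- \<omega> * t) * norm (P' (z - z0)))))"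

definition hyperbolic_fixed_point ::
  "(real \<Rightarrow> ell2 \<Rightarrow> ell2) \<Rightarrow> (ell2 \<Rightarrow> ereal) \<Rightarrow> ell2 \<Rightarrow> bool"
  where "hyperbolic_fixed_point \<phi> tmax z0 \<longleftrightarrow>
    fixed_point \<phi> tmax z0 \<and>
    (\<exists>N J. box_around z0 N \<and> finite J \<and> J \<subseteq> {1..} \<and> hyperbolic_wrt \<phi> tmax N J z0)"

section \<open>Pitchfork bifurcation\<close>

text \<open>The family \<open>u' = F\<^sub>\<nu>(u)\<close> is considered on the domain \<open>U\<close>.\<close>

definition pitchfork :: "ell2 set \<Rightarrow> (real \<Rightarrow> vfield) \<Rightarrow> real \<Rightarrow> real \<Rightarrow> bool"
  where "pitchfork U F \<nu>m \<nu>p \<longleftrightarrow>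
    \<nu>m < 0 \<and> 0 < \<nu>p \<and>
    (\<exists>\<phi> tmax \<epsilon> n X c T u0.
      (\<forall>\<nu>\<in>{\<nu>m..\<nu>p}. semiflow_of U (F \<nu>) (\<phi> \<nu>) (tmax \<nu>)) \<and>
      0 < \<epsilon> \<and>
      (\<forall>\<nu>\<in>{\<nu>m..\<nu>p}. isolating_cuboid (\<phi> \<nu>) (tmax \<nu>) \<epsilon> n X c T) \<and>
      (let R = cuboid n X c T 1 in
        u0 \<in> R \<and>
        (\<forall>\<nu>\<in>{\<nu>m..\<nu>p}. fixed_point (\<phi> \<nu>) (tmax \<nu>) u0) \<and>
        (\<forall>\<nu>\<in>{\<nu>m..\<nu>p} - {0}. hyperbolic_fixed_point (\<phi> \<nu>) (tmax \<nu>) u0) \<and>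
        (\<forall>\<nu>\<in>{\<nu>m..0}. maximal_invariant_set (\<phi> \<nu>) (tmax \<nu>) R {u0}) \<and>
        (\<forall>\<nu>\<in>{0<..\<nu>p}. \<exists>um up zm zp.
          um \<in> R \<and> up \<in> R \<and> um \<noteq> u0 \<and> up \<noteq> u0 \<and> um \<noteq> up \<and>
          hyperbolic_fixed_point (\<phi> \<nu>) (tmax \<nu>) um \<and>
          hyperbolic_fixed_point (\<phi> \<nu>) (tmax \<nu>) up \<and>
          heteroclinic (\<phi> \<nu>) (tmax \<nu>) u0 um zm \<and>
          heteroclinic (\<phi> \<nu>) (tmax \<nu>) u0 up zp \<and>
          maximal_invariant_set (\<phi> \<nu>) (tmax \<nu>) R ({u0, um, up} \<union> range zm \<union> range zp))))"

end

theory Submission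
  imports Defs "HOL-Real_Asymp.Real_Asymp"
begin

text \<open>
  Four substitutions remove the terms \<open>b\<^sub>1\<^sup>2\<close>, \<open>b\<^sub>1 b\<^sub>2\<close>, \<open>b\<^sub>1\<^sup>3\<close>, \<open>b\<^sub>1\<^sup>2 b\<^sub>3\<close> that are too large for the remainder bounds.
  On the box \<open>S\<^sub>C\<close> the first equation is then \<open>b\<^sub>1' = \<nu> b\<^sub>1 - \<kappa> b\<^sub>1\<^sup>3 + O(C\<^sup>5)\<close> with \<open>\<kappa> > 0\<close>, while the coordinates
  \<open>b\<^sub>k\<close>, \<open>k \<ge> 2\<close>, are damped at a rate of order \<open>k\<^sup>4\<close>, which dominates the loss of one derivative in \<open>h\<^sub>k\<close>; \<open>S\<^sub>C\<close> is
  forward invariant if \<open>\<nu> \<le> \<kappa> C\<^sup>2\<close>, so a fixed box is an isolating cuboid with \<open>n = 0\<close>.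

  Let \<open>Q(w) = w\<^sub>1\<^sup>2 - \<Sum>\<^sub>k\<^sub>\<ge>\<^sub>2 w\<^sub>k\<^sup>2\<close>. For the difference \<open>w\<close> of two solutions, \<open>Q(w)\<close> can only become negative if it was
  negative before, and in this case \<open>\<Sum>\<^sub>k\<^sub>\<ge>\<^sub>2 w\<^sub>k\<^sup>2\<close> has decayed exponentially. Hence two full trajectories with the same
  first coordinate at one time coincide. A full trajectory in \<open>S\<^sub>C\<close>, \<open>\<nu> \<le> \<kappa> C\<^sup>2\<close>, lies in \<open>S\<^sub>0\<^sub>.\<^sub>9\<^sub>C\<close>, because at a larger
  value a coordinate would decrease at a positive rate in all of the past. For \<open>\<nu> \<le> 0\<close> only the zero trajectory
  remains, and for \<open>\<nu> > 0\<close> all full trajectories lie in \<open>S\<^sub>\<rho>\<close>, \<open>\<rho> = \<surd>(\<nu>/\<kappa>)\<close>. There the flow contracts the part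
  \<open>\<bar>b\<^sub>1\<bar> \<ge> \<rho>/\<surd>2\<close>, which gives one fixed point on each side, and \<open>\<bar>b\<^sub>1\<bar>\<close> grows exponentially along \<open>Q > 0\<close> in
  \<open>\<bar>b\<^sub>1\<bar> \<le> \<rho>/\<surd>2\<close>. The images of \<open>S\<^sub>\<rho>\<close> under the flow are connected and contain the fixed points, so each of them meets
  \<open>b\<^sub>1 = \<plusminus>\<rho>/\<surd>2\<close>, and a point in the intersection of all of them lies on a connecting orbit. It is unique by the cone
  argument.
\<close>

section \<open>Analytic maps between normed spaces\<close>

text \<open>The linear part grows like k^4, so the field is not Lipschitz on the phase space, and
  neither classical existence theory nor linearisation at a fixed point applies directly. Everything
  is derived from two sources: variation of constants in each coordinate, where damping of order k^4
  pays for the factor k of the nonlinearity, and differential inequalities for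
  \<open>(coord w 1)^2\<close> and \<open>Yp w\<close> along the difference w of two solutions. The
  sign of Q replaces spectra and invariant manifolds.

  The width C of the box in the first coordinate is the scale at which \<nu> b_1 and \<kappa> b_1^3
  balance; both are then of order C^3, and an error C^5 is smaller by the factor C^2. Orders in C
  are not tracked by hand: every term of the remainder carries a size exponent and two Lipschitz
  exponents, computed by sum and product rules.

  The threshold \<rho>/sqrt 2 is chosen because the divided difference of \<nu> x - \<kappa> x^3
  between 0 and a point below it is at least \<nu>/2, while between two points beyond it on the same
  side it is at most -\<nu>/2.\<close>

definition power_series_at ::
  "real \<Rightarrow> ('a::real_normed_vector list \<Rightarrow> 'b::real_normed_vector) \<Rightarrow> (nat \<Rightarrow> real) \<Rightarrow> ('a \<Rightarrow> 'b) \<Rightarrow> 'a \<Rightarrow> bool"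
  where "power_series_at r M K f x \<longleftrightarrow>
    (\<forall>vs i. i < length vs \<longrightarrow> linear (\<lambda>v. M (vs[i := v]))) \<and>
    (\<forall>vs. norm (M vs) \<le> K (length vs) * prod_list (map norm vs)) \<and>
    (\<forall>n. 0 \<le> K n) \<and> summable (\<lambda>n. K n * r ^ n) \<and>
    (\<forall>v. norm v < r \<longrightarrow> (\<lambda>n. M (replicate n v)) sums f (x + v))"

definition analytic_at_point :: "('a::real_normed_vector \<Rightarrow> 'b::real_normed_vector) \<Rightarrow> 'a \<Rightarrow> bool"
  where "analytic_at_point f x \<longleftrightarrow> (\<exists>r>0. \<exists>M K. power_series_at r M K f x)"

text \<open>\<open>power_series_at\<close> adds \<open>0 \<le> K n\<close> to the conditions of
  \<open>analytic_map_on\<close>, so that majorants can be multiplied and compared term by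
  term.\<close>

lemma analytic_map_onI: "(\<And>x. x \<in> S \<Longrightarrow> analytic_at_point f x) \<Longrightarrow> analytic_map_on f S"
  unfolding analytic_map_on_def analytic_at_point_def power_series_at_def by meson

lemma power_series_at_shrink:
  assumes "power_series_at r M K f x" "0 < r'" "r' \<le> r"
  shows "power_series_at r' M K f x"
proof -
  have "summable (\<lambda>n. K n * r' ^ n)"
  proof (rule summable_comparison_test'[of "\<lambda>n. K n * r ^ n" 0])
    show "summable (\<lambda>n. K n * r ^ n)" using assms(1) by (simp add: power_series_at_def)
    show "norm (K n * r' ^ n) \<le> K n * r ^ n" for n
      using assms by (simp add: power_series_at_def mult_left_mono power_mono)
  qed
  then show ?thesis using assms by (simp add: power_series_at_def)
qed

lemma power_series_at_sums: "power_series_at r M K f x \<Longrightarrow> norm v < r \<Longrightarrow> (\<lambda>n. M (replicate n v)) sums f (x + v)"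
  by (simp add: power_series_at_def)

lemma prod_list_norm_nonneg: "0 \<le> prod_list (map norm (vs :: 'a::real_normed_vector list))"
  by (induction vs) auto

lemma prod_list_norm_replicate: "prod_list (map norm (replicate n (v :: 'a::real_normed_vector))) = norm v ^ n"
  by (induction n) auto

lemma power_series_at_norm_replicate:
  assumes "power_series_at r M K f x"
  shows "norm (M (replicate n v)) \<le> K n * norm v ^ n"
proof -
  have "norm (M vs) \<le> K (length vs) * prod_list (map norm vs)" for vs
    using assms by (simp add: power_series_at_def)
  from this[of "replicate n v"] show ?thesis by (simp only: prod_list_norm_replicate length_replicate)
qed

lemma power_series_summable_norm:
  assumes "power_series_at r M K f x" "norm v < r"
  shows "summable (\<lambda>n. norm (M (replicate n v)))"
proof (rule summable_comparison_test'[of "\<lambda>n. K n * r ^ n" 0])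
  show "summable (\<lambda>n. K n * r ^ n)" using assms(1) by (simp add: power_series_at_def)
  fix n
  have "norm (M (replicate n v)) \<le> K n * norm v ^ n"
    using assms(1) by (rule power_series_at_norm_replicate)
  also have "\<dots> \<le> K n * r ^ n"
    using assms by (intro mult_left_mono power_mono) (auto simp: power_series_at_def)
  finally show "norm (norm (M (replicate n v))) \<le> K n * r ^ n" by simp
qed

lemma analytic_at_point_add:
  assumes "analytic_at_point f x" "analytic_at_point g x"
  shows "analytic_at_point (\<lambda>y. f y + g y) x"
proof -
  obtain r M K r' M' K' where f: "r > 0" "power_series_at r M K f x"
    and g: "r' > 0" "power_series_at r' M' K' g x"
    using assms unfolding analytic_at_point_def by blast
  let ?r = "min r r'"
  have f': "power_series_at ?r M K f x" and g': "power_series_at ?r M' K' g x"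
    using f g by (auto intro: power_series_at_shrink)
  have "power_series_at ?r (\<lambda>vs. M vs + M' vs) (\<lambda>n. K n + K' n) (\<lambda>y. f y + g y) x"
    using f' g' unfolding power_series_at_def
    by (auto intro!: linear_compose_add summable_add sums_add norm_triangle_mono simp: distrib_right)
  then show ?thesis unfolding analytic_at_point_def using f(1) g(1) by (meson min_less_iff_conj)
qed

lemma analytic_at_point_affine:
  fixes L :: "'a::real_normed_vector \<Rightarrow> 'b::real_normed_vector"
  assumes "bounded_linear L"
  shows "analytic_at_point (\<lambda>y. c + L y) x"
proof -
  interpret bounded_linear L by fact
  obtain B where B: "B \<ge> 0" "\<And>v. norm (L v) \<le> norm v * B" using nonneg_bounded by blast
  define M where "M vs = (if vs = [] then c + L x else if length vs = 1 then L (hd vs) else 0)" for vs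
  define K where "K n = (if n = 0 then norm (c + L x) else if n = 1 then B else 0)" for n :: nat
  have "power_series_at 1 M K (\<lambda>y. c + L y) x"
    unfolding power_series_at_def
  proof (intro conjI allI impI)
    fix vs :: "'a list" and i assume i: "i < length vs"
    show "linear (\<lambda>v. M (vs[i := v]))"
    proof (cases "length vs = 1")
      case True
      then obtain w where "vs = [w]" by (auto simp: length_Suc_conv)
      then have "(\<lambda>v. M (vs[i := v])) = L" using i by (auto simp: M_def)
      then show ?thesis using linear_axioms by simp
    next
      case False
      have "length (vs[i := v]) \<noteq> 0" "length (vs[i := v]) \<noteq> 1" for v using i False by auto
      then have "M (vs[i := v]) = 0" for v unfolding M_def by (metis list.size(3))
      then show ?thesis by (simp add: module_hom_zero)
    qed
  next
    fix vs :: "'a list"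
    show "norm (M vs) \<le> K (length vs) * prod_list (map norm vs)"
      using B by (cases vs) (auto simp: M_def K_def mult.commute)
  next
    show "0 \<le> K n" for n using B by (auto simp: K_def)
    show "summable (\<lambda>n. K n * 1 ^ n)" by (rule summable_finite[of "{0,1}"]) (auto simp: K_def)
    fix v :: 'a
    have "(\<lambda>n. M (replicate n v)) sums (\<Sum>n\<in>{0,1}. M (replicate n v))"
      by (rule sums_finite) (auto simp: M_def)
    also have "(\<Sum>n\<in>{0,1}. M (replicate n v)) = c + L (x + v)" by (simp add: M_def add)
    finally show "(\<lambda>n. M (replicate n v)) sums (c + L (x + v))" .
  qed
  then show ?thesis unfolding analytic_at_point_def by (meson zero_less_one)
qed

lemma analytic_at_point_const: "analytic_at_point (\<lambda>y. c) x"
  using analytic_at_point_affine[OF bounded_linear_zero, of c x] by simp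

lemma analytic_at_point_linear: "bounded_linear L \<Longrightarrow> analytic_at_point L x"
  using analytic_at_point_affine[of L 0 x] by simp

lemma analytic_at_point_compose_linear:
  assumes "analytic_at_point f x" "bounded_linear L"
  shows "analytic_at_point (\<lambda>y. L (f y)) x"
proof -
  interpret bounded_linear L by fact
  obtain B where B: "B \<ge> 0" "\<And>v. norm (L v) \<le> norm v * B" using nonneg_bounded by blast
  obtain r M K where f: "r > 0" "power_series_at r M K f x"
    using assms unfolding analytic_at_point_def by blast
  have "power_series_at r (\<lambda>vs. L (M vs)) (\<lambda>n. B * K n) (\<lambda>y. L (f y)) x"
    unfolding power_series_at_def
  proof (intro conjI allI impI)
    show "linear (\<lambda>v. L (M (vs[i := v])))" if "i < length vs" for vs i
      using f(2) that linear_compose[OF _ linear_axioms, of "\<lambda>v. M (vs[i := v])"]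
      by (auto simp: power_series_at_def o_def)
    show "norm (L (M vs)) \<le> B * K (length vs) * prod_list (map norm vs)" for vs
    proof -
      have "norm (M vs) \<le> K (length vs) * prod_list (map norm vs)"
        using f(2) by (simp add: power_series_at_def)
      then have "norm (M vs) * B \<le> K (length vs) * prod_list (map norm vs) * B"
        using B(1) by (rule mult_right_mono)
      with B(2)[of "M vs"] show ?thesis by (simp add: mult_ac)
    qed
    show "0 \<le> B * K n" for n using f(2) B(1) by (simp add: power_series_at_def)
    show "summable (\<lambda>n. B * K n * r ^ n)"
      using f(2) summable_mult[of "\<lambda>n. K n * r ^ n" B] by (simp add: power_series_at_def mult.assoc)
    show "(\<lambda>n. L (M (replicate n v))) sums L (f (x + v))" if "norm v < r" for v
      using f(2) that sums by (auto simp: power_series_at_def)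
  qed
  then show ?thesis unfolding analytic_at_point_def using f(1) by blast
qed

text \<open>Cauchy product on the level of forms: the form of degree n splits its argument list
  after j entries and gives the prefix to f and the suffix to g. Forms need not be symmetric, so one
  splitting per j suffices, and each slot occurs in exactly one of the two factors.\<close>

lemma analytic_at_point_mult:
  fixes f g :: "'a::real_normed_vector \<Rightarrow> real"
  assumes "analytic_at_point f x" "analytic_at_point g x"
  shows "analytic_at_point (\<lambda>y. f y * g y) x"
proof -
  obtain r0 M K r' M' K' where f0: "r0 > 0" "power_series_at r0 M K f x"
    and g0: "r' > 0" "power_series_at r' M' K' g x"
    using assms unfolding analytic_at_point_def by blast
  define r where "r = min r0 r'"
  have r: "r > 0" using f0(1) g0(1) by (simp add: r_def)
  have f: "power_series_at r M K f x" and g: "power_series_at r M' K' g x"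
    using f0 g0 by (auto intro: power_series_at_shrink simp: r_def)
  define P where "P vs = (\<Sum>j\<le>length vs. M (take j vs) * M' (drop j vs))" for vs
  define Q where "Q n = (\<Sum>j\<le>n. K j * K' (n - j))" for n
  have K: "0 \<le> K n" "0 \<le> K' n" for n using f g by (auto simp: power_series_at_def)
  have "power_series_at r P Q (\<lambda>y. f y * g y) x"
    unfolding power_series_at_def
  proof (intro conjI allI impI)
    fix vs :: "'a list" and i assume i: "i < length vs"
    have "linear (\<lambda>v. M (take j (vs[i := v])) * M' (drop j (vs[i := v])))" if "j \<le> length vs" for j
    proof (cases "i < j")
      case True
      have "linear (\<lambda>v. M ((take j vs)[i := v]))" using f True i that by (auto simp: power_series_at_def)
      then have "linear (\<lambda>v. M ((take j vs)[i := v]) * M' (drop j vs))"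
        by (rule linear_compose[OF _ linear_times[of "M' (drop j vs)"], unfolded o_def mult.commute[of "M' (drop j vs)"]])
      then show ?thesis using True by (simp add: take_update_swap)
    next
      case False
      have "linear (\<lambda>v. M' ((drop j vs)[i - j := v]))" using g False i by (auto simp: power_series_at_def)
      then have "linear (\<lambda>v. M (take j vs) * M' ((drop j vs)[i - j := v]))"
        by (rule linear_compose[OF _ linear_times[of "M (take j vs)"], unfolded o_def])
      then show ?thesis using False by (simp add: drop_update_swap)
    qed
    then show "linear (\<lambda>v. P (vs[i := v]))"
      unfolding P_def length_list_update by (intro linear_compose_sum) auto
  next
    fix vs :: "'a list"
    have "norm (P vs) \<le> (\<Sum>j\<le>length vs. norm (M (take j vs) * M' (drop j vs)))"
      unfolding P_def by (rule norm_sum)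
    also have "\<dots> \<le> (\<Sum>j\<le>length vs. K j * K' (length vs - j) * prod_list (map norm vs))"
    proof (rule sum_mono)
      fix j assume "j \<in> {..length vs}"
      then have l: "length (take j vs) = j" "length (drop j vs) = length vs - j" by auto
      have 1: "norm (M (take j vs)) \<le> K j * prod_list (map norm (take j vs))"
        using f l unfolding power_series_at_def by metis
      have 2: "norm (M' (drop j vs)) \<le> K' (length vs - j) * prod_list (map norm (drop j vs))"
        using g l unfolding power_series_at_def by metis
      have "prod_list (map norm vs) = prod_list (map norm (take j vs)) * prod_list (map norm (drop j vs))"
        by (metis append_take_drop_id map_append prod_list.append)
      with mult_mono[OF 1 2 mult_nonneg_nonneg[OF K(1) prod_list_norm_nonneg] norm_ge_zero]
      show "norm (M (take j vs) * M' (drop j vs)) \<le> K j * K' (length vs - j) * prod_list (map norm vs)"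
        by (simp add: abs_mult mult_ac)
    qed
    finally show "norm (P vs) \<le> Q (length vs) * prod_list (map norm vs)"
      by (simp add: Q_def sum_distrib_right)
  next
    show "0 \<le> Q n" for n using K by (auto simp: Q_def intro!: sum_nonneg)
    have "summable (\<lambda>n. \<Sum>j\<le>n. (K j * r ^ j) * (K' (n - j) * r ^ (n - j)))"
      using f g r K by (intro summable_Cauchy_product) (simp_all add: power_series_at_def)
    moreover have "(\<Sum>j\<le>n. (K j * r ^ j) * (K' (n - j) * r ^ (n - j))) = Q n * r ^ n" for n
      unfolding Q_def sum_distrib_right
      by (intro sum.cong refl) (simp add: mult_ac flip: power_add)
    ultimately show "summable (\<lambda>n. Q n * r ^ n)" by simp
  next
    fix v :: 'a assume v: "norm v < r"
    have "(\<lambda>n. \<Sum>j\<le>n. M (replicate j v) * M' (replicate (n - j) v)) sums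
        ((\<Sum>n. M (replicate n v)) * (\<Sum>n. M' (replicate n v)))"
      by (intro Cauchy_product_sums power_series_summable_norm[OF f v] power_series_summable_norm[OF g v])
    moreover have "P (replicate n v) = (\<Sum>j\<le>n. M (replicate j v) * M' (replicate (n - j) v))" for n
      unfolding P_def by (auto intro!: sum.cong simp: min_def)
    moreover have "(\<Sum>n. M (replicate n v)) = f (x + v)" "(\<Sum>n. M' (replicate n v)) = g (x + v)"
      using f g v by (auto simp: power_series_at_def intro: sums_unique[symmetric])
    ultimately show "(\<lambda>n. P (replicate n v)) sums (f (x + v) * g (x + v))" by simp
  qed
  then show ?thesis unfolding analytic_at_point_def using r by blast
qed

text \<open>Coefficients of the reciprocal \<open>u\<close> of a power series \<open>f\<close> with constant term \<open>c\<close>, from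
  \<open>c u\<^sub>n = - \<Sum>\<^sub>1\<^sub>\<le>\<^sub>j\<^sub>\<le>\<^sub>n f\<^sub>j u\<^sub>n\<^sub>-\<^sub>j\<close>.\<close>

function reciprocal_form :: "('a list \<Rightarrow> real) \<Rightarrow> real \<Rightarrow> 'a list \<Rightarrow> real" where
  "reciprocal_form M c vs = (if vs = [] then 1 / c
     else - (\<Sum>j\<in>{1..length vs}. M (take j vs) * reciprocal_form M c (drop j vs)) / c)"
  by pat_completeness auto
termination by (relation "Wellfounded.measure (\<lambda>(M, c, vs). length vs)") auto

declare reciprocal_form.simps [simp del]

text \<open>The recursion of \<open>reciprocal_form\<close> with the minus sign dropped and bounds
  in place of forms, so that it dominates their norms when c is the absolute value of the constant
  term.\<close>

function reciprocal_majorant :: "(nat \<Rightarrow> real) \<Rightarrow> real \<Rightarrow> nat \<Rightarrow> real" where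
  "reciprocal_majorant K c n = (if n = 0 then 1 / c
     else (\<Sum>j\<in>{1..n}. K j * reciprocal_majorant K c (n - j)) / c)"
  by pat_completeness auto
termination by (relation "Wellfounded.measure (\<lambda>(K, c, n). n)") auto

declare reciprocal_majorant.simps [simp del]

lemma reciprocal_form_linear:
  assumes M: "\<And>vs i. i < length vs \<Longrightarrow> linear (\<lambda>v. M (vs[i := v]))"
  shows "i < length vs \<Longrightarrow> linear (\<lambda>v. reciprocal_form M c (vs[i := v]))"
proof (induction "length vs" arbitrary: vs i rule: less_induct)
  case less
  let ?R = "reciprocal_form M c"
  have "linear (\<lambda>v. M (take j (vs[i := v])) * ?R (drop j (vs[i := v])))"
    if "j \<in> {1..length vs}" for j
  proof (cases "i < j")
    case True
    have "linear (\<lambda>v. M ((take j vs)[i := v]))" using M True less.prems that by auto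
    then have "linear (\<lambda>v. M ((take j vs)[i := v]) * ?R (drop j vs))"
      by (rule linear_compose[OF _ linear_times[of "?R (drop j vs)"], unfolded o_def mult.commute[of "?R (drop j vs)"]])
    then show ?thesis using True by (simp add: take_update_swap)
  next
    case False
    have "linear (\<lambda>v. ?R ((drop j vs)[i - j := v]))"
      using False less.prems that by (intro less.hyps) auto
    then have "linear (\<lambda>v. M (take j vs) * ?R ((drop j vs)[i - j := v]))"
      by (rule linear_compose[OF _ linear_times[of "M (take j vs)"], unfolded o_def])
    then show ?thesis using False by (simp add: drop_update_swap)
  qed
  then have *: "linear (\<lambda>v. \<Sum>j\<in>{1..length vs}. M (take j (vs[i := v])) * ?R (drop j (vs[i := v])))"
    by (intro linear_compose_sum) auto
  have "linear (\<lambda>v. (- 1 / c) * (\<Sum>j\<in>{1..length vs}. M (take j (vs[i := v])) * ?R (drop j (vs[i := v]))))"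
    using linear_compose[OF * linear_times[of "- 1 / c"]] by (simp add: o_def)
  moreover have "?R (vs[i := v]) = (- 1 / c) * (\<Sum>j\<in>{1..length vs}. M (take j (vs[i := v])) * ?R (drop j (vs[i := v])))" for v
    using less.prems by (subst reciprocal_form.simps) (auto simp: divide_inverse mult_ac)
  ultimately show ?case by simp
qed

lemma reciprocal_majorant_nonneg:
  assumes "\<And>n. 0 \<le> K n" "c > 0" shows "0 \<le> reciprocal_majorant K c n"
proof (induction n rule: less_induct)
  case (less n)
  show ?case by (subst reciprocal_majorant.simps) (use less assms in \<open>auto intro!: sum_nonneg divide_nonneg_pos mult_nonneg_nonneg\<close>)
qed

lemma reciprocal_form_bound:
  fixes M :: "'a::real_normed_vector list \<Rightarrow> real"
  assumes M: "\<And>vs. norm (M vs) \<le> K (length vs) * prod_list (map norm vs)"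
    and K: "\<And>n. 0 \<le> K n" and c: "c \<noteq> 0"
  shows "norm (reciprocal_form M c vs) \<le> reciprocal_majorant K \<bar>c\<bar> (length vs) * prod_list (map norm vs)"
proof (induction "length vs" arbitrary: vs rule: less_induct)
  case less
  let ?R = "reciprocal_form M c" and ?Q = "reciprocal_majorant K \<bar>c\<bar>"
  show ?case
  proof (cases "vs = []")
    case True
    then show ?thesis using c by (simp add: reciprocal_form.simps[of _ _ "[]"] reciprocal_majorant.simps[of _ _ 0])
  next
    case False
    have "\<bar>\<Sum>j\<in>{1..length vs}. M (take j vs) * ?R (drop j vs)\<bar> \<le>
        (\<Sum>j\<in>{1..length vs}. \<bar>M (take j vs) * ?R (drop j vs)\<bar>)" by (rule sum_abs)
    also have "\<dots> \<le> (\<Sum>j\<in>{1..length vs}. K j * ?Q (length vs - j) * prod_list (map norm vs))"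
    proof (rule sum_mono)
      fix j assume j: "j \<in> {1..length vs}"
      then have l: "length (take j vs) = j" "length (drop j vs) = length vs - j" by auto
      have 1: "norm (M (take j vs)) \<le> K j * prod_list (map norm (take j vs))" using M l by metis
      have 2: "norm (?R (drop j vs)) \<le> ?Q (length vs - j) * prod_list (map norm (drop j vs))"
        using less[of "drop j vs"] j False by auto
      have "prod_list (map norm vs) = prod_list (map norm (take j vs)) * prod_list (map norm (drop j vs))"
        by (metis append_take_drop_id map_append prod_list.append)
      with mult_mono[OF 1 2 mult_nonneg_nonneg[OF K prod_list_norm_nonneg] norm_ge_zero]
      show "\<bar>M (take j vs) * ?R (drop j vs)\<bar> \<le> K j * ?Q (length vs - j) * prod_list (map norm vs)"
        by (simp add: abs_mult mult_ac)
    qed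
    finally have "\<bar>\<Sum>j\<in>{1..length vs}. M (take j vs) * ?R (drop j vs)\<bar> / \<bar>c\<bar> \<le>
        (\<Sum>j\<in>{1..length vs}. K j * ?Q (length vs - j)) * prod_list (map norm vs) / \<bar>c\<bar>"
      using c by (intro divide_right_mono) (auto simp: sum_distrib_right)
    then show ?thesis using False
      by (subst reciprocal_form.simps, subst reciprocal_majorant.simps) simp
  qed
qed

text \<open>The formal reciprocal always exists; what must be proved is a positive radius. Once the
  radius is so small that the nonconstant majorant terms sum to at most \<bar>c\<bar>, the recursion
  keeps \<open>?Q n * r1 ^ n\<close> below 1/\<bar>c\<bar>. The Cauchy product with the series of f
  is then 1, 0, 0, ..., which identifies the sum.\<close>

lemma analytic_at_point_reciprocal:
  fixes f :: "'a::real_normed_vector \<Rightarrow> real"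
  assumes "analytic_at_point f x" "f x \<noteq> 0"
  shows "analytic_at_point (\<lambda>y. 1 / f y) x"
proof -
  obtain r0 M K where r0: "r0 > 0" and f0: "power_series_at r0 M K f x"
    using assms unfolding analytic_at_point_def by blast
  define c where "c = f x"
  have c: "c \<noteq> 0" using assms(2) by (simp add: c_def)
  have K: "0 \<le> K n" for n using f0 by (auto simp: power_series_at_def)
  \<comment> \<open>At v = 0 all forms of positive degree vanish, so the constant term of the series
    is the value f x.\<close>
  have M_zero: "(\<lambda>n. M (replicate n 0)) sums c"
    using power_series_at_sums[OF f0, of 0] r0 by (simp add: c_def)
  have "M (replicate n 0) = 0" if "n \<noteq> 0" for n
    using power_series_at_norm_replicate[OF f0, of n 0] that by (simp add: power_0_left)
  then have "(\<lambda>n. M (replicate n 0)) sums (\<Sum>n\<in>{0}. M (replicate n 0))" by (intro sums_finite) auto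
  then have "(\<lambda>n. M (replicate n 0)) sums M []" by simp
  with M_zero have M0: "M [] = c" using sums_unique2 by blast
  define S where "S = (\<Sum>n. K n * r0 ^ n)"
  have sumK: "summable (\<lambda>n. K n * r0 ^ n)" using f0 by (simp add: power_series_at_def)
  have S0: "S \<ge> 0" unfolding S_def by (intro suminf_nonneg sumK) (use K r0 in auto)
  \<comment> \<open>For j \<ge> 1 and \<theta> \<le> 1 one has
    \<open>\<theta> ^ j \<le> \<theta>\<close>, so shrinking the radius by \<theta> shrinks the
    whole nonconstant part to at most \<theta> S, and \<theta> is chosen to bring this below
    \<bar>c\<bar>.\<close>
  define \<theta> where "\<theta> = min 1 (\<bar>c\<bar> / (S + 1))"
  have \<theta>: "0 < \<theta>" "\<theta> \<le> 1" "\<theta> * S \<le> \<bar>c\<bar>"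
  proof -
    show "0 < \<theta>" "\<theta> \<le> 1" using c S0 by (auto simp: \<theta>_def)
    have "\<theta> * S \<le> \<bar>c\<bar> / (S + 1) * S" using S0 by (intro mult_right_mono) (auto simp: \<theta>_def)
    also have "\<dots> = \<bar>c\<bar> * (S / (S + 1))" by simp
    also have "\<dots> \<le> \<bar>c\<bar> * 1" using S0 by (intro mult_left_mono) auto
    finally show "\<theta> * S \<le> \<bar>c\<bar>" by simp
  qed
  define r1 where "r1 = \<theta> * r0"
  have r1: "r1 > 0" "r1 \<le> r0" using \<theta> r0 by (auto simp: r1_def mult_le_cancel_right1)
  have sumle: "(\<Sum>j\<in>{1..n}. K j * r1 ^ j) \<le> \<bar>c\<bar>" for n
  proof -
    have "(\<Sum>j\<in>{1..n}. K j * r1 ^ j) \<le> (\<Sum>j\<in>{1..n}. \<theta> * (K j * r0 ^ j))"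
    proof (rule sum_mono)
      fix j assume "j \<in> {1..n}"
      then have "\<theta> ^ j \<le> \<theta> ^ 1" using \<theta> by (intro power_decreasing) auto
      then have "\<theta> ^ j * (K j * r0 ^ j) \<le> \<theta> * (K j * r0 ^ j)" using K r0 by (intro mult_right_mono) auto
      then show "K j * r1 ^ j \<le> \<theta> * (K j * r0 ^ j)" by (simp add: r1_def power_mult_distrib mult_ac)
    qed
    also have "\<dots> = \<theta> * (\<Sum>j\<in>{1..n}. K j * r0 ^ j)" by (simp add: sum_distrib_left)
    also have "\<dots> \<le> \<theta> * S" unfolding S_def
      by (intro mult_left_mono sum_le_suminf sumK) (use K r0 \<theta> in auto)
    finally show ?thesis using \<theta>(3) by simp
  qed
  let ?R = "reciprocal_form M c" and ?Q = "reciprocal_majorant K \<bar>c\<bar>"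
  have Q0: "0 \<le> ?Q n" for n using K c by (intro reciprocal_majorant_nonneg) auto
  have Qle: "?Q n * r1 ^ n \<le> 1 / \<bar>c\<bar>" for n
  proof (induction n rule: less_induct)
    case (less n)
    show ?case
    proof (cases "n = 0")
      case True then show ?thesis by (simp add: reciprocal_majorant.simps[of _ _ 0])
    next
      case False
      have "?Q n * r1 ^ n = (\<Sum>j\<in>{1..n}. (K j * r1 ^ j) * (?Q (n - j) * r1 ^ (n - j))) / \<bar>c\<bar>"
      proof -
        have "?Q n * r1 ^ n = (\<Sum>j\<in>{1..n}. K j * ?Q (n - j) * r1 ^ n) / \<bar>c\<bar>"
          using False by (subst reciprocal_majorant.simps) (simp add: sum_distrib_right)
        also have "(\<Sum>j\<in>{1..n}. K j * ?Q (n - j) * r1 ^ n) =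
            (\<Sum>j\<in>{1..n}. (K j * r1 ^ j) * (?Q (n - j) * r1 ^ (n - j)))"
          by (intro sum.cong refl) (simp add: mult_ac flip: power_add)
        finally show ?thesis .
      qed
      also have "\<dots> \<le> (\<Sum>j\<in>{1..n}. (K j * r1 ^ j) * (1 / \<bar>c\<bar>)) / \<bar>c\<bar>"
        using less K r1 by (intro divide_right_mono sum_mono mult_left_mono) auto
      also have "\<dots> = (\<Sum>j\<in>{1..n}. K j * r1 ^ j) * (1 / \<bar>c\<bar>) / \<bar>c\<bar>"
        by (simp only: sum_distrib_right)
      also have "\<dots> \<le> \<bar>c\<bar> * (1 / \<bar>c\<bar>) / \<bar>c\<bar>"
        by (intro divide_right_mono mult_right_mono sumle) auto
      finally show ?thesis using c by simp
    qed
  qed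
  \<comment> \<open>Boundedness of the terms at r1 becomes a geometric majorant at half the
    radius.\<close>
  define r where "r = r1 / 2"
  have r: "r > 0" "r \<le> r0" using r1 by (auto simp: r_def)
  have f: "power_series_at r M K f x" using f0 r by (rule power_series_at_shrink)
  have bnd: "norm (?R vs) \<le> ?Q (length vs) * prod_list (map norm vs)" for vs
    using f K c by (intro reciprocal_form_bound) (auto simp: power_series_at_def)
  have sumQ: "summable (\<lambda>n. ?Q n * r ^ n)"
  proof (rule summable_comparison_test'[of "\<lambda>n. (1 / \<bar>c\<bar>) * (1/2) ^ n" 0])
    show "summable (\<lambda>n. 1 / \<bar>c\<bar> * (1 / 2) ^ n)" by (intro summable_mult summable_geometric) auto
    fix n
    have "?Q n * r ^ n = (?Q n * r1 ^ n) * (1/2) ^ n" by (simp add: r_def power_divide)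
    also have "\<dots> \<le> (1 / \<bar>c\<bar>) * (1/2) ^ n" by (intro mult_right_mono Qle) auto
    finally show "norm (?Q n * r ^ n) \<le> (1 / \<bar>c\<bar>) * (1/2) ^ n" using Q0 r by simp
  qed
  have "power_series_at r ?R ?Q (\<lambda>y. 1 / f y) x"
    unfolding power_series_at_def
  proof (intro conjI allI impI)
    show "linear (\<lambda>v. ?R (vs[i := v]))" if "i < length vs" for vs i
      using f that by (intro reciprocal_form_linear) (auto simp: power_series_at_def)
    fix v :: 'a assume v: "norm v < r"
    have "summable (\<lambda>n. norm (?R (replicate n v)))"
    proof (rule summable_comparison_test'[OF sumQ, of 0])
      fix n
      have "norm (?R (replicate n v)) \<le> ?Q n * norm v ^ n"
        using bnd[of "replicate n v"] by (simp add: prod_list_norm_replicate)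
      also have "\<dots> \<le> ?Q n * r ^ n" using v Q0 by (intro mult_left_mono power_mono) auto
      finally show "norm (norm (?R (replicate n v))) \<le> ?Q n * r ^ n" by simp
    qed
    note sumR = this
    have "(\<lambda>n. \<Sum>j\<le>n. M (replicate j v) * ?R (replicate (n - j) v)) sums
        ((\<Sum>n. M (replicate n v)) * (\<Sum>n. ?R (replicate n v)))"
      by (intro Cauchy_product_sums power_series_summable_norm[OF f v] sumR)
    moreover have "(\<Sum>j\<le>n. M (replicate j v) * ?R (replicate (n - j) v)) = (if n = 0 then 1 else 0)" for n
    proof (cases "n = 0")
      case True then show ?thesis using c M0 by (simp add: reciprocal_form.simps[of _ _ "[]"])
    next
      case False
      have "(\<Sum>j\<le>n. M (replicate j v) * ?R (replicate (n - j) v)) =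
        c * ?R (replicate n v) + (\<Sum>j\<in>{1..n}. M (replicate j v) * ?R (replicate (n - j) v))"
        using M0 by (simp add: sum.atLeast_Suc_atMost[of 0] flip: atLeast0AtMost)
      also have "c * ?R (replicate n v) = - (\<Sum>j\<in>{1..n}. M (replicate j v) * ?R (replicate (n - j) v))"
        using False c by (subst reciprocal_form.simps) (auto simp: min_def intro!: sum.cong)
      finally show ?thesis using False by simp
    qed
    ultimately have "(\<lambda>n. if n = 0 then 1 else 0 :: real) sums
        ((\<Sum>n. M (replicate n v)) * (\<Sum>n. ?R (replicate n v)))" by simp
    moreover have "(\<lambda>n. if n = 0 then 1 else 0 :: real) sums 1"
      using sums_single[of 0 "\<lambda>_. 1::real"] by simp
    ultimately have "(\<Sum>n. M (replicate n v)) * (\<Sum>n. ?R (replicate n v)) = 1"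
      using sums_unique2 by blast
    moreover have "(\<Sum>n. M (replicate n v)) = f (x + v)"
      using f v by (auto simp: power_series_at_def intro: sums_unique[symmetric])
    ultimately have "(\<Sum>n. ?R (replicate n v)) = 1 / f (x + v)" by (metis mult_eq_0_iff nonzero_mult_div_cancel_left zero_neq_one)
    with summable_sums[OF summable_norm_cancel[OF sumR]]
    show "(\<lambda>n. ?R (replicate n v)) sums (1 / f (x + v))" by simp
  qed (use bnd Q0 sumQ in auto)
  then show ?thesis unfolding analytic_at_point_def using r by blast
qed

section \<open>Boxes in the sequence space\<close>

lemma norm_ell2_sq: "(norm a)\<^sup>2 = (\<Sum>k. (coord a k)\<^sup>2)"
  by (simp add: norm_ell2_def ell2_norm_def suminf_nonneg summable_coord_sq)

lemma abs_coord_le_norm: "\<bar>coord a k\<bar> \<le> norm a"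
proof -
  have "(\<Sum>i\<in>{k}. (coord a i)\<^sup>2) \<le> (\<Sum>i. (coord a i)\<^sup>2)"
    by (intro sum_le_suminf summable_coord_sq) auto
  then have "\<bar>coord a k\<bar>\<^sup>2 \<le> (norm a)\<^sup>2" by (simp add: norm_ell2_sq)
  then show ?thesis by (simp add: abs_le_square_iff[symmetric])
qed

lemma bounded_linear_coord: "bounded_linear (\<lambda>a. coord a k)"
  by (rule bounded_linear_intro[of _ 1]) (auto simp: abs_coord_le_norm)

lemmas continuous_on_coord [continuous_intros] = bounded_linear.continuous_on[OF bounded_linear_coord]

lemma norm_ell2_sq_le_split:
  assumes "summable R" "\<And>k. k \<ge> n \<Longrightarrow> (coord w k)\<^sup>2 \<le> R k"
  shows "(norm w)\<^sup>2 \<le> (\<Sum>k<n. (coord w k)\<^sup>2) + (\<Sum>k. R (k + n))"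
proof -
  have "(norm w)\<^sup>2 = (\<Sum>k. (coord w (k + n))\<^sup>2) + (\<Sum>k<n. (coord w k)\<^sup>2)"
    unfolding norm_ell2_sq by (rule suminf_split_initial_segment[OF summable_coord_sq])
  moreover have "(\<Sum>k. (coord w (k + n))\<^sup>2) \<le> (\<Sum>k. R (k + n))"
    using assms summable_coord_sq[of w]
    by (intro suminf_le) (auto simp: summable_iff_shift[of "\<lambda>k. (coord w k)\<^sup>2"] summable_iff_shift[of R])
  ultimately show ?thesis by simp
qed

text \<open>Dominated convergence: the envelope R makes the tail of the squared norm uniformly
  small, and the finite head converges coordinate by coordinate.\<close>

lemma tendsto_ell2I:
  assumes lim: "\<And>k. ((\<lambda>x. coord (f x) k) \<longlongrightarrow> coord l k) F"
    and bnd: "\<forall>\<^sub>F x in F. \<forall>k. \<bar>coord (f x) k - coord l k\<bar> \<le> R k"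
    and R: "summable (\<lambda>k. (R k)\<^sup>2)"
  shows "(f \<longlongrightarrow> l) F"
proof (rule tendstoI)
  fix e :: real assume e: "e > 0"
  obtain n where n: "norm (\<Sum>k. (R (k + n))\<^sup>2) < e\<^sup>2 / 2"
    using suminf_exist_split[OF _ R, of "e\<^sup>2 / 2"] e by auto
  have "((\<lambda>x. \<Sum>k<n. (coord (f x) k - coord l k)\<^sup>2) \<longlongrightarrow> (\<Sum>k<n. (coord l k - coord l k)\<^sup>2)) F"
    by (intro tendsto_intros lim)
  then have "\<forall>\<^sub>F x in F. (\<Sum>k<n. (coord (f x) k - coord l k)\<^sup>2) < e\<^sup>2 / 2"
    using e by (intro order_tendstoD(2)) auto
  with bnd show "\<forall>\<^sub>F x in F. dist (f x) l < e"
  proof eventually_elim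
    case (elim x)
    have "(norm (f x - l))\<^sup>2 \<le> (\<Sum>k<n. (coord (f x - l) k)\<^sup>2) + (\<Sum>k. (R (k + n))\<^sup>2)"
      using elim(1) R by (intro norm_ell2_sq_le_split) (auto simp: abs_le_square_iff[symmetric] intro: order_trans[OF _ abs_ge_self])
    also have "\<dots> < e\<^sup>2" using elim(2) n by simp
    finally show ?case using e by (simp add: dist_norm power_less_imp_less_base)
  qed
qed

definition ell2_box :: "(nat \<Rightarrow> real) \<Rightarrow> (nat \<Rightarrow> real) \<Rightarrow> ell2 set"
  where "ell2_box l r = {z. \<forall>k\<ge>1. l k \<le> coord z k \<and> coord z k \<le> r k}"

lemma ell2_boxD: "z \<in> ell2_box l r \<Longrightarrow> k \<ge> 1 \<Longrightarrow> l k \<le> coord z k \<and> coord z k \<le> r k"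
  by (simp add: ell2_box_def)

lemma summable_between:
  fixes x l r :: "nat \<Rightarrow> real"
  assumes "summable (\<lambda>k. (\<bar>l k\<bar> + \<bar>r k\<bar>)\<^sup>2)" "\<And>k. k \<ge> 1 \<Longrightarrow> l k \<le> x k \<and> x k \<le> r k"
  shows "summable (\<lambda>k. (x k)\<^sup>2)"
proof (rule summable_comparison_test'[OF assms(1), of 1])
  fix k :: nat assume "k \<ge> 1"
  then have "\<bar>x k\<bar> \<le> \<bar>l k\<bar> + \<bar>r k\<bar>" using assms(2)[of k] by auto
  then have "\<bar>x k\<bar>\<^sup>2 \<le> (\<bar>l k\<bar> + \<bar>r k\<bar>)\<^sup>2" by (intro power_mono) auto
  then show "norm ((x k)\<^sup>2) \<le> (\<bar>l k\<bar> + \<bar>r k\<bar>)\<^sup>2" by simp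
qed

lemma tendsto_ell2_boxI:
  assumes lim: "\<And>k. k \<ge> 1 \<Longrightarrow> ((\<lambda>x. coord (f x) k) \<longlongrightarrow> coord y k) F"
    and R: "summable (\<lambda>k. (\<bar>l k\<bar> + \<bar>r k\<bar>)\<^sup>2)"
    and f: "\<forall>\<^sub>F x in F. f x \<in> ell2_box l r" and y: "y \<in> ell2_box l r"
  shows "(f \<longlongrightarrow> y) F"
proof (rule tendsto_ell2I[where R = "\<lambda>k. 2 * (\<bar>l k\<bar> + \<bar>r k\<bar>)"])
  show "((\<lambda>x. coord (f x) k) \<longlongrightarrow> coord y k) F" for k
    using lim[of k] by (cases "k = 0") auto
  show "summable (\<lambda>k. (2 * (\<bar>l k\<bar> + \<bar>r k\<bar>))\<^sup>2)"
    using summable_mult[OF R, of "2\<^sup>2"] by (simp only: power_mult_distrib)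
  show "\<forall>\<^sub>F x in F. \<forall>k. \<bar>coord (f x) k - coord y k\<bar> \<le> 2 * (\<bar>l k\<bar> + \<bar>r k\<bar>)"
    using f
  proof eventually_elim
    case (elim x)
    show ?case
    proof
      fix k show "\<bar>coord (f x) k - coord y k\<bar> \<le> 2 * (\<bar>l k\<bar> + \<bar>r k\<bar>)"
        using ell2_boxD[OF elim, of k] ell2_boxD[OF y, of k] by (cases "k = 0") auto
    qed
  qed
qed

text \<open>The Hilbert cube argument: a product of compact intervals is compact by Tychonoff, and
  on it the square-summable envelope makes \<open>Abs_ell2\<close> continuous from the product
  topology into the norm topology.\<close>

lemma compact_ell2_box:
  assumes R: "summable (\<lambda>k. (\<bar>l k\<bar> + \<bar>r k\<bar>)\<^sup>2)"
  shows "compact (ell2_box l r)"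
proof -
  \<comment> \<open>The dummy coordinate 0 is pinned to 0, as the representation of the phase space
    demands.\<close>
  define P :: "(nat \<Rightarrow> real) set" where "P = PiE UNIV (\<lambda>k. if k = 0 then {0} else {l k..r k})"
  have "compactin (product_topology (\<lambda>i. euclidean) UNIV) P"
    unfolding P_def compactin_PiE by (auto simp: compactin_euclidean_iff)
  then have "compact P" by (simp add: euclidean_product_topology compactin_euclidean_iff)
  have coordP: "coord (Abs_ell2 x) = x" if "x \<in> P" for x
  proof (rule coord_Abs)
    show "x 0 = 0" using that by (auto simp: P_def PiE_def Pi_def split: if_splits)
    show "summable (\<lambda>k. (x k)\<^sup>2)"
      by (rule summable_between[OF R]) (use that in \<open>force simp: P_def PiE_def Pi_def split: if_splits\<close>)
  qed
  have inbox: "Abs_ell2 x \<in> ell2_box l r" if "x \<in> P" for x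
    using that coordP[OF that] by (fastforce simp: ell2_box_def P_def PiE_def Pi_def split: if_splits)
  have "continuous_on P Abs_ell2"
    unfolding continuous_on_def
  proof
    fix x assume x: "x \<in> P"
    show "(Abs_ell2 \<longlongrightarrow> Abs_ell2 x) (at x within P)"
    proof (rule tendsto_ell2_boxI[OF _ R _ inbox[OF x]])
      show "\<forall>\<^sub>F y in at x within P. Abs_ell2 y \<in> ell2_box l r"
        using inbox by (auto simp: eventually_at_filter)
      fix k :: nat
      have "((\<lambda>y. y k) \<longlongrightarrow> x k) (at x within P)"
        using continuous_on_product_coordinates[of k] x
        by (metis UNIV_I continuous_on_def subset_UNIV tendsto_within_subset)
      then show "((\<lambda>y. coord (Abs_ell2 y) k) \<longlongrightarrow> coord (Abs_ell2 x) k) (at x within P)"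
        unfolding coordP[OF x]
        by (rule tendsto_cong[THEN iffD1, rotated]) (auto simp: eventually_at_filter coordP)
    qed
  qed
  moreover have "ell2_box l r = Abs_ell2 ` P"
  proof (intro equalityI subsetI)
    fix z assume "z \<in> ell2_box l r"
    then have "coord z \<in> P" by (auto simp: P_def PiE_def Pi_def ell2_box_def)
    then show "z \<in> Abs_ell2 ` P" by (metis coord_inverse imageI)
  qed (use inbox in auto)
  ultimately show ?thesis using \<open>compact P\<close> compact_continuous_image by metis
qed

lemma convex_ell2_box: "convex (ell2_box l r)"
  unfolding convex_def
proof (intro ballI allI impI)
  fix x y and u v :: real
  assume x: "x \<in> ell2_box l r" and y: "y \<in> ell2_box l r" and uv: "0 \<le> u" "0 \<le> v" "u + v = 1"
  show "u *\<^sub>R x + v *\<^sub>R y \<in> ell2_box l r"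
    unfolding ell2_box_def mem_Collect_eq
  proof (intro allI impI)
    fix k :: nat assume "k \<ge> 1"
    with ell2_boxD[OF x this] ell2_boxD[OF y this] have "coord x k \<in> {l k..r k}" "coord y k \<in> {l k..r k}" by auto
    then have "u *\<^sub>R coord x k + v *\<^sub>R coord y k \<in> {l k..r k}"
      using convex_real_interval(5)[of "l k" "r k"] uv unfolding convex_def by blast
    then show "l k \<le> coord (u *\<^sub>R x + v *\<^sub>R y) k \<and> coord (u *\<^sub>R x + v *\<^sub>R y) k \<le> r k" by simp
  qed
qed

section \<open>Solutions in inward-pointing boxes\<close>

lemma at_within_nonneg_eq: "0 \<le> (t::real) \<Longrightarrow> t < b \<Longrightarrow> at t within {0..b} = at t within {0..}"
  by (rule at_within_nhd[of _ "{..<b}"]) auto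

text \<open>On the interval from the last time at which f is at most \<rho> up to t the derivative
  is nonpositive, so the mean value theorem forbids a rise. The sign is demanded only where f
  exceeds \<rho>, since outside the box is exactly where the clamped equation controls it.\<close>

lemma barrier_le:
  fixes f :: "real \<Rightarrow> real"
  assumes f: "continuous_on {0..} f" and f0: "f 0 \<le> \<rho>"
    and der: "\<And>t. t \<ge> 0 \<Longrightarrow> f t > \<rho> \<Longrightarrow> \<exists>D\<le>0. (f has_real_derivative D) (at t within {0..})"
    and t: "t \<ge> 0"
  shows "f t \<le> \<rho>"
proof (rule ccontr)
  assume "\<not> f t \<le> \<rho>"
  then have ft: "f t > \<rho>" by simp
  define S where "S = {0..t} \<inter> f -` {..\<rho>}"
  have "closed S" unfolding S_def
    by (intro continuous_closed_preimage continuous_on_subset[OF f]) auto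
  moreover have "S \<subseteq> {0..t}" by (auto simp: S_def)
  ultimately have "compact S" by (meson bounded_closed_interval bounded_subset compact_eq_bounded_closed)
  moreover have "S \<noteq> {}" using f0 t by (auto simp: S_def)
  ultimately obtain \<tau> where \<tau>: "\<tau> \<in> S" "\<And>s. s \<in> S \<Longrightarrow> s \<le> \<tau>" by (meson compact_attains_sup)
  have \<tau>t: "0 \<le> \<tau>" "\<tau> < t" "f \<tau> \<le> \<rho>" using \<tau>(1) ft by (auto simp: S_def less_le)
  have above: "f s > \<rho>" if "\<tau> < s" "s \<le> t" for s
    using \<tau>(2)[of s] that \<tau>t by (force simp: S_def not_le[symmetric])
  have "\<forall>s\<in>{\<tau><..<t}. \<exists>D\<le>0. (f has_real_derivative D) (at s)"
  proof
    fix s assume s: "s \<in> {\<tau><..<t}"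
    then obtain D where "D \<le> 0" "(f has_real_derivative D) (at s within {0..})"
      using der[of s] above[of s] \<tau>t by auto
    moreover have "at s within {0..} = at s"
      using s \<tau>t by (intro at_within_interior) auto
    ultimately show "\<exists>D\<le>0. (f has_real_derivative D) (at s)" by auto
  qed
  from bchoice[OF this] obtain D
    where "\<forall>s\<in>{\<tau><..<t}. D s \<le> 0 \<and> (f has_real_derivative D s) (at s)" ..
  note D = bspec[OF this]
  obtain \<xi> where "\<tau> < \<xi>" "\<xi> < t" "f t - f \<tau> = D \<xi> * (t - \<tau>)"
  proof (rule mvt[of \<tau> t f "\<lambda>s h. D s * h"])
    show "continuous_on {\<tau>..t} f" using f by (rule continuous_on_subset) (use \<tau>t in auto)
    show "(f has_derivative (\<lambda>h. D s * h)) (at s)" if "\<tau> < s" "s < t" for s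
      using D[of s] that by (auto simp: has_field_derivative_def)
  qed (use \<tau>t in auto)
  with D[of \<xi>] \<tau>t have "f t - f \<tau> \<le> 0" by (simp add: mult_nonpos_nonneg)
  with ft \<tau>t show False by simp
qed

definition duhamel :: "real \<Rightarrow> real \<Rightarrow> (real \<Rightarrow> real) \<Rightarrow> real \<Rightarrow> real"
  where "duhamel d x G t = exp (- d * t) * (x + integral {0..t} (\<lambda>s. exp (d * s) * G s))"

lemma duhamel_deriv:
  assumes G: "continuous_on {0..} G" and t: "t \<ge> 0"
  shows "(duhamel d x G has_real_derivative (- d * duhamel d x G t + G t)) (at t within {0..})"
proof -
  have "continuous_on {0..t+1} (\<lambda>s. exp (d * s) * G s)"
    by (intro continuous_intros continuous_on_subset[OF G]) auto
  then have "((\<lambda>t. integral {0..t} (\<lambda>s. exp (d * s) * G s)) has_real_derivative exp (d * t) * G t) (at t within {0..t+1})"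
    by (rule integral_has_real_derivative) (use t in auto)
  then have I: "((\<lambda>t. integral {0..t} (\<lambda>s. exp (d * s) * G s)) has_real_derivative exp (d * t) * G t) (at t within {0..})"
    using t by (simp add: at_within_nonneg_eq)
  show ?thesis unfolding duhamel_def
    by (rule derivative_eq_intros I refl)+ (simp add: algebra_simps flip: exp_add)
qed

lemma duhamel_0 [simp]: "duhamel d x G 0 = x"
  by (simp add: duhamel_def)

text \<open>A forcing term that grows like exp(\<gamma> s) is damped by the factor 1/(d + \<gamma>).
  With d of order k^4 this factor compensates the loss of derivatives. The choice \<gamma> = 0 gives
  boundedness of the Picard iterates, a positive \<gamma> gives contraction.\<close>

lemma duhamel_bound:
  assumes G: "continuous_on {0..t} G" and t: "t \<ge> 0" and d: "d + \<gamma> > 0"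
    and M: "\<And>s. 0 \<le> s \<Longrightarrow> s \<le> t \<Longrightarrow> \<bar>G s\<bar> \<le> M * exp (\<gamma> * s)"
  shows "\<bar>duhamel d x G t\<bar> \<le> exp (- d * t) * \<bar>x\<bar> + M / (d + \<gamma>) * exp (\<gamma> * t)"
proof -
  have M0: "M \<ge> 0" using M[of 0] t by simp
  have "((\<lambda>s. M * exp ((d + \<gamma>) * s)) has_integral
      M / (d + \<gamma>) * exp ((d + \<gamma>) * t) - M / (d + \<gamma>) * exp ((d + \<gamma>) * 0)) {0..t}"
    using d t by (intro fundamental_theorem_of_calculus)
      (auto intro!: derivative_eq_intros simp: has_real_derivative_iff_has_vector_derivative[symmetric])
  note hi = this
  have "norm (integral {0..t} (\<lambda>s. exp (d * s) * G s)) \<le> integral {0..t} (\<lambda>s. M * exp ((d + \<gamma>) * s))"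
  proof (rule integral_norm_bound_integral)
    show "(\<lambda>s. exp (d * s) * G s) integrable_on {0..t}"
      by (intro integrable_continuous_real continuous_intros G)
    show "(\<lambda>s. M * exp ((d + \<gamma>) * s)) integrable_on {0..t}" using hi by blast
    fix s assume "s \<in> {0..t}"
    then have "exp (d * s) * \<bar>G s\<bar> \<le> exp (d * s) * (M * exp (\<gamma> * s))" using M by (intro mult_left_mono) auto
    then show "norm (exp (d * s) * G s) \<le> M * exp ((d + \<gamma>) * s)"
      by (simp add: abs_mult distrib_right exp_add mult.left_commute)
  qed
  also have "\<dots> \<le> M / (d + \<gamma>) * exp ((d + \<gamma>) * t)"
    unfolding integral_unique[OF hi] using M0 d by simp
  finally have I: "\<bar>integral {0..t} (\<lambda>s. exp (d * s) * G s)\<bar> \<le> M / (d + \<gamma>) * exp ((d + \<gamma>) * t)" by simp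
  have "\<bar>duhamel d x G t\<bar> \<le> exp (- d * t) * (\<bar>x\<bar> + M / (d + \<gamma>) * exp ((d + \<gamma>) * t))"
    unfolding duhamel_def abs_mult using I by (intro mult_mono) auto
  also have "\<dots> = exp (- d * t) * \<bar>x\<bar> + M / (d + \<gamma>) * exp (\<gamma> * t)"
    by (simp add: distrib_left distrib_right exp_add exp_minus)
  finally show ?thesis .
qed

lemma linear_ode_bound:
  assumes f: "\<And>s. 0 \<le> s \<Longrightarrow> s \<le> t \<Longrightarrow> (f has_real_derivative (- d * f s + G s)) (at s within {0..t})"
    and G: "continuous_on {0..t} G" and t: "t \<ge> 0" and d: "d + \<gamma> > 0"
    and M: "\<And>s. 0 \<le> s \<Longrightarrow> s \<le> t \<Longrightarrow> \<bar>G s\<bar> \<le> M * exp (\<gamma> * s)"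
  shows "\<bar>f t\<bar> \<le> exp (- d * t) * \<bar>f 0\<bar> + M / (d + \<gamma>) * exp (\<gamma> * t)"
proof -
  have "((\<lambda>s. exp (d * s) * f s) has_real_derivative exp (d * s) * G s) (at s within {0..t})"
    if "0 \<le> s" "s \<le> t" for s
    by (rule derivative_eq_intros f[OF that] refl)+ (simp add: algebra_simps)
  then have "((\<lambda>s. exp (d * s) * G s) has_integral exp (d * t) * f t - exp (d * 0) * f 0) {0..t}"
    by (intro fundamental_theorem_of_calculus t)
      (auto simp: has_real_derivative_iff_has_vector_derivative[symmetric])
  then have "f t = duhamel d (f 0) G t"
    unfolding duhamel_def by (simp add: integral_unique flip: exp_add mult.assoc)
  with duhamel_bound[OF G t d M, of "f 0"] show ?thesis by simp
qed

text \<open>Completing the square in c x^2 - 4 L gives 8 L x^2 \<le> c x^4 + 16 L^2 / c, which is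
  the origin of the rate 16 L^2 / c. One factor x stands for the k lost by the nonlinearity, the
  other for the weight k of the norm in which the contraction takes place.\<close>

lemma picard_rate:
  fixes c L D x :: real
  assumes c: "c > 0" and L: "L > 0" and D: "c * x ^ 4 + 16 * L\<^sup>2 / c \<le> D"
  shows "L * x\<^sup>2 / D \<le> 1 / 8"
proof -
  have "0 \<le> (c * x\<^sup>2 - 4 * L)\<^sup>2" by simp
  then have "c * (8 * L * x\<^sup>2) \<le> c * (c * x ^ 4 + 16 * L\<^sup>2 / c)"
    using c by (simp add: power2_eq_square power4_eq_xxxx algebra_simps)
  then have "8 * L * x\<^sup>2 \<le> D" using c D by simp
  moreover have "D > 0" using c L D by (smt (verit) divide_pos_pos mult_nonneg_nonneg zero_le_even_power even_numeral zero_less_power mult_pos_pos)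
  ultimately show ?thesis by (simp add: divide_le_eq)
qed

lemma duhamel_diff:
  assumes "continuous_on {0..} G" "continuous_on {0..} G'"
  shows "duhamel d x G t - duhamel d x G' t = duhamel d 0 (\<lambda>s. G s - G' s) t"
proof -
  have "(\<lambda>s. exp (d * s) * H s) integrable_on {0..t}" if "continuous_on {0..} H" for H
    by (intro integrable_continuous_real continuous_intros continuous_on_subset[OF that]) auto
  then show ?thesis unfolding duhamel_def
    using assms by (simp add: integral_diff right_diff_distrib distrib_left)
qed

text \<open>With a metric on \<open>nat\<close>, the bounded continuous functions on \<open>real \<times> nat\<close> form a Banach space.\<close>

instantiation nat :: metric_space
begin

definition dist_nat :: "nat \<Rightarrow> nat \<Rightarrow> real" where "dist_nat m n = of_bool (m \<noteq> n)"
definition uniformity_nat :: "(nat \<times> nat) filter"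
  where "uniformity_nat = (INF e\<in>{0<..}. principal {(m, n). dist m n < e})"

instance
proof
  fix m n k :: nat and U :: "nat set"
  show "(uniformity :: (nat \<times> nat) filter) = (INF e\<in>{0<..}. principal {(m, n). dist m n < e})"
    by (rule uniformity_nat_def)
  have "\<forall>\<^sub>F (x', y) in uniformity. x' = x \<longrightarrow> y \<in> U" if "x \<in> U" for x
    unfolding uniformity_nat_def
    by (rule eventually_INF1[of 1]) (use that in \<open>auto simp: eventually_principal dist_nat_def split: if_splits\<close>)
  then show "open U \<longleftrightarrow> (\<forall>x\<in>U. \<forall>\<^sub>F (x', y) in uniformity. x' = x \<longrightarrow> y \<in> U)"
    by (auto simp: open_discrete)
  show "dist m n = 0 \<longleftrightarrow> m = n" by (simp add: dist_nat_def)
  show "dist m n \<le> dist m k + dist n k" by (auto simp: dist_nat_def)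
qed

end

text \<open>The second component is discrete, hence locally constant, and joint continuity reduces
  to continuity in t for each k.\<close>

lemma bcontfun_real_nat:
  fixes f :: "real \<times> nat \<Rightarrow> real"
  assumes "\<And>k. continuous_on UNIV (\<lambda>t. f (t, k))" "\<And>t k. \<bar>f (t, k)\<bar> \<le> B"
  shows "f \<in> bcontfun"
proof -
  have "isCont f (t0, k0)" for t0 k0
  proof -
    have "\<forall>\<^sub>F p in nhds (t0, k0). snd p \<in> {k0}"
      by (rule topological_tendstoD[of snd _ "nhds (t0, k0)", where S = "{k0}"])
        (auto intro!: tendsto_eq_intros filterlim_ident simp: open_discrete)
    then have ev: "\<forall>\<^sub>F p in nhds (t0, k0). f p = (\<lambda>p. f (fst p, k0)) p"
      by eventually_elim (auto simp: prod_eq_iff)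
    have "isCont (\<lambda>t. f (t, k0)) (fst (t0, k0))" using assms(1)[of k0] by (simp add: continuous_on_eq_continuous_at)
    then have "isCont (\<lambda>p. f (fst p, k0)) (t0, k0)"
      by (intro isCont_o2[of "(t0, k0)" fst "\<lambda>t. f (t, k0)"]) auto
    with ev show ?thesis by (subst isCont_cong[OF ev])
  qed
  then have "continuous_on UNIV f" by (auto simp: continuous_on_eq_continuous_at)
  moreover have "bounded (range f)" using assms(2) by (auto intro!: boundedI)
  ultimately show ?thesis by (simp add: bcontfun_def)
qed

text \<open>The sum of 1/k^2 is pi^2/6, which is less than 4 = 2^2. A supremum norm with weight k
  therefore controls the norm of the phase space.\<close>

lemma norm_le_of_weighted:
  assumes "\<And>k. k \<ge> 1 \<Longrightarrow> \<bar>coord w k\<bar> \<le> D / real k"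
  shows "norm w \<le> 2 * D"
proof -
  have "\<bar>coord w 1\<bar> \<le> D" using assms[of 1] by simp
  then have D: "D \<ge> 0" by linarith
  have s: "(\<lambda>k. D\<^sup>2 * (1 / (real (k+1))\<^sup>2)) sums (D\<^sup>2 * (pi\<^sup>2 / 6))"
    using sums_mult[OF inverse_squares_sums, of "D\<^sup>2"] by (simp only: of_nat_power)
  have "(norm w)\<^sup>2 = (\<Sum>k. (coord w (k + 1))\<^sup>2)"
    using suminf_split_initial_segment[OF summable_coord_sq[of w], of 1] by (simp add: norm_ell2_sq)
  also have "\<dots> \<le> (\<Sum>k. D\<^sup>2 * (1 / (real (k+1))\<^sup>2))"
  proof (rule suminf_le)
    show "summable (\<lambda>k. (coord w (k + 1))\<^sup>2)"
      using summable_coord_sq[of w] by (rule summable_ignore_initial_segment)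
    show "summable (\<lambda>k. D\<^sup>2 * (1 / (real (k+1))\<^sup>2))" using s by (rule sums_summable)
    fix k
    have "\<bar>coord w (k+1)\<bar>\<^sup>2 \<le> (D / real (k+1))\<^sup>2" using assms[of "k+1"] by (intro power_mono) auto
    then show "(coord w (k+1))\<^sup>2 \<le> D\<^sup>2 * (1 / (real (k+1))\<^sup>2)" by (simp add: power_divide)
  qed
  also have "\<dots> = D\<^sup>2 * (pi\<^sup>2 / 6)" using s by (rule sums_unique[symmetric])
  also have "\<dots> \<le> D\<^sup>2 * 4"
  proof (intro mult_left_mono)
    have "pi\<^sup>2 \<le> 4\<^sup>2" using pi_less_4 by (intro power_mono) auto
    then show "pi\<^sup>2 / 6 \<le> 4" by simp
  qed auto
  finally have "(norm w)\<^sup>2 \<le> (2 * D)\<^sup>2" by (simp add: power_mult_distrib)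
  then show ?thesis by (rule power2_le_imp_le) (use D in simp)
qed

text \<open>The equation is x_k' = - d_k x_k + g_k(x). The faces of the box lie at distance of order
  1/k from 0, so that the weighted supremum norm of its points is finite, and g is controlled on the
  box only.\<close>

locale inward_box =
  fixes l r d :: "nat \<Rightarrow> real" and g :: "ell2 \<Rightarrow> nat \<Rightarrow> real" and c B L :: real
  assumes c_pos: "c > 0" and d_ge: "\<And>k. k \<ge> 1 \<Longrightarrow> c * real k ^ 4 \<le> d k"
    and lr: "\<And>k. k \<ge> 1 \<Longrightarrow> l k \<le> r k"
    and B: "\<And>k. k \<ge> 1 \<Longrightarrow> \<bar>l k\<bar> \<le> B / real k" "\<And>k. k \<ge> 1 \<Longrightarrow> \<bar>r k\<bar> \<le> B / real k"
    and L_pos: "L > 0"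
    and g_bound: "\<And>x k. x \<in> ell2_box l r \<Longrightarrow> k \<ge> 1 \<Longrightarrow> \<bar>g x k\<bar> \<le> L * real k"
    and g_lipschitz: "\<And>x y k. x \<in> ell2_box l r \<Longrightarrow> y \<in> ell2_box l r \<Longrightarrow> k \<ge> 1 \<Longrightarrow>
      \<bar>g x k - g y k\<bar> \<le> L * real k * norm (x - y)"
    and inward_r: "\<And>x k. x \<in> ell2_box l r \<Longrightarrow> k \<ge> 1 \<Longrightarrow> coord x k = r k \<Longrightarrow> g x k \<le> d k * r k"
    and inward_l: "\<And>x k. x \<in> ell2_box l r \<Longrightarrow> k \<ge> 1 \<Longrightarrow> coord x k = l k \<Longrightarrow> d k * l k \<le> g x k"
begin

lemma B_nonneg: "B \<ge> 0"
  using B(1)[of 1] by simp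

lemma d_pos: "k \<ge> 1 \<Longrightarrow> d k > 0"
  using d_ge[of k] c_pos by (smt (verit) mult_pos_pos of_nat_0_less_iff zero_less_power less_le_trans zero_less_one)

lemma summable_lr: "summable (\<lambda>k. (\<bar>l k\<bar> + \<bar>r k\<bar>)\<^sup>2)"
proof (rule summable_comparison_test'[of "\<lambda>k. (2 * B)\<^sup>2 * (1 / real k ^ 2)" 1])
  show "summable (\<lambda>k. (2 * B)\<^sup>2 * (1 / real k ^ 2))"
    by (intro summable_mult) (use inverse_power_summable[of 2, where 'a = real] in \<open>simp add: divide_inverse\<close>)
  fix k :: nat assume k: "k \<ge> 1"
  have "(\<bar>l k\<bar> + \<bar>r k\<bar>)\<^sup>2 \<le> (2 * (B / real k))\<^sup>2"
    using B[OF k] by (intro power_mono) auto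
  then show "norm ((\<bar>l k\<bar> + \<bar>r k\<bar>)\<^sup>2) \<le> (2 * B)\<^sup>2 * (1 / real k ^ 2)"
    by (simp add: power_mult_distrib power_divide)
qed

text \<open>Composing g with this projection makes the nonlinearity globally defined without losing
  its bounds. Solutions of the modified equation turn out never to leave the box, where the
  projection is the identity.\<close>

definition clamp :: "(nat \<Rightarrow> real) \<Rightarrow> ell2" where
  "clamp x = Abs_ell2 (\<lambda>k. if k = 0 then 0 else max (l k) (min (r k) (x k)))"

lemma coord_clamp: "coord (clamp x) k = (if k = 0 then 0 else max (l k) (min (r k) (x k)))"
proof -
  have "summable (\<lambda>k. (if k = 0 then 0 else max (l k) (min (r k) (x k)))\<^sup>2)"
    by (rule summable_between[OF summable_lr]) (use lr in auto)
  then show ?thesis unfolding clamp_def by (subst coord_Abs) auto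
qed

lemma clamp_in_box: "clamp x \<in> ell2_box l r"
  unfolding ell2_box_def using lr by (auto simp: coord_clamp)

lemma continuous_clamp:
  assumes "\<And>k. k \<ge> 1 \<Longrightarrow> continuous_on S (\<lambda>t. x t k)"
  shows "continuous_on S (\<lambda>t. clamp (x t))"
  unfolding continuous_on_def
proof
  fix t assume t: "t \<in> S"
  show "((\<lambda>t. clamp (x t)) \<longlongrightarrow> clamp (x t)) (at t within S)"
  proof (rule tendsto_ell2_boxI[OF _ summable_lr _ clamp_in_box])
    fix k :: nat assume k: "k \<ge> 1"
    then have "((\<lambda>t. x t k) \<longlongrightarrow> x t k) (at t within S)"
      using assms[OF k] t by (simp add: continuous_on_def)
    then show "((\<lambda>t. coord (clamp (x t)) k) \<longlongrightarrow> coord (clamp (x t)) k) (at t within S)"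
      unfolding coord_clamp using k by (auto intro!: tendsto_intros)
  qed (simp add: clamp_in_box)
qed

lemma continuous_on_g: "k \<ge> 1 \<Longrightarrow> continuous_on (ell2_box l r) (\<lambda>x. g x k)"
  by (rule lipschitz_on_continuous_on[of "L * real k"], rule lipschitz_onI)
    (use g_lipschitz L_pos in \<open>auto simp: dist_norm\<close>)

lemma continuous_g_clamp:
  assumes "\<And>k. k \<ge> 1 \<Longrightarrow> continuous_on S (\<lambda>t. x t k)" "k \<ge> 1"
  shows "continuous_on S (\<lambda>t. g (clamp (x t)) k)"
proof -
  have "continuous_on S (\<lambda>t. clamp (x t))" by (rule continuous_clamp[OF assms(1)])
  from continuous_on_compose2[OF continuous_on_g[OF assms(2)] this] show ?thesis
    by (simp add: image_subset_iff clamp_in_box)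
qed

definition \<gamma> :: real where "\<gamma> = 16 * L\<^sup>2 / c"

lemma \<gamma>_pos: "\<gamma> > 0"
  using L_pos c_pos by (simp add: \<gamma>_def)

text \<open>The rate \<open>\<gamma>\<close> makes the Picard operator a contraction in the norm weighted with \<open>exp (- \<gamma> t)\<close>.\<close>

lemma \<gamma>_ineq: assumes k: "k \<ge> 1" shows "L * (real k)\<^sup>2 / (d k + \<gamma>) \<le> 1 / 8"
  by (rule picard_rate[OF c_pos L_pos]) (use d_ge[OF k] in \<open>simp add: \<gamma>_def\<close>)

text \<open>A bounded function v encodes a trajectory that may grow like exp(\<gamma> t) and decays
  like 1/k, so the plain supremum norm of v is the weighted norm needed for the contraction.\<close>

definition unweight :: "((real \<times> nat) \<Rightarrow>\<^sub>C real) \<Rightarrow> real \<Rightarrow> nat \<Rightarrow> real"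
  where "unweight v t k = exp (\<gamma> * t) * apply_bcontfun v (t, k) / real k"

lemma continuous_unweight: "continuous_on S (\<lambda>t. unweight v t k)"
proof -
  have "continuous_on S (\<lambda>t. apply_bcontfun v (t, k))"
    by (rule continuous_on_compose2[OF continuous_on_apply_bcontfun[of UNIV v]]) (auto intro!: continuous_intros)
  then show ?thesis unfolding unweight_def divide_inverse by (intro continuous_intros)
qed

lemma clamp_unweight_diff:
  "norm (clamp (unweight v t) - clamp (unweight w t)) \<le> 2 * (exp (\<gamma> * t) * dist v w)"
proof (rule norm_le_of_weighted)
  fix k :: nat assume k: "k \<ge> 1"
  have "\<bar>coord (clamp (unweight v t) - clamp (unweight w t)) k\<bar> \<le> \<bar>unweight v t k - unweight w t k\<bar>"
    using k by (auto simp: coord_clamp max_def min_def)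
  also have "\<dots> = exp (\<gamma> * t) * \<bar>apply_bcontfun v (t, k) - apply_bcontfun w (t, k)\<bar> / real k"
    by (simp add: unweight_def abs_mult flip: right_diff_distrib diff_divide_distrib)
  also have "\<dots> \<le> exp (\<gamma> * t) * dist v w / real k"
    using dist_bounded[of v "(t, k)" w] k by (intro divide_right_mono mult_left_mono) (auto simp: dist_real_def)
  finally show "\<bar>coord (clamp (unweight v t) - clamp (unweight w t)) k\<bar> \<le> exp (\<gamma> * t) * dist v w / real k" .
qed

text \<open>Elements of the Banach space live on all of \<real> and on all indices; the values at t
  < 0 are frozen at time 0 and the dummy index 0 is set to 0.\<close>

definition picard_fun :: "ell2 \<Rightarrow> ((real \<times> nat) \<Rightarrow>\<^sub>C real) \<Rightarrow> real \<times> nat \<Rightarrow> real" where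
  "picard_fun z v = (\<lambda>(t, k). if k = 0 then 0 else exp (- \<gamma> * max 0 t) * real k *
    duhamel (d k) (coord z k) (\<lambda>s. g (clamp (unweight v s)) k) (max 0 t))"

definition picard :: "ell2 \<Rightarrow> ((real \<times> nat) \<Rightarrow>\<^sub>C real) \<Rightarrow> ((real \<times> nat) \<Rightarrow>\<^sub>C real)"
  where "picard z v = Bcontfun (picard_fun z v)"

lemma continuous_G: "k \<ge> 1 \<Longrightarrow> continuous_on S (\<lambda>s. g (clamp (unweight v s)) k)"
  by (intro continuous_g_clamp continuous_unweight)

lemma continuous_duhamel:
  assumes "continuous_on {0..} G" shows "continuous_on {0..} (duhamel a x G)"
  unfolding continuous_on_eq_continuous_within
  using DERIV_continuous[OF duhamel_deriv[OF assms]] by auto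

lemma picard_apply:
  assumes z: "z \<in> ell2_box l r" shows "apply_bcontfun (picard z v) = picard_fun z v"
proof -
  have "picard_fun z v \<in> bcontfun"
  \<comment> \<open>After multiplication by k, the initial value contributes at most B and the
    forcing term at most L/c, because L k / d_k \<le> L / (c k^3).\<close>
  proof (rule bcontfun_real_nat[where B = "B + L / c"])
    fix k
    show "continuous_on UNIV (\<lambda>t. picard_fun z v (t, k))"
    proof (cases "k = 0")
      case False
      have "continuous_on UNIV (\<lambda>t. duhamel (d k) (coord z k) (\<lambda>s. g (clamp (unweight v s)) k) (max 0 t))"
        by (rule continuous_on_compose2[OF continuous_duhamel[OF continuous_G]])
          (use False in \<open>auto intro!: continuous_intros\<close>)
      then show ?thesis using False unfolding picard_fun_def by (auto intro!: continuous_intros)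
    qed (simp add: picard_fun_def)
    fix t
    show "\<bar>picard_fun z v (t, k)\<bar> \<le> B + L / c"
    proof (cases "k = 0")
      case True then show ?thesis using B_nonneg L_pos c_pos by (simp add: picard_fun_def)
    next
      case False
      then have k: "k \<ge> 1" by simp
      define \<tau> where "\<tau> = max 0 t"
      have \<tau>: "\<tau> \<ge> 0" by (simp add: \<tau>_def)
      have "\<bar>duhamel (d k) (coord z k) (\<lambda>s. g (clamp (unweight v s)) k) \<tau>\<bar> \<le>
          exp (- d k * \<tau>) * \<bar>coord z k\<bar> + (L * real k) / (d k + 0) * exp (0 * \<tau>)"
        by (intro duhamel_bound continuous_G k \<tau>) (use d_pos[OF k] g_bound[OF clamp_in_box k] in auto)
      also have "\<dots> \<le> 1 * (B / real k) + L / (c * real k)"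
      proof (rule add_mono)
        have "\<bar>coord z k\<bar> \<le> B / real k" using ell2_boxD[OF z k] B[OF k] by linarith
        then show "exp (- d k * \<tau>) * \<bar>coord z k\<bar> \<le> 1 * (B / real k)"
          using \<tau> d_pos[OF k] by (intro mult_mono) auto
        have "L * real k / d k \<le> L * real k / (c * real k ^ 4)"
          using d_ge[OF k] c_pos L_pos k d_pos[OF k] by (intro divide_left_mono mult_pos_pos) auto
        also have "\<dots> = L / (c * real k ^ 3)" using k by (simp add: power_numeral_reduce)
        also have "\<dots> \<le> L / (c * real k)"
          using c_pos L_pos k self_le_power[of "real k" 3] by (intro divide_left_mono mult_pos_pos mult_left_mono) auto
        finally show "(L * real k) / (d k + 0) * exp (0 * \<tau>) \<le> L / (c * real k)" by simp
      qed
      finally have D: "\<bar>duhamel (d k) (coord z k) (\<lambda>s. g (clamp (unweight v s)) k) \<tau>\<bar> \<le> (B + L / c) / real k"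
        by (simp add: add_divide_distrib)
      have "\<bar>picard_fun z v (t, k)\<bar> =
          exp (- \<gamma> * \<tau>) * (real k * \<bar>duhamel (d k) (coord z k) (\<lambda>s. g (clamp (unweight v s)) k) \<tau>\<bar>)"
        using False by (simp add: picard_fun_def \<tau>_def abs_mult)
      also have "\<dots> \<le> 1 * (real k * ((B + L / c) / real k))"
        using \<gamma>_pos \<tau> D by (intro mult_mono) auto
      finally show ?thesis using k by simp
    qed
  qed
  then show ?thesis unfolding picard_def by (rule Bcontfun_inverse)
qed

lemma picard_contraction:
  assumes z: "z \<in> ell2_box l r"
  shows "dist (picard z v) (picard z w) \<le> 1 / 2 * dist v w"
proof (rule dist_bound)
  fix p :: "real \<times> nat"
  obtain t k where p: "p = (t, k)" by fastforce
  show "dist (apply_bcontfun (picard z v) p) (apply_bcontfun (picard z w) p) \<le> 1 / 2 * dist v w"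
  proof (cases "k = 0")
    case True then show ?thesis by (simp add: p picard_apply[OF z] picard_fun_def)
  next
    case False
    then have k: "k \<ge> 1" by simp
    define \<tau> where "\<tau> = max 0 t"
    have \<tau>: "\<tau> \<ge> 0" by (simp add: \<tau>_def)
    let ?G = "\<lambda>v s. g (clamp (unweight v s)) k"
    have "\<bar>duhamel (d k) 0 (\<lambda>s. ?G v s - ?G w s) \<tau>\<bar> \<le>
        exp (- d k * \<tau>) * \<bar>0\<bar> + (2 * L * real k * dist v w) / (d k + \<gamma>) * exp (\<gamma> * \<tau>)"
    proof (intro duhamel_bound continuous_intros continuous_G k \<tau>)
      show "0 < d k + \<gamma>" using d_pos[OF k] \<gamma>_pos by simp
      fix s :: real
      have "\<bar>?G v s - ?G w s\<bar> \<le> L * real k * norm (clamp (unweight v s) - clamp (unweight w s))"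
        by (intro g_lipschitz clamp_in_box k)
      also have "\<dots> \<le> L * real k * (2 * (exp (\<gamma> * s) * dist v w))"
        using L_pos by (intro mult_left_mono clamp_unweight_diff) auto
      finally show "\<bar>?G v s - ?G w s\<bar> \<le> 2 * L * real k * dist v w * exp (\<gamma> * s)" by (simp add: mult_ac)
    qed
    also have "duhamel (d k) 0 (\<lambda>s. ?G v s - ?G w s) \<tau> =
        duhamel (d k) (coord z k) (?G v) \<tau> - duhamel (d k) (coord z k) (?G w) \<tau>"
      by (rule duhamel_diff[symmetric]; rule continuous_G[OF k])
    finally have D: "\<bar>duhamel (d k) (coord z k) (?G v) \<tau> - duhamel (d k) (coord z k) (?G w) \<tau>\<bar> \<le>
        2 * L * real k * dist v w / (d k + \<gamma>) * exp (\<gamma> * \<tau>)" by simp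
    have "dist (apply_bcontfun (picard z v) p) (apply_bcontfun (picard z w) p) = exp (- \<gamma> * \<tau>) * (real k *
        \<bar>duhamel (d k) (coord z k) (?G v) \<tau> - duhamel (d k) (coord z k) (?G w) \<tau>\<bar>)"
      using False by (simp add: p picard_apply[OF z] picard_fun_def \<tau>_def[symmetric] dist_real_def abs_mult
          flip: right_diff_distrib)
    also have "\<dots> \<le> exp (- \<gamma> * \<tau>) * (real k * (2 * L * real k * dist v w / (d k + \<gamma>) * exp (\<gamma> * \<tau>)))"
      using D by (intro mult_left_mono) auto
    also have "\<dots> = 2 * dist v w * (L * (real k)\<^sup>2 / (d k + \<gamma>))"
      by (simp add: exp_minus power2_eq_square field_simps)
    also have "\<dots> \<le> 2 * dist v w * (1 / 8)" by (intro mult_left_mono \<gamma>_ineq k) auto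
    also have "\<dots> \<le> 1 / 2 * dist v w" by simp
    finally show ?thesis .
  qed
qed

text \<open>The fixed point of the Picard operator solves the clamped equation. The barrier lemma,
  applied at each face separately, shows that it stays in the box, so it solves the original
  equation.\<close>

theorem solution_exists:
  assumes z: "z \<in> ell2_box l r"
  obtains u where "u 0 = z" "continuous_on {0..} u" "\<And>t. t \<ge> 0 \<Longrightarrow> u t \<in> ell2_box l r"
    "\<And>t k. t \<ge> 0 \<Longrightarrow> k \<ge> 1 \<Longrightarrow>
      ((\<lambda>t. coord (u t) k) has_real_derivative (- d k * coord (u t) k + g (u t) k)) (at t within {0..})"
proof -
  have "\<exists>!v. picard z v = v"
    by (rule banach_fix_type[where c = "1/2" and f = "picard z"]) (use picard_contraction[OF z] in auto)
  then obtain v where v: "picard z v = v" by blast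
  define b where "b t k = duhamel (d k) (coord z k) (\<lambda>s. g (clamp (unweight v s)) k) t" for t k
  have vb: "unweight v t k = b t k" if "t \<ge> 0" "k \<ge> 1" for t k
  proof -
    have "apply_bcontfun v (t, k) = picard_fun z v (t, k)" using v picard_apply[OF z, of v] by simp
    then show ?thesis using that by (simp add: unweight_def picard_fun_def b_def exp_minus)
  qed
  define u where "u = (\<lambda>t. clamp (unweight v t))"
  have b_der: "((\<lambda>t. b t k) has_real_derivative (- d k * b t k + g (u t) k)) (at t within {0..})"
    if "t \<ge> 0" "k \<ge> 1" for t k
    unfolding b_def u_def using that by (intro duhamel_deriv continuous_G) auto
  have b_cont: "continuous_on {0..} (\<lambda>t. b t k)" if "k \<ge> 1" for k
    unfolding b_def using that by (intro continuous_duhamel continuous_G)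
  have b0: "b 0 k = coord z k" for k by (simp add: b_def)
  have u_box: "u t \<in> ell2_box l r" for t by (simp add: u_def clamp_in_box)
  \<comment> \<open>While b_k exceeds r_k, its clamped value sits exactly on the face, so the inward
    condition bounds g by d_k r_k \<le> d_k b_k and the derivative is nonpositive.\<close>
  have upper: "b t k \<le> r k" if "t \<ge> 0" "k \<ge> 1" for t k
  proof (rule barrier_le[OF b_cont[OF that(2)] _ _ that(1)])
    show "b 0 k \<le> r k" using ell2_boxD[OF z that(2)] by (simp add: b0)
    fix s :: real assume s: "s \<ge> 0" "b s k > r k"
    then have "coord (u s) k = r k" using that vb[OF s(1) that(2)] lr[OF that(2)] by (simp add: u_def coord_clamp)
    then have "g (u s) k \<le> d k * r k" using inward_r[OF u_box that(2)] by blast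
    also have "\<dots> \<le> d k * b s k" using s d_pos[OF that(2)] by simp
    finally show "\<exists>D\<le>0. ((\<lambda>t. b t k) has_real_derivative D) (at s within {0..})"
      using b_der[OF s(1) that(2)] by (intro exI[of _ "- d k * b s k + g (u s) k"]) auto
  qed
  have lower: "- b t k \<le> - l k" if "t \<ge> 0" "k \<ge> 1" for t k
  proof (rule barrier_le[OF _ _ _ that(1), where f = "\<lambda>t. - b t k"])
    show "continuous_on {0..} (\<lambda>t. - b t k)" by (intro continuous_intros b_cont that)
    show "- b 0 k \<le> - l k" using ell2_boxD[OF z that(2)] by (simp add: b0)
    fix s :: real assume s: "s \<ge> 0" "- b s k > - l k"
    then have "coord (u s) k = l k" using that vb[OF s(1) that(2)] lr[OF that(2)] by (simp add: u_def coord_clamp)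
    then have "d k * l k \<le> g (u s) k" using inward_l[OF u_box that(2)] by blast
    moreover have "d k * b s k \<le> d k * l k" using s d_pos[OF that(2)] by simp
    ultimately show "\<exists>D\<le>0. ((\<lambda>t. - b t k) has_real_derivative D) (at s within {0..})"
      using DERIV_minus[OF b_der[OF s(1) that(2)]]
      by (intro exI[of _ "- (- d k * b s k + g (u s) k)"]) auto
  qed
  have coord_u: "coord (u t) k = b t k" if "t \<ge> 0" "k \<ge> 1" for t k
    using upper[OF that] lower[OF that] vb[OF that] that by (simp add: u_def coord_clamp)
  show ?thesis
  proof (rule that[of u])
    show "u 0 = z"
    proof (rule ell2_eqI)
      fix k show "coord (u 0) k = coord z k" using coord_u[of 0 k] b0 by (cases "k = 0") auto
    qed
    show "continuous_on {0..} u" unfolding u_def by (rule continuous_clamp, rule continuous_unweight)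
    show "u t \<in> ell2_box l r" for t by (rule u_box)
    fix t :: real and k :: nat assume tk: "t \<ge> 0" "k \<ge> 1"
    have "((\<lambda>t. coord (u t) k) has_real_derivative (- d k * b t k + g (u t) k)) (at t within {0..})"
      by (rule has_field_derivative_transform_within[OF b_der[OF tk] zero_less_one]) (use tk coord_u in auto)
    then show "((\<lambda>t. coord (u t) k) has_real_derivative (- d k * coord (u t) k + g (u t) k)) (at t within {0..})"
      unfolding coord_u[OF tk] .
  qed
qed

end

section \<open>The semiflow of a damped system\<close>

text \<open>\<open>d k\<close> is the linear damping rate; the remaining part of \<open>F\<close> loses one derivative at most.\<close>

locale damped_system =
  fixes U :: "ell2 set" and F :: vfield and d :: "nat \<Rightarrow> real" and c c1 L :: real
  assumes c_pos: "c > 0" and c1_nonneg: "c1 \<ge> 0" and L_pos: "L > 0"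
    and d_ge: "\<And>k. k \<ge> 1 \<Longrightarrow> c * real k ^ 4 - c1 \<le> d k"
    and lipschitz: "\<And>x y k. x \<in> U \<Longrightarrow> y \<in> U \<Longrightarrow> k \<ge> 1 \<Longrightarrow>
      \<bar>(F x k + d k * coord x k) - (F y k + d k * coord y k)\<bar> \<le> L * real k * norm (x - y)"
begin

abbreviation "N x k \<equiv> F x k + d k * coord x k"

definition \<gamma> :: real where "\<gamma> = c1 + 16 * L\<^sup>2 / c"

text \<open>Let W be the maximum over [0, t] of exp(- \<gamma> s) times the distance, attained at
  \<tau>. Variation of constants at \<tau> bounds each coordinate by its initial part plus a forcing
  part of size W/8 with decay 1/k. Summation gives W \<le> norm (w 0) + W/4, and W is
  absorbed.\<close>

lemma solution_lipschitz:
  assumes t: "t \<ge> 0"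
    and u: "continuous_on {0..t} u" "u ` {0..t} \<subseteq> U"
      "\<And>s k. 0 \<le> s \<Longrightarrow> s \<le> t \<Longrightarrow> k \<ge> 1 \<Longrightarrow> ((\<lambda>s. coord (u s) k) has_real_derivative F (u s) k) (at s within {0..t})"
    and v: "continuous_on {0..t} v" "v ` {0..t} \<subseteq> U"
      "\<And>s k. 0 \<le> s \<Longrightarrow> s \<le> t \<Longrightarrow> k \<ge> 1 \<Longrightarrow> ((\<lambda>s. coord (v s) k) has_real_derivative F (v s) k) (at s within {0..t})"
  shows "norm (u t - v t) \<le> 2 * exp (\<gamma> * t) * norm (u 0 - v 0)"
proof -
  define w where "w s = u s - v s" for s
  have w_cont: "continuous_on {0..t} w" unfolding w_def by (intro continuous_intros u v)
  have "continuous_on {0..t} (\<lambda>s. exp (- \<gamma> * s) * norm (w s))"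
    by (intro continuous_intros w_cont)
  then obtain \<tau> where \<tau>: "\<tau> \<in> {0..t}"
    and \<tau>_max: "\<And>s. s \<in> {0..t} \<Longrightarrow> exp (- \<gamma> * s) * norm (w s) \<le> exp (- \<gamma> * \<tau>) * norm (w \<tau>)"
    using continuous_attains_sup[of "{0..t}" "\<lambda>s. exp (- \<gamma> * s) * norm (w s)"] t by auto
  define W where "W = exp (- \<gamma> * \<tau>) * norm (w \<tau>)"
  have w_le: "norm (w s) \<le> W * exp (\<gamma> * s)" if "s \<in> {0..t}" for s
    using \<tau>_max[OF that] by (simp add: W_def exp_minus field_simps)
  have sub: "{0..\<tau>} \<subseteq> {0..t}" using \<tau> by auto
  have N_cont: "continuous_on {0..\<tau>} (\<lambda>s. N (x s) k)"
    if x: "continuous_on {0..t} x" "x ` {0..t} \<subseteq> U" and k: "k \<ge> 1" for x k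
  proof -
    have "continuous_on U (\<lambda>y. N y k)"
      by (rule lipschitz_on_continuous_on[of "L * real k"], rule lipschitz_onI)
        (use lipschitz k L_pos in \<open>auto simp: dist_norm\<close>)
    then show ?thesis
      by (rule continuous_on_compose2) (use continuous_on_subset[OF x(1) sub] x(2) sub in auto)
  qed
  have w_coord: "\<bar>coord (w \<tau>) k\<bar> \<le> exp (\<gamma> * \<tau>) * \<bar>coord (w 0) k\<bar> + exp (\<gamma> * \<tau>) * (W / 8) / real k"
    if k: "k \<ge> 1" for k
  proof -
    have D: "c * real k ^ 4 + 16 * L\<^sup>2 / c \<le> d k + \<gamma>" using d_ge[OF k] by (simp add: \<gamma>_def)
    have Dpos: "d k + \<gamma> > 0" using D c_pos L_pos by (smt (verit) divide_pos_pos mult_nonneg_nonneg of_nat_0_le_iff zero_le_power zero_less_power mult_pos_pos)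
    have "\<bar>coord (w \<tau>) k\<bar> \<le> exp (- d k * \<tau>) * \<bar>coord (w 0) k\<bar> + L * real k * W / (d k + \<gamma>) * exp (\<gamma> * \<tau>)"
    proof (rule linear_ode_bound[where G = "\<lambda>s. N (u s) k - N (v s) k"])
      show "((\<lambda>s. coord (w s) k) has_real_derivative - d k * coord (w s) k + (N (u s) k - N (v s) k)) (at s within {0..\<tau>})"
        if "0 \<le> s" "s \<le> \<tau>" for s
      proof -
        have "((\<lambda>s. coord (u s) k - coord (v s) k) has_real_derivative F (u s) k - F (v s) k) (at s within {0..t})"
          using that \<tau> by (intro DERIV_diff u v k) auto
        from DERIV_subset[OF this sub] show ?thesis by (simp add: w_def algebra_simps)
      qed
      show "continuous_on {0..\<tau>} (\<lambda>s. N (u s) k - N (v s) k)"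
        by (intro continuous_on_diff N_cont u v k)
      fix s assume s: "0 \<le> s" "s \<le> \<tau>"
      have "\<bar>N (u s) k - N (v s) k\<bar> \<le> L * real k * norm (w s)"
        unfolding w_def using s u(2) v(2) \<tau> by (intro lipschitz k) auto
      also have "\<dots> \<le> L * real k * (W * exp (\<gamma> * s))"
        using s \<tau> L_pos by (intro mult_left_mono w_le) auto
      finally show "\<bar>N (u s) k - N (v s) k\<bar> \<le> L * real k * W * exp (\<gamma> * s)" by (simp add: mult_ac)
    qed (use \<tau> Dpos in auto)
    also have "\<dots> \<le> exp (\<gamma> * \<tau>) * \<bar>coord (w 0) k\<bar> + W / 8 / real k * exp (\<gamma> * \<tau>)"
    proof (intro add_mono mult_right_mono)
      have "(- d k) * \<tau> \<le> \<gamma> * \<tau>" using Dpos \<tau> by (intro mult_right_mono) auto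
      then show "exp (- d k * \<tau>) \<le> exp (\<gamma> * \<tau>)" by simp
      have "L * real k * W / (d k + \<gamma>) = (L * (real k)\<^sup>2 / (d k + \<gamma>)) * (W / real k)"
        using k by (simp add: power2_eq_square)
      also have "\<dots> \<le> 1 / 8 * (W / real k)"
        using picard_rate[OF c_pos L_pos D] by (intro mult_right_mono) (auto simp: W_def)
      finally show "L * real k * W / (d k + \<gamma>) \<le> W / 8 / real k" by simp
    qed auto
    finally show ?thesis by (simp add: mult_ac)
  qed
  have "norm (w \<tau>) \<le> exp (\<gamma> * \<tau>) * norm (w 0) + 2 * (exp (\<gamma> * \<tau>) * (W / 8))"
  proof -
    \<comment> \<open>The initial part is only square-summable while the forcing part is bounded by
      a multiple of 1/k, so the two need different norms. The truncation p of w \<tau> carries the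
      first and w \<tau> - p the second.\<close>
    define p where "p = Abs_ell2 (\<lambda>k. max (- exp (\<gamma> * \<tau>) * \<bar>coord (w 0) k\<bar>) (min (exp (\<gamma> * \<tau>) * \<bar>coord (w 0) k\<bar>) (coord (w \<tau>) k)))"
    have p: "coord p k = max (- exp (\<gamma> * \<tau>) * \<bar>coord (w 0) k\<bar>) (min (exp (\<gamma> * \<tau>) * \<bar>coord (w 0) k\<bar>) (coord (w \<tau>) k))" for k
      unfolding p_def
    proof (subst coord_Abs)
      show "summable (\<lambda>k. (max (- exp (\<gamma> * \<tau>) * \<bar>coord (w 0) k\<bar>) (min (exp (\<gamma> * \<tau>) * \<bar>coord (w 0) k\<bar>) (coord (w \<tau>) k)))\<^sup>2)"
      proof (rule summable_comparison_test'[OF summable_coord_sq[of "w \<tau>"]])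
        fix k
        have "\<bar>max (- exp (\<gamma> * \<tau>) * \<bar>coord (w 0) k\<bar>) (min (exp (\<gamma> * \<tau>) * \<bar>coord (w 0) k\<bar>) (coord (w \<tau>) k))\<bar> \<le> \<bar>coord (w \<tau>) k\<bar>"
          using mult_nonneg_nonneg[of "exp (\<gamma> * \<tau>)" "\<bar>coord (w 0) k\<bar>"] by (simp del: mult_nonneg_nonneg)
        then show "norm ((max (- exp (\<gamma> * \<tau>) * \<bar>coord (w 0) k\<bar>) (min (exp (\<gamma> * \<tau>) * \<bar>coord (w 0) k\<bar>) (coord (w \<tau>) k)))\<^sup>2) \<le> (coord (w \<tau>) k)\<^sup>2"
          by (simp add: abs_le_square_iff)
      qed
    qed auto
    have "norm p \<le> norm (exp (\<gamma> * \<tau>) *\<^sub>R w 0)"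
    proof (rule power2_le_imp_le)
      show "(norm p)\<^sup>2 \<le> (norm (exp (\<gamma> * \<tau>) *\<^sub>R w 0))\<^sup>2"
        unfolding norm_ell2_sq
      proof (intro suminf_le summable_coord_sq)
        fix k
        have "\<bar>coord p k\<bar> \<le> \<bar>exp (\<gamma> * \<tau>) * coord (w 0) k\<bar>"
        proof -
          have "\<bar>max (- B) (min B x)\<bar> \<le> B" if "0 \<le> B" for B x :: real using that by auto
          from this[of "exp (\<gamma> * \<tau>) * \<bar>coord (w 0) k\<bar>" "coord (w \<tau>) k"]
          show ?thesis unfolding p abs_mult by simp
        qed
        then show "(coord p k)\<^sup>2 \<le> (coord (exp (\<gamma> * \<tau>) *\<^sub>R w 0) k)\<^sup>2" by (simp add: abs_le_square_iff)
      qed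
    qed simp
    moreover have "norm (w \<tau> - p) \<le> 2 * (exp (\<gamma> * \<tau>) * (W / 8))"
    proof (rule norm_le_of_weighted)
      fix k :: nat assume k: "k \<ge> 1"
      have "\<bar>x - max (- B) (min B x)\<bar> \<le> e" if "0 \<le> B" "0 \<le> e" "\<bar>x\<bar> \<le> B + e" for B e x :: real
        using that by auto
      from this[OF _ _ w_coord[OF k]] show "\<bar>coord (w \<tau> - p) k\<bar> \<le> exp (\<gamma> * \<tau>) * (W / 8) / real k"
        by (simp add: p W_def)
    qed
    moreover have "norm (w \<tau>) \<le> norm p + norm (w \<tau> - p)" by (metis add_diff_cancel_left' add_diff_eq norm_triangle_ineq)
    ultimately show ?thesis by simp
  qed
  then have "W \<le> exp (- \<gamma> * \<tau>) * (exp (\<gamma> * \<tau>) * norm (w 0) + 2 * (exp (\<gamma> * \<tau>) * (W / 8)))"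
    unfolding W_def by (intro mult_left_mono) auto
  also have "\<dots> = norm (w 0) + W / 4" by (simp add: exp_minus field_simps)
  finally have "W \<le> 2 * norm (w 0)" using norm_ge_zero[of "w 0"] by linarith
  have "norm (w t) \<le> W * exp (\<gamma> * t)" using t by (intro w_le) auto
  also have "\<dots> \<le> 2 * norm (w 0) * exp (\<gamma> * t)"
    using \<open>W \<le> 2 * norm (w 0)\<close> by (intro mult_right_mono) auto
  finally show ?thesis by (simp add: w_def mult_ac)
qed

section \<open>Maximal solutions and the semiflow they form\<close>

lemma solution_on_seg:
  assumes "solution_on U F T u" "0 \<le> t" "ereal t < T"
  shows "continuous_on {0..t} u" "u ` {0..t} \<subseteq> U"
    "\<And>s k. 0 \<le> s \<Longrightarrow> s \<le> t \<Longrightarrow> k \<ge> 1 \<Longrightarrow> ((\<lambda>s. coord (u s) k) has_real_derivative F (u s) k) (at s within {0..t})"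
proof -
  let ?D = "{t. 0 \<le> t \<and> ereal t < T}"
  have sub: "{0..t} \<subseteq> ?D" using assms(3) by (auto intro: le_less_trans[of _ "ereal t"])
  have D: "continuous_on ?D u" "u ` ?D \<subseteq> U"
      "\<forall>t\<in>?D. \<forall>k\<ge>1. ((\<lambda>t. coord (u t) k) has_real_derivative F (u t) k) (at t within ?D)"
    using assms(1) unfolding solution_on_def Let_def by auto
  show "continuous_on {0..t} u" using D(1) sub by (rule continuous_on_subset)
  show "u ` {0..t} \<subseteq> U" using D(2) sub by blast
  show "((\<lambda>s. coord (u s) k) has_real_derivative F (u s) k) (at s within {0..t})"
    if "0 \<le> s" "s \<le> t" "k \<ge> 1" for s k
    by (rule DERIV_subset[OF _ sub]) (use D(3) that sub in auto)
qed

lemma solution_on_lipschitz: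
  assumes "solution_on U F T u" "solution_on U F T' v" "0 \<le> t" "ereal t < T" "ereal t < T'"
  shows "norm (u t - v t) \<le> 2 * exp (\<gamma> * t) * norm (u 0 - v 0)"
  by (intro solution_lipschitz solution_on_seg[OF assms(1)] solution_on_seg[OF assms(2)] assms)

lemma solution_on_unique:
  assumes "solution_on U F T u" "solution_on U F T' v" "u 0 = v 0" "0 \<le> t" "ereal t < T" "ereal t < T'"
  shows "u t = v t"
  using solution_on_lipschitz[OF assms(1,2,4-6)] assms(3) by simp

text \<open>Inserting 0 gives existence time 0, instead of the supremum minus infinity of the empty
  set, to points through which no solution starts.\<close>

definition exit_time :: "ell2 \<Rightarrow> ereal" where
  "exit_time z = Sup (insert 0 {T. \<exists>u. 0 < T \<and> solution_on U F T u \<and> u 0 = z})"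

text \<open>By uniqueness the chosen value does not depend on the solution, so solutions on
  different intervals need not be glued.\<close>

definition flow :: "real \<Rightarrow> ell2 \<Rightarrow> ell2" where
  "flow t z = (SOME x. \<exists>T u. 0 < T \<and> ereal t < T \<and> solution_on U F T u \<and> u 0 = z \<and> x = u t)"

lemma exit_time_nonneg: "0 \<le> exit_time z"
  unfolding exit_time_def by (rule Sup_upper) simp

lemma solution_exit_time:
  assumes "0 < T" "solution_on U F T u" "u 0 = z"
  shows "T \<le> exit_time z" "0 \<le> t \<Longrightarrow> ereal t < T \<Longrightarrow> u t = flow t z"
proof -
  show "T \<le> exit_time z" unfolding exit_time_def by (rule Sup_upper) (use assms in auto)
  assume t: "0 \<le> t" "ereal t < T"
  have "\<exists>x. \<exists>T u. 0 < T \<and> ereal t < T \<and> solution_on U F T u \<and> u 0 = z \<and> x = u t"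
    using assms t by blast
  from someI_ex[OF this] obtain T' v where "ereal t < T'" "solution_on U F T' v" "v 0 = z" "flow t z = v t"
    unfolding flow_def by blast
  then show "u t = flow t z" using solution_on_unique[OF assms(2)] assms(3) t by simp
qed

lemma exit_time_solution:
  assumes "0 \<le> t" "ereal t < exit_time z"
  obtains T u where "0 < T" "ereal t < T" "solution_on U F T u" "u 0 = z" "T \<le> exit_time z"
    "\<And>s. 0 \<le> s \<Longrightarrow> ereal s < T \<Longrightarrow> flow s z = u s"
proof -
  obtain T where T: "T \<in> insert 0 {T. \<exists>u. 0 < T \<and> solution_on U F T u \<and> u 0 = z}" "ereal t < T"
    using assms(2) unfolding exit_time_def less_Sup_iff by blast
  moreover have "T \<noteq> 0" using T(2) assms(1) by (auto simp: zero_ereal_def)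
  ultimately obtain u where u: "0 < T" "solution_on U F T u" "u 0 = z" by auto
  then show ?thesis using that[of T u] T(2) solution_exit_time[OF u] by metis
qed

lemma flow_solution: "solution_on U F (exit_time z) (\<lambda>t. flow t z)"
proof -
  let ?D = "{t. 0 \<le> t \<and> ereal t < exit_time z}"
  \<comment> \<open>All three conditions are local in t: near t the flow agrees with a single
    solution living beyond t. The conditions are named by meta-equations, later discharged with
    \<open>reflexive\<close>, so that one local argument serves all of them.\<close>
  have *: "isCont_within \<and> flow t z \<in> U \<and> der"
    if t: "t \<in> ?D" and "isCont_within \<equiv> continuous (at t within ?D) (\<lambda>t. flow t z)"
      and "der \<equiv> \<forall>k\<ge>1. ((\<lambda>t. coord (flow t z) k) has_real_derivative F (flow t z) k) (at t within ?D)"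
    for t isCont_within der
  proof -
    obtain T u where T: "0 < T" "ereal t < T" "solution_on U F T u" "u 0 = z" "T \<le> exit_time z"
      and fl: "\<And>s. 0 \<le> s \<Longrightarrow> ereal s < T \<Longrightarrow> flow s z = u s"
      using exit_time_solution[of t z] t by auto
    let ?E = "{t. 0 \<le> t \<and> ereal t < T}"
    have E: "continuous_on ?E u" "u ` ?E \<subseteq> U"
        "\<forall>t\<in>?E. \<forall>k\<ge>1. ((\<lambda>t. coord (u t) k) has_real_derivative F (u t) k) (at t within ?E)"
      using T(3) unfolding solution_on_def Let_def by auto
    have tE: "t \<in> ?E" using t T(2) by auto
    have "open {s. ereal s < T}"
      using open_vimage[OF open_lessThan[of T], of ereal] continuous_on_ereal[OF continuous_on_id, of UNIV]
      by (simp add: vimage_def)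
    then have at: "at t within ?D = at t within ?E"
      using T(2,5) by (intro at_within_nhd[of _ "{s. ereal s < T}"]) (auto intro: less_le_trans)
    obtain \<delta> where \<delta>: "\<delta> > 0" "\<And>s. dist s t < \<delta> \<Longrightarrow> ereal s < T"
      using \<open>open {s. ereal s < T}\<close> T(2) unfolding open_dist by blast
    have "continuous (at t within ?E) u" using E(1) tE by (simp add: continuous_on_eq_continuous_within)
    then have "continuous (at t within ?E) (\<lambda>t. flow t z)"
      by (rule continuous_transform_within[OF _ \<delta>(1) tE]) (use fl in auto)
    moreover have "flow t z \<in> U" using E(2) tE fl[of t] by auto
    moreover have "((\<lambda>t. coord (flow t z) k) has_real_derivative F (flow t z) k) (at t within ?E)" if "k \<ge> 1" for k
    proof -
      have "((\<lambda>t. coord (u t) k) has_real_derivative F (u t) k) (at t within ?E)" using E(3) tE that by auto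
      then show ?thesis
        using fl[of t] tE by (auto intro: has_field_derivative_transform_within[OF _ \<delta>(1) tE] simp: fl)
    qed
    ultimately show ?thesis using that(2,3) at by auto
  qed
  show ?thesis
    unfolding solution_on_def Let_def
  proof (intro conjI ballI allI impI)
    show "continuous_on ?D (\<lambda>t. flow t z)"
      unfolding continuous_on_eq_continuous_within using *[OF _ reflexive reflexive] by blast
    show "(\<lambda>t. flow t z) ` ?D \<subseteq> U" using *[OF _ reflexive reflexive] by blast
    fix t k assume "t \<in> ?D" "1 \<le> (k :: nat)"
    then show "((\<lambda>t. coord (flow t z) k) has_real_derivative F (flow t z) k) (at t within ?D)"
      using *[OF _ reflexive reflexive] by blast
  qed
qed

lemma flow_0: "0 < exit_time z \<Longrightarrow> flow 0 z = z"
  by (rule exit_time_solution[of 0 z]) (auto simp: zero_ereal_def)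

lemma flow_shift:
  assumes s: "0 \<le> s" and st: "0 \<le> t" "ereal (s + t) < exit_time z"
  shows "ereal t < exit_time (flow s z)" "flow t (flow s z) = flow (t + s) z"
proof -
  obtain T u where T: "0 < T" "ereal (s + t) < T" "solution_on U F T u" "u 0 = z"
    and fl: "\<And>r. 0 \<le> r \<Longrightarrow> ereal r < T \<Longrightarrow> flow r z = u r"
    using exit_time_solution[of "s + t" z] s st by (metis add_nonneg_nonneg)
  define T' where "T' = T - ereal s"
  have T'_iff: "ereal r < T' \<longleftrightarrow> ereal (r + s) < T" for r
    unfolding T'_def by (cases T) auto
  let ?D = "{t. 0 \<le> t \<and> ereal t < T}" and ?D' = "{t. 0 \<le> t \<and> ereal t < T'}"
  have D: "continuous_on ?D u" "u ` ?D \<subseteq> U"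
      "\<forall>t\<in>?D. \<forall>k\<ge>1. ((\<lambda>t. coord (u t) k) has_real_derivative F (u t) k) (at t within ?D)"
    using T(3) unfolding solution_on_def Let_def by auto
  have im: "(\<lambda>r. r + s) ` ?D' \<subseteq> ?D" using s by (auto simp: T'_iff)
  have sol: "solution_on U F T' (\<lambda>r. u (r + s))"
    unfolding solution_on_def Let_def
  proof (intro conjI ballI allI impI)
    show "continuous_on ?D' (\<lambda>r. u (r + s))"
      by (rule continuous_on_compose2[OF D(1) _ im]) (intro continuous_intros)
    show "(\<lambda>r. u (r + s)) ` ?D' \<subseteq> U" using D(2) im by (auto simp: image_subset_iff)
    fix r k assume r: "r \<in> ?D'" and k: "1 \<le> (k :: nat)"
    have "((\<lambda>t. coord (u t) k) has_real_derivative F (u (r + s)) k) (at (r + s) within ?D)"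
      using D(3) im r k by blast
    then have "((\<lambda>t. coord (u t) k) has_real_derivative F (u (r + s)) k) (at (r + s) within (\<lambda>r. r + s) ` ?D')"
      using im by (rule DERIV_subset)
    then have "((\<lambda>t. coord (u t) k) \<circ> (\<lambda>r. r + s) has_real_derivative F (u (r + s)) k * 1) (at r within ?D')"
      by (rule DERIV_image_chain) (auto intro!: derivative_eq_intros)
    then show "((\<lambda>r. coord (u (r + s)) k) has_real_derivative F (u (r + s)) k) (at r within ?D')"
      by (simp add: o_def)
  qed
  have "ereal t < T'" using T(2) by (simp add: T'_iff add.commute)
  moreover have "0 < T'" using \<open>ereal t < T'\<close> st(1) by (auto simp: zero_ereal_def intro: le_less_trans[of _ "ereal t"])
  moreover have "u (0 + s) = flow s z" using fl[of s] s st T(2) by (simp add: le_less_trans[of "ereal s" "ereal (s + t)"])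
  ultimately have 1: "T' \<le> exit_time (flow s z)" "u (t + s) = flow t (flow s z)"
    using solution_exit_time[OF _ sol] st(1) by auto
  show "ereal t < exit_time (flow s z)" using \<open>ereal t < T'\<close> 1(1) by simp
  show "flow t (flow s z) = flow (t + s) z" using 1(2) fl[of "t + s"] s st T(2) by (simp add: add.commute)
qed

lemma flow_lipschitz:
  assumes "0 \<le> t" "ereal t < exit_time x" "ereal t < exit_time y"
  shows "norm (flow t x - flow t y) \<le> 2 * exp (\<gamma> * t) * norm (x - y)"
proof -
  have "0 < exit_time x" "0 < exit_time y" using assms by (auto simp: zero_ereal_def intro: le_less_trans[of _ "ereal t"])
  then show ?thesis
    using solution_on_lipschitz[OF flow_solution[of x] flow_solution[of y] assms] by (simp add: flow_0)
qed

text \<open>Continuity in t along the fixed solution through z0 is combined with the Lipschitz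
  dependence on the initial point, whose constant stays bounded for t near t0.\<close>

lemma flow_continuous: "continuous_on {(t, z). 0 \<le> t \<and> ereal t < exit_time z} (\<lambda>(t, z). flow t z)"
  unfolding continuous_on_def
proof (intro ballI)
  let ?D = "{(t, z). 0 \<le> t \<and> ereal t < exit_time z}"
  fix p assume p: "p \<in> ?D"
  obtain t0 z0 where pp: "p = (t0, z0)" by fastforce
  have t0: "0 \<le> t0" "ereal t0 < exit_time z0" using p pp by auto
  let ?E = "{t. 0 \<le> t \<and> ereal t < exit_time z0}"
  have cont: "continuous_on ?E (\<lambda>t. flow t z0)"
    using flow_solution[of z0] by (simp add: solution_on_def Let_def)
  have fst_lim: "(fst \<longlongrightarrow> t0) (at p within ?D)" and snd_lim: "(snd \<longlongrightarrow> z0) (at p within ?D)"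
    unfolding pp by (auto intro!: tendsto_eq_intros)
  have inD: "\<forall>\<^sub>F q in at p within ?D. q \<in> ?D" by (simp add: eventually_at_filter)
  have "open {s. ereal s < exit_time z0}"
    using open_vimage[OF open_lessThan[of "exit_time z0"], of ereal] continuous_on_ereal[OF continuous_on_id, of UNIV]
    by (simp add: vimage_def)
  from topological_tendstoD[OF fst_lim this] t0
  have ev: "\<forall>\<^sub>F q in at p within ?D. ereal (fst q) < exit_time z0" by simp
  have evE: "\<forall>\<^sub>F q in at p within ?D. fst q \<in> ?E"
    using inD ev by eventually_elim auto
  have lim1: "((\<lambda>q. flow (fst q) z0) \<longlongrightarrow> flow t0 z0) (at p within ?D)"
    by (rule continuous_on_tendsto_compose[OF cont fst_lim _ evE]) (use t0 in auto)
  have lim2: "((\<lambda>q. flow (fst q) (snd q) - flow (fst q) z0) \<longlongrightarrow> 0) (at p within ?D)"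
  proof (rule Lim_null_comparison)
    show "\<forall>\<^sub>F q in at p within ?D. norm (flow (fst q) (snd q) - flow (fst q) z0) \<le> 2 * exp (\<gamma> * fst q) * norm (snd q - z0)"
      using inD evE by eventually_elim (auto intro!: flow_lipschitz)
    have "((\<lambda>q. 2 * exp (\<gamma> * fst q) * norm (snd q - z0)) \<longlongrightarrow> 2 * exp (\<gamma> * t0) * norm (z0 - z0)) (at p within ?D)"
      by (intro tendsto_intros fst_lim snd_lim)
    then show "((\<lambda>q. 2 * exp (\<gamma> * fst q) * norm (snd q - z0)) \<longlongrightarrow> 0) (at p within ?D)" by simp
  qed
  from tendsto_add[OF lim2 lim1]
  show "((\<lambda>(t, z). flow t z) \<longlongrightarrow> (case p of (t, z) \<Rightarrow> flow t z)) (at p within ?D)"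
    by (simp add: pp case_prod_unfold)
qed

theorem semiflow_of_flow: "semiflow_of U F flow exit_time"
  unfolding semiflow_of_def
proof (intro conjI allI ballI impI)
  show "local_semiflow flow exit_time"
    unfolding local_semiflow_def
    using flow_shift exit_time_nonneg flow_continuous flow_0 by (smt (verit) add.commute)
  show "exit_time z = 0" if "z \<notin> U" for z
  proof -
    have "{T. \<exists>u. 0 < T \<and> solution_on U F T u \<and> u 0 = z} = {}"
      using that by (force simp: solution_on_def Let_def zero_ereal_def)
    then show ?thesis unfolding exit_time_def by (simp only:) simp
  qed
  show "solution_on U F (exit_time z) (\<lambda>t. flow t z)" for z by (rule flow_solution)
  fix z T u assume "0 < T \<and> solution_on U F T u \<and> u 0 = z"
  then show "T \<le> exit_time z" "\<And>t. 0 \<le> t \<and> ereal t < T \<Longrightarrow> u t = flow t z"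
    using solution_exit_time by blast+
qed

end

section \<open>The change of variables\<close>

lemma lam_1: "lam 1 \<mu> = 1 - \<mu>" and lam_Suc_0: "lam (Suc 0) \<mu> = 1 - \<mu>" and lam_2: "lam 2 \<mu> = 4 - 16 * \<mu>" and lam_3: "lam 3 \<mu> = 9 - 81 * \<mu>"
  by (simp_all add: lam_def)

text \<open>
  \<open>cP\<close>, \<open>cE\<close>, \<open>cF\<close> solve the homological equations that remove \<open>b\<^sub>1\<^sup>2\<close> from the second, \<open>b\<^sub>1 b\<^sub>2\<close> from the
  first and \<open>b\<^sub>1\<^sup>3\<close> from the third equation. \<open>cG\<close> removes \<open>b\<^sub>1\<^sup>2 b\<^sub>3\<close> from the first equation: its size
  \<open>C\<^sup>5\<close> would be harmless, but its derivative with respect to \<open>b\<^sub>3\<close> violates the Jacobian bound of order \<open>C\<^sup>3\<close>.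
\<close>

definition cE :: "real \<Rightarrow> real" where "cE \<mu> = 2 / lam 2 \<mu>"
definition cP :: "real \<Rightarrow> real" where "cP \<mu> = 2 / (lam 2 \<mu> - 2 * lam 1 \<mu>)"
definition cG :: "real \<Rightarrow> real" where "cG \<mu> = (4 - cP \<mu> * lam 2 \<mu>) / (lam 1 \<mu> + lam 3 \<mu>)"
definition cF :: "real \<Rightarrow> real" where "cF \<mu> = 6 * cP \<mu> / (lam 3 \<mu> - 3 * lam 1 \<mu>)"

text \<open>No resonance occurs: the divisors 4 - 16 \<mu>, 2 - 14 \<mu>, 10 - 82 \<mu> and 6 - 78
  \<mu> are negative for all \<mu> \<ge> 1/2.\<close>

lemma
  assumes "1 / 2 \<le> \<mu>"
  shows cE_eq: "cE \<mu> * lam 2 \<mu> = 2"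
    and cP_eq: "cP \<mu> * (lam 2 \<mu> - 2 * lam 1 \<mu>) = 2"
    and cG_eq: "cG \<mu> * (lam 1 \<mu> + lam 3 \<mu>) = 4 - cP \<mu> * lam 2 \<mu>"
    and cF_eq: "cF \<mu> * (lam 3 \<mu> - 3 * lam 1 \<mu>) = 6 * cP \<mu>"
  using assms by (auto simp: cE_def cP_def cG_def cF_def lam_1 lam_Suc_0 lam_2 lam_3 divide_simps)

lemma abs_divide_le: "\<bar>x\<bar> \<le> c * \<bar>y\<bar> \<Longrightarrow> y \<noteq> 0 \<Longrightarrow> \<bar>x / y\<bar> \<le> (c :: real)"
  by (simp add: divide_le_eq)

text \<open>The bounds have to hold uniformly as \<mu> grows without limit. In the last one the
  factor \<open>lam 2 \<mu>\<close> is unbounded, but it is compensated by the divisors of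
  \<open>cG\<close> and \<open>cP\<close>, which grow at the same rate.\<close>

lemma
  assumes "1 / 2 \<le> \<mu>"
  shows cE_bound: "\<bar>cE \<mu>\<bar> \<le> 1 / 2" and cP_bound: "\<bar>cP \<mu>\<bar> \<le> 2 / 5"
    and cG_bound: "\<bar>cG \<mu>\<bar> \<le> 1" and cF_bound: "\<bar>cF \<mu>\<bar> \<le> 1"
    and cPG_bound: "\<bar>lam 2 \<mu> * (cG \<mu> + cP \<mu>)\<bar> \<le> 8"
proof -
  show "\<bar>cE \<mu>\<bar> \<le> 1 / 2" unfolding cE_def using assms by (intro abs_divide_le) (auto simp: lam_2)
  show cP: "\<bar>cP \<mu>\<bar> \<le> 2 / 5" unfolding cP_def
    using assms by (intro abs_divide_le) (auto simp: lam_1 lam_Suc_0 lam_2)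
  have cPl: "0 \<le> cP \<mu> * lam 2 \<mu>" "cP \<mu> * lam 2 \<mu> \<le> 4"
    using assms by (auto simp: cP_def lam_1 lam_Suc_0 lam_2 divide_simps)
  show "\<bar>cG \<mu>\<bar> \<le> 1" unfolding cG_def
    using assms cPl by (intro abs_divide_le) (auto simp: lam_1 lam_Suc_0 lam_3)
  show "\<bar>cF \<mu>\<bar> \<le> 1" unfolding cF_def
    using assms cP by (intro abs_divide_le) (auto simp: lam_1 lam_Suc_0 lam_3)
  have "\<bar>lam 2 \<mu> * cG \<mu>\<bar> = \<bar>lam 2 \<mu> * (4 - cP \<mu> * lam 2 \<mu>) / (lam 1 \<mu> + lam 3 \<mu>)\<bar>" by (simp add: cG_def)
  also have "\<dots> \<le> 4"
  proof (rule abs_divide_le)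
    have "\<bar>lam 2 \<mu> * (4 - cP \<mu> * lam 2 \<mu>)\<bar> \<le> \<bar>lam 2 \<mu>\<bar> * 4"
      unfolding abs_mult using cPl by (intro mult_left_mono) auto
    also have "\<dots> \<le> 4 * \<bar>lam 1 \<mu> + lam 3 \<mu>\<bar>" using assms by (simp add: lam_1 lam_Suc_0 lam_2 lam_3)
    finally show "\<bar>lam 2 \<mu> * (4 - cP \<mu> * lam 2 \<mu>)\<bar> \<le> 4 * \<bar>lam 1 \<mu> + lam 3 \<mu>\<bar>" .
  qed (use assms in \<open>auto simp: lam_1 lam_Suc_0 lam_3\<close>)
  finally show "\<bar>lam 2 \<mu> * (cG \<mu> + cP \<mu>)\<bar> \<le> 8" using cPl by (simp add: distrib_left mult.commute)
qed

text \<open>The last entry acts first on b. The intermediate values arise in the order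
  \<open>y2\<close>, \<open>a3\<close>, \<open>a1\<close>, \<open>a2\<close>, and each substitution
  uses coordinates that are already updated: \<open>cE\<close> multiplies \<open>y2\<close>, not
  b_2, and \<open>cG\<close> multiplies \<open>a1\<close> and \<open>a3\<close>.\<close>

definition nf_list :: "subst list" where
  "nf_list = [(2, {{#1, 3#}}, \<lambda>\<mu> m. cG \<mu>), (1, {{#1, 2#}}, \<lambda>\<mu> m. cE \<mu>),
    (3, {{#1, 1, 1#}}, \<lambda>\<mu> m. cF \<mu>), (2, {{#1, 1#}}, \<lambda>\<mu> m. cP \<mu>)]"

lemma nf_list_nf_subst: "list_all nf_subst nf_list"
  by (simp add: nf_list_def)

abbreviation \<Phi> :: "real \<Rightarrow> ell2 \<Rightarrow> ell2" where "\<Phi> \<equiv> nf_map nf_list"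

definition y2 :: "real \<Rightarrow> ell2 \<Rightarrow> real" where "y2 \<mu> b = coord b 2 + cP \<mu> * (coord b 1 * coord b 1)"
definition a1 :: "real \<Rightarrow> ell2 \<Rightarrow> real" where "a1 \<mu> b = coord b 1 * (1 + cE \<mu> * y2 \<mu> b)"
definition a3 :: "real \<Rightarrow> ell2 \<Rightarrow> real" where "a3 \<mu> b = coord b 3 + cF \<mu> * (coord b 1 * (coord b 1 * coord b 1))"
definition a2 :: "real \<Rightarrow> ell2 \<Rightarrow> real" where "a2 \<mu> b = y2 \<mu> b + cG \<mu> * (a1 \<mu> b * a3 \<mu> b)"

lemma coord_\<Phi>: "coord (\<Phi> \<mu> b) k =
  (if k = 1 then a1 \<mu> b else if k = 2 then a2 \<mu> b else if k = 3 then a3 \<mu> b else coord b k)"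
  by (auto simp: nf_map_def nf_list_def coord_unit_vec a1_def a2_def a3_def y2_def algebra_simps)

lemma \<Phi>_eq: "\<Phi> \<mu> b = b + (a1 \<mu> b - coord b 1) *\<^sub>R unit_vec 1 + (a2 \<mu> b - coord b 2) *\<^sub>R unit_vec 2
    + (a3 \<mu> b - coord b 3) *\<^sub>R unit_vec 3"
  by (rule ell2_eqI) (auto simp: coord_\<Phi> coord_unit_vec)

text \<open>The substitutions are undone in reverse order. First \<open>z2\<close> removes the
  \<open>cG\<close> term and recovers \<open>y2\<close>; then a_1 = b_1 (1 + cE z2) is linear in
  b_1; finally b_3 and b_2 follow by subtraction.\<close>

definition z2 :: "real \<Rightarrow> ell2 \<Rightarrow> real" where "z2 \<mu> a = coord a 2 + (- cG \<mu>) * (coord a 1 * coord a 3)"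
definition b1 :: "real \<Rightarrow> ell2 \<Rightarrow> real" where "b1 \<mu> a = coord a 1 * (1 / (1 + cE \<mu> * z2 \<mu> a))"
definition b3 :: "real \<Rightarrow> ell2 \<Rightarrow> real" where "b3 \<mu> a = coord a 3 + (- cF \<mu>) * (b1 \<mu> a * (b1 \<mu> a * b1 \<mu> a))"
definition b2 :: "real \<Rightarrow> ell2 \<Rightarrow> real" where "b2 \<mu> a = z2 \<mu> a + (- cP \<mu>) * (b1 \<mu> a * b1 \<mu> a)"

definition \<Psi> :: "real \<Rightarrow> ell2 \<Rightarrow> ell2" where
  "\<Psi> \<mu> a = a + (b1 \<mu> a + (- 1) * coord a 1) *\<^sub>R unit_vec 1 + (b2 \<mu> a + (- 1) * coord a 2) *\<^sub>R unit_vec 2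
    + (b3 \<mu> a + (- 1) * coord a 3) *\<^sub>R unit_vec 3"

lemma coord_\<Psi>: "coord (\<Psi> \<mu> a) k =
  (if k = 1 then b1 \<mu> a else if k = 2 then b2 \<mu> a else if k = 3 then b3 \<mu> a else coord a k)"
  by (auto simp: \<Psi>_def coord_unit_vec)

lemma z2_\<Phi>: "z2 \<mu> (\<Phi> \<mu> b) = y2 \<mu> b"
  by (simp add: z2_def coord_\<Phi> a2_def)

lemma \<Psi>_\<Phi>:
  assumes "1 + cE \<mu> * y2 \<mu> b \<noteq> 0" shows "\<Psi> \<mu> (\<Phi> \<mu> b) = b"
proof -
  have 1: "b1 \<mu> (\<Phi> \<mu> b) = coord b 1" using assms by (simp add: b1_def z2_\<Phi> coord_\<Phi> a1_def)
  show ?thesis by (rule ell2_eqI) (auto simp: coord_\<Psi> coord_\<Phi> 1 b2_def b3_def z2_\<Phi> y2_def a3_def)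
qed

lemma y2_\<Psi>: "y2 \<mu> (\<Psi> \<mu> a) = z2 \<mu> a"
  by (simp add: y2_def coord_\<Psi> b2_def)

lemma \<Phi>_\<Psi>:
  assumes "1 + cE \<mu> * z2 \<mu> a \<noteq> 0" shows "\<Phi> \<mu> (\<Psi> \<mu> a) = a"
proof -
  have 1: "a1 \<mu> (\<Psi> \<mu> a) = coord a 1" using assms by (simp add: a1_def y2_\<Psi> coord_\<Psi> b1_def)
  have 3: "a3 \<mu> (\<Psi> \<mu> a) = coord a 3" by (simp add: a3_def coord_\<Psi> b3_def)
  show ?thesis by (rule ell2_eqI) (auto simp: coord_\<Psi> coord_\<Phi> 1 3 a2_def y2_\<Psi> z2_def)
qed

lemma analytic_coord: "analytic_at_point (\<lambda>b. coord b k) x"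
  by (intro analytic_at_point_linear bounded_linear_coord)

lemma analytic_scaleR_vec: "analytic_at_point f x \<Longrightarrow> analytic_at_point (\<lambda>y. f y *\<^sub>R v) x"
  by (rule analytic_at_point_compose_linear[OF _ bounded_linear_scaleR_left])

lemmas analytic_rules = analytic_at_point_add analytic_at_point_mult analytic_coord analytic_at_point_const
  analytic_scaleR_vec analytic_at_point_linear[OF bounded_linear_ident]

lemma analytic_\<Phi>: "analytic_at_point (\<Phi> \<mu>) x"
proof -
  have "\<Phi> \<mu> = (\<lambda>b. b + (a1 \<mu> b + (- 1) * coord b 1) *\<^sub>R unit_vec 1 + (a2 \<mu> b + (- 1) * coord b 2) *\<^sub>R unit_vec 2
    + (a3 \<mu> b + (- 1) * coord b 3) *\<^sub>R unit_vec 3)"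
    by (rule ext) (simp add: \<Phi>_eq)
  moreover have "analytic_at_point \<dots> x"
    unfolding a1_def a2_def a3_def y2_def by (intro analytic_rules)
  ultimately show ?thesis by simp
qed

lemma analytic_\<Psi>:
  assumes "1 + cE \<mu> * z2 \<mu> x \<noteq> 0" shows "analytic_at_point (\<Psi> \<mu>) x"
proof -
  have z: "analytic_at_point (z2 \<mu>) x" unfolding z2_def by (intro analytic_rules)
  have 1: "analytic_at_point (b1 \<mu>) x" unfolding b1_def
    using assms by (intro analytic_rules analytic_at_point_reciprocal z) auto
  have "analytic_at_point (b2 \<mu>) x" "analytic_at_point (b3 \<mu>) x"
    unfolding b2_def b3_def by (intro analytic_rules z 1)+
  with 1 show ?thesis unfolding \<Psi>_def by (intro analytic_rules)
qed

lemma analytic_at_point_cong: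
  assumes f: "analytic_at_point f x" and V: "open V" "x \<in> V" and eq: "\<And>y. y \<in> V \<Longrightarrow> f y = g y"
  shows "analytic_at_point g x"
proof -
  obtain r M K where r: "r > 0" and p: "power_series_at r M K f x"
    using f unfolding analytic_at_point_def by blast
  obtain e where e: "e > 0" "ball x e \<subseteq> V" using V open_contains_ball by blast
  have "power_series_at (min r e) M K f x" using p r e by (intro power_series_at_shrink[OF p]) auto
  moreover have "f (x + v) = g (x + v)" if "norm v < min r e" for v
    using e that by (intro eq) (auto simp: dist_norm)
  ultimately have "power_series_at (min r e) M K g x" by (simp add: power_series_at_def)
  then show ?thesis unfolding analytic_at_point_def using r e(1) by (meson min_less_iff_conj)
qed

text \<open>Radius 1/2 keeps the denominator 1 + cE y2 at least 1/2 for every \<mu> \<ge> 1/2, so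
  that one domain serves all parameters.\<close>

definition nf_dom :: "ell2 set" where "nf_dom = ball 0 (1 / 2)"

lemma nf_domD: "b \<in> nf_dom \<Longrightarrow> \<bar>coord b k\<bar> \<le> 1 / 2"
  using abs_coord_le_norm[of b k] by (simp add: nf_dom_def)

lemma E_ge:
  assumes "1 / 2 \<le> \<mu>" "\<bar>coord b 1\<bar> \<le> 1 / 2" "\<bar>coord b 2\<bar> \<le> 1 / 2"
  shows "1 / 2 \<le> 1 + cE \<mu> * y2 \<mu> b"
proof -
  have "\<bar>cP \<mu> * (coord b 1 * coord b 1)\<bar> \<le> 2 / 5 * (1 / 2 * (1 / 2))"
    unfolding abs_mult using assms cP_bound[OF assms(1)] by (intro mult_mono) auto
  then have "\<bar>y2 \<mu> b\<bar> \<le> 1" using assms(3) unfolding y2_def by linarith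
  then have "\<bar>cE \<mu> * y2 \<mu> b\<bar> \<le> 1 / 2 * 1"
    unfolding abs_mult using cE_bound[OF assms(1)] by (intro mult_mono) auto
  then show ?thesis by linarith
qed

lemma E_ge_dom: "1 / 2 \<le> \<mu> \<Longrightarrow> b \<in> nf_dom \<Longrightarrow> 1 / 2 \<le> 1 + cE \<mu> * y2 \<mu> b"
  by (intro E_ge nf_domD)

text \<open>The explicit inverse also shows that the image is open: it is the preimage of
  \<open>nf_dom\<close> under \<Psi> within the open set where the denominator of \<Psi> does not
  vanish.\<close>

theorem analytic_diffeo_\<Phi>:
  assumes \<mu>: "1 / 2 \<le> \<mu>" shows "analytic_diffeo_on (\<Phi> \<mu>) nf_dom"
proof -
  have inv: "\<Psi> \<mu> (\<Phi> \<mu> b) = b" if "b \<in> nf_dom" for b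
    using E_ge_dom[OF \<mu> that] by (intro \<Psi>_\<Phi>) auto
  let ?D = "{a. 1 + cE \<mu> * z2 \<mu> a \<noteq> 0}"
  have "continuous_on UNIV (z2 \<mu>)" unfolding z2_def by (intro continuous_intros)
  then have D: "open ?D" by (intro open_Collect_neq continuous_intros)
  have z_cont: "continuous_on ?D (z2 \<mu>)" unfolding z2_def by (intro continuous_intros)
  have b1_cont: "continuous_on ?D (b1 \<mu>)"
    unfolding b1_def by (intro continuous_intros z_cont) auto
  have "continuous_on ?D (\<Psi> \<mu>)"
    unfolding \<Psi>_def b2_def b3_def by (intro continuous_intros b1_cont z_cont)
  then have "open (?D \<inter> \<Psi> \<mu> -` nf_dom)"
    by (rule continuous_open_preimage) (auto simp: D nf_dom_def)
  moreover have im: "\<Phi> \<mu> ` nf_dom = ?D \<inter> \<Psi> \<mu> -` nf_dom"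
  proof (intro equalityI subsetI)
    fix a assume "a \<in> \<Phi> \<mu> ` nf_dom"
    then obtain b where b: "b \<in> nf_dom" "a = \<Phi> \<mu> b" by blast
    with E_ge_dom[OF \<mu> b(1)] inv show "a \<in> ?D \<inter> \<Psi> \<mu> -` nf_dom" by (auto simp: z2_\<Phi>)
  next
    fix a assume "a \<in> ?D \<inter> \<Psi> \<mu> -` nf_dom"
    then show "a \<in> \<Phi> \<mu> ` nf_dom" by (intro image_eqI[of _ _ "\<Psi> \<mu> a"]) (auto simp: \<Phi>_\<Psi>)
  qed
  ultimately have op: "open (\<Phi> \<mu> ` nf_dom)" by simp
  have inj: "inj_on (\<Phi> \<mu>) nf_dom" using inv by (rule inj_on_inverseI)
  have "analytic_map_on (inv_into nf_dom (\<Phi> \<mu>)) (\<Phi> \<mu> ` nf_dom)"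
  proof (rule analytic_map_onI)
    fix x assume x: "x \<in> \<Phi> \<mu> ` nf_dom"
    have "analytic_at_point (\<Psi> \<mu>) x" using x im by (intro analytic_\<Psi>) auto
    then show "analytic_at_point (inv_into nf_dom (\<Phi> \<mu>)) x"
      by (rule analytic_at_point_cong[OF _ op x]) (use inv inj in auto)
  qed
  then show ?thesis
    unfolding analytic_diffeo_on_def using inj op analytic_map_onI[OF analytic_\<Phi>] by blast
qed

text \<open>\<open>Y2\<close> is the velocity of \<open>y2\<close>; \<open>nf_field\<close> solves the triangular system \<open>D\<Phi> F = G \<circ> \<Phi>\<close>.\<close>

definition Y2 :: "real \<Rightarrow> ell2 \<Rightarrow> real" where
  "Y2 \<mu> b = KS_ladder \<mu> (\<Phi> \<mu> b) 2 - cG \<mu> * (KS_ladder \<mu> (\<Phi> \<mu> b) 1 * a3 \<mu> b + a1 \<mu> b * KS_ladder \<mu> (\<Phi> \<mu> b) 3)"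

definition F1 :: "real \<Rightarrow> ell2 \<Rightarrow> real" where
  "F1 \<mu> b = (KS_ladder \<mu> (\<Phi> \<mu> b) 1 - cE \<mu> * coord b 1 * Y2 \<mu> b) / (1 + cE \<mu> * y2 \<mu> b)"

definition nf_field :: "real \<Rightarrow> vfield" where
  "nf_field \<mu> b k = (if k = 1 then F1 \<mu> b
    else if k = 2 then Y2 \<mu> b - 2 * cP \<mu> * coord b 1 * F1 \<mu> b
    else if k = 3 then KS_ladder \<mu> (\<Phi> \<mu> b) 3 - 3 * cF \<mu> * (coord b 1)\<^sup>2 * F1 \<mu> b
    else KS_ladder \<mu> (\<Phi> \<mu> b) k)"

definition remainder :: "real \<Rightarrow> vfield" where
  "remainder \<mu> b k = nf_field \<mu> b k - lam k \<mu> * coord b k - (if k = 1 then 4 / lam 2 \<mu> * (coord b 1) ^ 3 else 0)"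

lemma normalized_remainder: "normalized_system remainder = nf_field"
  by (intro ext) (simp add: normalized_system_def remainder_def)

lemma coord_line: "1 \<le> i \<Longrightarrow> coord (b + t *\<^sub>R unit_vec i) k = coord b k + of_bool (i = k) * t"
  by (auto simp: coord_unit_vec)

lemma y2_DERIV: "1 \<le> i \<Longrightarrow> ((\<lambda>t. y2 \<mu> (b + t *\<^sub>R unit_vec i)) has_real_derivative
    of_bool (i = 2) + 2 * cP \<mu> * coord b 1 * of_bool (i = 1)) (at 0)"
  unfolding y2_def coord_line by (auto intro!: derivative_eq_intros)

lemma a1_DERIV: "1 \<le> i \<Longrightarrow> ((\<lambda>t. a1 \<mu> (b + t *\<^sub>R unit_vec i)) has_real_derivative
    of_bool (i = 1) * (1 + cE \<mu> * y2 \<mu> b) + coord b 1 * (cE \<mu> *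
      (of_bool (i = 2) + 2 * cP \<mu> * coord b 1 * of_bool (i = 1)))) (at 0)"
  unfolding a1_def by (simp only: coord_line) (auto intro!: derivative_eq_intros y2_DERIV)

lemma a3_DERIV: "1 \<le> i \<Longrightarrow> ((\<lambda>t. a3 \<mu> (b + t *\<^sub>R unit_vec i)) has_real_derivative
    of_bool (i = 3) + 3 * cF \<mu> * (coord b 1)\<^sup>2 * of_bool (i = 1)) (at 0)"
  unfolding a3_def coord_line
  by (auto intro!: derivative_eq_intros simp: power2_eq_square)

lemma a2_DERIV: "1 \<le> i \<Longrightarrow> ((\<lambda>t. a2 \<mu> (b + t *\<^sub>R unit_vec i)) has_real_derivative
    (of_bool (i = 2) + 2 * cP \<mu> * coord b 1 * of_bool (i = 1)) + cG \<mu> * (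
      (of_bool (i = 1) * (1 + cE \<mu> * y2 \<mu> b) + coord b 1 * (cE \<mu> *
        (of_bool (i = 2) + 2 * cP \<mu> * coord b 1 * of_bool (i = 1)))) * a3 \<mu> b +
      a1 \<mu> b * (of_bool (i = 3) + 3 * cF \<mu> * (coord b 1)\<^sup>2 * of_bool (i = 1)))) (at 0)"
  unfolding a2_def
  by (rule DERIV_add[OF y2_DERIV DERIV_cmult[OF DERIV_mult'[OF a1_DERIV a3_DERIV, THEN DERIV_cong]]]) (simp_all add: algebra_simps)

text \<open>Row k of the derivative is supported on the columns 1, 2, 3 and k. Row 1 reads (1 + cE
  y2) F_1 + cE b_1 Y2 = G_1, and Y2 is obtained beforehand by differentiating y2 = a_2 - cG a_1 a_3,
  so the system is solved without matrix inversion.\<close>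

theorem transforms_\<Phi>:
  assumes \<mu>: "1 / 2 \<le> \<mu>"
  shows "transforms_into (\<Phi> \<mu>) nf_dom (KS_ladder \<mu>) (normalized_system remainder \<mu>)"
  unfolding transforms_into_def normalized_remainder
proof (intro ballI allI impI)
  fix b and k :: nat assume b: "b \<in> nf_dom" and k: "1 \<le> k"
  let ?G = "KS_ladder \<mu> (\<Phi> \<mu> b)" and ?F = "nf_field \<mu> b"
  define pd where "pd i = partial_deriv (\<lambda>x. coord (\<Phi> \<mu> x) k) i b" for i
  have E: "1 + cE \<mu> * y2 \<mu> b \<noteq> 0" using E_ge_dom[OF \<mu> b] by auto
  have F1E: "(1 + cE \<mu> * y2 \<mu> b) * F1 \<mu> b + cE \<mu> * coord b 1 * Y2 \<mu> b = ?G 1"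
    using E by (simp add: F1_def)
  have pd1: "pd i = of_bool (i = 1) * (1 + cE \<mu> * y2 \<mu> b) + coord b 1 * (cE \<mu> *
      (of_bool (i = 2) + 2 * cP \<mu> * coord b 1 * of_bool (i = 1)))" if "k = 1" "1 \<le> i" for i
    proof -
    have "(\<lambda>t. coord (\<Phi> \<mu> (b + t *\<^sub>R unit_vec i)) k) = (\<lambda>t. a1 \<mu> (b + t *\<^sub>R unit_vec i))"
      using that(1) by (simp add: coord_\<Phi>)
    then show ?thesis unfolding pd_def partial_deriv_def by (simp only:) (rule DERIV_imp_deriv[OF a1_DERIV[OF that(2)]])
  qed
  have pd2: "pd i = (of_bool (i = 2) + 2 * cP \<mu> * coord b 1 * of_bool (i = 1)) + cG \<mu> * (
      (of_bool (i = 1) * (1 + cE \<mu> * y2 \<mu> b) + coord b 1 * (cE \<mu> *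
        (of_bool (i = 2) + 2 * cP \<mu> * coord b 1 * of_bool (i = 1)))) * a3 \<mu> b +
      a1 \<mu> b * (of_bool (i = 3) + 3 * cF \<mu> * (coord b 1)\<^sup>2 * of_bool (i = 1)))" if "k = 2" "1 \<le> i" for i
    proof -
    have "(\<lambda>t. coord (\<Phi> \<mu> (b + t *\<^sub>R unit_vec i)) k) = (\<lambda>t. a2 \<mu> (b + t *\<^sub>R unit_vec i))"
      using that(1) by (simp add: coord_\<Phi>)
    then show ?thesis unfolding pd_def partial_deriv_def by (simp only:) (rule DERIV_imp_deriv[OF a2_DERIV[OF that(2)]])
  qed
  have pd3: "pd i = of_bool (i = 3) + 3 * cF \<mu> * (coord b 1)\<^sup>2 * of_bool (i = 1)" if "k = 3" "1 \<le> i" for i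
    proof -
    have "(\<lambda>t. coord (\<Phi> \<mu> (b + t *\<^sub>R unit_vec i)) k) = (\<lambda>t. a3 \<mu> (b + t *\<^sub>R unit_vec i))"
      using that(1) by (simp add: coord_\<Phi>)
    then show ?thesis unfolding pd_def partial_deriv_def by (simp only:) (rule DERIV_imp_deriv[OF a3_DERIV[OF that(2)]])
  qed
  have pd4: "pd i = of_bool (i = k)" if "k \<ge> 4" "1 \<le> i" for i
  proof -
    have "((\<lambda>t. coord b k + of_bool (i = k) * t) has_real_derivative of_bool (i = k)) (at 0)"
      by (auto intro!: derivative_eq_intros)
    then show ?thesis unfolding pd_def partial_deriv_def coord_\<Phi> using that
      by (simp only: coord_line) (auto intro!: DERIV_imp_deriv)
  qed
  have supp: "pd i = 0" if "1 \<le> i" "i \<notin> {1, 2, 3, k}" for i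
    using pd1[of i] pd2[of i] pd3[of i] pd4[of i] that k
    by (cases "k = 1"; cases "k = 2"; cases "k = 3") auto
  have "((\<lambda>i. pd i * ?F i) has_sum (\<Sum>i\<in>{1, 2, 3, k}. pd i * ?F i)) {1, 2, 3, k}"
    by (rule has_sum_finite) auto
  then have hs: "((\<lambda>i. pd i * ?F i) has_sum (\<Sum>i\<in>{1, 2, 3, k}. pd i * ?F i)) {1..}"
    by (rule has_sum_cong_neutral[THEN iffD1, rotated 3]) (use supp k in auto)
  have "(\<Sum>i\<in>{1, 2, 3, k}. pd i * ?F i) = ?G k"
  proof -
    consider "k = 1" | "k = 2" | "k = 3" | "k \<ge> 4" using k by linarith
    then show ?thesis
    proof cases
      case 1
      then have "{1, 2, 3, k} = {1, 2, 3}" by auto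
      then have "(\<Sum>i\<in>{1, 2, 3, k}. pd i * ?F i) = pd 1 * ?F 1 + pd 2 * ?F 2 + pd 3 * ?F 3" by simp
      also have "\<dots> = (1 + cE \<mu> * y2 \<mu> b) * F1 \<mu> b + cE \<mu> * coord b 1 * Y2 \<mu> b"
        using 1 by (simp add: pd1 nf_field_def algebra_simps)
      finally show ?thesis using F1E 1 by simp
    next
      case 2
      then have "{1, 2, 3, k} = {1, 2, 3}" by auto
      then have "(\<Sum>i\<in>{1, 2, 3, k}. pd i * ?F i) = pd 1 * ?F 1 + pd 2 * ?F 2 + pd 3 * ?F 3" by simp
      also have "\<dots> = Y2 \<mu> b + cG \<mu> * (((1 + cE \<mu> * y2 \<mu> b) * F1 \<mu> b + cE \<mu> * coord b 1 * Y2 \<mu> b) * a3 \<mu> b + a1 \<mu> b * ?G 3)"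
        using 2 by (simp add: pd2 nf_field_def algebra_simps)
      also have "\<dots> = ?G 2" unfolding F1E by (simp add: Y2_def)
      finally show ?thesis using 2 by simp
    next
      case 3
      then have "{1, 2, 3, k} = {1, 2, 3}" by auto
      then have "(\<Sum>i\<in>{1, 2, 3, k}. pd i * ?F i) = pd 1 * ?F 1 + pd 2 * ?F 2 + pd 3 * ?F 3" by simp
      also have "\<dots> = ?G 3" using 3 by (simp add: pd3 nf_field_def)
      finally show ?thesis using 3 by simp
    next
      case 4
      then show ?thesis by (simp add: pd4 nf_field_def)
    qed
  qed
  with hs show "((\<lambda>i. partial_deriv (\<lambda>x. coord (\<Phi> \<mu> x) k) i b * ?F i) has_sum ?G k) {1..}"
    unfolding pd_def by simp
qed

section \<open>The remainder\<close>

text \<open>The term i = 0 vanishes because \<open>coord a 0 = 0\<close>, which turns the sum over i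
  \<ge> 1 of the ladder into a series over all naturals.\<close>

definition corr :: "nat \<Rightarrow> ell2 \<Rightarrow> real" where "corr k a = (\<Sum>i. coord a i * coord a (i + k))"
text \<open>The part of \<open>corr\<close> that involves no coordinate changed by \<Phi>.\<close>

definition tail4 :: "nat \<Rightarrow> ell2 \<Rightarrow> real" where "tail4 k a = (\<Sum>i. coord a (i + 4) * coord a (i + 4 + k))"
definition NK :: "ell2 \<Rightarrow> nat \<Rightarrow> real" where
  "NK a k = - real k * (\<Sum>i=1..k-1. coord a i * coord a (k - i)) + 2 * real k * corr k a"

lemma summable_coord_shift_sq: "summable (\<lambda>i. (coord a (i + m))\<^sup>2)"
  using summable_coord_sq by (rule summable_ignore_initial_segment)

lemma summable_coord_shift_mult: "summable (\<lambda>i. \<bar>coord a (i + m)\<bar> * \<bar>coord b (i + n)\<bar>)"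
  using summable_coord_shift_sq by (intro summable_mult_of_squares) simp_all

lemma summable_coord_shift_mult': "summable (\<lambda>i. coord a (i + m) * coord b (i + n))"
  using summable_coord_shift_sq by (intro summable_mult_of_squares) simp_all

lemma KS_ladder_NK: "KS_ladder \<mu> a k = lam k \<mu> * coord a k + NK a k"
proof -
  have "summable (\<lambda>i. norm (coord a i * coord a (i + k)))"
    using summable_coord_shift_mult[of a 0 a k] by (simp add: abs_mult)
  moreover have "(\<lambda>i. coord a i * coord a (i + k)) sums corr k a"
    unfolding corr_def using summable_coord_shift_mult'[of a 0 a k] by (simp add: summable_sums)
  ultimately have "((\<lambda>i. coord a i * coord a (i + k)) has_sum corr k a) UNIV"
    by (rule norm_summable_imp_has_sum)
  then have "((\<lambda>i. coord a i * coord a (k + i)) has_sum corr k a) {1..}"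
    by (rule has_sum_cong_neutral[THEN iffD1, rotated 3]) (auto simp: add.commute not_le)
  then show ?thesis unfolding KS_ladder_def NK_def by (simp add: infsumI)
qed

lemma corr_split: "corr k a = coord a 1 * coord a (1 + k) + coord a 2 * coord a (2 + k)
    + coord a 3 * coord a (3 + k) + tail4 k a"
proof -
  have "corr k a = tail4 k a + (\<Sum>i<4. coord a i * coord a (i + k))"
    unfolding corr_def tail4_def
    using suminf_split_initial_segment[OF summable_coord_shift_mult'[of a 0 a k], of 4] by (simp add: add_ac)
  also have "(\<Sum>i<4. coord a i * coord a (i + k)) =
      coord a 1 * coord a (1 + k) + coord a 2 * coord a (2 + k) + coord a 3 * coord a (3 + k)"
    by (simp add: eval_nat_numeral)
  finally show ?thesis by simp
qed

lemma tail4_\<Phi>: "tail4 k (\<Phi> \<mu> b) = tail4 k b"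
  by (simp add: tail4_def coord_\<Phi>)

lemma corr_\<Phi>:
  "corr 1 (\<Phi> \<mu> b) = a1 \<mu> b * a2 \<mu> b + a2 \<mu> b * a3 \<mu> b + a3 \<mu> b * coord b 4 + tail4 1 b"
  "corr 2 (\<Phi> \<mu> b) = a1 \<mu> b * a3 \<mu> b + a2 \<mu> b * coord b 4 + a3 \<mu> b * coord b 5 + tail4 2 b"
  "corr 3 (\<Phi> \<mu> b) = a1 \<mu> b * coord b 4 + a2 \<mu> b * coord b 5 + a3 \<mu> b * coord b 6 + tail4 3 b"
  unfolding corr_split tail4_\<Phi> by (simp_all add: coord_\<Phi>)

definition N1 :: "real \<Rightarrow> ell2 \<Rightarrow> real" where
  "N1 \<mu> b = 2 * (a1 \<mu> b * a2 \<mu> b + a2 \<mu> b * a3 \<mu> b + a3 \<mu> b * coord b 4 + tail4 1 b)"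
definition N3 :: "real \<Rightarrow> ell2 \<Rightarrow> real" where
  "N3 \<mu> b = 6 * (a1 \<mu> b * coord b 4 + a2 \<mu> b * coord b 5 + a3 \<mu> b * coord b 6 + tail4 3 b) - 6 * (a1 \<mu> b * a2 \<mu> b)"
text \<open>The part of the velocity \<open>Y2\<close> that is already small, of order C^4 on the
  box; the terms split off in \<open>Y2_eq\<close> take part in cancellations.\<close>

definition R2 :: "real \<Rightarrow> ell2 \<Rightarrow> real" where
  "R2 \<mu> b = 4 * (a2 \<mu> b * coord b 4 + a3 \<mu> b * coord b 5 + tail4 2 b)
    - cG \<mu> * (N1 \<mu> b * a3 \<mu> b) - cG \<mu> * (a1 \<mu> b * N3 \<mu> b)"

lemma KS_\<Phi>:
  "KS_ladder \<mu> (\<Phi> \<mu> b) 1 = lam 1 \<mu> * a1 \<mu> b + N1 \<mu> b"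
  "KS_ladder \<mu> (\<Phi> \<mu> b) 2 = lam 2 \<mu> * a2 \<mu> b - 2 * (a1 \<mu> b)\<^sup>2
    + 4 * (a1 \<mu> b * a3 \<mu> b + a2 \<mu> b * coord b 4 + a3 \<mu> b * coord b 5 + tail4 2 b)"
  "KS_ladder \<mu> (\<Phi> \<mu> b) 3 = lam 3 \<mu> * a3 \<mu> b + N3 \<mu> b"
proof -
  show "KS_ladder \<mu> (\<Phi> \<mu> b) 1 = lam 1 \<mu> * a1 \<mu> b + N1 \<mu> b"
    unfolding KS_ladder_NK NK_def N1_def using corr_\<Phi>(1)[of \<mu> b] by (simp add: coord_\<Phi>)
  show "KS_ladder \<mu> (\<Phi> \<mu> b) 2 = lam 2 \<mu> * a2 \<mu> b - 2 * (a1 \<mu> b)\<^sup>2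
    + 4 * (a1 \<mu> b * a3 \<mu> b + a2 \<mu> b * coord b 4 + a3 \<mu> b * coord b 5 + tail4 2 b)"
    unfolding KS_ladder_NK NK_def corr_\<Phi> by (simp add: coord_\<Phi> power2_eq_square)
  have "{1..3-1::nat} = {1, 2}" by auto
  then show "KS_ladder \<mu> (\<Phi> \<mu> b) 3 = lam 3 \<mu> * a3 \<mu> b + N3 \<mu> b"
    unfolding KS_ladder_NK NK_def N3_def corr_\<Phi> by (simp add: coord_\<Phi> algebra_simps)
qed

text \<open>The product a_1 a_3 arrives with the coefficient lam2 cG + 4 - cG (lam1 + lam3). The
  equation for \<open>cG\<close> does not make it vanish but turns it into lam2 (cG + cP), the value
  for which the first equation loses its b_1^2 b_3 term.\<close>

lemma Y2_eq:
  assumes "1 / 2 \<le> \<mu>"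
  shows "Y2 \<mu> b = lam 2 \<mu> * y2 \<mu> b - 2 * (a1 \<mu> b)\<^sup>2 + lam 2 \<mu> * (cG \<mu> + cP \<mu>) * (a1 \<mu> b * a3 \<mu> b) + R2 \<mu> b"
proof -
  have "Y2 \<mu> b = lam 2 \<mu> * y2 \<mu> b - 2 * (a1 \<mu> b)\<^sup>2 + R2 \<mu> b
      + (lam 2 \<mu> * cG \<mu> + 4 - cG \<mu> * (lam 1 \<mu> + lam 3 \<mu>)) * (a1 \<mu> b * a3 \<mu> b)"
    unfolding Y2_def KS_\<Phi> R2_def a2_def by (simp add: algebra_simps)
  then show ?thesis unfolding cG_eq[OF assms] by (simp add: algebra_simps)
qed

text \<open>Nested products are kept unexpanded so that the order rules follow the syntax.
  Differences that vanish to higher order appear as factors \<open>cE \<mu> * y2 \<mu> b\<close>,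
  which is the denominator minus 1.\<close>

definition h1 :: "real \<Rightarrow> ell2 \<Rightarrow> real" where
  "h1 \<mu> b = 2 * (cE \<mu> * ((coord b 1 * (coord b 1 * coord b 1)) * (cE \<mu> * y2 \<mu> b)))
    + (1 / (1 + cE \<mu> * y2 \<mu> b)) * (2 * (coord b 1 * (y2 \<mu> b * (cE \<mu> * y2 \<mu> b)))
      + 2 * (cG \<mu> * ((a1 \<mu> b * a3 \<mu> b) * (cE \<mu> * (coord b 1 * y2 \<mu> b))))
      - 2 * (cP \<mu> * ((coord b 1 * a3 \<mu> b) * (cE \<mu> * (coord b 1 * y2 \<mu> b))))
      + 2 * (coord b 2 * a3 \<mu> b) + 2 * (cG \<mu> * ((a1 \<mu> b * a3 \<mu> b) * a3 \<mu> b))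
      + 2 * (a3 \<mu> b * coord b 4 + tail4 1 b) - cE \<mu> * (coord b 1 * R2 \<mu> b))"

definition h2 :: "real \<Rightarrow> ell2 \<Rightarrow> real" where
  "h2 \<mu> b = lam 2 \<mu> * (cG \<mu> + cP \<mu>) * (a1 \<mu> b * a3 \<mu> b) + R2 \<mu> b
    - 2 * ((coord b 1 * coord b 1) * ((cE \<mu> * y2 \<mu> b) * (2 + cE \<mu> * y2 \<mu> b)))
    - 2 * (cP \<mu> * (coord b 1 * (2 * (cE \<mu> * (coord b 1 * (coord b 1 * coord b 1))) + h1 \<mu> b)))"

definition h3 :: "real \<Rightarrow> ell2 \<Rightarrow> real" where
  "h3 \<mu> b = 6 * (a1 \<mu> b * coord b 4 + a2 \<mu> b * coord b 5 + a3 \<mu> b * coord b 6 + tail4 3 b)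
    - 6 * (coord b 1 * coord b 2 + coord b 1 * (cE \<mu> * (y2 \<mu> b * y2 \<mu> b)) + cG \<mu> * (a1 \<mu> b * (a1 \<mu> b * a3 \<mu> b)))
    - 3 * (cF \<mu> * ((coord b 1 * coord b 1) * (2 * (cE \<mu> * (coord b 1 * (coord b 1 * coord b 1))) + h1 \<mu> b)))"

text \<open>Since cE lam2 = 2, the contribution of - cE b_1 Y2 cancels 2 b_1 y2 to leading order,
  and its quadratic part - 2 a_1^2 produces the cubic coefficient 2 cE = 4 / lam2. The terms in
  b_1^2 a_3 have coefficients 2 cG from a_1 a_2, 2 cP from a_2 a_3 and - 2 (cG + cP) from Y2, with
  sum 0.\<close>

lemma F1_eq:
  assumes \<mu>: "1 / 2 \<le> \<mu>" and E: "1 + cE \<mu> * y2 \<mu> b \<noteq> 0"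
  shows "F1 \<mu> b = lam 1 \<mu> * coord b 1 + 2 * cE \<mu> * coord b 1 ^ 3 + h1 \<mu> b"
proof -
  define x e E l2 where "x = coord b 1" and "e = cE \<mu>" and "E = 1 + cE \<mu> * y2 \<mu> b" and "l2 = lam 2 \<mu>"
  have el: "e * l2 = 2" using cE_eq[OF \<mu>] by (simp add: e_def l2_def)
  have a1: "a1 \<mu> b = x * E" by (simp add: a1_def x_def E_def)
  have y2E: "e * y2 \<mu> b = E - 1" by (simp add: E_def e_def)
  have y2b: "y2 \<mu> b = coord b 2 + cP \<mu> * (x * x)" by (simp add: y2_def x_def)
  have "KS_ladder \<mu> (\<Phi> \<mu> b) 1 - e * x * Y2 \<mu> b =
      lam 1 \<mu> * x * E + 2 * (x * E) * (y2 \<mu> b + cG \<mu> * (x * E * a3 \<mu> b))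
      + 2 * (y2 \<mu> b + cG \<mu> * (x * E * a3 \<mu> b)) * a3 \<mu> b + 2 * (a3 \<mu> b * coord b 4 + tail4 1 b)
      - (e * l2) * (x * y2 \<mu> b) + 2 * e * x * (x * E)\<^sup>2 - (e * l2) * ((cG \<mu> + cP \<mu>) * x * (x * E * a3 \<mu> b))
      - e * (x * R2 \<mu> b)"
    unfolding KS_\<Phi> Y2_eq[OF \<mu>] N1_def a2_def a1 l2_def[symmetric] by (simp add: algebra_simps)
  also have "\<dots> = lam 1 \<mu> * x * E + 2 * e * x ^ 3 * E\<^sup>2 + (2 * (x * (y2 \<mu> b * (E - 1)))
      + 2 * (cG \<mu> * ((x * E * a3 \<mu> b) * (x * (E - 1))))
      - 2 * (cP \<mu> * ((x * a3 \<mu> b) * (x * (E - 1))))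
      + 2 * (coord b 2 * a3 \<mu> b) + 2 * (cG \<mu> * ((x * E * a3 \<mu> b) * a3 \<mu> b))
      + 2 * (a3 \<mu> b * coord b 4 + tail4 1 b) - e * (x * R2 \<mu> b))"
    unfolding el y2b by (simp add: algebra_simps power2_eq_square power3_eq_cube)
  finally have num: "KS_ladder \<mu> (\<Phi> \<mu> b) 1 - e * x * Y2 \<mu> b = \<dots>" .
  have "h1 \<mu> b = 2 * e * x ^ 3 * (E - 1) + (1 / E) * (2 * (x * (y2 \<mu> b * (E - 1)))
      + 2 * (cG \<mu> * ((x * E * a3 \<mu> b) * (x * (E - 1))))
      - 2 * (cP \<mu> * ((x * a3 \<mu> b) * (x * (E - 1))))
      + 2 * (coord b 2 * a3 \<mu> b) + 2 * (cG \<mu> * ((x * E * a3 \<mu> b) * a3 \<mu> b))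
      + 2 * (a3 \<mu> b * coord b 4 + tail4 1 b) - e * (x * R2 \<mu> b))"
    unfolding h1_def a1 x_def[symmetric] e_def[symmetric] y2E[symmetric]
    by (simp add: E_def e_def power3_eq_cube mult_ac)
  moreover have "F1 \<mu> b = (KS_ladder \<mu> (\<Phi> \<mu> b) 1 - e * x * Y2 \<mu> b) / E"
    by (simp add: F1_def x_def e_def E_def)
  moreover have "E \<noteq> 0" using E by (simp add: E_def)
  \<comment> \<open>The cubic term of the numerator carries the square of the denominator E, so one
    factor E survives the division; writing it as 1 + (E - 1) moves the excess into the
    remainder.\<close>
  moreover have "F = l * x + 2 * e * x ^ 3 + h"
    if "h = 2 * e * x ^ 3 * (E - 1) + (1 / E) * Q" "F = (l * x * E + 2 * e * x ^ 3 * E\<^sup>2 + Q) / E" "E \<noteq> 0"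
    for F l h Q :: real
    unfolding that(1,2) using that(3) by (simp add: add_divide_distrib power2_eq_square algebra_simps)
  ultimately show ?thesis
    unfolding num x_def[symmetric] e_def[symmetric] by blast
qed

text \<open>After collecting powers of b_1, the coefficients left over in the second and third
  equation are the homological equations of \<open>cP\<close> and \<open>cF\<close>.\<close>

lemma remainder_low:
  assumes \<mu>: "1 / 2 \<le> \<mu>" and E: "1 + cE \<mu> * y2 \<mu> b \<noteq> 0"
  shows "remainder \<mu> b 1 = h1 \<mu> b" "remainder \<mu> b 2 = h2 \<mu> b" "remainder \<mu> b 3 = h3 \<mu> b"
proof -
  note F1 = F1_eq[OF assms]
  have e: "4 / lam 2 \<mu> = 2 * cE \<mu>" by (simp add: cE_def)
  have "remainder \<mu> b 1 = F1 \<mu> b - lam 1 \<mu> * coord b 1 - 4 / lam 2 \<mu> * coord b 1 ^ 3"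
    by (simp add: remainder_def nf_field_def)
  then show "remainder \<mu> b 1 = h1 \<mu> b" unfolding e F1 by simp
  define x where "x = coord b 1"
  have a1: "a1 \<mu> b = x * (1 + cE \<mu> * y2 \<mu> b)" by (simp add: a1_def x_def)
  have "remainder \<mu> b 2 = Y2 \<mu> b - 2 * cP \<mu> * x * F1 \<mu> b - lam 2 \<mu> * coord b 2"
    by (simp add: remainder_def nf_field_def x_def)
  also have "\<dots> = h2 \<mu> b + x\<^sup>2 * (cP \<mu> * (lam 2 \<mu> - 2 * lam 1 \<mu>) - 2)"
    unfolding F1 Y2_eq[OF \<mu>] h2_def x_def[symmetric] y2_def[of \<mu> b] a1_def[of \<mu> b]
    by (simp add: algebra_simps power2_eq_square power3_eq_cube)
  finally show "remainder \<mu> b 2 = h2 \<mu> b" unfolding cP_eq[OF \<mu>] by simp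
  have "remainder \<mu> b 3 = KS_ladder \<mu> (\<Phi> \<mu> b) 3 - 3 * cF \<mu> * x\<^sup>2 * F1 \<mu> b - lam 3 \<mu> * coord b 3"
    by (simp add: remainder_def nf_field_def x_def)
  also have "\<dots> = h3 \<mu> b + x ^ 3 * (cF \<mu> * (lam 3 \<mu> - 3 * lam 1 \<mu>) - 6 * cP \<mu>)"
    unfolding KS_\<Phi> F1 N3_def h3_def a2_def x_def[symmetric]
    by (simp add: a1 a3_def y2_def x_def[symmetric, unfolded One_nat_def] algebra_simps power2_eq_square power3_eq_cube)
  finally show "remainder \<mu> b 3 = h3 \<mu> b" unfolding cF_eq[OF \<mu>] by simp
qed

lemma remainder_high: "k \<ge> 4 \<Longrightarrow> remainder \<mu> b k = NK (\<Phi> \<mu> b) k"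
  by (simp add: remainder_def nf_field_def KS_ladder_NK coord_\<Phi>)

text \<open>\<open>Ocl p q r f\<close>: on \<open>D C\<close> the function is \<open>O(C\<^sup>p)\<close>, with Lipschitz constants \<open>O(C\<^sup>q)\<close> and
  \<open>O(C\<^sup>r)\<close> with respect to \<open>\<delta>1\<close> and \<open>\<delta>2\<close>, uniformly in \<open>\<mu>\<close> and \<open>C\<close>. The exponent 9 stands for infinity.\<close>

locale order_calculus =
  fixes Cs :: "real set" and D :: "real \<Rightarrow> ell2 set" and \<delta>1 \<delta>2 :: "ell2 \<Rightarrow> ell2 \<Rightarrow> real"
  assumes Cs: "\<And>C. C \<in> Cs \<Longrightarrow> 0 < C \<and> C \<le> 1"
    and \<delta>_nonneg: "\<And>b b'. 0 \<le> \<delta>1 b b'" "\<And>b b'. 0 \<le> \<delta>2 b b'"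
begin

definition Ocl :: "nat \<Rightarrow> nat \<Rightarrow> nat \<Rightarrow> (real \<Rightarrow> ell2 \<Rightarrow> real) \<Rightarrow> bool" where
  "Ocl p q r f \<longleftrightarrow> (\<exists>K\<ge>0. \<forall>\<mu>\<ge>1/2. \<forall>C\<in>Cs. \<forall>b\<in>D C. \<bar>f \<mu> b\<bar> \<le> K * C ^ p \<and>
    (\<forall>b'\<in>D C. \<bar>f \<mu> b - f \<mu> b'\<bar> \<le> K * (C ^ q * \<delta>1 b b' + C ^ r * \<delta>2 b b')))"

lemma OO_I:
  assumes "0 \<le> K"
    "\<And>\<mu> C b. 1 / 2 \<le> \<mu> \<Longrightarrow> C \<in> Cs \<Longrightarrow> b \<in> D C \<Longrightarrow> \<bar>f \<mu> b\<bar> \<le> K * C ^ p"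
    "\<And>\<mu> C b b'. 1 / 2 \<le> \<mu> \<Longrightarrow> C \<in> Cs \<Longrightarrow> b \<in> D C \<Longrightarrow> b' \<in> D C \<Longrightarrow>
      \<bar>f \<mu> b - f \<mu> b'\<bar> \<le> K * (C ^ q * \<delta>1 b b' + C ^ r * \<delta>2 b b')"
  shows "Ocl p q r f"
  unfolding Ocl_def using assms by blast

lemma OO_E:
  assumes "Ocl p q r f"
  obtains K where "0 \<le> K"
    "\<And>\<mu> C b. 1 / 2 \<le> \<mu> \<Longrightarrow> C \<in> Cs \<Longrightarrow> b \<in> D C \<Longrightarrow> \<bar>f \<mu> b\<bar> \<le> K * C ^ p"
    "\<And>\<mu> C b b'. 1 / 2 \<le> \<mu> \<Longrightarrow> C \<in> Cs \<Longrightarrow> b \<in> D C \<Longrightarrow> b' \<in> D C \<Longrightarrow>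
      \<bar>f \<mu> b - f \<mu> b'\<bar> \<le> K * (C ^ q * \<delta>1 b b' + C ^ r * \<delta>2 b b')"
  using assms unfolding Ocl_def by blast

lemma dist_weaken:
  assumes "C \<in> Cs" "q' \<le> q" "r' \<le> r" "0 \<le> K"
  shows "K * (C ^ q * \<delta>1 b b' + C ^ r * \<delta>2 b b') \<le> K * (C ^ q' * \<delta>1 b b' + C ^ r' * \<delta>2 b b')"
  using assms Cs[OF assms(1)] \<delta>_nonneg
  by (intro mult_left_mono add_mono mult_right_mono power_decreasing) auto

lemma OO_mono:
  assumes "Ocl p q r f" "p' \<le> p" "q' \<le> q" "r' \<le> r"
  shows "Ocl p' q' r' f"
proof -
  obtain K where K: "0 \<le> K"
    "\<And>\<mu> C b. 1 / 2 \<le> \<mu> \<Longrightarrow> C \<in> Cs \<Longrightarrow> b \<in> D C \<Longrightarrow> \<bar>f \<mu> b\<bar> \<le> K * C ^ p"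
    "\<And>\<mu> C b b'. 1 / 2 \<le> \<mu> \<Longrightarrow> C \<in> Cs \<Longrightarrow> b \<in> D C \<Longrightarrow> b' \<in> D C \<Longrightarrow>
      \<bar>f \<mu> b - f \<mu> b'\<bar> \<le> K * (C ^ q * \<delta>1 b b' + C ^ r * \<delta>2 b b')"
    using assms(1) by (rule OO_E) blast
  show ?thesis
  proof (rule OO_I[OF K(1)])
    fix \<mu> C :: real and b b' assume *: "1 / 2 \<le> \<mu>" "C \<in> Cs" "b \<in> D C"
    have "K * C ^ p \<le> K * C ^ p'" using K(1) Cs[OF *(2)] assms(2) by (intro mult_left_mono power_decreasing) auto
    with K(2)[OF *] show "\<bar>f \<mu> b\<bar> \<le> K * C ^ p'" by linarith
    assume b': "b' \<in> D C"
    from K(3)[OF * b'] dist_weaken[OF *(2) assms(3,4) K(1), of b b']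
    show "\<bar>f \<mu> b - f \<mu> b'\<bar> \<le> K * (C ^ q' * \<delta>1 b b' + C ^ r' * \<delta>2 b b')" by linarith
  qed
qed

lemma OO_add:
  assumes "Ocl p q r f" "Ocl p' q' r' g"
  shows "Ocl (min p p') (min q q') (min r r') (\<lambda>\<mu> b. f \<mu> b + g \<mu> b)"
proof -
  let ?p = "min p p'" and ?q = "min q q'" and ?r = "min r r'"
  have "Ocl ?p ?q ?r f" "Ocl ?p ?q ?r g" using assms by (auto intro: OO_mono)
  then obtain K L where K: "0 \<le> K" "0 \<le> L"
    and b: "\<And>\<mu> C b. 1 / 2 \<le> \<mu> \<Longrightarrow> C \<in> Cs \<Longrightarrow> b \<in> D C \<Longrightarrow> \<bar>f \<mu> b\<bar> \<le> K * C ^ ?p"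
    "\<And>\<mu> C b. 1 / 2 \<le> \<mu> \<Longrightarrow> C \<in> Cs \<Longrightarrow> b \<in> D C \<Longrightarrow> \<bar>g \<mu> b\<bar> \<le> L * C ^ ?p"
    "\<And>\<mu> C b b'. 1 / 2 \<le> \<mu> \<Longrightarrow> C \<in> Cs \<Longrightarrow> b \<in> D C \<Longrightarrow> b' \<in> D C \<Longrightarrow>
      \<bar>f \<mu> b - f \<mu> b'\<bar> \<le> K * (C ^ ?q * \<delta>1 b b' + C ^ ?r * \<delta>2 b b')"
    "\<And>\<mu> C b b'. 1 / 2 \<le> \<mu> \<Longrightarrow> C \<in> Cs \<Longrightarrow> b \<in> D C \<Longrightarrow> b' \<in> D C \<Longrightarrow>
      \<bar>g \<mu> b - g \<mu> b'\<bar> \<le> L * (C ^ ?q * \<delta>1 b b' + C ^ ?r * \<delta>2 b b')"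
    by (elim OO_E) blast
  show ?thesis
  proof (rule OO_I[of "K + L"])
    fix \<mu> C :: real and c c' assume *: "1 / 2 \<le> \<mu>" "C \<in> Cs" "c \<in> D C"
    show "\<bar>f \<mu> c + g \<mu> c\<bar> \<le> (K + L) * C ^ ?p"
      using b(1,2)[OF *] unfolding distrib_right by linarith
    assume "c' \<in> D C"
    then show "\<bar>f \<mu> c + g \<mu> c - (f \<mu> c' + g \<mu> c')\<bar> \<le> (K + L) * (C ^ ?q * \<delta>1 c c' + C ^ ?r * \<delta>2 c c')"
      using b(3,4)[OF *, of c'] unfolding distrib_right[of K L] by linarith
  qed (use K in simp)
qed

lemma OO_mult:
  assumes "Ocl p q r f" "Ocl p' q' r' g"
  shows "Ocl (p + p') (min (p + q') (q + p')) (min (p + r') (r + p')) (\<lambda>\<mu> b. f \<mu> b * g \<mu> b)"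
proof -
  let ?q = "min (p + q') (q + p')" and ?r = "min (p + r') (r + p')"
  obtain K L where K: "0 \<le> K" "0 \<le> L"
    and b: "\<And>\<mu> C b. 1 / 2 \<le> \<mu> \<Longrightarrow> C \<in> Cs \<Longrightarrow> b \<in> D C \<Longrightarrow> \<bar>f \<mu> b\<bar> \<le> K * C ^ p"
    "\<And>\<mu> C b. 1 / 2 \<le> \<mu> \<Longrightarrow> C \<in> Cs \<Longrightarrow> b \<in> D C \<Longrightarrow> \<bar>g \<mu> b\<bar> \<le> L * C ^ p'"
    "\<And>\<mu> C b b'. 1 / 2 \<le> \<mu> \<Longrightarrow> C \<in> Cs \<Longrightarrow> b \<in> D C \<Longrightarrow> b' \<in> D C \<Longrightarrow>
      \<bar>f \<mu> b - f \<mu> b'\<bar> \<le> K * (C ^ q * \<delta>1 b b' + C ^ r * \<delta>2 b b')"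
    "\<And>\<mu> C b b'. 1 / 2 \<le> \<mu> \<Longrightarrow> C \<in> Cs \<Longrightarrow> b \<in> D C \<Longrightarrow> b' \<in> D C \<Longrightarrow>
      \<bar>g \<mu> b - g \<mu> b'\<bar> \<le> L * (C ^ q' * \<delta>1 b b' + C ^ r' * \<delta>2 b b')"
    using assms by (elim OO_E) blast
  show ?thesis
  proof (rule OO_I[of "2 * K * L"])
    fix \<mu> C :: real and c c' assume *: "1 / 2 \<le> \<mu>" "C \<in> Cs" "c \<in> D C"
    have C: "0 < C" "C \<le> 1" using Cs[OF *(2)] by auto
    have "\<bar>f \<mu> c\<bar> * \<bar>g \<mu> c\<bar> \<le> (K * C ^ p) * (L * C ^ p')"
      using b(1,2)[OF *] K C by (intro mult_mono) auto
    moreover have "(K * C ^ p) * (L * C ^ p') \<le> 2 * K * L * C ^ (p + p')"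
      using K C by (simp add: power_add mult_ac)
    ultimately show "\<bar>f \<mu> c * g \<mu> c\<bar> \<le> 2 * K * L * C ^ (p + p')" by (simp add: abs_mult)
    assume c': "c' \<in> D C"
    let ?d1 = "\<delta>1 c c'" and ?d2 = "\<delta>2 c c'"
    have n: "0 \<le> ?d1" "0 \<le> ?d2" using \<delta>_nonneg by auto
    have "\<bar>f \<mu> c * g \<mu> c - f \<mu> c' * g \<mu> c'\<bar> = \<bar>f \<mu> c * (g \<mu> c - g \<mu> c') + (f \<mu> c - f \<mu> c') * g \<mu> c'\<bar>"
      by (simp add: algebra_simps)
    also have "\<dots> \<le> \<bar>f \<mu> c\<bar> * \<bar>g \<mu> c - g \<mu> c'\<bar> + \<bar>f \<mu> c - f \<mu> c'\<bar> * \<bar>g \<mu> c'\<bar>"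
      by (rule order_trans[OF abs_triangle_ineq]) (simp add: abs_mult)
    also have "\<dots> \<le> (K * C ^ p) * (L * (C ^ q' * ?d1 + C ^ r' * ?d2)) + (K * (C ^ q * ?d1 + C ^ r * ?d2)) * (L * C ^ p')"
      using b(1,3,4)[OF *] b(2)[OF *(1,2) c'] c' K C n by (intro add_mono mult_mono) auto
    also have "\<dots> = K * L * ((C ^ (p + q') * ?d1 + C ^ (p + r') * ?d2) + (C ^ (q + p') * ?d1 + C ^ (r + p') * ?d2))"
      by (simp add: power_add algebra_simps)
    also have "\<dots> \<le> K * L * ((C ^ ?q * ?d1 + C ^ ?r * ?d2) + (C ^ ?q * ?d1 + C ^ ?r * ?d2))"
      using K C n by (intro mult_left_mono add_mono mult_right_mono power_decreasing) auto
    finally show "\<bar>f \<mu> c * g \<mu> c - f \<mu> c' * g \<mu> c'\<bar> \<le> 2 * K * L * (C ^ ?q * ?d1 + C ^ ?r * ?d2)"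
      by (simp add: algebra_simps)
  qed (use K in simp)
qed

lemma OO_coeff:
  assumes "\<And>\<mu>. 1 / 2 \<le> \<mu> \<Longrightarrow> \<bar>c \<mu>\<bar> \<le> M"
  shows "Ocl 0 9 9 (\<lambda>\<mu> b. c \<mu>)"
proof (rule OO_I[of M])
  show "0 \<le> M" using assms[of 1] by simp
  fix C b b' assume "C \<in> Cs"
  then have "0 < C" using Cs by blast
  then show "\<bar>c \<mu> - c \<mu>\<bar> \<le> M * (C ^ 9 * \<delta>1 b b' + C ^ 9 * \<delta>2 b b')" for \<mu>
    using \<open>0 \<le> M\<close> \<delta>_nonneg by simp
qed (use assms in simp)

lemma OO_const: "Ocl 0 9 9 (\<lambda>\<mu> b. c)"
  by (rule OO_coeff[of _ "\<bar>c\<bar>"]) simp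

lemma OO_diff:
  assumes "Ocl p q r f" "Ocl p' q' r' g"
  shows "Ocl (min p p') (min q q') (min r r') (\<lambda>\<mu> b. f \<mu> b - g \<mu> b)"
proof -
  have "Ocl p' q' r' (\<lambda>\<mu> b. - g \<mu> b)"
  proof -
    obtain L where "0 \<le> L" "\<And>\<mu> C b. 1 / 2 \<le> \<mu> \<Longrightarrow> C \<in> Cs \<Longrightarrow> b \<in> D C \<Longrightarrow> \<bar>g \<mu> b\<bar> \<le> L * C ^ p'"
      "\<And>\<mu> C b b'. 1 / 2 \<le> \<mu> \<Longrightarrow> C \<in> Cs \<Longrightarrow> b \<in> D C \<Longrightarrow> b' \<in> D C \<Longrightarrow>
        \<bar>g \<mu> b - g \<mu> b'\<bar> \<le> L * (C ^ q' * \<delta>1 b b' + C ^ r' * \<delta>2 b b')"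
      using assms(2) by (rule OO_E) blast
    then show ?thesis by (intro OO_I[of L]) (auto simp: abs_minus_commute)
  qed
  from OO_add[OF assms(1) this] show ?thesis by simp
qed

lemma OO_reciprocal:
  assumes f: "Ocl 0 q r f" and ge: "\<And>\<mu> C b. 1 / 2 \<le> \<mu> \<Longrightarrow> C \<in> Cs \<Longrightarrow> b \<in> D C \<Longrightarrow> 1 / 2 \<le> f \<mu> b"
  shows "Ocl 0 q r (\<lambda>\<mu> b. 1 / f \<mu> b)"
proof -
  obtain L where L: "0 \<le> L"
    "\<And>\<mu> C b b'. 1 / 2 \<le> \<mu> \<Longrightarrow> C \<in> Cs \<Longrightarrow> b \<in> D C \<Longrightarrow> b' \<in> D C \<Longrightarrow>
      \<bar>f \<mu> b - f \<mu> b'\<bar> \<le> L * (C ^ q * \<delta>1 b b' + C ^ r * \<delta>2 b b')"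
    using f by (rule OO_E) blast
  show ?thesis
  proof (rule OO_I[of "2 + 4 * L"])
    fix \<mu> C :: real and b b' assume *: "1 / 2 \<le> \<mu>" "C \<in> Cs" "b \<in> D C"
    have le2: "\<bar>1 / f \<mu> b\<bar> \<le> 2" using ge[OF *] by (simp add: divide_simps)
    then show "\<bar>1 / f \<mu> b\<bar> \<le> (2 + 4 * L) * C ^ 0" using L(1) by simp
    assume b': "b' \<in> D C"
    have le2': "\<bar>1 / f \<mu> b'\<bar> \<le> 2" using ge[OF *(1,2) b'] by (simp add: divide_simps)
    let ?d = "C ^ q * \<delta>1 b b' + C ^ r * \<delta>2 b b'"
    have d: "0 \<le> ?d" using Cs[OF *(2)] \<delta>_nonneg by simp
    have "1 / f \<mu> b - 1 / f \<mu> b' = - (f \<mu> b - f \<mu> b') * (1 / f \<mu> b) * (1 / f \<mu> b')"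
      using ge[OF *] ge[OF *(1,2) b'] by (simp add: field_simps)
    then have "\<bar>1 / f \<mu> b - 1 / f \<mu> b'\<bar> = \<bar>f \<mu> b - f \<mu> b'\<bar> * \<bar>1 / f \<mu> b\<bar> * \<bar>1 / f \<mu> b'\<bar>"
      by (simp add: abs_mult abs_minus_commute)
    also have "\<dots> \<le> (L * ?d) * 2 * 2"
      using L(2)[OF * b'] le2 le2' L(1) d by (intro mult_mono) auto
    also have "\<dots> \<le> (2 + 4 * L) * ?d" using d by (simp add: algebra_simps)
    finally show "\<bar>1 / f \<mu> b - 1 / f \<mu> b'\<bar> \<le> (2 + 4 * L) * ?d" .
  qed (use L in simp)
qed

end

text \<open>The order computations are done once and used twice: on the ball \<open>nf_dom\<close>
  with the norm, where they give Lipschitz continuity, and on the boxes with separate distances for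
  b_1 and for the rest, where the powers of C matter.\<close>

locale nf_orders = order_calculus +
  assumes OO_b1: "Ocl 1 0 9 (\<lambda>\<mu> b. coord b 1)"
    and OO_bk: "\<And>j. 2 \<le> j \<Longrightarrow> j \<le> 6 \<Longrightarrow> Ocl 3 9 0 (\<lambda>\<mu> b. coord b j)"
    and OO_tail: "\<And>j. 1 \<le> j \<Longrightarrow> j \<le> 3 \<Longrightarrow> Ocl 6 9 3 (\<lambda>\<mu> b. tail4 j b)"
    and small: "\<And>C b. C \<in> Cs \<Longrightarrow> b \<in> D C \<Longrightarrow> \<bar>coord b 1\<bar> \<le> 1 / 2 \<and> \<bar>coord b 2\<bar> \<le> 1 / 2"
begin

lemma OO_tails: "Ocl 6 9 3 (\<lambda>\<mu> b. tail4 1 b)" "Ocl 6 9 3 (\<lambda>\<mu> b. tail4 2 b)" "Ocl 6 9 3 (\<lambda>\<mu> b. tail4 3 b)"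
  by (rule OO_tail; simp)+

lemma OO_coords: "Ocl 3 9 0 (\<lambda>\<mu> b. coord b 2)" "Ocl 3 9 0 (\<lambda>\<mu> b. coord b 3)"
  "Ocl 3 9 0 (\<lambda>\<mu> b. coord b 4)" "Ocl 3 9 0 (\<lambda>\<mu> b. coord b 5)" "Ocl 3 9 0 (\<lambda>\<mu> b. coord b 6)"
  by (rule OO_bk; simp)+

lemma OO_coeffs: "Ocl 0 9 9 (\<lambda>\<mu> b. cE \<mu>)" "Ocl 0 9 9 (\<lambda>\<mu> b. cP \<mu>)" "Ocl 0 9 9 (\<lambda>\<mu> b. cG \<mu>)"
  "Ocl 0 9 9 (\<lambda>\<mu> b. cF \<mu>)" "Ocl 0 9 9 (\<lambda>\<mu> b. lam 2 \<mu> * (cG \<mu> + cP \<mu>))"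
  by (rule OO_coeff, erule cE_bound cP_bound cG_bound cF_bound cPG_bound)+

lemmas OO_base = OO_b1 OO_coords OO_tails OO_coeffs OO_const

lemmas OO_ops = OO_mult OO_add OO_diff

text \<open>The rules determine exponents by unification along the term; \<open>OO_mono\<close>
  weakens them to the stated ones, leaving only comparisons of numerals. The later order lemmas
  follow the same pattern.\<close>

lemma OO_y2: "Ocl 2 1 0 y2"
  unfolding y2_def by (rule OO_mono, (rule OO_base OO_ops)+, simp_all)

lemma OO_denom: "Ocl 0 1 0 (\<lambda>\<mu> b. 1 + cE \<mu> * y2 \<mu> b)"
  by (rule OO_mono, (rule OO_base OO_y2 OO_ops)+, simp_all)

lemma OO_1E: "Ocl 0 1 0 (\<lambda>\<mu> b. 1 / (1 + cE \<mu> * y2 \<mu> b))"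
  by (rule OO_reciprocal[OF OO_denom]) (use small E_ge in blast)

lemma OO_a1: "Ocl 1 0 1 a1"
  unfolding a1_def by (rule OO_mono, (rule OO_base OO_denom OO_ops)+, simp_all)

lemma OO_a3: "Ocl 3 2 0 a3"
  unfolding a3_def by (rule OO_mono, (rule OO_base OO_ops)+, simp_all)

lemma OO_a2: "Ocl 2 1 0 a2"
  unfolding a2_def by (rule OO_mono, (rule OO_base OO_y2 OO_a1 OO_a3 OO_ops)+, simp_all)

lemmas OO_facts = OO_base OO_1E OO_y2 OO_a1 OO_a2 OO_a3

lemma OO_N1: "Ocl 3 2 1 N1"
  unfolding N1_def by (rule OO_mono, (rule OO_facts OO_ops)+, simp_all)

lemma OO_N3: "Ocl 3 2 1 N3"
  unfolding N3_def by (rule OO_mono, (rule OO_facts OO_ops)+, simp_all)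

lemma OO_R2: "Ocl 4 3 2 R2"
  unfolding R2_def by (rule OO_mono, (rule OO_facts OO_N1 OO_N3 OO_ops)+, simp_all)

text \<open>The exponents 5 and 3 are those demanded of h_1 and of its derivatives by the remainder
  bounds.\<close>

lemma OO_h1: "Ocl 5 4 3 h1"
  unfolding h1_def by (rule OO_mono, (rule OO_facts OO_R2 OO_ops)+, simp_all)

lemma OO_h2: "Ocl 4 3 1 h2"
  unfolding h2_def by (rule OO_mono, (rule OO_facts OO_R2 OO_h1 OO_ops)+, simp_all)

lemma OO_h3: "Ocl 4 3 1 h3"
  unfolding h3_def by (rule OO_mono, (rule OO_facts OO_R2 OO_h1 OO_ops)+, simp_all)

end

section \<open>The quadratic terms in the norm of the phase space\<close>

lemma sum_coord_inj_sq_le: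
  assumes "finite I" "inj_on f I" shows "(\<Sum>i\<in>I. (coord x (f i))\<^sup>2) \<le> (norm x)\<^sup>2"
proof -
  have "(\<Sum>i\<in>I. (coord x (f i))\<^sup>2) = (\<Sum>j\<in>f ` I. (coord x j)\<^sup>2)"
    using assms by (simp add: sum.reindex)
  also have "\<dots> \<le> (norm x)\<^sup>2" unfolding norm_ell2_sq
    using assms by (intro sum_le_suminf summable_coord_sq) auto
  finally show ?thesis .
qed

lemma sum_coord_mult_le:
  assumes "finite I" "inj_on f I" "inj_on g I"
  shows "(\<Sum>i\<in>I. \<bar>coord x (f i)\<bar> * \<bar>coord y (g i)\<bar>) \<le> norm x * norm y"
proof -
  have "(\<Sum>i\<in>I. \<bar>coord x (f i)\<bar> * \<bar>coord y (g i)\<bar>) \<le> L2_set (\<lambda>i. coord x (f i)) I * L2_set (\<lambda>i. coord y (g i)) I"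
    by (rule L2_set_mult_ineq)
  also have "\<dots> \<le> norm x * norm y"
    unfolding L2_set_def using assms
    by (intro mult_mono real_le_lsqrt sum_coord_inj_sq_le) (auto intro: sum_nonneg)
  finally show ?thesis .
qed

lemma abs_suminf_coord_mult_le: "\<bar>\<Sum>i. coord x (i + m) * coord y (i + n)\<bar> \<le> norm x * norm y"
proof -
  have s: "summable (\<lambda>i. \<bar>coord x (i + m) * coord y (i + n)\<bar>)"
    using summable_coord_shift_mult[of x m y n] by (simp add: abs_mult)
  then have "\<bar>\<Sum>i. coord x (i + m) * coord y (i + n)\<bar> \<le> (\<Sum>i. \<bar>coord x (i + m) * coord y (i + n)\<bar>)"
    by (rule summable_rabs)
  also have "\<dots> \<le> norm x * norm y"
    by (rule suminf_le_const[OF s]) (auto simp: abs_mult intro!: sum_coord_mult_le inj_onI)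
  finally show ?thesis .
qed

lemma suminf_coord_mult_diff:
  "(\<Sum>i. coord x (i + m) * coord x (i + n)) - (\<Sum>i. coord y (i + m) * coord y (i + n)) =
    (\<Sum>i. coord x (i + m) * coord (x - y) (i + n)) + (\<Sum>i. coord (x - y) (i + m) * coord y (i + n))"
proof -
  have "(\<Sum>i. coord x (i + m) * coord x (i + n)) - (\<Sum>i. coord y (i + m) * coord y (i + n)) =
      (\<Sum>i. coord x (i + m) * coord x (i + n) - coord y (i + m) * coord y (i + n))"
    by (intro suminf_diff summable_coord_shift_mult')
  also have "\<dots> = (\<Sum>i. coord x (i + m) * coord (x - y) (i + n) + coord (x - y) (i + m) * coord y (i + n))"
    by (simp add: algebra_simps)
  also have "\<dots> = (\<Sum>i. coord x (i + m) * coord (x - y) (i + n)) + (\<Sum>i. coord (x - y) (i + m) * coord y (i + n))"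
    by (intro suminf_add[symmetric] summable_coord_shift_mult')
  finally show ?thesis .
qed

lemma suminf_coord_mult_lipschitz:
  "\<bar>(\<Sum>i. coord x (i + m) * coord x (i + n)) - (\<Sum>i. coord y (i + m) * coord y (i + n))\<bar> \<le>
    (norm x + norm y) * norm (x - y)"
  unfolding suminf_coord_mult_diff distrib_right
  using abs_suminf_coord_mult_le[of x m "x - y" n] abs_suminf_coord_mult_le[of "x - y" m y n]
  by (simp add: mult.commute)

text \<open>Cauchy-Schwarz bounds both the finite convolution and the correlation by products of
  norms; they enter with weights 1 and 2, hence the factor 3.\<close>

lemma NK_lipschitz: "\<bar>NK x k - NK y k\<bar> \<le> 3 * (norm x + norm y) * real k * norm (x - y)"
proof -
  let ?I = "{1..k-1}"
  have "(\<Sum>i\<in>?I. coord x i * coord x (k - i)) - (\<Sum>i\<in>?I. coord y i * coord y (k - i)) =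
      (\<Sum>i\<in>?I. coord x i * coord (x - y) (k - i) + coord (x - y) i * coord y (k - i))"
    unfolding sum_subtractf[symmetric] by (intro sum.cong refl) (simp add: algebra_simps)
  also have "\<bar>\<dots>\<bar> \<le> (\<Sum>i\<in>?I. \<bar>coord x i\<bar> * \<bar>coord (x - y) (k - i)\<bar> + \<bar>coord (x - y) i\<bar> * \<bar>coord y (k - i)\<bar>)"
  proof (rule order_trans[OF sum_abs], rule sum_mono)
    fix i
    show "\<bar>coord x i * coord (x - y) (k - i) + coord (x - y) i * coord y (k - i)\<bar> \<le>
        \<bar>coord x i\<bar> * \<bar>coord (x - y) (k - i)\<bar> + \<bar>coord (x - y) i\<bar> * \<bar>coord y (k - i)\<bar>"
      unfolding abs_mult[symmetric] by (rule abs_triangle_ineq)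
  qed
  also have "\<dots> \<le> norm x * norm (x - y) + norm (x - y) * norm y"
    unfolding sum.distrib
    by (intro add_mono sum_coord_mult_le) (auto intro!: inj_onI)
  finally have 1: "\<bar>(\<Sum>i\<in>?I. coord x i * coord x (k - i)) - (\<Sum>i\<in>?I. coord y i * coord y (k - i))\<bar> \<le>
      (norm x + norm y) * norm (x - y)" by (simp add: algebra_simps)
  have 2: "\<bar>corr k x - corr k y\<bar> \<le> (norm x + norm y) * norm (x - y)"
    using suminf_coord_mult_lipschitz[of x 0 k y] by (simp add: corr_def)
  have "NK x k - NK y k = real k * (2 * (corr k x - corr k y) -
      ((\<Sum>i\<in>?I. coord x i * coord x (k - i)) - (\<Sum>i\<in>?I. coord y i * coord y (k - i))))"
    by (simp add: NK_def algebra_simps)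
  then have "\<bar>NK x k - NK y k\<bar> = real k * \<bar>2 * (corr k x - corr k y) -
      ((\<Sum>i\<in>?I. coord x i * coord x (k - i)) - (\<Sum>i\<in>?I. coord y i * coord y (k - i)))\<bar>"
    by (simp add: abs_mult)
  also have "\<dots> \<le> real k * (3 * ((norm x + norm y) * norm (x - y)))"
    using 1 2 by (intro mult_left_mono) auto
  also have "\<dots> = 3 * (norm x + norm y) * real k * norm (x - y)" by simp
  finally show ?thesis .
qed

lemma NK_0 [simp]: "NK 0 k = 0"
  by (simp add: NK_def corr_def)

lemma \<Phi>_0 [simp]: "\<Phi> \<mu> 0 = 0"
  by (rule ell2_eqI) (simp add: coord_\<Phi> a1_def a2_def a3_def y2_def)

lemma remainder_0: assumes "1 / 2 \<le> \<mu>" shows "remainder \<mu> 0 k = 0"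
proof -
  have G: "KS_ladder \<mu> 0 k = 0" for k by (simp add: KS_ladder_NK)
  show ?thesis by (simp add: remainder_def nf_field_def F1_def Y2_def G)
qed

text \<open>With C = 1 all powers of C are 1, and \<open>Ocl\<close> expresses boundedness and
  Lipschitz continuity in the norm, uniformly in \<mu>.\<close>

interpretation dom: nf_orders "{1}" "\<lambda>_. nf_dom" "\<lambda>_ _. 0" "\<lambda>b b'. norm (b - b')"
proof -
  interpret order_calculus "{1}" "\<lambda>_. nf_dom" "\<lambda>_ _. 0" "\<lambda>b b'. norm (b - b')"
    by unfold_locales auto
  have coord: "Ocl p q r (\<lambda>\<mu> b. coord b j)" for p q r j
    by (rule OO_I[of 1]) (use abs_coord_le_norm[of "_ - _" j] in \<open>auto dest: nf_domD[of _ j]\<close>)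
  have tail: "Ocl p q r (\<lambda>\<mu> b. tail4 j b)" for p q r j
  proof (rule OO_I[of 1])
    have n: "norm b \<le> 1 / 2" if "b \<in> nf_dom" for b using that by (simp add: nf_dom_def)
    fix C :: real and b b' assume C: "C \<in> {1}" and b: "b \<in> nf_dom"
    have "\<bar>tail4 j b\<bar> \<le> norm b * norm b"
      unfolding tail4_def using abs_suminf_coord_mult_le[of b 4 b "4 + j"] by (simp add: add.assoc)
    also have "\<dots> \<le> 1 / 2 * (1 / 2)" using n[OF b] by (intro mult_mono) auto
    finally show "\<bar>tail4 j b\<bar> \<le> 1 * C ^ p" using C by simp
    assume b': "b' \<in> nf_dom"
    have "\<bar>tail4 j b - tail4 j b'\<bar> \<le> (norm b + norm b') * norm (b - b')"
      unfolding tail4_def using suminf_coord_mult_lipschitz[of b 4 "4 + j" b'] by (simp add: add.assoc)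
    also have "\<dots> \<le> 1 * norm (b - b')" using n[OF b] n[OF b'] by (intro mult_right_mono) auto
    finally show "\<bar>tail4 j b - tail4 j b'\<bar> \<le> 1 * (C ^ q * 0 + C ^ r * norm (b - b'))" using C by simp
  qed simp
  show "nf_orders {1} (\<lambda>_. nf_dom) (\<lambda>_ _. 0) (\<lambda>b b'. norm (b - b'))"
    by unfold_locales (use coord tail nf_domD in blast)+
qed

lemma dom_lipschitz:
  assumes "dom.Ocl p q r f"
  obtains K where "0 \<le> K" "\<And>\<mu> b b'. 1 / 2 \<le> \<mu> \<Longrightarrow> b \<in> nf_dom \<Longrightarrow> b' \<in> nf_dom \<Longrightarrow>
    \<bar>f \<mu> b - f \<mu> b'\<bar> \<le> K * norm (b - b')"
  using assms by (rule dom.OO_E) force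

text \<open>For the modes k \<le> 3 the order calculus yields constants. For k \<ge> 4 the remainder
  is the quadratic term composed with the Lipschitz map \<Phi>, which is where the factor k
  arises.\<close>

theorem remainder_lipschitz:
  obtains L where "0 < L" "\<And>\<mu> b b' k. 1 / 2 \<le> \<mu> \<Longrightarrow> b \<in> nf_dom \<Longrightarrow> b' \<in> nf_dom \<Longrightarrow> 1 \<le> k \<Longrightarrow>
    \<bar>remainder \<mu> b k - remainder \<mu> b' k\<bar> \<le> L * real k * norm (b - b')"
proof -
  obtain K1 where K1: "0 \<le> K1" "\<And>\<mu> b b'. 1 / 2 \<le> \<mu> \<Longrightarrow> b \<in> nf_dom \<Longrightarrow> b' \<in> nf_dom \<Longrightarrow>
    \<bar>a1 \<mu> b - a1 \<mu> b'\<bar> \<le> K1 * norm (b - b')" using dom.OO_a1 by (rule dom_lipschitz) blast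
  obtain K2 where K2: "0 \<le> K2" "\<And>\<mu> b b'. 1 / 2 \<le> \<mu> \<Longrightarrow> b \<in> nf_dom \<Longrightarrow> b' \<in> nf_dom \<Longrightarrow>
    \<bar>a2 \<mu> b - a2 \<mu> b'\<bar> \<le> K2 * norm (b - b')" using dom.OO_a2 by (rule dom_lipschitz) blast
  obtain K3 where K3: "0 \<le> K3" "\<And>\<mu> b b'. 1 / 2 \<le> \<mu> \<Longrightarrow> b \<in> nf_dom \<Longrightarrow> b' \<in> nf_dom \<Longrightarrow>
    \<bar>a3 \<mu> b - a3 \<mu> b'\<bar> \<le> K3 * norm (b - b')" using dom.OO_a3 by (rule dom_lipschitz) blast
  obtain H1 where H1: "0 \<le> H1" "\<And>\<mu> b b'. 1 / 2 \<le> \<mu> \<Longrightarrow> b \<in> nf_dom \<Longrightarrow> b' \<in> nf_dom \<Longrightarrow>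
    \<bar>h1 \<mu> b - h1 \<mu> b'\<bar> \<le> H1 * norm (b - b')" using dom.OO_h1 by (rule dom_lipschitz) blast
  obtain H2 where H2: "0 \<le> H2" "\<And>\<mu> b b'. 1 / 2 \<le> \<mu> \<Longrightarrow> b \<in> nf_dom \<Longrightarrow> b' \<in> nf_dom \<Longrightarrow>
    \<bar>h2 \<mu> b - h2 \<mu> b'\<bar> \<le> H2 * norm (b - b')" using dom.OO_h2 by (rule dom_lipschitz) blast
  obtain H3 where H3: "0 \<le> H3" "\<And>\<mu> b b'. 1 / 2 \<le> \<mu> \<Longrightarrow> b \<in> nf_dom \<Longrightarrow> b' \<in> nf_dom \<Longrightarrow>
    \<bar>h3 \<mu> b - h3 \<mu> b'\<bar> \<le> H3 * norm (b - b')" using dom.OO_h3 by (rule dom_lipschitz) blast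
  define K where "K = 4 + K1 + K2 + K3"
  have \<Phi>_lip: "norm (\<Phi> \<mu> b - \<Phi> \<mu> b') \<le> K * norm (b - b')"
    if \<mu>: "1 / 2 \<le> \<mu>" and b: "b \<in> nf_dom" and b': "b' \<in> nf_dom" for \<mu> b b'
  proof -
    have u: "norm (unit_vec j) \<le> 1" for j
    proof (rule power2_le_imp_le)
      have "(\<Sum>i. (coord (unit_vec j) i)\<^sup>2) = (\<Sum>i\<in>{j}. (coord (unit_vec j) i)\<^sup>2)"
        by (rule suminf_finite) (auto simp: coord_unit_vec)
      then show "(norm (unit_vec j))\<^sup>2 \<le> 1\<^sup>2" by (simp add: norm_ell2_sq coord_unit_vec)
    qed simp
    have w: "\<bar>coord b j - coord b' j\<bar> \<le> norm (b - b')" for j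
      using abs_coord_le_norm[of "b - b'" j] by simp
    have tri: "norm (x + c1 *\<^sub>R unit_vec 1 + c2 *\<^sub>R unit_vec 2 + c3 *\<^sub>R unit_vec 3) \<le> norm x + \<bar>c1\<bar> + \<bar>c2\<bar> + \<bar>c3\<bar>"
      for x c1 c2 c3
    proof -
      have "norm (c *\<^sub>R unit_vec j) \<le> \<bar>c\<bar>" for c j using mult_left_mono[OF u, of "\<bar>c\<bar>" j] by simp
      from this[of c1 1] this[of c2 2] this[of c3 3]
        norm_triangle_ineq[of "x + c1 *\<^sub>R unit_vec 1 + c2 *\<^sub>R unit_vec 2" "c3 *\<^sub>R unit_vec 3"]
        norm_triangle_ineq[of "x + c1 *\<^sub>R unit_vec 1" "c2 *\<^sub>R unit_vec 2"]
        norm_triangle_ineq[of x "c1 *\<^sub>R unit_vec 1"]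
      show ?thesis by linarith
    qed
    have "\<Phi> \<mu> b - \<Phi> \<mu> b' = (b - b')
        + ((a1 \<mu> b - a1 \<mu> b') - (coord b 1 - coord b' 1)) *\<^sub>R unit_vec 1
        + ((a2 \<mu> b - a2 \<mu> b') - (coord b 2 - coord b' 2)) *\<^sub>R unit_vec 2
        + ((a3 \<mu> b - a3 \<mu> b') - (coord b 3 - coord b' 3)) *\<^sub>R unit_vec 3"
      unfolding \<Phi>_eq by (simp add: algebra_simps)
    also have "norm \<dots> \<le> norm (b - b') + (K1 + 1) * norm (b - b') + (K2 + 1) * norm (b - b') + (K3 + 1) * norm (b - b')"
      unfolding distrib_right
      using tri K1(2)[OF \<mu> b b'] K2(2)[OF \<mu> b b'] K3(2)[OF \<mu> b b'] w[of 1] w[of 2] w[of 3]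
      by (smt (verit) mult_1)
    finally show ?thesis by (simp add: K_def algebra_simps)
  qed
  define L where "L = 3 * K * K + H1 + H2 + H3"
  have L: "0 < L" using K1 K2 K3 H1 H2 H3 unfolding L_def K_def by (intro add_pos_nonneg mult_pos_pos) auto
  show ?thesis
  proof (rule that[OF L])
    fix \<mu> :: real and b b' and k :: nat
    assume \<mu>: "1 / 2 \<le> \<mu>" and b: "b \<in> nf_dom" and b': "b' \<in> nf_dom" and k: "1 \<le> k"
    have E: "1 + cE \<mu> * y2 \<mu> b \<noteq> 0" "1 + cE \<mu> * y2 \<mu> b' \<noteq> 0" using E_ge_dom[OF \<mu>] b b' by force+
    have K0: "0 \<le> K" using K1 K2 K3 by (simp add: K_def)
    have low: "H * norm (b - b') \<le> L * real k * norm (b - b')" if "H \<in> {H1, H2, H3}" for H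
    proof (intro mult_right_mono)
      have "H \<le> L" using that H1(1) H2(1) H3(1) K0 by (auto simp: L_def)
      also have "\<dots> \<le> L * real k" using L k by simp
      finally show "H \<le> L * real k" .
    qed simp
    consider "k = 1" | "k = 2" | "k = 3" | "k \<ge> 4" using k by linarith
    then show "\<bar>remainder \<mu> b k - remainder \<mu> b' k\<bar> \<le> L * real k * norm (b - b')"
    proof cases
      case 1 then show ?thesis using H1(2)[OF \<mu> b b'] low[of H1] remainder_low[OF \<mu>] E by simp
    next
      case 2 then show ?thesis using H2(2)[OF \<mu> b b'] low[of H2] remainder_low[OF \<mu>] E by simp
    next
      case 3 then show ?thesis using H3(2)[OF \<mu> b b'] low[of H3] remainder_low[OF \<mu>] E by simp
    next
      case 4
      have z: "0 \<in> nf_dom" by (simp add: nf_dom_def)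
      have n: "norm (\<Phi> \<mu> c) \<le> K / 2" if "c \<in> nf_dom" for c
      proof -
        have "norm (\<Phi> \<mu> c) \<le> K * norm c" using \<Phi>_lip[OF \<mu> that z] by simp
        also have "\<dots> \<le> K * (1 / 2)" using that K0 by (intro mult_left_mono) (auto simp: nf_dom_def)
        finally show ?thesis by simp
      qed
      have "\<bar>NK (\<Phi> \<mu> b) k - NK (\<Phi> \<mu> b') k\<bar> \<le>
          3 * (norm (\<Phi> \<mu> b) + norm (\<Phi> \<mu> b')) * real k * norm (\<Phi> \<mu> b - \<Phi> \<mu> b')" by (rule NK_lipschitz)
      also have "\<dots> \<le> 3 * K * real k * (K * norm (b - b'))"
        using n[OF b] n[OF b'] K0 by (intro mult_mono \<Phi>_lip \<mu> b b') auto
      also have "\<dots> = (3 * K * K) * (real k * norm (b - b'))" by simp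
      also have "\<dots> \<le> L * (real k * norm (b - b'))"
        using H1(1) H2(1) H3(1) by (intro mult_right_mono) (auto simp: L_def)
      finally show ?thesis using 4 by (simp add: remainder_high)
    qed
  qed
qed

section \<open>Bounds of the remainder on the boxes\<close>

text \<open>The distance \<bar>k - i\<bar>: one of the two truncated differences is always
  0.\<close>

definition nd :: "nat \<Rightarrow> nat \<Rightarrow> nat" where "nd k i = (k - i) + (i - k)"

text \<open>
  Weights of the sums that bound differences of the quadratic terms on \<open>S_box s C\<close>,
  where \<open>\<bar>b\<^sub>i\<bar> \<le> C\<^sup>3 / i\<^sup>4\<close>.
\<close>

definition wstar :: "ell2 \<Rightarrow> real" where "wstar w = (\<Sum>i. \<bar>coord w (i + 2)\<bar> / real (i + 2) ^ 3)"
definition wconv :: "nat \<Rightarrow> ell2 \<Rightarrow> real" where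
  "wconv k w = (\<Sum>i. \<bar>coord w (i + 2)\<bar> / real (1 + nd k (i + 2)) ^ 3)"

lemma summable_inverse_shift: "m \<ge> 1 \<Longrightarrow> p \<ge> 2 \<Longrightarrow> summable (\<lambda>i. 1 / real (i + m) ^ p)"
  using summable_ignore_initial_segment[OF inverse_power_summable[of p, where 'a = real], of m]
  by (simp add: divide_inverse)

lemma summable_coord_weight:
  assumes "summable c" "\<And>i. 0 \<le> c i"
  shows "summable (\<lambda>i. \<bar>coord w (i + m)\<bar> * c i)"
proof (rule summable_comparison_test'[OF summable_mult[OF assms(1), of "norm w"], of 0])
  fix i
  show "norm (\<bar>coord w (i + m)\<bar> * c i) \<le> norm w * c i"
    using assms(2)[of i] abs_coord_le_norm[of w "i + m"] by (simp add: abs_mult mult_right_mono)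
qed

lemma summable_wstar: "m \<ge> 1 \<Longrightarrow> summable (\<lambda>i. \<bar>coord w (i + m)\<bar> / real (i + m) ^ 3)"
  using summable_coord_weight[OF summable_inverse_shift[of m 3], of w m] by simp

lemma wstar_nonneg: "0 \<le> wstar w"
  unfolding wstar_def by (intro suminf_nonneg summable_wstar) auto

lemma wstar_tail: "m \<ge> 2 \<Longrightarrow> (\<Sum>i. \<bar>coord w (i + m)\<bar> / real (i + m) ^ 3) \<le> wstar w"
proof -
  assume "m \<ge> 2"
  then obtain n where m: "m = n + 2" by (metis le_iff_add add.commute)
  have "wstar w = (\<Sum>i. \<bar>coord w (i + n + 2)\<bar> / real (i + n + 2) ^ 3)
      + (\<Sum>i<n. \<bar>coord w (i + 2)\<bar> / real (i + 2) ^ 3)"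
    unfolding wstar_def by (rule suminf_split_initial_segment[OF summable_wstar]) simp
  moreover have "0 \<le> (\<Sum>i<n. \<bar>coord w (i + 2)\<bar> / real (i + 2) ^ 3)" by (rule sum_nonneg) simp
  ultimately show ?thesis unfolding m by (simp only: add.assoc)
qed

lemma coord_le_wstar: assumes "2 \<le> j" shows "\<bar>coord w j\<bar> \<le> real j ^ 3 * wstar w"
proof -
  have "(\<Sum>i\<in>{j - 2}. \<bar>coord w (i + 2)\<bar> / real (i + 2) ^ 3) \<le> wstar w"
    unfolding wstar_def by (intro sum_le_suminf summable_wstar) auto
  moreover have "j - 2 + 2 = j" using assms by simp
  ultimately have "\<bar>coord w j\<bar> / real j ^ 3 \<le> wstar w" by simp
  then show ?thesis using assms by (simp add: divide_le_eq mult.commute)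
qed

text \<open>This is zeta(2); it enters all later smallness conditions as a symbolic
  constant.\<close>

definition Z :: real where "Z = (\<Sum>m. 1 / real (m + 1) ^ 2)"

lemma Z_sum: "summable (\<lambda>m. 1 / real (m + 1) ^ 2)"
  by (rule summable_inverse_shift) auto

lemma Z_ge: "1 \<le> Z"
proof -
  have "(\<Sum>m\<in>{0}. 1 / real (m + 1) ^ 2) \<le> Z" unfolding Z_def by (intro sum_le_suminf Z_sum) auto
  then show ?thesis by simp
qed

text \<open>Uniformity in k holds because the distance \<bar>k - i\<bar> takes each value at most
  twice, once on either side of k.\<close>

lemma nd_sum:
  assumes "p \<ge> 2"
  shows "summable (\<lambda>i. 1 / real (1 + nd k (i + m)) ^ p)" "(\<Sum>i. 1 / real (1 + nd k (i + m)) ^ p) \<le> 2 * Z"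
proof -
  let ?f = "\<lambda>i. 1 / real (1 + nd k (i + m)) ^ p"
  let ?g = "\<lambda>i. 1 / real (1 + nd k i) ^ p"
  have tail_le: "?g (i + k) \<le> 1 / real (i + 1) ^ 2" for i
    using assms by (auto simp: nd_def intro!: divide_left_mono power_increasing)
  have tail: "summable (\<lambda>i. ?g (i + k))"
    by (rule summable_comparison_test'[OF Z_sum, of 0]) (use tail_le in simp)
  have sg: "summable ?g" using tail by (rule summable_iff_shift[THEN iffD1])
  then show sf: "summable ?f" by (rule summable_ignore_initial_segment)
  have "(\<Sum>i. ?f i) \<le> (\<Sum>i. ?g i)"
    using suminf_split_initial_segment[OF sg, of m] by (simp add: sum_nonneg)
  also have "\<dots> = (\<Sum>i. ?g (i + k)) + (\<Sum>i<k. ?g i)" by (rule suminf_split_initial_segment[OF sg])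
  also have "(\<Sum>i. ?g (i + k)) \<le> Z" unfolding Z_def by (intro suminf_le tail_le tail Z_sum)
  also have "(\<Sum>i<k. ?g i) \<le> Z"
  proof -
    have "(\<Sum>i<k. ?g i) \<le> (\<Sum>i<k. 1 / real ((k - i) + 1) ^ 2)"
    proof (rule sum_mono)
      fix i assume "i \<in> {..<k}"
      then have "1 + nd k i = (k - i) + 1" by (simp add: nd_def)
      moreover have "1 / real ((k - i) + 1) ^ p \<le> 1 / real ((k - i) + 1) ^ 2"
        using assms by (intro divide_left_mono power_increasing) auto
      ultimately show "1 / real (1 + nd k i) ^ p \<le> 1 / real ((k - i) + 1) ^ 2" by simp
    qed
    also have "\<dots> = (\<Sum>j\<in>(\<lambda>i. k - i) ` {..<k}. 1 / real (j + 1) ^ 2)"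
      by (rule sum.reindex[symmetric, unfolded o_def]) (auto intro!: inj_onI)
    also have "\<dots> \<le> Z" unfolding Z_def by (intro sum_le_suminf Z_sum) auto
    finally show ?thesis .
  qed
  finally show "(\<Sum>i. ?f i) \<le> 2 * Z" by simp
qed

lemma summable_wconv: "summable (\<lambda>i. \<bar>coord w (i + 2)\<bar> / real (1 + nd k (i + 2)) ^ 3)"
  using summable_coord_weight[OF nd_sum(1)[of 3 k 2], of w 2] by simp

lemma wconv_nonneg: "0 \<le> wconv k w"
  unfolding wconv_def by (intro suminf_nonneg summable_wconv) auto

text \<open>For i \<ge> 2 and k \<ge> 1 one has 1 + \<bar>k - i\<bar> \<le> k i. This lets the two
  weights be compared at the price of k^3.\<close>

lemma wstar_le_wconv: assumes k: "k \<ge> 1" shows "wstar w \<le> real k ^ 3 * wconv k w"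
proof -
  have "wstar w \<le> (\<Sum>i. real k ^ 3 * (\<bar>coord w (i + 2)\<bar> / real (1 + nd k (i + 2)) ^ 3))"
    unfolding wstar_def
  proof (intro suminf_le summable_wstar summable_mult summable_wconv)
    fix i
    have "1 + nd k (i + 2) \<le> k * (i + 2)"
    proof (cases "k \<le> i + 2")
      case True
      have "1 * (i + 2) \<le> k * (i + 2)" using k by (intro mult_le_mono) auto
      then show ?thesis using True k by (auto simp: nd_def)
    next
      case False
      have "k * 2 \<le> k * (i + 2)" by (intro mult_le_mono) auto
      then show ?thesis using False by (auto simp: nd_def)
    qed
    then have "real (1 + nd k (i + 2)) \<le> real k * real (i + 2)" by (metis of_nat_le_iff of_nat_mult)
    then have "real (1 + nd k (i + 2)) ^ 3 \<le> (real k * real (i + 2)) ^ 3" by (intro power_mono) auto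
    then have "1 / real (i + 2) ^ 3 \<le> real k ^ 3 / real (1 + nd k (i + 2)) ^ 3"
      unfolding power_mult_distrib by (simp add: divide_simps del: of_nat_add of_nat_Suc)
    from mult_left_mono[OF this, of "\<bar>coord w (i + 2)\<bar>"]
    show "\<bar>coord w (i + 2)\<bar> / real (i + 2) ^ 3 \<le> real k ^ 3 * (\<bar>coord w (i + 2)\<bar> / real (1 + nd k (i + 2)) ^ 3)"
      by (simp add: mult_ac)
  qed simp
  also have "\<dots> = real k ^ 3 * wconv k w" unfolding wconv_def by (rule suminf_mult[OF summable_wconv])
  finally show ?thesis .
qed

text \<open>A common envelope A makes the bilinear difference linear in x - y. Its coordinate i
  meets A at i + k in one half of the correlation and at \<bar>k - i\<bar> otherwise: for i \<ge> k
  this is the other half of the correlation, for i < k the convolution.\<close>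

lemma NK_diff_bound:
  fixes k :: nat
  assumes x: "\<And>i. \<bar>coord x i\<bar> \<le> A i" and y: "\<And>i. \<bar>coord y i\<bar> \<le> A i" and A: "summable A"
  defines "T \<equiv> \<lambda>i. \<bar>coord (x - y) i\<bar> * (A (nd k i) + A (i + k))"
  shows "summable T" "\<bar>NK x k - NK y k\<bar> \<le> 2 * real k * (\<Sum>i. T i)"
proof -
  let ?v = "x - y"
  have A0: "0 \<le> A i" for i using x[of i] by linarith
  have s1: "summable (\<lambda>i. \<bar>coord ?v (i + 0)\<bar> * A (i + k))"
    by (rule summable_coord_weight) (use A A0 in \<open>auto intro: summable_ignore_initial_segment\<close>)
  have s2: "summable (\<lambda>i. \<bar>coord ?v (i + k)\<bar> * A i)"
    by (rule summable_coord_weight[OF A A0])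
  let ?S = "\<lambda>i. \<bar>coord ?v i\<bar> * A (nd k i)"
  have "summable (\<lambda>i. ?S (i + k))" using s2 by (simp add: nd_def)
  then have s3: "summable ?S" by (rule summable_iff_shift[THEN iffD1])
  show "summable T" unfolding T_def distrib_left using s1 s3 by (intro summable_add) simp_all
  have T: "(\<Sum>i. T i) = (\<Sum>i. ?S i) + (\<Sum>i. \<bar>coord ?v i\<bar> * A (i + k))"
    unfolding T_def distrib_left using s1 s3 by (intro suminf_add[symmetric]) simp_all
  have S: "(\<Sum>i. ?S i) = (\<Sum>i. \<bar>coord ?v (i + k)\<bar> * A i) + (\<Sum>i<k. \<bar>coord ?v i\<bar> * A (k - i))"
    by (subst suminf_split_initial_segment[OF s3, of k]) (auto simp: nd_def intro!: sum.cong)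
  let ?I = "{1..k-1}"
  have "(\<Sum>i\<in>?I. coord x i * coord x (k - i)) - (\<Sum>i\<in>?I. coord y i * coord y (k - i)) =
      (\<Sum>i\<in>?I. coord x i * coord ?v (k - i) + coord ?v i * coord y (k - i))"
    unfolding sum_subtractf[symmetric] by (intro sum.cong refl) (simp add: algebra_simps)
  also have "\<bar>\<dots>\<bar> \<le> (\<Sum>i\<in>?I. A i * \<bar>coord ?v (k - i)\<bar> + \<bar>coord ?v i\<bar> * A (k - i))"
  proof (rule order_trans[OF sum_abs], rule sum_mono)
    fix i
    have "\<bar>coord x i * coord ?v (k - i) + coord ?v i * coord y (k - i)\<bar> \<le>
        \<bar>coord x i\<bar> * \<bar>coord ?v (k - i)\<bar> + \<bar>coord ?v i\<bar> * \<bar>coord y (k - i)\<bar>"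
      unfolding abs_mult[symmetric] by (rule abs_triangle_ineq)
    also have "\<dots> \<le> A i * \<bar>coord ?v (k - i)\<bar> + \<bar>coord ?v i\<bar> * A (k - i)"
      by (intro add_mono mult_mono x y A0) auto
    finally show "\<bar>coord x i * coord ?v (k - i) + coord ?v i * coord y (k - i)\<bar> \<le>
        A i * \<bar>coord ?v (k - i)\<bar> + \<bar>coord ?v i\<bar> * A (k - i)" .
  qed
  \<comment> \<open>The reflection i -> k - i exchanges the two halves.\<close>
  also have "\<dots> = 2 * (\<Sum>i\<in>?I. \<bar>coord ?v i\<bar> * A (k - i))"
  proof -
    have "(\<Sum>i\<in>?I. A i * \<bar>coord ?v (k - i)\<bar>) = (\<Sum>i\<in>?I. \<bar>coord ?v i\<bar> * A (k - i))"
      by (rule sum.reindex_bij_witness[of _ "\<lambda>i. k - i" "\<lambda>i. k - i"]) auto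
    then show ?thesis by (simp add: sum.distrib)
  qed
  also have "(\<Sum>i\<in>?I. \<bar>coord ?v i\<bar> * A (k - i)) \<le> (\<Sum>i<k. \<bar>coord ?v i\<bar> * A (k - i))"
    by (rule sum_mono2) (auto intro: mult_nonneg_nonneg A0)
  finally have conv: "\<bar>(\<Sum>i\<in>?I. coord x i * coord x (k - i)) - (\<Sum>i\<in>?I. coord y i * coord y (k - i))\<bar> \<le>
      2 * (\<Sum>i<k. \<bar>coord ?v i\<bar> * A (k - i))" by simp
  have c1: "\<bar>\<Sum>i. coord x (i + 0) * coord ?v (i + k)\<bar> \<le> (\<Sum>i. \<bar>coord ?v (i + k)\<bar> * A i)"
  proof (rule order_trans[OF summable_rabs])
    show s: "summable (\<lambda>i. \<bar>coord x (i + 0) * coord ?v (i + k)\<bar>)"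
      using summable_coord_shift_mult[of x 0 ?v k] by (simp add: abs_mult)
    show "(\<Sum>i. \<bar>coord x (i + 0) * coord ?v (i + k)\<bar>) \<le> (\<Sum>i. \<bar>coord ?v (i + k)\<bar> * A i)"
    proof (intro suminf_le s s2)
      fix i
      have "\<bar>coord x i\<bar> * \<bar>coord ?v (i + k)\<bar> \<le> A i * \<bar>coord ?v (i + k)\<bar>"
        by (intro mult_right_mono x) simp
      then show "\<bar>coord x (i + 0) * coord ?v (i + k)\<bar> \<le> \<bar>coord ?v (i + k)\<bar> * A i"
        by (simp add: abs_mult mult.commute)
    qed
  qed
  have c2: "\<bar>\<Sum>i. coord ?v (i + 0) * coord y (i + k)\<bar> \<le> (\<Sum>i. \<bar>coord ?v i\<bar> * A (i + k))"
  proof (rule order_trans[OF summable_rabs])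
    show s: "summable (\<lambda>i. \<bar>coord ?v (i + 0) * coord y (i + k)\<bar>)"
      using summable_coord_shift_mult[of ?v 0 y k] by (simp add: abs_mult)
    show "(\<Sum>i. \<bar>coord ?v (i + 0) * coord y (i + k)\<bar>) \<le> (\<Sum>i. \<bar>coord ?v i\<bar> * A (i + k))"
    proof (intro suminf_le s)
      show "summable (\<lambda>i. \<bar>coord ?v i\<bar> * A (i + k))" using s1 by simp
      fix i
      have "\<bar>coord ?v i\<bar> * \<bar>coord y (i + k)\<bar> \<le> \<bar>coord ?v i\<bar> * A (i + k)"
        by (intro mult_left_mono y) simp
      then show "\<bar>coord ?v (i + 0) * coord y (i + k)\<bar> \<le> \<bar>coord ?v i\<bar> * A (i + k)"
        by (simp add: abs_mult)
    qed
  qed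
  have corr: "\<bar>corr k x - corr k y\<bar> \<le> (\<Sum>i. \<bar>coord ?v (i + k)\<bar> * A i) + (\<Sum>i. \<bar>coord ?v i\<bar> * A (i + k))"
    using suminf_coord_mult_diff[of x 0 k y] c1 c2 by (simp add: corr_def)
  have "NK x k - NK y k = real k * (2 * (corr k x - corr k y) -
      ((\<Sum>i\<in>?I. coord x i * coord x (k - i)) - (\<Sum>i\<in>?I. coord y i * coord y (k - i))))"
    by (simp add: NK_def algebra_simps)
  then have "\<bar>NK x k - NK y k\<bar> = real k * \<bar>2 * (corr k x - corr k y) -
      ((\<Sum>i\<in>?I. coord x i * coord x (k - i)) - (\<Sum>i\<in>?I. coord y i * coord y (k - i)))\<bar>"
    by (simp add: abs_mult)
  also have "\<dots> \<le> real k * (2 * (\<Sum>i. T i))"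
    using conv corr unfolding T S by (intro mult_left_mono) auto
  finally show "\<bar>NK x k - NK y k\<bar> \<le> 2 * real k * (\<Sum>i. T i)" by simp
qed

text \<open>Decay with exponent at least 4 leaves the summable weight k^-3 after one factor k has
  been lost. Constants obtained below may depend on s.\<close>

locale sbox =
  fixes s :: real assumes s: "4 \<le> s"
begin

lemma pw_ge: "n \<ge> 1 \<Longrightarrow> m \<le> 4 \<Longrightarrow> real n ^ m \<le> real n powr s"
proof -
  assume n: "n \<ge> 1" and m: "m \<le> 4"
  have "real n ^ m = real n powr real m" using n by (simp add: powr_realpow)
  also have "\<dots> \<le> real n powr s" using n m s by (intro powr_mono) auto
  finally show ?thesis .
qed

lemma inv_pw_le: "1 \<le> m \<Longrightarrow> m \<le> 4 \<Longrightarrow> 1 / real n powr s \<le> 1 / real n ^ m"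
  using pw_ge[of n m] by (cases "n = 0") (auto intro!: divide_left_mono)

lemma pw_scale:
  assumes "1 \<le> m" "1 \<le> n" "n \<le> c * m"
  shows "1 / real m powr s \<le> real c powr s / real n powr s"
proof -
  have "real n powr s \<le> (real c * real m) powr s"
    using assms s by (intro powr_mono2) (auto simp flip: of_nat_mult)
  then have "real n powr s \<le> real c powr s * real m powr s" by (simp add: powr_mult)
  then show ?thesis using assms by (simp add: divide_simps)
qed

lemma S_boxD:
  assumes "b \<in> S_box s C" "0 < C" "C \<le> 1"
  shows "\<bar>coord b 1\<bar> \<le> 2 * C" "2 \<le> k \<Longrightarrow> \<bar>coord b k\<bar> \<le> C ^ 3 / real k powr s" "2 \<le> k \<Longrightarrow> \<bar>coord b k\<bar> \<le> C ^ 3 / real k ^ 3"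
proof -
  have "sqrt 2 * C \<le> 2 * C" using assms sqrt2_less_2 by (intro mult_right_mono) auto
  moreover have "\<bar>coord b 1\<bar> \<le> sqrt 2 * C" using assms(1) by (simp add: S_box_def)
  ultimately show "\<bar>coord b 1\<bar> \<le> 2 * C" by (rule order_trans[rotated])
  show 1: "\<bar>coord b k\<bar> \<le> C ^ 3 / real k powr s" if "2 \<le> k" using assms that by (simp add: S_box_def)
  show "\<bar>coord b k\<bar> \<le> C ^ 3 / real k ^ 3" if "2 \<le> k"
  proof -
    have "C ^ 3 * (1 / real k powr s) \<le> C ^ 3 * (1 / real k ^ 3)"
      using assms by (intro mult_left_mono inv_pw_le) auto
    with 1[OF that] show ?thesis by simp
  qed
qed

lemma S_box_coord_small:
  assumes "b \<in> S_box s C" "0 < C" "C \<le> 1" "2 \<le> k"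
  shows "\<bar>coord b k\<bar> \<le> C ^ 3"
proof -
  have "C ^ 3 / real k ^ 3 \<le> C ^ 3 / 1" using assms by (intro divide_left_mono) auto
  then show ?thesis using S_boxD(3)[OF assms] by simp
qed

text \<open>The difference in b_1 and the weighted sum of the other differences are kept apart,
  because derivatives of the remainder with respect to b_1 have a different order in C from the
  others.\<close>

sublocale box: nf_orders "{0<..1/4}" "S_box s" "\<lambda>b b'. \<bar>coord b 1 - coord b' 1\<bar>" "\<lambda>b b'. wstar (b - b')"
proof -
  interpret order_calculus "{0<..1/4}" "S_box s" "\<lambda>b b'. \<bar>coord b 1 - coord b' 1\<bar>" "\<lambda>b b'. wstar (b - b')"
    by unfold_locales (auto simp: wstar_nonneg)
  have 1: "Ocl 1 0 9 (\<lambda>\<mu> b. coord b 1)"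
  proof (rule OO_I[of 2])
    fix C :: real and b b' assume C: "C \<in> {0<..1/4}" and b: "b \<in> S_box s C"
    show "\<bar>coord b 1\<bar> \<le> 2 * C ^ 1" using S_boxD(1)[OF b] C by simp
    have "0 \<le> C ^ 9 * wstar (b - b')" using C by (simp add: wstar_nonneg)
    then show "\<bar>coord b 1 - coord b' 1\<bar> \<le> 2 * (C ^ 0 * \<bar>coord b 1 - coord b' 1\<bar> + C ^ 9 * wstar (b - b'))"
      by simp
  qed simp
  have 2: "Ocl 3 9 0 (\<lambda>\<mu> b. coord b j)" if j: "2 \<le> j" for j
  proof (rule OO_I[of "real j ^ 3"])
    fix C :: real and b b' assume C: "C \<in> {0<..1/4}" and b: "b \<in> S_box s C"
    have "1 * C ^ 3 \<le> real j ^ 3 * C ^ 3" using C j by (intro mult_right_mono one_le_power) auto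
    then show "\<bar>coord b j\<bar> \<le> real j ^ 3 * C ^ 3" using S_box_coord_small[OF b _ _ j] C by (simp, linarith)
    have "0 \<le> C ^ 9 * \<bar>coord b 1 - coord b' 1\<bar>" using C by simp
    then have "real j ^ 3 * wstar (b - b') \<le> real j ^ 3 * (C ^ 9 * \<bar>coord b 1 - coord b' 1\<bar> + C ^ 0 * wstar (b - b'))"
      by (intro mult_left_mono) auto
    with coord_le_wstar[OF j, of "b - b'"]
    show "\<bar>coord b j - coord b' j\<bar> \<le> real j ^ 3 * (C ^ 9 * \<bar>coord b 1 - coord b' 1\<bar> + C ^ 0 * wstar (b - b'))"
      by simp
  qed simp
  have 3: "Ocl 6 9 3 (\<lambda>\<mu> b. tail4 j b)" if j: "j \<le> 3" for j
  \<comment> \<open>Z bounds the value and 65 = 64 + 1 the difference. The 64 = 4^3 pays for moving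
    the weight to the shifted index, since i + 4 + j \<le> 4 (i + 4).\<close>
  proof (rule OO_I[of "65 + Z"])
    fix C :: real and b b' assume C: "C \<in> {0<..1/4}" and b: "b \<in> S_box s C"
    have C0: "0 < C" "C \<le> 1" using C by auto
    have s1: "summable (\<lambda>i. \<bar>coord x (i + 4) * coord y (i + 4 + j)\<bar>)" for x y
      using summable_coord_shift_mult[of x 4 y "4 + j"] by (simp add: abs_mult add.assoc)
    have "\<bar>tail4 j b\<bar> \<le> (\<Sum>i. \<bar>coord b (i + 4) * coord b (i + 4 + j)\<bar>)"
      unfolding tail4_def by (rule summable_rabs[OF s1])
    also have "\<dots> \<le> (\<Sum>i. C ^ 6 * (1 / real (i + 1) ^ 2))"
    proof (intro suminf_le s1 summable_mult Z_sum)
      fix i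
      have "\<bar>coord b (i + 4)\<bar> * \<bar>coord b (i + 4 + j)\<bar> \<le> (C ^ 3 / real (i + 4) ^ 3) * C ^ 3"
        by (intro mult_mono S_boxD(3)[OF b C0] S_box_coord_small[OF b C0]) (use C0 in auto)
      also have "\<dots> = C ^ 6 * (1 / real (i + 4) ^ 3)" by (simp flip: power_add)
      also have "\<dots> \<le> C ^ 6 * (1 / real (i + 1) ^ 2)"
      proof (intro mult_left_mono divide_left_mono)
        have "real (i + 1) ^ 2 \<le> real (i + 4) ^ 2" by (intro power_mono) auto
        also have "\<dots> \<le> real (i + 4) ^ 3" by (intro power_increasing) auto
        finally show "real (i + 1) ^ 2 \<le> real (i + 4) ^ 3" .
      qed (use C0 in auto)
      finally show "\<bar>coord b (i + 4) * coord b (i + 4 + j)\<bar> \<le> C ^ 6 * (1 / real (i + 1) ^ 2)" by (simp add: abs_mult)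
    qed
    also have "\<dots> = C ^ 6 * Z" unfolding Z_def by (rule suminf_mult[OF Z_sum])
    also have "\<dots> \<le> (65 + Z) * C ^ 6" using C0 by (simp add: distrib_right mult.commute)
    finally show "\<bar>tail4 j b\<bar> \<le> (65 + Z) * C ^ 6" .
    assume b': "b' \<in> S_box s C"
    let ?w = "b - b'"
    have A: "\<bar>\<Sum>i. coord b (i + 4) * coord ?w (i + 4 + j)\<bar> \<le> 64 * C ^ 3 * wstar ?w"
    proof -
      have "\<bar>\<Sum>i. coord b (i + 4) * coord ?w (i + 4 + j)\<bar> \<le> (\<Sum>i. \<bar>coord b (i + 4) * coord ?w (i + 4 + j)\<bar>)"
        by (rule summable_rabs[OF s1])
      also have "\<dots> \<le> (\<Sum>i. 64 * C ^ 3 * (\<bar>coord ?w (i + (4 + j))\<bar> / real (i + (4 + j)) ^ 3))"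
      proof (intro suminf_le s1 summable_mult summable_wstar)
        fix i
        have "real (i + (4 + j)) ^ 3 \<le> (4 * real (i + 4)) ^ 3" using j by (intro power_mono) auto
        then have "1 / real (i + 4) ^ 3 \<le> 64 / real (i + (4 + j)) ^ 3"
          unfolding power_mult_distrib by (simp add: divide_simps del: of_nat_add)
        then have "C ^ 3 * (1 / real (i + 4) ^ 3) \<le> C ^ 3 * (64 / real (i + (4 + j)) ^ 3)"
          using C0 by (intro mult_left_mono) auto
        with S_boxD(3)[OF b C0, of "i + 4"] have "\<bar>coord b (i + 4)\<bar> \<le> C ^ 3 * (64 / real (i + (4 + j)) ^ 3)" by simp
        from mult_right_mono[OF this, of "\<bar>coord ?w (i + 4 + j)\<bar>"]
        show "\<bar>coord b (i + 4) * coord ?w (i + 4 + j)\<bar> \<le> 64 * C ^ 3 * (\<bar>coord ?w (i + (4 + j))\<bar> / real (i + (4 + j)) ^ 3)"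
          by (simp add: abs_mult mult_ac add.assoc)
      qed simp
      also have "\<dots> = 64 * C ^ 3 * (\<Sum>i. \<bar>coord ?w (i + (4 + j))\<bar> / real (i + (4 + j)) ^ 3)"
        by (intro suminf_mult summable_wstar) simp
      also have "\<dots> \<le> 64 * C ^ 3 * wstar ?w" using C0 by (intro mult_left_mono wstar_tail) auto
      finally show ?thesis .
    qed
    have B: "\<bar>\<Sum>i. coord ?w (i + 4) * coord b' (i + 4 + j)\<bar> \<le> C ^ 3 * wstar ?w"
    proof -
      have "\<bar>\<Sum>i. coord ?w (i + 4) * coord b' (i + 4 + j)\<bar> \<le> (\<Sum>i. \<bar>coord ?w (i + 4) * coord b' (i + 4 + j)\<bar>)"
        by (rule summable_rabs[OF s1])
      also have "\<dots> \<le> (\<Sum>i. C ^ 3 * (\<bar>coord ?w (i + 4)\<bar> / real (i + 4) ^ 3))"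
      proof (intro suminf_le s1 summable_mult summable_wstar)
        fix i
        have "C ^ 3 / real (i + 4 + j) ^ 3 \<le> C ^ 3 / real (i + 4) ^ 3"
          using C0 by (intro divide_left_mono power_mono) auto
        with S_boxD(3)[OF b' C0, of "i + 4 + j"] have "\<bar>coord b' (i + 4 + j)\<bar> \<le> C ^ 3 / real (i + 4) ^ 3" by simp
        from mult_left_mono[OF this, of "\<bar>coord ?w (i + 4)\<bar>"]
        show "\<bar>coord ?w (i + 4) * coord b' (i + 4 + j)\<bar> \<le> C ^ 3 * (\<bar>coord ?w (i + 4)\<bar> / real (i + 4) ^ 3)"
          by (simp add: abs_mult mult_ac)
      qed simp
      also have "\<dots> = C ^ 3 * (\<Sum>i. \<bar>coord ?w (i + 4)\<bar> / real (i + 4) ^ 3)"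
        by (intro suminf_mult summable_wstar) simp
      also have "\<dots> \<le> C ^ 3 * wstar ?w" using C0 by (intro mult_left_mono wstar_tail) auto
      finally show ?thesis .
    qed
    have "tail4 j b - tail4 j b' = (\<Sum>i. coord b (i + 4) * coord ?w (i + 4 + j)) + (\<Sum>i. coord ?w (i + 4) * coord b' (i + 4 + j))"
      using suminf_coord_mult_diff[of b 4 "4 + j" b'] by (simp add: tail4_def add.assoc)
    then have "\<bar>tail4 j b - tail4 j b'\<bar> \<le> 65 * (C ^ 3 * wstar ?w)" using A B by simp
    also have "\<dots> \<le> (65 + Z) * (C ^ 9 * \<bar>coord b 1 - coord b' 1\<bar> + C ^ 3 * wstar ?w)"
      using C0 Z_ge wstar_nonneg[of ?w] by (intro mult_mono) auto
    finally show "\<bar>tail4 j b - tail4 j b'\<bar> \<le> (65 + Z) * (C ^ 9 * \<bar>coord b 1 - coord b' 1\<bar> + C ^ 3 * wstar (b - b'))" .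
  qed (use Z_ge in simp)
  have 4: "\<bar>coord b 1\<bar> \<le> 1 / 2 \<and> \<bar>coord b 2\<bar> \<le> 1 / 2" if C: "C \<in> {0<..1/4}" and b: "b \<in> S_box s C" for C b
  proof
    show "\<bar>coord b 1\<bar> \<le> 1 / 2" using S_boxD(1)[OF b] C by simp
    have "C ^ 3 \<le> (1 / 4) ^ 3" using C by (intro power_mono) auto
    then show "\<bar>coord b 2\<bar> \<le> 1 / 2" using S_box_coord_small[OF b, of 2] C by (simp add: power3_eq_cube)
  qed
  show "nf_orders {0<..1/4} (S_box s) (\<lambda>b b'. \<bar>coord b 1 - coord b' 1\<bar>) (\<lambda>b b'. wstar (b - b'))"
    by unfold_locales (use 1 2 3 4 in blast)+
qed


text \<open>The weight C^(4 - i) puts the three modified modes on one footing: weighted values are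
  of order C^4, weighted differences of order C^3 in b_1 and C in the rest, as the high modes
  require.\<close>

lemma low_modes:
  obtains K where "1 \<le> K"
    "\<And>\<mu> C b i. 1 / 2 \<le> \<mu> \<Longrightarrow> 0 < C \<Longrightarrow> C \<le> 1 / 4 \<Longrightarrow> b \<in> S_box s C \<Longrightarrow> i \<in> {1, 2, 3} \<Longrightarrow>
      \<bar>coord (\<Phi> \<mu> b) i\<bar> \<le> K * C ^ i"
    "\<And>\<mu> C b b' i. 1 / 2 \<le> \<mu> \<Longrightarrow> 0 < C \<Longrightarrow> C \<le> 1 / 4 \<Longrightarrow> b \<in> S_box s C \<Longrightarrow> b' \<in> S_box s C \<Longrightarrow> i \<in> {1, 2, 3} \<Longrightarrow>
      C ^ (4 - i) * \<bar>coord (\<Phi> \<mu> b - \<Phi> \<mu> b') i\<bar> \<le> K * (C ^ 3 * \<bar>coord b 1 - coord b' 1\<bar> + C * wstar (b - b'))"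
proof -
  obtain K1 where K1: "0 \<le> K1" "\<And>\<mu> C b. 1 / 2 \<le> \<mu> \<Longrightarrow> C \<in> {0<..1/4} \<Longrightarrow> b \<in> S_box s C \<Longrightarrow> \<bar>a1 \<mu> b\<bar> \<le> K1 * C ^ 1"
    "\<And>\<mu> C b b'. 1 / 2 \<le> \<mu> \<Longrightarrow> C \<in> {0<..1/4} \<Longrightarrow> b \<in> S_box s C \<Longrightarrow> b' \<in> S_box s C \<Longrightarrow>
      \<bar>a1 \<mu> b - a1 \<mu> b'\<bar> \<le> K1 * (C ^ 0 * \<bar>coord b 1 - coord b' 1\<bar> + C ^ 1 * wstar (b - b'))"
    using box.OO_a1 by (rule box.OO_E) blast
  obtain K2 where K2: "0 \<le> K2" "\<And>\<mu> C b. 1 / 2 \<le> \<mu> \<Longrightarrow> C \<in> {0<..1/4} \<Longrightarrow> b \<in> S_box s C \<Longrightarrow> \<bar>a2 \<mu> b\<bar> \<le> K2 * C ^ 2"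
    "\<And>\<mu> C b b'. 1 / 2 \<le> \<mu> \<Longrightarrow> C \<in> {0<..1/4} \<Longrightarrow> b \<in> S_box s C \<Longrightarrow> b' \<in> S_box s C \<Longrightarrow>
      \<bar>a2 \<mu> b - a2 \<mu> b'\<bar> \<le> K2 * (C ^ 1 * \<bar>coord b 1 - coord b' 1\<bar> + C ^ 0 * wstar (b - b'))"
    using box.OO_a2 by (rule box.OO_E) blast
  obtain K3 where K3: "0 \<le> K3" "\<And>\<mu> C b. 1 / 2 \<le> \<mu> \<Longrightarrow> C \<in> {0<..1/4} \<Longrightarrow> b \<in> S_box s C \<Longrightarrow> \<bar>a3 \<mu> b\<bar> \<le> K3 * C ^ 3"
    "\<And>\<mu> C b b'. 1 / 2 \<le> \<mu> \<Longrightarrow> C \<in> {0<..1/4} \<Longrightarrow> b \<in> S_box s C \<Longrightarrow> b' \<in> S_box s C \<Longrightarrow>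
      \<bar>a3 \<mu> b - a3 \<mu> b'\<bar> \<le> K3 * (C ^ 2 * \<bar>coord b 1 - coord b' 1\<bar> + C ^ 0 * wstar (b - b'))"
    using box.OO_a3 by (rule box.OO_E) blast
  define K where "K = 1 + K1 + K2 + K3"
  show ?thesis
  proof (rule that[of K])
    show "1 \<le> K" using K1 K2 K3 by (simp add: K_def)
    fix \<mu> C :: real and b b' and i :: nat
    assume \<mu>: "1 / 2 \<le> \<mu>" and C: "0 < C" "C \<le> 1 / 4" and b: "b \<in> S_box s C" and i: "i \<in> {1, 2, 3}"
    have C': "C \<in> {0<..1/4}" using C by simp
    have le: "L * x \<le> K * x" if "L \<in> {K1, K2, K3}" "0 \<le> x" for L x
      using that K1(1) K2(1) K3(1) by (intro mult_right_mono) (auto simp: K_def)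
    show "\<bar>coord (\<Phi> \<mu> b) i\<bar> \<le> K * C ^ i"
    proof -
      have p: "0 \<le> C ^ m" for m using C by simp
      have "\<bar>a1 \<mu> b\<bar> \<le> K * C ^ 1" "\<bar>a2 \<mu> b\<bar> \<le> K * C ^ 2" "\<bar>a3 \<mu> b\<bar> \<le> K * C ^ 3"
        using order_trans[OF K1(2)[OF \<mu> C' b] le[OF _ p]] order_trans[OF K2(2)[OF \<mu> C' b] le[OF _ p]]
          order_trans[OF K3(2)[OF \<mu> C' b] le[OF _ p]] by auto
      then show ?thesis using i by (auto simp: coord_\<Phi>)
    qed
    assume b': "b' \<in> S_box s C"
    let ?d = "\<bar>coord b 1 - coord b' 1\<bar>" and ?W = "wstar (b - b')"
    have dW: "0 \<le> ?d" "0 \<le> ?W" by (simp_all add: wstar_nonneg)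
    have C1: "C ^ m \<le> C" if "1 \<le> m" for m using power_decreasing[OF that, of C] C by simp
    have "C ^ (4 - i) * \<bar>coord (\<Phi> \<mu> b - \<Phi> \<mu> b') i\<bar> \<le> C ^ (4 - i) * (K * (C ^ (i - 1) * ?d + C ^ of_bool (i = 1) * ?W))"
    proof (rule mult_left_mono)
      have n: "0 \<le> C ^ m * ?d + C ^ n * ?W" for m n using C dW by simp
      show "\<bar>coord (\<Phi> \<mu> b - \<Phi> \<mu> b') i\<bar> \<le> K * (C ^ (i - 1) * ?d + C ^ of_bool (i = 1) * ?W)"
      proof -
        have "\<bar>a1 \<mu> b - a1 \<mu> b'\<bar> \<le> K * (C ^ 0 * ?d + C ^ 1 * ?W)"
          "\<bar>a2 \<mu> b - a2 \<mu> b'\<bar> \<le> K * (C ^ 1 * ?d + C ^ 0 * ?W)"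
          "\<bar>a3 \<mu> b - a3 \<mu> b'\<bar> \<le> K * (C ^ 2 * ?d + C ^ 0 * ?W)"
          using order_trans[OF K1(3)[OF \<mu> C' b b'] le[OF _ n]] order_trans[OF K2(3)[OF \<mu> C' b b'] le[OF _ n]]
            order_trans[OF K3(3)[OF \<mu> C' b b'] le[OF _ n]] by auto
        then show ?thesis using i by (auto simp: coord_\<Phi>)
      qed
    qed (use C in simp)
    also have "\<dots> = K * (C ^ (4 - i + (i - 1)) * ?d + C ^ (4 - i + of_bool (i = 1)) * ?W)"
      by (simp add: power_add algebra_simps)
    also have "4 - i + (i - 1) = 3" using i by auto
    also have "K * (C ^ 3 * ?d + C ^ (4 - i + of_bool (i = 1)) * ?W) \<le> K * (C ^ 3 * ?d + C * ?W)"
      using i K1(1) K2(1) K3(1) dW by (intro mult_left_mono add_mono mult_right_mono C1) (auto simp: K_def)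
    finally show "C ^ (4 - i) * \<bar>coord (\<Phi> \<mu> b - \<Phi> \<mu> b') i\<bar> \<le> K * (C ^ 3 * ?d + C * ?W)" .
  qed
qed

text \<open>The envelope is a multiple of C^(min i 3) / i^s. Differences in the modes 1 to 3 are
  separated from the others because only their weights with C^(4 - i) are under control.\<close>

lemma NK_high:
  assumes K: "1 \<le> K" and C: "0 < C" "C \<le> 1 / 4" and k: "4 \<le> k"
    and x: "\<And>i. i \<in> {1, 2, 3} \<Longrightarrow> \<bar>coord x i\<bar> \<le> K * C ^ i" "\<And>i. 4 \<le> i \<Longrightarrow> \<bar>coord x i\<bar> \<le> C ^ 3 / real i powr s"
    and y: "\<And>i. i \<in> {1, 2, 3} \<Longrightarrow> \<bar>coord y i\<bar> \<le> K * C ^ i" "\<And>i. 4 \<le> i \<Longrightarrow> \<bar>coord y i\<bar> \<le> C ^ 3 / real i powr s"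
  defines "M \<equiv> 4 * K * 3 powr s * 4 powr s"
  shows "\<bar>NK x k - NK y k\<bar> \<le> M * real k * ((\<Sum>i\<in>{1, 2, 3}. C ^ (4 - i) * \<bar>coord (x - y) i\<bar>) / real k powr s
      + C * (\<Sum>i. \<bar>coord (x - y) (i + 4)\<bar> / real (1 + nd k (i + 4)) powr s))"
proof -
  \<comment> \<open>The factor 3^s rewrites the bounds K C^i of the low modes in the form of the
    envelope.\<close>
  define K1 where "K1 = K * 3 powr s"
  have K1: "1 \<le> K1" "K \<le> K1" "0 < K1"
  proof -
    have p: "1 \<le> (3::real) powr s" using s by (simp add: ge_one_powr_ge_zero)
    have "K * 1 \<le> K * 3 powr s" using K p by (intro mult_left_mono) auto
    then show "K \<le> K1" by (simp add: K1_def)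
    then show "1 \<le> K1" "0 < K1" using K by auto
  qed
  define A where "A i = K1 * C ^ min i 3 / real i powr s" for i :: nat
  have A0: "A 0 = 0" by (simp add: A_def)
  have Cp: "0 \<le> C ^ m" "C ^ m \<le> 1" for m using C by (auto intro: power_le_one)
  have A_nonneg: "0 \<le> A i" for i using K1 Cp by (simp add: A_def)
  have A_low: "K * C ^ i \<le> A i" if "i \<in> {1, 2, 3}" for i
  proof -
    have "real i powr s \<le> 3 powr s" using that s by (intro powr_mono2) auto
    then have "K * C ^ i * real i powr s \<le> K * C ^ i * 3 powr s" using K Cp by (intro mult_left_mono) auto
    moreover have "min i 3 = i" "0 < real i powr s" using that by auto
    ultimately show ?thesis by (simp add: A_def K1_def le_divide_eq mult_ac)
  qed
  have A_high: "C ^ 3 / real i powr s \<le> A i" if "4 \<le> i" for i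
    using that K1(1) Cp C mult_right_mono[of 1 K1 "C ^ 3"]
    unfolding A_def by (intro divide_right_mono) auto
  have bound: "\<bar>coord z i\<bar> \<le> A i"
    if "\<And>i. i \<in> {1, 2, 3} \<Longrightarrow> \<bar>coord z i\<bar> \<le> K * C ^ i" "\<And>i. 4 \<le> i \<Longrightarrow> \<bar>coord z i\<bar> \<le> C ^ 3 / real i powr s" for z i
  proof -
    consider "i = 0" | "i \<in> {1, 2, 3}" | "4 \<le> i" by force
    then show ?thesis
    proof cases
      case 1 then show ?thesis by (simp add: A0)
    next
      case 2 then show ?thesis using that(1)[OF 2] A_low[OF 2] by linarith
    next
      case 3 then show ?thesis using that(2)[OF 3] A_high[OF 3] by linarith
    qed
  qed
  have A_sum: "summable A"
  proof (rule summable_comparison_test'[of "\<lambda>i. K1 * (1 / real i ^ 2)" 1])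
    show "summable (\<lambda>i. K1 * (1 / real i ^ 2))"
      by (intro summable_mult) (use inverse_power_summable[of 2, where 'a = real] in \<open>simp add: divide_inverse\<close>)
    fix i :: nat
    have "A i = K1 * C ^ min i 3 * (1 / real i powr s)" by (simp add: A_def)
    also have "\<dots> \<le> K1 * 1 * (1 / real i ^ 2)"
      using K1 Cp by (intro mult_mono inv_pw_le) auto
    finally show "norm (A i) \<le> K1 * (1 / real i ^ 2)" using A_nonneg[of i] by simp
  qed
  let ?v = "\<lambda>i. \<bar>coord (x - y) i\<bar>"
  let ?T = "\<lambda>i. ?v i * (A (nd k i) + A (i + k))"
  have sT: "summable ?T" and NK: "\<bar>NK x k - NK y k\<bar> \<le> 2 * real k * (\<Sum>i. ?T i)"
    using NK_diff_bound[OF bound[OF x] bound[OF y] A_sum, of k] by auto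
  have split: "(\<Sum>i. ?T i) = (\<Sum>i. ?T (i + 4)) + (\<Sum>i\<in>{1, 2, 3}. ?T i)"
  proof -
    have "(\<Sum>i<4. ?T i) = (\<Sum>i\<in>{0, 1, 2, 3}. ?T i)" by (rule sum.cong) auto
    then show ?thesis using suminf_split_initial_segment[OF sT, of 4] by simp
  qed
  define M' where "M' = 2 * K1 * 4 powr s"
  have low: "?T i \<le> M' * (C ^ (4 - i) * ?v i / real k powr s)" if i: "i \<in> {1, 2, 3}" for i
  proof -
    \<comment> \<open>For k \<ge> 4 and i \<le> 3 the partner index j is k - i or k + i. It is at
      least 4 - i, which yields the missing power of C, and at least k/4, which yields the decay in
      k.\<close>
    have "A j \<le> K1 * 4 powr s * C ^ (4 - i) / real k powr s" if "4 - i \<le> j" "k \<le> 4 * j" for j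
    proof -
      have j: "1 \<le> j" "4 - i \<le> min j 3" using that i by auto
      have "A j = K1 * C ^ min j 3 * (1 / real j powr s)" by (simp add: A_def)
      also have "\<dots> \<le> K1 * C ^ (4 - i) * (real 4 powr s / real k powr s)"
        using K1 C j k that(2) by (intro mult_mono pw_scale power_decreasing) auto
      finally show ?thesis by (simp add: mult_ac)
    qed
    note le = this
    have "A (nd k i) \<le> K1 * 4 powr s * C ^ (4 - i) / real k powr s"
      by (rule le) (use i k in \<open>auto simp: nd_def\<close>)
    moreover have "A (i + k) \<le> K1 * 4 powr s * C ^ (4 - i) / real k powr s"
      by (rule le) (use i k in auto)
    ultimately have "A (nd k i) + A (i + k) \<le> M' * C ^ (4 - i) / real k powr s"
      by (simp add: M'_def)
    from mult_left_mono[OF this, of "?v i"] show ?thesis by (simp add: mult_ac)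
  qed
  have high: "?T (i + 4) \<le> M' * (C * (?v (i + 4) / real (1 + nd k (i + 4)) powr s))" for i
  proof -
    \<comment> \<open>A single power of C suffices here. The case j = 0 must be treated apart, and A
      vanishes there; for j \<ge> 1 the index 1 + \<bar>k - i\<bar> is at most 2 j.\<close>
    have A_le: "A j \<le> K1 * 2 powr s * C / real n powr s" if "1 \<le> n" "n \<le> 1 + j" for j n
    proof (cases "j = 0")
      case True then show ?thesis using K1 C by (simp add: A0)
    next
      case False
      have "A j = K1 * C ^ min j 3 * (1 / real j powr s)" by (simp add: A_def)
      also have "\<dots> \<le> K1 * C ^ 1 * (real 2 powr s / real n powr s)"
        using K1 C False that by (intro mult_mono pw_scale power_decreasing) auto
      finally show ?thesis by (simp add: mult_ac)
    qed
    let ?n = "1 + nd k (i + 4)"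
    have "A (nd k (i + 4)) + A (i + 4 + k) \<le> K1 * 2 powr s * C / real ?n powr s + K1 * 2 powr s * C / real ?n powr s"
      by (intro add_mono A_le) (auto simp: nd_def)
    also have "\<dots> = 2 * K1 * 2 powr s * (C / real ?n powr s)" by simp
    also have "\<dots> \<le> M' * (C / real ?n powr s)"
      unfolding M'_def using K1 C s by (intro mult_right_mono mult_left_mono powr_mono2) auto
    finally have "A (nd k (i + 4)) + A (i + 4 + k) \<le> M' * (C / real ?n powr s)" .
    from mult_left_mono[OF this, of "?v (i + 4)"] show ?thesis by (simp add: mult_ac)
  qed
  have sv: "summable (\<lambda>i. ?v (i + 4) / real (1 + nd k (i + 4)) powr s)"
  proof (rule summable_comparison_test'[of "\<lambda>i. ?v (i + 4) * (1 / real (1 + nd k (i + 4)) ^ 2)" 0])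
    show "summable (\<lambda>i. ?v (i + 4) * (1 / real (1 + nd k (i + 4)) ^ 2))"
      by (intro summable_coord_weight nd_sum) auto
    show "norm (?v (i + 4) / real (1 + nd k (i + 4)) powr s) \<le> ?v (i + 4) * (1 / real (1 + nd k (i + 4)) ^ 2)" for i
      using mult_left_mono[OF inv_pw_le[of 2 "1 + nd k (i + 4)"], of "?v (i + 4)"] by simp
  qed
  have "(\<Sum>i. ?T (i + 4)) \<le> (\<Sum>i. M' * (C * (?v (i + 4) / real (1 + nd k (i + 4)) powr s)))"
    by (intro suminf_le high summable_mult sv summable_ignore_initial_segment[OF sT])
  also have "\<dots> = M' * (C * (\<Sum>i. ?v (i + 4) / real (1 + nd k (i + 4)) powr s))"
    by (simp only: suminf_mult[OF summable_mult[OF sv]] suminf_mult[OF sv])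
  finally have t: "(\<Sum>i. ?T (i + 4)) \<le> M' * (C * (\<Sum>i. ?v (i + 4) / real (1 + nd k (i + 4)) powr s))" .
  have "(\<Sum>i\<in>{1, 2, 3}. ?T i) \<le> (\<Sum>i\<in>{1, 2, 3}. M' * (C ^ (4 - i) * ?v i / real k powr s))"
    by (intro sum_mono low)
  also have "\<dots> = M' * ((\<Sum>i\<in>{1, 2, 3}. C ^ (4 - i) * ?v i) / real k powr s)"
    by (simp only: sum_distrib_left[symmetric] sum_divide_distrib)
  finally have "(\<Sum>i. ?T i) \<le> M' * ((\<Sum>i\<in>{1, 2, 3}. C ^ (4 - i) * ?v i) / real k powr s
      + C * (\<Sum>i. ?v (i + 4) / real (1 + nd k (i + 4)) powr s))"
    unfolding split using t by (simp only: distrib_left)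
  then have "2 * real k * (\<Sum>i. ?T i) \<le> 2 * real k * (M' * ((\<Sum>i\<in>{1, 2, 3}. C ^ (4 - i) * ?v i) / real k powr s
      + C * (\<Sum>i. ?v (i + 4) / real (1 + nd k (i + 4)) powr s)))"
    by (intro mult_left_mono) auto
  with NK have "\<bar>NK x k - NK y k\<bar> \<le> 2 * real k * (M' * ((\<Sum>i\<in>{1, 2, 3}. C ^ (4 - i) * ?v i) / real k powr s
      + C * (\<Sum>i. ?v (i + 4) / real (1 + nd k (i + 4)) powr s)))" by (rule order_trans)
  moreover have "2 * real k * (M' * Y) = M * real k * Y" for Y by (simp add: M_def M'_def K1_def)
  ultimately show ?thesis by (simp only:)
qed

end

section \<open>Estimates of the remainder, mode by mode\<close>

context sbox
begin

lemma box_E: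
  assumes "1 / 2 \<le> \<mu>" "0 < C" "C \<le> 1 / 4" "b \<in> S_box s C"
  shows "1 + cE \<mu> * y2 \<mu> b \<noteq> 0"
proof -
  have "\<bar>coord b 1\<bar> \<le> 1 / 2 \<and> \<bar>coord b 2\<bar> \<le> 1 / 2" by (rule box.small[of C]) (use assms in auto)
  with E_ge[OF assms(1)] have "1 / 2 \<le> 1 + cE \<mu> * y2 \<mu> b" by blast
  then show ?thesis by auto
qed

lemma k_inv_pw: assumes "1 \<le> k" shows "real k / real k powr s \<le> 1 / real k ^ 3" "real k / real k powr s \<le> 1 / real k powr (s - 2)"
proof -
  have "real k / real k powr s \<le> real k / real k ^ 4"
    using mult_left_mono[OF inv_pw_le[of 4 k], of "real k"] by simp
  then show "real k / real k powr s \<le> 1 / real k ^ 3" using assms by (simp add: power_numeral_reduce)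
  have "real k / real k powr s = real k powr (1 - s)" using assms by (simp add: powr_diff)
  also have "\<dots> \<le> real k powr (- (s - 2))" using assms by (intro powr_mono) auto
  also have "\<dots> = 1 / real k powr (s - 2)" by (simp only: powr_minus_divide)
  finally show "real k / real k powr s \<le> 1 / real k powr (s - 2)" .
qed

text \<open>Both bounds come from \<open>NK_high\<close>: the size is the difference to the zero
  sequence, for which the quadratic term vanishes.\<close>

lemma high_mode_bounds:
  obtains K where "0 \<le> K"
    "\<And>\<mu> C b k. 1 / 2 \<le> \<mu> \<Longrightarrow> 0 < C \<Longrightarrow> C \<le> 1 / 4 \<Longrightarrow> b \<in> S_box s C \<Longrightarrow> 4 \<le> k \<Longrightarrow>
      \<bar>remainder \<mu> b k\<bar> \<le> K * (C ^ 4 / real k powr (s - 2))"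
    "\<And>\<mu> C b b' k. 1 / 2 \<le> \<mu> \<Longrightarrow> 0 < C \<Longrightarrow> C \<le> 1 / 4 \<Longrightarrow> b \<in> S_box s C \<Longrightarrow> b' \<in> S_box s C \<Longrightarrow> 4 \<le> k \<Longrightarrow>
      \<bar>remainder \<mu> b k - remainder \<mu> b' k\<bar> \<le>
        K * (C ^ 3 * \<bar>coord b 1 - coord b' 1\<bar> / real k ^ 3 + C * real k * wconv k (b - b'))"
proof -
  obtain K where K: "1 \<le> K"
    and x: "\<And>\<mu> C b i. 1 / 2 \<le> \<mu> \<Longrightarrow> 0 < C \<Longrightarrow> C \<le> 1 / 4 \<Longrightarrow> b \<in> S_box s C \<Longrightarrow> i \<in> {1, 2, 3} \<Longrightarrow>
      \<bar>coord (\<Phi> \<mu> b) i\<bar> \<le> K * C ^ i"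
    and dx: "\<And>\<mu> C b b' i. 1 / 2 \<le> \<mu> \<Longrightarrow> 0 < C \<Longrightarrow> C \<le> 1 / 4 \<Longrightarrow> b \<in> S_box s C \<Longrightarrow> b' \<in> S_box s C \<Longrightarrow> i \<in> {1, 2, 3} \<Longrightarrow>
      C ^ (4 - i) * \<bar>coord (\<Phi> \<mu> b - \<Phi> \<mu> b') i\<bar> \<le> K * (C ^ 3 * \<bar>coord b 1 - coord b' 1\<bar> + C * wstar (b - b'))"
    by (rule low_modes) blast
  define M where "M = 4 * K * 3 powr s * 4 powr s"
  have M: "0 \<le> M" using K by (simp add: M_def)
  define L where "L = M * (3 * K) + M + M * (3 * K) + M * (2 powr s * (3 * Z))"
  have Z0: "0 \<le> Z" using Z_ge by simp
  have xhigh: "\<bar>coord (\<Phi> \<mu> b) i\<bar> \<le> C ^ 3 / real i powr s"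
    if "0 < C" "C \<le> 1 / 4" "b \<in> S_box s C" "4 \<le> i" for \<mu> b C i
    using S_boxD(2)[OF that(3,1), of i] that(2,4) by (simp add: coord_\<Phi>)
  have vhigh: "coord (\<Phi> \<mu> b - \<Phi> \<mu> b') (i + 4) = coord (b - b') (i + 4)" for \<mu> b b' i
    by (simp add: coord_\<Phi>)
  show ?thesis
  proof (rule that[of L])
    show "0 \<le> L" using M K Z0 by (simp add: L_def)
    fix \<mu> C :: real and b and k :: nat
    assume \<mu>: "1 / 2 \<le> \<mu>" and C: "0 < C" "C \<le> 1 / 4" and b: "b \<in> S_box s C" and k: "4 \<le> k"
    have C1: "C \<le> 1" using C by simp
    let ?n = "\<lambda>i. 1 + nd k (i + 4)"
    show "\<bar>remainder \<mu> b k\<bar> \<le> L * (C ^ 4 / real k powr (s - 2))"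
    proof -
      have zero: "\<bar>coord (0 :: ell2) i\<bar> \<le> K * C ^ i" "\<bar>coord (0 :: ell2) i\<bar> \<le> C ^ 3 / real i powr s" for i
        using K C by simp_all
      have "\<bar>NK (\<Phi> \<mu> b) k - NK 0 k\<bar> \<le> M * real k * ((\<Sum>i\<in>{1, 2, 3}. C ^ (4 - i) * \<bar>coord (\<Phi> \<mu> b - 0) i\<bar>) / real k powr s
          + C * (\<Sum>i. \<bar>coord (\<Phi> \<mu> b - 0) (i + 4)\<bar> / real (?n i) powr s))"
        unfolding M_def by (intro NK_high K C k x[OF \<mu> C b] xhigh[OF C b] zero)
      also have "\<dots> \<le> M * real k * ((3 * K * C ^ 4) / real k powr s + C * (C ^ 3 * (2 powr s * (3 * Z)) / real k powr s))"
      proof (intro mult_left_mono add_mono divide_right_mono)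
        have "(\<Sum>i\<in>{1, 2, 3}. C ^ (4 - i) * \<bar>coord (\<Phi> \<mu> b - 0) i\<bar>) \<le> (\<Sum>i\<in>{1, 2, 3::nat}. K * C ^ 4)"
        proof (rule sum_mono)
          fix i :: nat assume i: "i \<in> {1, 2, 3}"
          have "C ^ (4 - i) * \<bar>coord (\<Phi> \<mu> b - 0) i\<bar> \<le> C ^ (4 - i) * (K * C ^ i)"
            using x[OF \<mu> C b i] C by (intro mult_left_mono) auto
          also have "\<dots> = K * C ^ (4 - i + i)" by (simp only: power_add mult_ac)
          also have "4 - i + i = 4" using i by auto
          finally show "C ^ (4 - i) * \<bar>coord (\<Phi> \<mu> b - 0) i\<bar> \<le> K * C ^ 4" .
        qed
        then show "(\<Sum>i\<in>{1, 2, 3}. C ^ (4 - i) * \<bar>coord (\<Phi> \<mu> b - 0) i\<bar>) \<le> 3 * K * C ^ 4" by simp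
        let ?W = "C ^ 3 * (2 powr s / real k powr s)"
        have term_le: "\<bar>coord (\<Phi> \<mu> b - 0) (i + 4)\<bar> / real (?n i) powr s \<le>
            ?W * (1 / real (i + 4) ^ 2 + 1 / real (?n i) ^ 2)" for i
        proof -
          have "\<bar>coord (\<Phi> \<mu> b - 0) (i + 4)\<bar> / real (?n i) powr s \<le> C ^ 3 * ((1 / real (i + 4) powr s) * (1 / real (?n i) powr s))"
            using divide_right_mono[OF xhigh[OF C b, of "i + 4" \<mu>], of "real (?n i) powr s"] by simp
          also have "(1 / real (i + 4) powr s) * (1 / real (?n i) powr s) \<le>
              (2 powr s / real k powr s) * (1 / real (i + 4) ^ 2 + 1 / real (?n i) ^ 2)"
          proof -
            have i1: "1 / real (i + 4) powr s \<le> 1 / real (i + 4) ^ 2" "1 / real (?n i) powr s \<le> 1 / real (?n i) ^ 2"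
              by (rule inv_pw_le; simp)+
            \<comment> \<open>One of the two indices is at least k/2. It supplies the decay k^-s,
              and the other one is summed with exponent 2.\<close>
            have "k \<le> 2 * (i + 4) \<or> k \<le> 2 * ?n i" by (auto simp: nd_def)
            then show ?thesis
            proof
              assume "k \<le> 2 * (i + 4)"
              then have "1 / real (i + 4) powr s \<le> real 2 powr s / real k powr s" using k by (intro pw_scale) auto
              then have "(1 / real (i + 4) powr s) * (1 / real (?n i) powr s) \<le> (2 powr s / real k powr s) * (1 / real (?n i) ^ 2)"
                by (intro mult_mono i1) auto
              also have "\<dots> \<le> (2 powr s / real k powr s) * (1 / real (i + 4) ^ 2 + 1 / real (?n i) ^ 2)"
                by (intro mult_left_mono) auto
              finally show ?thesis .
            next
              assume "k \<le> 2 * ?n i"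
              then have "1 / real (?n i) powr s \<le> real 2 powr s / real k powr s" using k by (intro pw_scale) auto
              then have "(1 / real (i + 4) powr s) * (1 / real (?n i) powr s) \<le> (1 / real (i + 4) ^ 2) * (2 powr s / real k powr s)"
                by (intro mult_mono i1) auto
              also have "\<dots> = (2 powr s / real k powr s) * (1 / real (i + 4) ^ 2)" by (rule mult.commute)
              also have "\<dots> \<le> (2 powr s / real k powr s) * (1 / real (i + 4) ^ 2 + 1 / real (?n i) ^ 2)"
                by (intro mult_left_mono) auto
              finally show ?thesis .
            qed
          qed
          then have "C ^ 3 * ((1 / real (i + 4) powr s) * (1 / real (?n i) powr s)) \<le>
              C ^ 3 * ((2 powr s / real k powr s) * (1 / real (i + 4) ^ 2 + 1 / real (?n i) ^ 2))"
            using C by (intro mult_left_mono) auto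
          finally show ?thesis by (simp only: mult.assoc)
        qed
        have s4: "summable (\<lambda>i. 1 / real (i + 4) ^ 2)" by (rule summable_inverse_shift) auto
        have sn: "summable (\<lambda>i. 1 / real (?n i) ^ 2)" by (rule nd_sum) simp
        have Z4: "(\<Sum>i. 1 / real (i + 4) ^ 2) \<le> Z"
          unfolding Z_def by (intro suminf_le s4 Z_sum divide_left_mono power_mono) auto
        have sT: "summable (\<lambda>i. ?W * (1 / real (i + 4) ^ 2 + 1 / real (?n i) ^ 2))"
          by (intro summable_mult summable_add s4 sn)
        have "(\<Sum>i. \<bar>coord (\<Phi> \<mu> b - 0) (i + 4)\<bar> / real (?n i) powr s) \<le>
            (\<Sum>i. ?W * (1 / real (i + 4) ^ 2 + 1 / real (?n i) ^ 2))"
        proof (intro suminf_le term_le sT)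
          show "summable (\<lambda>i. \<bar>coord (\<Phi> \<mu> b - 0) (i + 4)\<bar> / real (?n i) powr s)"
            by (rule summable_comparison_test'[OF sT, of 0]) (use term_le in simp)
        qed
        also have "\<dots> = ?W * ((\<Sum>i. 1 / real (i + 4) ^ 2) + (\<Sum>i. 1 / real (?n i) ^ 2))"
          by (simp only: suminf_mult[OF summable_add[OF s4 sn]] suminf_add[OF s4 sn])
        also have "\<dots> \<le> ?W * (Z + 2 * Z)"
          using C by (intro mult_left_mono add_mono Z4 nd_sum) auto
        finally show "(\<Sum>i. \<bar>coord (\<Phi> \<mu> b - 0) (i + 4)\<bar> / real (?n i) powr s) \<le> C ^ 3 * (2 powr s * (3 * Z)) / real k powr s"
          by simp
      qed (use C M in auto)
      also have "\<dots> = (M * (3 * K) + M * (2 powr s * (3 * Z))) * (C ^ 4 * (real k / real k powr s))"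
        by (simp add: power_numeral_reduce algebra_simps add_divide_distrib)
      also have "\<dots> \<le> L * (C ^ 4 * (1 / real k powr (s - 2)))"
        using C M K Z0 k_inv_pw[of k] k by (intro mult_mono) (auto simp: L_def)
      finally show ?thesis using k by (simp add: remainder_high)
    qed
    fix b' assume b': "b' \<in> S_box s C"
    let ?d = "\<bar>coord b 1 - coord b' 1\<bar>" and ?w = "b - b'"
    let ?v = "\<Phi> \<mu> b - \<Phi> \<mu> b'"
    have "\<bar>NK (\<Phi> \<mu> b) k - NK (\<Phi> \<mu> b') k\<bar> \<le> M * real k * ((\<Sum>i\<in>{1, 2, 3}. C ^ (4 - i) * \<bar>coord ?v i\<bar>) / real k powr s
        + C * (\<Sum>i. \<bar>coord ?v (i + 4)\<bar> / real (?n i) powr s))"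
      unfolding M_def by (intro NK_high K C k x[OF \<mu> C b] xhigh[OF C b] x[OF \<mu> C b'] xhigh[OF C b'])
    also have "\<dots> \<le> M * real k * ((3 * K * (C ^ 3 * ?d + C * wstar ?w)) / real k powr s + C * wconv k ?w)"
    proof (intro mult_left_mono add_mono divide_right_mono)
      have "(\<Sum>i\<in>{1, 2, 3}. C ^ (4 - i) * \<bar>coord ?v i\<bar>) \<le> (\<Sum>i\<in>{1, 2, 3::nat}. K * (C ^ 3 * ?d + C * wstar ?w))"
        by (intro sum_mono dx \<mu> C b b')
      then show "(\<Sum>i\<in>{1, 2, 3}. C ^ (4 - i) * \<bar>coord ?v i\<bar>) \<le> 3 * K * (C ^ 3 * ?d + C * wstar ?w)" by simp
      let ?q = "\<lambda>i. \<bar>coord ?w (i + 2)\<bar> / real (1 + nd k (i + 2)) ^ 3"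
      have q: "\<bar>coord ?v (i + 4)\<bar> / real (?n i) powr s \<le> ?q (i + 2)" for i
      proof -
        have e: "i + 2 + 2 = i + 4" by simp
        show ?thesis
          using mult_left_mono[OF inv_pw_le[of 3 "?n i"], of "\<bar>coord ?w (i + 4)\<bar>"]
          unfolding vhigh e by simp
      qed
      have sq: "summable (\<lambda>i. ?q (i + 2))" by (rule summable_ignore_initial_segment[OF summable_wconv])
      have "(\<Sum>i. \<bar>coord ?v (i + 4)\<bar> / real (?n i) powr s) \<le> (\<Sum>i. ?q (i + 2))"
      proof (intro suminf_le q sq)
        show "summable (\<lambda>i. \<bar>coord ?v (i + 4)\<bar> / real (?n i) powr s)"
          by (rule summable_comparison_test'[OF sq, of 0]) (use q in simp)
      qed
      also have "\<dots> \<le> wconv k ?w"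
        unfolding wconv_def using suminf_split_initial_segment[OF summable_wconv[of ?w k], of 2]
          sum_nonneg[of "{..<2}" ?q] by simp
      finally show "(\<Sum>i. \<bar>coord ?v (i + 4)\<bar> / real (?n i) powr s) \<le> wconv k ?w" .
    qed (use C M in auto)
    also have "\<dots> = M * (3 * K) * (real k / real k powr s * (C ^ 3 * ?d)) + M * (C * real k * wconv k ?w)
        + M * (3 * K) * (real k / real k powr s * (C * wstar ?w))"
      by (simp add: algebra_simps add_divide_distrib)
    also have "\<dots> \<le> M * (3 * K) * (1 / real k ^ 3 * (C ^ 3 * ?d)) + M * (C * real k * wconv k ?w)
        + M * (3 * K) * (C * real k * wconv k ?w)"
    proof (intro add_mono mult_left_mono order_refl mult_right_mono)
      show "real k / real k powr s \<le> 1 / real k ^ 3" using k by (intro k_inv_pw) auto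
      have "real k / real k powr s * (C * wstar ?w) \<le> 1 / real k ^ 3 * (C * (real k ^ 3 * wconv k ?w))"
        using k C by (intro mult_mono k_inv_pw mult_left_mono wstar_le_wconv) (auto simp: wstar_nonneg)
      also have "\<dots> = C * wconv k ?w * 1" using k by simp
      also have "\<dots> \<le> C * wconv k ?w * real k"
        using k C wconv_nonneg[of k ?w] by (intro mult_left_mono) auto
      finally show "real k / real k powr s * (C * wstar ?w) \<le> C * real k * wconv k ?w" by (simp add: mult_ac)
    qed (use C M K in auto)
    also have "\<dots> = M * (3 * K) * (C ^ 3 * ?d / real k ^ 3) + (M + M * (3 * K)) * (C * real k * wconv k ?w)"
      by (simp add: algebra_simps)
    also have "\<dots> \<le> L * (C ^ 3 * ?d / real k ^ 3) + L * (C * real k * wconv k ?w)"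
      using C M K Z0 wconv_nonneg[of k ?w] by (intro add_mono mult_right_mono) (auto simp: L_def)
    finally show "\<bar>remainder \<mu> b k - remainder \<mu> b' k\<bar> \<le> L * (C ^ 3 * ?d / real k ^ 3 + C * real k * wconv k ?w)"
      using k by (simp add: remainder_high distrib_left)
  qed
qed

theorem remainder_estimates:
  obtains K where "0 < K"
    "\<And>\<mu> C b. 1 / 2 \<le> \<mu> \<Longrightarrow> 0 < C \<Longrightarrow> C \<le> 1 / 4 \<Longrightarrow> b \<in> S_box s C \<Longrightarrow> \<bar>remainder \<mu> b 1\<bar> \<le> K * C ^ 5"
    "\<And>\<mu> C b k. 1 / 2 \<le> \<mu> \<Longrightarrow> 0 < C \<Longrightarrow> C \<le> 1 / 4 \<Longrightarrow> b \<in> S_box s C \<Longrightarrow> 2 \<le> k \<Longrightarrow>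
      \<bar>remainder \<mu> b k\<bar> \<le> K * (C ^ 4 / real k powr (s - 2))"
    "\<And>\<mu> C b b'. 1 / 2 \<le> \<mu> \<Longrightarrow> 0 < C \<Longrightarrow> C \<le> 1 / 4 \<Longrightarrow> b \<in> S_box s C \<Longrightarrow> b' \<in> S_box s C \<Longrightarrow>
      \<bar>remainder \<mu> b 1 - remainder \<mu> b' 1\<bar> \<le> K * (C ^ 3 * (\<bar>coord b 1 - coord b' 1\<bar> + wstar (b - b')))"
    "\<And>\<mu> C b b' k. 1 / 2 \<le> \<mu> \<Longrightarrow> 0 < C \<Longrightarrow> C \<le> 1 / 4 \<Longrightarrow> b \<in> S_box s C \<Longrightarrow> b' \<in> S_box s C \<Longrightarrow> 2 \<le> k \<Longrightarrow>
      \<bar>remainder \<mu> b k - remainder \<mu> b' k\<bar> \<le>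
        K * (C ^ 3 * \<bar>coord b 1 - coord b' 1\<bar> / real k ^ 3 + C * real k * wconv k (b - b'))"
proof -
  obtain H1 where H1: "0 \<le> H1" "\<And>\<mu> C b. 1 / 2 \<le> \<mu> \<Longrightarrow> C \<in> {0<..1/4} \<Longrightarrow> b \<in> S_box s C \<Longrightarrow> \<bar>h1 \<mu> b\<bar> \<le> H1 * C ^ 5"
    "\<And>\<mu> C b b'. 1 / 2 \<le> \<mu> \<Longrightarrow> C \<in> {0<..1/4} \<Longrightarrow> b \<in> S_box s C \<Longrightarrow> b' \<in> S_box s C \<Longrightarrow>
      \<bar>h1 \<mu> b - h1 \<mu> b'\<bar> \<le> H1 * (C ^ 4 * \<bar>coord b 1 - coord b' 1\<bar> + C ^ 3 * wstar (b - b'))"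
    using box.OO_h1 by (rule box.OO_E) blast
  obtain H2 where H2: "0 \<le> H2" "\<And>\<mu> C b. 1 / 2 \<le> \<mu> \<Longrightarrow> C \<in> {0<..1/4} \<Longrightarrow> b \<in> S_box s C \<Longrightarrow> \<bar>h2 \<mu> b\<bar> \<le> H2 * C ^ 4"
    "\<And>\<mu> C b b'. 1 / 2 \<le> \<mu> \<Longrightarrow> C \<in> {0<..1/4} \<Longrightarrow> b \<in> S_box s C \<Longrightarrow> b' \<in> S_box s C \<Longrightarrow>
      \<bar>h2 \<mu> b - h2 \<mu> b'\<bar> \<le> H2 * (C ^ 3 * \<bar>coord b 1 - coord b' 1\<bar> + C ^ 1 * wstar (b - b'))"
    using box.OO_h2 by (rule box.OO_E) blast
  obtain H3 where H3: "0 \<le> H3" "\<And>\<mu> C b. 1 / 2 \<le> \<mu> \<Longrightarrow> C \<in> {0<..1/4} \<Longrightarrow> b \<in> S_box s C \<Longrightarrow> \<bar>h3 \<mu> b\<bar> \<le> H3 * C ^ 4"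
    "\<And>\<mu> C b b'. 1 / 2 \<le> \<mu> \<Longrightarrow> C \<in> {0<..1/4} \<Longrightarrow> b \<in> S_box s C \<Longrightarrow> b' \<in> S_box s C \<Longrightarrow>
      \<bar>h3 \<mu> b - h3 \<mu> b'\<bar> \<le> H3 * (C ^ 3 * \<bar>coord b 1 - coord b' 1\<bar> + C ^ 1 * wstar (b - b'))"
    using box.OO_h3 by (rule box.OO_E) blast
  obtain H4 where H4: "0 \<le> H4"
    "\<And>\<mu> C b k. 1 / 2 \<le> \<mu> \<Longrightarrow> 0 < C \<Longrightarrow> C \<le> 1 / 4 \<Longrightarrow> b \<in> S_box s C \<Longrightarrow> 4 \<le> k \<Longrightarrow>
      \<bar>remainder \<mu> b k\<bar> \<le> H4 * (C ^ 4 / real k powr (s - 2))"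
    "\<And>\<mu> C b b' k. 1 / 2 \<le> \<mu> \<Longrightarrow> 0 < C \<Longrightarrow> C \<le> 1 / 4 \<Longrightarrow> b \<in> S_box s C \<Longrightarrow> b' \<in> S_box s C \<Longrightarrow> 4 \<le> k \<Longrightarrow>
      \<bar>remainder \<mu> b k - remainder \<mu> b' k\<bar> \<le>
        H4 * (C ^ 3 * \<bar>coord b 1 - coord b' 1\<bar> / real k ^ 3 + C * real k * wconv k (b - b'))"
    by (rule high_mode_bounds) blast
  define H where "H = H1 + H2 + H3 + H4 + 1"
  \<comment> \<open>The factors 3^(s - 2) and 27 = 3^3 restore the weights in k for the modes 2 and
    3, whose bounds come without them.\<close>
  define K where "K = 3 powr (s - 2) * H + 27 * H"
  have p3: "0 < (3::real) powr (s - 2)" "1 \<le> (3::real) powr (s - 2)" using s by (auto intro!: ge_one_powr_ge_zero)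
  have H: "1 \<le> H" "H1 \<le> H" "H2 \<le> H" "H3 \<le> H" "H4 \<le> H" using H1 H2 H3 H4 by (auto simp: H_def)
  have "0 \<le> 3 powr (s - 2) * H" using H p3 by simp
  then have K: "H \<le> K" "27 * H \<le> K" "3 powr (s - 2) * H \<le> K" "0 < K"
    using H unfolding K_def by linarith+
  show ?thesis
  proof (rule that[of K])
    show "0 < K" by (rule K)
    fix \<mu> C :: real and b
    assume \<mu>: "1 / 2 \<le> \<mu>" and C: "0 < C" "C \<le> 1 / 4" and b: "b \<in> S_box s C"
    have C': "C \<in> {0<..1/4}" using C by simp
    note low = remainder_low[OF \<mu> box_E[OF \<mu> C b]]
    have "H1 * C ^ 5 \<le> K * C ^ 5" using H K C by (intro mult_right_mono) auto
    then show "\<bar>remainder \<mu> b 1\<bar> \<le> K * C ^ 5" unfolding low using H1(2)[OF \<mu> C' b] by linarith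
    show "\<bar>remainder \<mu> b k\<bar> \<le> K * (C ^ 4 / real k powr (s - 2))" if k: "2 \<le> k" for k
    proof (cases "4 \<le> k")
      case True
      have "H4 * (C ^ 4 / real k powr (s - 2)) \<le> K * (C ^ 4 / real k powr (s - 2))"
        using H K C by (intro mult_right_mono) auto
      with H4(2)[OF \<mu> C b True] show ?thesis by linarith
    next
      case False
      then have k23: "k = 2 \<or> k = 3" using k by auto
      have "\<bar>remainder \<mu> b k\<bar> \<le> H * C ^ 4"
      proof -
        have "H2 * C ^ 4 \<le> H * C ^ 4" "H3 * C ^ 4 \<le> H * C ^ 4" using H C by (auto intro!: mult_right_mono)
        with H2(2)[OF \<mu> C' b] H3(2)[OF \<mu> C' b] k23 show ?thesis using low by auto
      qed
      also have "\<dots> \<le> (3 powr (s - 2) * H) * (C ^ 4 / real k powr (s - 2))"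
      proof -
        have "real k powr (s - 2) \<le> 3 powr (s - 2)" using k23 s by (intro powr_mono2) auto
        from mult_right_mono[OF this, of "H * C ^ 4"] show ?thesis using H C k by (simp add: le_divide_eq mult_ac)
      qed
      also have "\<dots> \<le> K * (C ^ 4 / real k powr (s - 2))" using K C by (intro mult_right_mono) auto
      finally show ?thesis .
    qed
    fix b' assume b': "b' \<in> S_box s C"
    note low' = remainder_low[OF \<mu> box_E[OF \<mu> C b']]
    let ?d = "\<bar>coord b 1 - coord b' 1\<bar>" and ?w = "b - b'"
    have W: "0 \<le> wstar ?w" by (rule wstar_nonneg)
    have "\<bar>remainder \<mu> b 1 - remainder \<mu> b' 1\<bar> \<le> H1 * (C ^ 4 * ?d + C ^ 3 * wstar ?w)"
      unfolding low low' by (rule H1(3)[OF \<mu> C' b b'])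
    also have "\<dots> \<le> K * (C ^ 3 * ?d + C ^ 3 * wstar ?w)"
      using C H K H1(1) W by (intro mult_mono add_mono mult_right_mono power_decreasing) auto
    finally show "\<bar>remainder \<mu> b 1 - remainder \<mu> b' 1\<bar> \<le> K * (C ^ 3 * (?d + wstar ?w))"
      by (simp add: distrib_left)
    show "\<bar>remainder \<mu> b k - remainder \<mu> b' k\<bar> \<le> K * (C ^ 3 * ?d / real k ^ 3 + C * real k * wconv k ?w)"
      if k: "2 \<le> k" for k
    proof (cases "4 \<le> k")
      case True
      have "H4 * (C ^ 3 * ?d / real k ^ 3 + C * real k * wconv k ?w) \<le> K * (C ^ 3 * ?d / real k ^ 3 + C * real k * wconv k ?w)"
        using H K C wconv_nonneg[of k ?w] by (intro mult_right_mono) auto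
      with H4(3)[OF \<mu> C b b' True] show ?thesis by linarith
    next
      case False
      then have k23: "k = 2 \<or> k = 3" using k by auto
      have "\<bar>remainder \<mu> b k - remainder \<mu> b' k\<bar> \<le> H * (C ^ 3 * ?d + C * wstar ?w)"
      proof -
        have n: "0 \<le> C ^ 3 * ?d + C * wstar ?w" using C W by simp
        have "H2 * (C ^ 3 * ?d + C * wstar ?w) \<le> H * (C ^ 3 * ?d + C * wstar ?w)"
          "H3 * (C ^ 3 * ?d + C * wstar ?w) \<le> H * (C ^ 3 * ?d + C * wstar ?w)"
          using H n by (auto intro!: mult_right_mono)
        with H2(3)[OF \<mu> C' b b'] H3(3)[OF \<mu> C' b b'] k23 show ?thesis using low low' by auto
      qed
      also have "\<dots> \<le> H * (27 * (C ^ 3 * ?d / real k ^ 3) + 27 * (C * real k * wconv k ?w))"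
      proof (intro mult_left_mono add_mono)
        have k27: "real k ^ 3 \<le> 27" using k23 by auto
        have "C ^ 3 * ?d * real k ^ 3 \<le> C ^ 3 * ?d * 27" using k27 C by (intro mult_left_mono) auto
        then show "C ^ 3 * ?d \<le> 27 * (C ^ 3 * ?d / real k ^ 3)" using k by (simp add: le_divide_eq mult_ac)
        have "wstar ?w \<le> real k ^ 3 * wconv k ?w" using k by (intro wstar_le_wconv) simp
        also have "\<dots> \<le> 27 * (real k * wconv k ?w)"
          using k27 k wconv_nonneg[of k ?w] mult_right_mono[of 1 "real k" "wconv k ?w"] by (intro mult_mono) auto
        finally have "C * wstar ?w \<le> C * (27 * (real k * wconv k ?w))" using C by (intro mult_left_mono) auto
        then show "C * wstar ?w \<le> 27 * (C * real k * wconv k ?w)" by (simp add: mult_ac)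
      qed (use H in simp)
      also have "\<dots> = 27 * H * (C ^ 3 * ?d / real k ^ 3 + C * real k * wconv k ?w)" by (simp add: algebra_simps)
      also have "\<dots> \<le> K * (C ^ 3 * ?d / real k ^ 3 + C * real k * wconv k ?w)"
        using K C wconv_nonneg[of k ?w] by (intro mult_right_mono) auto
      finally show ?thesis .
    qed
  qed
qed

end

text \<open>The dependence on t is affine: a change of one coordinate affects two different products
  of the series, as k \<ge> 1, and never both factors of the same one.\<close>

lemma tail4_line:
  assumes "1 \<le> i" "1 \<le> k"
  shows "tail4 k (b + t *\<^sub>R unit_vec i) = tail4 k b
    + t * (of_bool (4 + k \<le> i) * coord b (i - k) + of_bool (4 \<le> i) * coord b (i + k))"
proof -
  let ?x = "b + t *\<^sub>R unit_vec i"
  have "tail4 k ?x - tail4 k b = (\<Sum>m. coord ?x (m + 4) * coord (?x - b) (m + (4 + k)))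
      + (\<Sum>m. coord (?x - b) (m + 4) * coord b (m + (4 + k)))"
    unfolding tail4_def using suminf_coord_mult_diff[of ?x 4 "4 + k" b] by (simp only: add.assoc)
  also have "(\<Sum>m. coord ?x (m + 4) * coord (?x - b) (m + (4 + k))) =
      (\<Sum>m\<in>{i - (4 + k)}. coord ?x (m + 4) * coord (?x - b) (m + (4 + k)))"
    by (rule suminf_finite) (auto simp: coord_unit_vec)
  also have "\<dots> = t * (of_bool (4 + k \<le> i) * coord b (i - k))"
    using assms by (auto simp: coord_unit_vec)
  also have "(\<Sum>m. coord (?x - b) (m + 4) * coord b (m + (4 + k))) =
      (\<Sum>m\<in>{i - 4}. coord (?x - b) (m + 4) * coord b (m + (4 + k)))"
    by (rule suminf_finite) (auto simp: coord_unit_vec)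
  also have "\<dots> = t * (of_bool (4 \<le> i) * coord b (i + k))"
    using assms by (auto simp: coord_unit_vec)
  finally show ?thesis by (simp add: distrib_left)
qed

lemma coord_\<Phi>_differentiable:
  assumes i: "1 \<le> i" shows "(\<lambda>t. coord (\<Phi> \<mu> (b + t *\<^sub>R unit_vec i)) k) differentiable (at 0)"
proof -
  have "(\<lambda>t. coord b k + of_bool (i = k) * t) differentiable (at 0)" by (intro derivative_intros)
  moreover have "(\<lambda>t. a1 \<mu> (b + t *\<^sub>R unit_vec i)) differentiable (at 0)"
    "(\<lambda>t. a2 \<mu> (b + t *\<^sub>R unit_vec i)) differentiable (at 0)"
    "(\<lambda>t. a3 \<mu> (b + t *\<^sub>R unit_vec i)) differentiable (at 0)"
    using a1_DERIV[OF i] a2_DERIV[OF i] a3_DERIV[OF i] unfolding real_differentiable_def by blast+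
  ultimately show ?thesis
    unfolding coord_\<Phi> coord_line[OF i] by (cases "k = 1"; cases "k = 2"; cases "k = 3") simp_all
qed

lemma KS_\<Phi>_differentiable:
  assumes i: "1 \<le> i" and k: "1 \<le> k"
  shows "(\<lambda>t. KS_ladder \<mu> (\<Phi> \<mu> (b + t *\<^sub>R unit_vec i)) k) differentiable (at 0)"
proof -
  note [derivative_intros] = coord_\<Phi>_differentiable[OF i]
  have T: "(\<lambda>t. tail4 k (b + t *\<^sub>R unit_vec i)) differentiable (at 0)"
    unfolding tail4_line[OF i k] by (intro derivative_intros)
  show ?thesis
    unfolding KS_ladder_NK NK_def corr_split tail4_\<Phi>
    by (intro derivative_intros T) (auto intro!: differentiable_mult coord_\<Phi>_differentiable[OF i])
qed

lemma remainder_differentiable: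
  assumes i: "1 \<le> i" and k: "1 \<le> k" and E: "1 + cE \<mu> * y2 \<mu> b \<noteq> 0"
  shows "(\<lambda>t. remainder \<mu> (b + t *\<^sub>R unit_vec i) k) differentiable (at 0)"
proof -
  note [derivative_intros] = KS_\<Phi>_differentiable[OF i]
  have a: "(\<lambda>t. a1 \<mu> (b + t *\<^sub>R unit_vec i)) differentiable (at 0)"
    "(\<lambda>t. a3 \<mu> (b + t *\<^sub>R unit_vec i)) differentiable (at 0)"
    "(\<lambda>t. y2 \<mu> (b + t *\<^sub>R unit_vec i)) differentiable (at 0)"
    using a1_DERIV[OF i] a3_DERIV[OF i] y2_DERIV[OF i] unfolding real_differentiable_def by blast+
  note [derivative_intros] = a
  have c: "(\<lambda>t. coord (b + t *\<^sub>R unit_vec i) j) differentiable (at 0)" for j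
    unfolding coord_line[OF i] by (intro derivative_intros)
  note [derivative_intros] = c
  have Y: "(\<lambda>t. Y2 \<mu> (b + t *\<^sub>R unit_vec i)) differentiable (at 0)"
    unfolding Y2_def by (intro derivative_intros) auto
  note [derivative_intros] = Y
  have F: "(\<lambda>t. F1 \<mu> (b + t *\<^sub>R unit_vec i)) differentiable (at 0)"
    unfolding F1_def using E by (intro derivative_intros) auto
  note [derivative_intros] = F
  have "(\<lambda>t. nf_field \<mu> (b + t *\<^sub>R unit_vec i) k) differentiable (at 0)"
    unfolding nf_field_def using k
    by (cases "k = 1"; cases "k = 2"; cases "k = 3") (simp_all, (intro derivative_intros; simp)+)
  note [derivative_intros] = this
  have "(\<lambda>t. if k = 1 then 4 / lam 2 \<mu> * coord (b + t *\<^sub>R unit_vec i) 1 ^ 3 else 0) differentiable (at 0)"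
  proof (cases "k = 1")
    case True
    show ?thesis unfolding if_P[OF True] by (intro derivative_intros)
  qed (simp only: if_False, rule differentiable_const)
  note [derivative_intros] = this
  show ?thesis unfolding remainder_def by (intro derivative_intros)
qed

lemma infsum_le_suminf:
  fixes g G :: "nat \<Rightarrow> real"
  assumes G: "summable G" "\<And>i. 0 \<le> G i" and g: "\<And>i. i \<in> A \<Longrightarrow> 0 \<le> g i \<and> g i \<le> G i"
  shows "g summable_on A" "infsum g A \<le> suminf G"
proof -
  have hs: "(G has_sum suminf G) UNIV"
    using G by (intro norm_summable_imp_has_sum summable_sums) auto
  then have GA: "G summable_on A" using summable_on_subset_banach has_sum_imp_summable by blast
  then show gA: "g summable_on A"
    by (rule summable_on_comparison_test) (use g in auto)
  have "infsum g A \<le> infsum G UNIV"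
    by (rule infsum_mono_neutral[OF gA has_sum_imp_summable[OF hs]]) (use g G in auto)
  then show "infsum g A \<le> suminf G" using hs by (simp add: infsumI)
qed

section \<open>From Lipschitz estimates to the Jacobian bounds\<close>

context sbox
begin

text \<open>Coordinates bounded by 2 C / k give a norm of at most 4 C; the bound C \<le> 1/10 makes
  this at most 2/5, inside the ball of radius 1/2.\<close>

lemma S_box_subset_dom:
  assumes "0 < C" "C \<le> 1 / 10" shows "S_box s C \<subseteq> nf_dom"
proof
  fix b assume b: "b \<in> S_box s C"
  have C1: "C \<le> 1" using assms by simp
  have "norm b \<le> 2 * (2 * C)"
  proof (rule norm_le_of_weighted)
    fix k :: nat assume k: "1 \<le> k"
    show "\<bar>coord b k\<bar> \<le> 2 * C / real k"
    proof (cases "k = 1")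
      case True then show ?thesis using S_boxD(1)[OF b assms(1) C1] by simp
    next
      case False
      have "\<bar>coord b k\<bar> \<le> C ^ 3 / real k ^ 3" using False k by (intro S_boxD(3)[OF b assms(1) C1]) auto
      also have "\<dots> \<le> C / real k"
        using assms k power_decreasing[of 1 3 C] by (intro frac_le) (auto intro: self_le_power)
      also have "\<dots> \<le> 2 * C / real k" using assms by (intro divide_right_mono) auto
      finally show ?thesis .
    qed
  qed
  then show "b \<in> nf_dom" using assms by (simp add: nf_dom_def)
qed

text \<open>Lipschitz information exists inside the box only, and b may lie on its boundary. A step
  towards the centre in direction i stays inside, so a one-sided limit of the difference quotients
  already bounds the existing derivative.\<close>

lemma partial_deriv_bound:
  assumes b: "b \<in> S_box s C" and C: "0 < C" "C \<le> 1" and i: "1 \<le> i"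
    and d: "(\<lambda>t. f (b + t *\<^sub>R unit_vec i)) differentiable (at 0)"
    and m: "\<And>t. b + t *\<^sub>R unit_vec i \<in> S_box s C \<Longrightarrow> \<bar>f b - f (b + t *\<^sub>R unit_vec i)\<bar> \<le> m * \<bar>t\<bar>"
  shows "\<bar>partial_deriv f i b\<bar> \<le> m"
proof -
  define r where "r = (if i = 1 then sqrt 2 * C else C ^ 3 / real i powr s)"
  have r: "0 < r" using C i by (simp add: r_def)
  have bi: "\<bar>coord b i\<bar> \<le> r" using b i by (auto simp: S_box_def r_def)
  have in_box: "b + t *\<^sub>R unit_vec i \<in> S_box s C" if "\<bar>coord b i + t\<bar> \<le> r" for t
    using b that i unfolding S_box_def mem_Collect_eq coord_line[OF i] r_def by (auto split: if_splits)
  define D where "D = partial_deriv f i b"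
  have "((\<lambda>t. f (b + t *\<^sub>R unit_vec i)) has_real_derivative D) (at 0)"
    using d unfolding D_def partial_deriv_def by (simp add: DERIV_deriv_iff_real_differentiable)
  then have "((\<lambda>t. (f (b + t *\<^sub>R unit_vec i) - f b) / t) \<longlongrightarrow> D) (at 0)"
    by (simp add: has_field_derivative_iff)
  then have lim: "((\<lambda>t. \<bar>(f (b + t *\<^sub>R unit_vec i) - f b) / t\<bar>) \<longlongrightarrow> \<bar>D\<bar>) (at 0)"
    by (rule tendsto_rabs)
  have le: "\<bar>(f (b + t *\<^sub>R unit_vec i) - f b) / t\<bar> \<le> m" if "\<bar>coord b i + t\<bar> \<le> r" "t \<noteq> 0" for t
    using m[OF in_box[OF that(1)]] that(2) by (simp add: divide_le_eq abs_minus_commute)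
  have "\<bar>D\<bar> \<le> m"
  proof (cases "coord b i \<le> 0")
    case True
    have ev: "\<forall>\<^sub>F t in at_right 0. \<bar>(f (b + t *\<^sub>R unit_vec i) - f b) / t\<bar> \<le> m"
      using eventually_at_right_real[OF r] by eventually_elim (rule le, use True bi in auto)
    have "((\<lambda>t. \<bar>(f (b + t *\<^sub>R unit_vec i) - f b) / t\<bar>) \<longlongrightarrow> \<bar>D\<bar>) (at_right 0)"
      using lim by (simp add: filterlim_at_split)
    then show ?thesis by (rule tendsto_upperbound[OF _ ev]) simp
  next
    case False
    have r': "- r < 0" using r by simp
    have ev: "\<forall>\<^sub>F t in at_left 0. \<bar>(f (b + t *\<^sub>R unit_vec i) - f b) / t\<bar> \<le> m"
      using eventually_at_left_real[OF r'] by eventually_elim (rule le, use False bi in auto)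
    have "((\<lambda>t. \<bar>(f (b + t *\<^sub>R unit_vec i) - f b) / t\<bar>) \<longlongrightarrow> \<bar>D\<bar>) (at_left 0)"
      using lim by (simp add: filterlim_at_split)
    then show ?thesis by (rule tendsto_upperbound[OF _ ev]) simp
  qed
  then show ?thesis by (simp add: D_def)
qed

lemma wstar_line: "1 \<le> i \<Longrightarrow> wstar (b - (b + t *\<^sub>R unit_vec i)) = of_bool (2 \<le> i) * (\<bar>t\<bar> / real i ^ 3)"
proof -
  assume i: "1 \<le> i"
  have "wstar (b - (b + t *\<^sub>R unit_vec i)) = (\<Sum>j\<in>{i - 2}. \<bar>coord (b - (b + t *\<^sub>R unit_vec i)) (j + 2)\<bar> / real (j + 2) ^ 3)"
    unfolding wstar_def by (rule suminf_finite) (auto simp: coord_unit_vec)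
  then show ?thesis using i by (auto simp: coord_unit_vec)
qed

lemma wconv_line: "1 \<le> i \<Longrightarrow> wconv k (b - (b + t *\<^sub>R unit_vec i)) = of_bool (2 \<le> i) * (\<bar>t\<bar> / real (1 + nd k i) ^ 3)"
proof -
  assume i: "1 \<le> i"
  have "wconv k (b - (b + t *\<^sub>R unit_vec i)) = (\<Sum>j\<in>{i - 2}. \<bar>coord (b - (b + t *\<^sub>R unit_vec i)) (j + 2)\<bar> / real (1 + nd k (j + 2)) ^ 3)"
    unfolding wconv_def by (rule suminf_finite) (auto simp: coord_unit_vec)
  then show ?thesis using i by (auto simp: coord_unit_vec)
qed

theorem remainder_bounds_remainder: "remainder_bounds s nf_dom remainder"
proof -
  obtain K where K: "0 < K"
    and v1: "\<And>\<mu> C b. 1 / 2 \<le> \<mu> \<Longrightarrow> 0 < C \<Longrightarrow> C \<le> 1 / 4 \<Longrightarrow> b \<in> S_box s C \<Longrightarrow> \<bar>remainder \<mu> b 1\<bar> \<le> K * C ^ 5"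
    and vk: "\<And>\<mu> C b k. 1 / 2 \<le> \<mu> \<Longrightarrow> 0 < C \<Longrightarrow> C \<le> 1 / 4 \<Longrightarrow> b \<in> S_box s C \<Longrightarrow> 2 \<le> k \<Longrightarrow>
      \<bar>remainder \<mu> b k\<bar> \<le> K * (C ^ 4 / real k powr (s - 2))"
    and d1: "\<And>\<mu> C b b'. 1 / 2 \<le> \<mu> \<Longrightarrow> 0 < C \<Longrightarrow> C \<le> 1 / 4 \<Longrightarrow> b \<in> S_box s C \<Longrightarrow> b' \<in> S_box s C \<Longrightarrow>
      \<bar>remainder \<mu> b 1 - remainder \<mu> b' 1\<bar> \<le> K * (C ^ 3 * (\<bar>coord b 1 - coord b' 1\<bar> + wstar (b - b')))"
    and dk: "\<And>\<mu> C b b' k. 1 / 2 \<le> \<mu> \<Longrightarrow> 0 < C \<Longrightarrow> C \<le> 1 / 4 \<Longrightarrow> b \<in> S_box s C \<Longrightarrow> b' \<in> S_box s C \<Longrightarrow> 2 \<le> k \<Longrightarrow>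
      \<bar>remainder \<mu> b k - remainder \<mu> b' k\<bar> \<le>
        K * (C ^ 3 * \<bar>coord b 1 - coord b' 1\<bar> / real k ^ 3 + C * real k * wconv k (b - b'))"
    by (rule remainder_estimates) blast
  \<comment> \<open>The doubled diagonal entry contributes 2 K, row and column together at most 4 Z
    K, and the 1 makes the inequality strict.\<close>
  define \<beta> where "\<beta> = K * (4 * Z + 2) + 1"
  have \<beta>: "0 < \<beta>" using K Z_ge by (simp add: \<beta>_def add_pos_pos)
  show ?thesis
    unfolding remainder_bounds_def
  proof (rule exI[of _ "1/10"], rule exI[of _ "\<lambda>_. K + 1"], rule exI[of _ "\<lambda>_. \<beta>"], intro conjI allI impI ballI)
    show "\<exists>k. \<forall>k'\<ge>k. K + 1 = K + 1 \<and> \<beta> = \<beta>" by simp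
    fix \<mu> C :: real
    assume \<mu>: "1 / 2 \<le> \<mu>" and "0 < C \<and> C \<le> 1 / 10"
    then have C: "0 < C" "C \<le> 1 / 10" "C \<le> 1 / 4" "C \<le> 1" by auto
    have C3: "C ^ 3 \<le> C" using power_decreasing[of 1 3 C] C by simp
    show "S_box s C \<subseteq> nf_dom" by (rule S_box_subset_dom[OF C(1,2)])
    fix b assume b: "b \<in> S_box s C"
    have diff: "(\<lambda>t. remainder \<mu> (b + t *\<^sub>R unit_vec i) k) differentiable (at 0)" if "1 \<le> i" "1 \<le> k" for i k
      by (rule remainder_differentiable[OF that box_E[OF \<mu> C(1,3) b]])
    then show "(\<lambda>t. remainder \<mu> (b + t *\<^sub>R unit_vec i) k) differentiable (at 0)" if "1 \<le> i" "1 \<le> k" for i k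
      using that by blast
    have "K * C ^ 5 < (K + 1) * C ^ 5" using C by (intro mult_strict_right_mono) auto
    with v1[OF \<mu> C(1,3) b] show "\<bar>remainder \<mu> b 1\<bar> < (K + 1) * C ^ 5" by linarith
    show "\<bar>remainder \<mu> b k\<bar> < (K + 1) * C ^ 4 / real k powr (s - 2)" if k: "2 \<le> k" for k
    proof -
      have "K * (C ^ 4 / real k powr (s - 2)) < (K + 1) * (C ^ 4 / real k powr (s - 2))"
        using C k by (intro mult_strict_right_mono divide_pos_pos) auto
      with vk[OF \<mu> C(1,3) b k] show ?thesis by simp
    qed
    define D where "D j i = \<bar>partial_deriv (\<lambda>x. remainder \<mu> x j) i b\<bar>" for j i
    have D0: "0 \<le> D j i" for j i by (simp add: D_def)
    have D1: "D 1 i \<le> K * C ^ 3 * (1 / real i ^ 3)" if i: "1 \<le> i" for i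
      unfolding D_def
    proof (rule partial_deriv_bound[OF b C(1,4) i diff[OF i order_refl]])
      fix t assume b': "b + t *\<^sub>R unit_vec i \<in> S_box s C"
      show "\<bar>remainder \<mu> b 1 - remainder \<mu> (b + t *\<^sub>R unit_vec i) 1\<bar> \<le> K * C ^ 3 * (1 / real i ^ 3) * \<bar>t\<bar>"
        using d1[OF \<mu> C(1,3) b b'] i unfolding wstar_line[OF i] by (cases "i = 1") (auto simp: coord_unit_vec mult_ac)
    qed
    have Dk1: "D k 1 \<le> K * C ^ 3 * (1 / real k ^ 3)" if k: "2 \<le> k" for k
      unfolding D_def
    proof (rule partial_deriv_bound[OF b C(1,4) order_refl diff[OF order_refl]])
      show "1 \<le> k" using k by simp
      fix t assume b': "b + t *\<^sub>R unit_vec 1 \<in> S_box s C"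
      show "\<bar>remainder \<mu> b k - remainder \<mu> (b + t *\<^sub>R unit_vec 1) k\<bar> \<le> K * C ^ 3 * (1 / real k ^ 3) * \<bar>t\<bar>"
        using dk[OF \<mu> C(1,3) b b' k] unfolding wconv_line[OF order_refl] by (simp add: coord_unit_vec mult_ac)
    qed
    have Dk: "D k i \<le> K * C * (real k / real (1 + nd k i) ^ 3)" if k: "2 \<le> k" and i: "2 \<le> i" for k i
      unfolding D_def
    proof (rule partial_deriv_bound[OF b C(1,4)])
      show i1: "1 \<le> i" using i by simp
      show "(\<lambda>t. remainder \<mu> (b + t *\<^sub>R unit_vec i) k) differentiable (at 0)" using k i by (intro diff) auto
      fix t assume b': "b + t *\<^sub>R unit_vec i \<in> S_box s C"
      show "\<bar>remainder \<mu> b k - remainder \<mu> (b + t *\<^sub>R unit_vec i) k\<bar> \<le> K * C * (real k / real (1 + nd k i) ^ 3) * \<bar>t\<bar>"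
        using dk[OF \<mu> C(1,3) b b' k] i unfolding wconv_line[OF i1] by (simp add: coord_unit_vec mult_ac)
    qed
    have s3: "summable (\<lambda>i. 2 * K * C ^ 3 * (1 / real (i + 1) ^ 2))" by (intro summable_mult Z_sum)
    show "jacobian_bound (remainder \<mu>) b 1 (\<beta> * C ^ 3)"
    proof -
      define G where "G i = 2 * K * C ^ 3 * (1 / real i ^ 3)" for i :: nat
      have sG: "summable G"
        unfolding G_def by (intro summable_mult) (use inverse_power_summable[of 3, where 'a = real] in \<open>simp add: divide_inverse\<close>)
      have G0: "0 \<le> G i" for i using K C by (simp add: G_def)
      have "G 0 = 0" by (simp add: G_def)
      have le: "0 \<le> D 1 i + D i 1 \<and> D 1 i + D i 1 \<le> G i" if "i \<in> {1..} - {1}" for i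
        using D1[of i] Dk1[of i] D0[of 1 i] D0[of i 1] that by (simp add: G_def)
      have "suminf G = (\<Sum>i. G (i + 1)) + (\<Sum>i<1. G i)" by (rule suminf_split_initial_segment[OF sG])
      also have "(\<Sum>i. G (i + 1)) \<le> (\<Sum>i. 2 * K * C ^ 3 * (1 / real (i + 1) ^ 2))"
        unfolding G_def using K C
        by (intro suminf_le summable_ignore_initial_segment[OF sG, unfolded G_def] s3 mult_left_mono divide_left_mono power_increasing) auto
      also have "\<dots> = 2 * K * C ^ 3 * Z" unfolding Z_def by (rule suminf_mult[OF Z_sum])
      finally have "suminf G \<le> 2 * K * C ^ 3 * Z" by (simp add: \<open>G 0 = 0\<close>)
      then have "2 * D 1 1 + (\<Sum>\<^sub>\<infinity>i\<in>{1..} - {1}. D 1 i + D i 1) \<le> K * (2 * Z + 2) * C ^ 3"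
        using infsum_le_suminf(2)[OF sG G0 le, of "{1..} - {1}"] D1[of 1] by (simp add: algebra_simps)
      also have "\<dots> < \<beta> * C ^ 3"
      proof (rule mult_strict_right_mono)
        have "K * (2 * Z + 2) \<le> K * (4 * Z + 2)" using K Z_ge by (intro mult_left_mono) auto
        then show "K * (2 * Z + 2) < \<beta>" by (simp add: \<beta>_def)
      qed (use C in simp)
      finally show ?thesis
        unfolding jacobian_bound_def Let_def D_def[symmetric] using infsum_le_suminf(1)[OF sG G0 le, of "{1..} - {1}"] by blast
    qed
    show "jacobian_bound (remainder \<mu>) b k (\<beta> * real k * C)" if k: "2 \<le> k" for k
    proof -
      define G where "G i = 2 * K * C * real k * (1 / real (1 + nd k (i + 0)) ^ 2)" for i :: nat
      have sG: "summable G" unfolding G_def by (intro summable_mult nd_sum) simp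
      have G0: "0 \<le> G i" for i using K C by (simp add: G_def)
      have le: "0 \<le> D k i + D i k \<and> D k i + D i k \<le> G i" if i: "i \<in> {1..} - {k}" for i
      proof (cases "i = 1")
        case True
        have "D k 1 + D 1 k \<le> 2 * K * (C ^ 3 * (1 / real k ^ 3))" using D1[of k] Dk1[of k] k by simp
        also have "\<dots> \<le> 2 * K * (C * (1 / real k))"
          using K C C3 k by (intro mult_left_mono mult_mono divide_left_mono self_le_power) auto
        also have "\<dots> = G 1"
        proof -
          have "1 + nd k 1 = k" using k by (simp add: nd_def)
          then show ?thesis unfolding G_def using k by (simp add: power2_eq_square)
        qed
        finally show ?thesis using True D0 by simp
      next
        case False
        then have i2: "2 \<le> i" using i by auto
        let ?n = "1 + nd k i"
        have nd: "nd i k = nd k i" by (simp add: nd_def)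
        \<comment> \<open>The column entry carries the factor i instead of k. Exchanging it for k
          costs one power of 1 + \<bar>k - i\<bar>, so the cube in the weight becomes a square,
          which is still summable.\<close>
        have "i \<le> k * ?n"
        proof -
          have "i \<le> k + nd k i" by (auto simp: nd_def)
          also have "\<dots> \<le> k * 1 + k * nd k i" using k by (intro add_mono) auto
          finally show ?thesis by (simp add: distrib_left)
        qed
        then have "real i \<le> real k * real ?n" by (metis of_nat_le_iff of_nat_mult)
        then have "real i / real ?n ^ 3 \<le> real k * real ?n / real ?n ^ 3" by (intro divide_right_mono) auto
        also have "\<dots> = real k * (1 / real ?n ^ 2)" by (simp add: power_numeral_reduce del: of_nat_Suc of_nat_add)
        finally have 1: "real i / real ?n ^ 3 \<le> real k * (1 / real ?n ^ 2)" .
        have "real k * (1 / real ?n ^ 3) \<le> real k * (1 / real ?n ^ 2)"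
          by (intro mult_left_mono divide_left_mono power_increasing) auto
        then have 2: "real k / real ?n ^ 3 \<le> real k * (1 / real ?n ^ 2)" by simp
        have "D k i + D i k \<le> K * C * (real k / real ?n ^ 3) + K * C * (real i / real ?n ^ 3)"
          using Dk[OF k i2] Dk[OF i2 k] unfolding nd by (rule add_mono)
        also have "\<dots> \<le> K * C * (real k * (1 / real ?n ^ 2)) + K * C * (real k * (1 / real ?n ^ 2))"
          using K C 1 2 by (intro add_mono mult_left_mono) auto
        also have "\<dots> = G i" by (simp add: G_def)
        finally show ?thesis using D0 by simp
      qed
      have "suminf G = 2 * K * C * real k * (\<Sum>i. 1 / real (1 + nd k (i + 0)) ^ 2)"
        unfolding G_def by (intro suminf_mult nd_sum) simp
      also have "\<dots> \<le> 2 * K * C * real k * (2 * Z)" using K C by (intro mult_left_mono nd_sum) auto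
      finally have sum: "suminf G \<le> 2 * K * C * real k * (2 * Z)" .
      have "D k k \<le> K * C * real k" using Dk[OF k k] by (simp add: nd_def)
      with sum infsum_le_suminf(2)[OF sG G0 le, of "{1..} - {k}"]
      have "2 * D k k + (\<Sum>\<^sub>\<infinity>i\<in>{1..} - {k}. D k i + D i k) \<le> K * (4 * Z + 2) * (real k * C)"
        by (simp add: algebra_simps)
      also have "\<dots> < \<beta> * (real k * C)" using C k by (intro mult_strict_right_mono) (auto simp: \<beta>_def)
      finally show ?thesis
        unfolding jacobian_bound_def Let_def D_def[symmetric]
        using infsum_le_suminf(1)[OF sG G0 le, of "{1..} - {k}"] by (simp add: mult.assoc)
    qed
  qed (use K \<beta> in auto)
qed

end

section \<open>Energy estimates and cones\<close>

text \<open>The squared norm of the part orthogonal to the first coordinate direction, the negative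
  part of the quadratic form Q.\<close>

definition Yp :: "ell2 \<Rightarrow> real" where "Yp w = (\<Sum>k. (coord w (k + 2))\<^sup>2)"

lemma Yp_nonneg: "0 \<le> Yp w"
  unfolding Yp_def by (intro suminf_nonneg summable_coord_shift_sq) auto

lemma norm_sq_Yp: "(norm w)\<^sup>2 = (coord w 1)\<^sup>2 + Yp w"
proof -
  have "{..<2::nat} = {0, 1}" by auto
  then show ?thesis
    using suminf_split_initial_segment[OF summable_coord_sq[of w], of 2] by (simp add: norm_ell2_sq Yp_def)
qed

lemma coord_sq_le_Yp: "2 \<le> k \<Longrightarrow> (coord w k)\<^sup>2 \<le> Yp w"
  using norm_sq_Yp[of "coord_proj {2..} w"] abs_coord_le_norm[of "coord_proj {2..} w" k]
    abs_le_square_iff[of "coord (coord_proj {2..} w) k" "norm (coord_proj {2..} w)"]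
  by (simp add: coord_coord_proj Yp_def)

lemma coord_le_sqrt_Yp: "2 \<le> k \<Longrightarrow> \<bar>coord w k\<bar> \<le> sqrt (Yp w)"
  using coord_sq_le_Yp[of k w] by (simp add: real_le_rsqrt)

lemma norm_proj_1: "norm (coord_proj {1} w) = \<bar>coord w 1\<bar>"
proof -
  have "(norm (coord_proj {1} w))\<^sup>2 = (coord w 1)\<^sup>2"
    unfolding norm_sq_Yp by (simp add: coord_coord_proj Yp_def)
  then show ?thesis by (metis abs_norm_cancel power2_eq_iff abs_minus abs_of_nonneg)
qed

lemma norm_perp_1: "(norm (w - coord_proj {1} w))\<^sup>2 = Yp w"
  unfolding norm_sq_Yp by (simp add: coord_coord_proj Yp_def)

lemma Qform_1: "Qform {1} w = (coord w 1)\<^sup>2 - Yp w"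
  by (simp only: Qform_def norm_proj_1 norm_perp_1 power2_abs)

lemma proj_empty: "coord_proj {} w = 0"
  by (rule ell2_eqI) (simp add: coord_coord_proj)

lemma Yp_eq_0_iff: "Yp w + (coord w 1)\<^sup>2 = 0 \<longleftrightarrow> w = 0"
  using norm_sq_Yp[of w] by (metis add.commute norm_eq_zero zero_eq_power2)

lemma wconv_le_Yp: "wconv k w \<le> 2 * Z * sqrt (Yp w)"
proof -
  have "wconv k w \<le> (\<Sum>i. sqrt (Yp w) * (1 / real (1 + nd k (i + 2)) ^ 3))"
    unfolding wconv_def
  proof (intro suminf_le summable_wconv summable_mult nd_sum)
    fix i
    show "\<bar>coord w (i + 2)\<bar> / real (1 + nd k (i + 2)) ^ 3 \<le> sqrt (Yp w) * (1 / real (1 + nd k (i + 2)) ^ 3)"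
      using mult_right_mono[OF coord_le_sqrt_Yp[of "i + 2" w], of "1 / real (1 + nd k (i + 2)) ^ 3"] by simp
  qed simp
  also have "\<dots> = sqrt (Yp w) * (\<Sum>i. 1 / real (1 + nd k (i + 2)) ^ 3)"
    by (intro suminf_mult nd_sum) simp
  also have "\<dots> \<le> sqrt (Yp w) * (2 * Z)" by (intro mult_left_mono nd_sum) (auto simp: Yp_nonneg)
  finally show ?thesis by (simp add: mult_ac)
qed

lemma sum_inverse_sq_shift2: "summable (\<lambda>k. 1 / (real (k + 2))\<^sup>2)" "(\<Sum>k. 1 / (real (k + 2))\<^sup>2) \<le> Z"
proof -
  show s: "summable (\<lambda>k. 1 / (real (k + 2))\<^sup>2)" by (rule summable_inverse_shift) auto
  show "(\<Sum>k. 1 / (real (k + 2))\<^sup>2) \<le> Z"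
    unfolding Z_def by (intro suminf_le s Z_sum divide_left_mono power_mono) auto
qed

lemma wstar_le_Yp: "wstar w \<le> Z * sqrt (Yp w)"
proof -
  have "wstar w \<le> (\<Sum>i. sqrt (Yp w) * (1 / (real (i + 2))\<^sup>2))"
    unfolding wstar_def
  proof (intro suminf_le summable_wstar summable_mult sum_inverse_sq_shift2)
    fix i
    have "1 / real (i + 2) ^ 3 \<le> 1 / real (i + 2) ^ 2" by (intro divide_left_mono power_increasing) auto
    then have "\<bar>coord w (i + 2)\<bar> * (1 / real (i + 2) ^ 3) \<le> sqrt (Yp w) * (1 / (real (i + 2))\<^sup>2)"
      by (intro mult_mono coord_le_sqrt_Yp) (auto simp: Yp_nonneg)
    then show "\<bar>coord w (i + 2)\<bar> / real (i + 2) ^ 3 \<le> sqrt (Yp w) * (1 / (real (i + 2))\<^sup>2)" by simp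
  qed simp
  also have "\<dots> = sqrt (Yp w) * (\<Sum>i. 1 / (real (i + 2))\<^sup>2)"
    by (intro suminf_mult sum_inverse_sq_shift2)
  also have "\<dots> \<le> sqrt (Yp w) * Z" by (intro mult_left_mono sum_inverse_sq_shift2) (auto simp: Yp_nonneg)
  finally show ?thesis by (simp add: mult_ac)
qed

lemma two_mult_le: "2 * (x * y) \<le> x\<^sup>2 + (y\<^sup>2 :: real)"
  using zero_le_power2[of "x - y"] by (simp add: power2_diff)

text \<open>One fixed \<nu> with the remainder estimates for the exponent 4. \<open>C0_le\<close>
  puts the boxes into \<open>nf_dom\<close>, \<open>small\<close> makes the perturbation terms
  dominated by damping and by the cubic term, and \<open>\<nu>_small\<close> ensures that the
  amplitude of the nonzero fixed points fits into the box of size \<open>C0\<close>.\<close>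

locale ks_dyn =
  fixes \<nu> K L C0 :: real
  assumes K_pos: "0 < K" and L_pos: "0 < L" and C0_pos: "0 < C0" and C0_le: "C0 \<le> 1 / 10"
    and small: "64 * K * C0 * (1 + Z)\<^sup>2 \<le> 1" and \<nu>_small: "\<bar>\<nu>\<bar> \<le> C0\<^sup>2 / 10"
    and h_lip: "\<And>b b' k. b \<in> nf_dom \<Longrightarrow> b' \<in> nf_dom \<Longrightarrow> 1 \<le> k \<Longrightarrow>
      \<bar>remainder (1 - \<nu>) b k - remainder (1 - \<nu>) b' k\<bar> \<le> L * real k * norm (b - b')"
    and h1_bound: "\<And>C b. 0 < C \<Longrightarrow> C \<le> 1 / 4 \<Longrightarrow> b \<in> S_box 4 C \<Longrightarrow> \<bar>remainder (1 - \<nu>) b 1\<bar> \<le> K * C ^ 5"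
    and hk_bound: "\<And>C b k. 0 < C \<Longrightarrow> C \<le> 1 / 4 \<Longrightarrow> b \<in> S_box 4 C \<Longrightarrow> 2 \<le> k \<Longrightarrow>
      \<bar>remainder (1 - \<nu>) b k\<bar> \<le> K * (C ^ 4 / real k powr (4 - 2))"
    and h1_diff: "\<And>C b b'. 0 < C \<Longrightarrow> C \<le> 1 / 4 \<Longrightarrow> b \<in> S_box 4 C \<Longrightarrow> b' \<in> S_box 4 C \<Longrightarrow>
      \<bar>remainder (1 - \<nu>) b 1 - remainder (1 - \<nu>) b' 1\<bar> \<le> K * (C ^ 3 * (\<bar>coord b 1 - coord b' 1\<bar> + wstar (b - b')))"
    and hk_diff: "\<And>C b b' k. 0 < C \<Longrightarrow> C \<le> 1 / 4 \<Longrightarrow> b \<in> S_box 4 C \<Longrightarrow> b' \<in> S_box 4 C \<Longrightarrow> 2 \<le> k \<Longrightarrow>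
      \<bar>remainder (1 - \<nu>) b k - remainder (1 - \<nu>) b' k\<bar> \<le>
        K * (C ^ 3 * \<bar>coord b 1 - coord b' 1\<bar> / real k ^ 3 + C * real k * wconv k (b - b'))"
begin

interpretation sbox 4 by unfold_locales simp

abbreviation "F \<equiv> nf_field (1 - \<nu>)"
abbreviation "h \<equiv> remainder (1 - \<nu>)"
text \<open>Equals 1 / (3 - 4 \<nu>), close to 1/3. Its sign makes the bifurcation
  supercritical.\<close>

definition \<kappa> :: real where "\<kappa> = - 4 / lam 2 (1 - \<nu>)"
text \<open>Strength of the coupling between the first coordinate and the others in the energy
  estimates.\<close>

definition \<theta> :: "real \<Rightarrow> real" where "\<theta> C = 2 * K * C ^ 3 * (1 + Z)"

lemma \<nu>_le: "\<bar>\<nu>\<bar> \<le> 1 / 1000"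
proof -
  have "C0\<^sup>2 \<le> (1 / 10)\<^sup>2" using C0_pos C0_le by (intro power_mono) auto
  then show ?thesis using \<nu>_small by (simp add: power2_eq_square)
qed

lemma \<kappa>_bounds: "3 / 10 \<le> \<kappa>" "\<kappa> \<le> 4 / 10"
proof -
  have e: "\<kappa> = 1 / (3 - 4 * \<nu>)" using \<nu>_le by (simp add: \<kappa>_def lam_2 divide_simps)
  have "0 < 3 - 4 * \<nu>" using \<nu>_le by linarith
  then show "3 / 10 \<le> \<kappa>" "\<kappa> \<le> 4 / 10"
    unfolding e using \<nu>_le by (simp_all add: le_divide_eq divide_le_eq abs_le_iff)
qed

lemma lam_1_\<nu>: "lam 1 (1 - \<nu>) = \<nu>"
  by (simp add: lam_Suc_0)

lemma lam_high: assumes "2 \<le> k" shows "lam k (1 - \<nu>) \<le> - (real k ^ 4 / 2)" "\<bar>lam k (1 - \<nu>)\<bar> \<le> 2 * real k ^ 4"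
proof -
  have k: "4 * (real k)\<^sup>2 \<le> real k ^ 4" "0 \<le> (real k)\<^sup>2"
  proof -
    have "2\<^sup>2 \<le> (real k)\<^sup>2" using assms by (intro power_mono) auto
    from mult_right_mono[OF this, of "(real k)\<^sup>2"] show "4 * (real k)\<^sup>2 \<le> real k ^ 4"
      by (simp add: power4_eq_xxxx power2_eq_square mult_ac)
  qed simp
  have e: "lam k (1 - \<nu>) = (real k)\<^sup>2 - real k ^ 4 + \<nu> * real k ^ 4"
    by (simp add: lam_def power4_eq_xxxx power2_eq_square algebra_simps)
  have "\<bar>\<nu> * real k ^ 4\<bar> \<le> 1 / 1000 * real k ^ 4"
    unfolding abs_mult using \<nu>_le by (intro mult_mono) auto
  then show "lam k (1 - \<nu>) \<le> - (real k ^ 4 / 2)" "\<bar>lam k (1 - \<nu>)\<bar> \<le> 2 * real k ^ 4"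
    unfolding e using k zero_le_power[of "real k" 4] by linarith+
qed

lemma F_eq: "F b k = lam k (1 - \<nu>) * coord b k + (if k = 1 then - \<kappa> * coord b 1 ^ 3 else 0) + h b k"
  by (simp add: remainder_def \<kappa>_def)

lemma F_1: "F b 1 = \<nu> * coord b 1 - \<kappa> * coord b 1 ^ 3 + h b 1"
  unfolding F_eq lam_1_\<nu> by simp

lemma F_high: "2 \<le> k \<Longrightarrow> F b k = lam k (1 - \<nu>) * coord b k + h b k"
  unfolding F_eq by simp

lemma h_0: "h 0 k = 0"
  by (rule remainder_0) (use \<nu>_le in simp)

lemma small_consequences:
  assumes "0 < C" "C \<le> C0"
  shows "64 * K * C * (1 + Z)\<^sup>2 \<le> 1" "64 * K * C * (1 + Z) \<le> 1" "64 * K * C \<le> 1" "0 \<le> \<theta> C" "\<theta> C \<le> C\<^sup>2 / 32"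
    "2 * K * C * Z \<le> 1 / 4" "2 * K * C * Z\<^sup>2 \<le> 4" "C \<le> 1 / 4" "C \<le> 1"
proof -
  have C: "C \<le> 1 / 4" "C \<le> 1" using assms C0_le by auto
  then show "C \<le> 1 / 4" "C \<le> 1" by auto
  have "64 * K * C * (1 + Z)\<^sup>2 \<le> 64 * K * C0 * (1 + Z)\<^sup>2"
    using assms K_pos by (intro mult_right_mono mult_left_mono) auto
  then show 1: "64 * K * C * (1 + Z)\<^sup>2 \<le> 1" using small by linarith
  have p: "0 \<le> 64 * K * C" using assms K_pos by simp
  have "1 + Z \<le> (1 + Z)\<^sup>2" using Z_ge by (intro self_le_power) auto
  from mult_left_mono[OF this p] show 2: "64 * K * C * (1 + Z) \<le> 1" using 1 by linarith
  have "64 * K * C * 1 \<le> 64 * K * C * (1 + Z)" using Z_ge by (intro mult_left_mono p) auto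
  then show "64 * K * C \<le> 1" using 2 by linarith
  show "0 \<le> \<theta> C" using assms K_pos Z_ge by (simp add: \<theta>_def)
  have "\<theta> C = (64 * K * C * (1 + Z)) * (C\<^sup>2 / 32)" by (simp add: \<theta>_def power2_eq_square power3_eq_cube)
  also have "\<dots> \<le> 1 * (C\<^sup>2 / 32)" using 2 by (intro mult_right_mono) auto
  finally show "\<theta> C \<le> C\<^sup>2 / 32" by simp
  have "64 * K * C * Z \<le> 64 * K * C * (1 + Z)" by (intro mult_left_mono p) auto
  then show "2 * K * C * Z \<le> 1 / 4" using 2 by linarith
  have "Z\<^sup>2 \<le> (1 + Z)\<^sup>2" using Z_ge by (intro power_mono) auto
  from mult_left_mono[OF this p] show "2 * K * C * Z\<^sup>2 \<le> 4" using 1 by linarith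
qed

lemma S_box4: "b \<in> S_box 4 C \<Longrightarrow> 2 \<le> k \<Longrightarrow> \<bar>coord b k\<bar> \<le> C ^ 3 / real k ^ 4"
  by (simp add: S_box_def powr_numeral)

lemma hk_bound2: "0 < C \<Longrightarrow> C \<le> 1 / 4 \<Longrightarrow> b \<in> S_box 4 C \<Longrightarrow> 2 \<le> k \<Longrightarrow> \<bar>h b k\<bar> \<le> K * C ^ 4 / (real k)\<^sup>2"
  using hk_bound[of C b k] by (simp add: powr_numeral)

text \<open>T is the derivative of \<open>Yp\<close> along the flow, term by term; the bound 100/k^2
  justifies the termwise differentiation later. Three quarters of the damping k^4 w_k^2 remain after
  absorption, that is at least 12 w_k^2, and the summed cross terms take away 4, which leaves -
  8.\<close>

lemma energy_perp:
  assumes C: "0 < C" "C \<le> C0" and u: "u \<in> S_box 4 C" and v: "v \<in> S_box 4 C"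
  defines "w \<equiv> u - v"
  defines "T \<equiv> \<lambda>k. 2 * coord w (k + 2) * (F u (k + 2) - F v (k + 2))"
  shows "\<bar>T k\<bar> \<le> 100 * (1 / (real (k + 2))\<^sup>2)" "summable T"
    "suminf T \<le> - 8 * Yp w + \<theta> C * ((coord w 1)\<^sup>2 + Yp w)"
proof -
  note sc = small_consequences[OF C]
  let ?x = "\<bar>coord w 1\<bar>" and ?y = "sqrt (Yp w)"
  have y2: "?y\<^sup>2 = Yp w" by (simp add: Yp_nonneg)
  have y0: "0 \<le> ?y" by (simp add: Yp_nonneg)
  define A where "A = K * C ^ 3 * ((coord w 1)\<^sup>2 + Yp w) + 2 * K * C * Z * Yp w"
  have abs: "\<bar>T k\<bar> \<le> 100 * (1 / (real (k + 2))\<^sup>2)" for k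
  proof -
    let ?k = "k + 2"
    have k: "1 \<le> real ?k" "2 \<le> ?k" by auto
    have C3: "C ^ 3 \<le> 1" "C ^ 4 \<le> 1" using C sc by (auto intro: power_le_one)
    have wk: "\<bar>coord w ?k\<bar> \<le> 2 / real ?k ^ 4"
    proof -
      have "\<bar>coord w ?k\<bar> \<le> 2 * (C ^ 3 / real ?k ^ 4)"
        using S_box4[OF u k(2)] S_box4[OF v k(2)] by (simp add: w_def)
      also have "\<dots> \<le> 2 * (1 / real ?k ^ 4)" using C3 by (intro mult_left_mono divide_right_mono) auto
      finally show ?thesis by simp
    qed
    have "K * C ^ 4 / (real ?k)\<^sup>2 \<le> 1 / 1"
    proof (intro frac_le)
      have "K * C ^ 4 = (K * C) * C ^ 3" by (simp add: power_numeral_reduce)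
      also have "\<dots> \<le> 1 * 1" using sc C C3 K_pos by (intro mult_mono) auto
      finally show "K * C ^ 4 \<le> 1" by simp
    qed auto
    then have hk: "\<bar>h u ?k\<bar> \<le> 1" "\<bar>h v ?k\<bar> \<le> 1"
      using order_trans[OF hk_bound2[OF C(1) sc(8) u k(2)]] order_trans[OF hk_bound2[OF C(1) sc(8) v k(2)]]
      by auto
    have "\<bar>lam ?k (1 - \<nu>) * coord w ?k\<bar> \<le> (2 * real ?k ^ 4) * (2 / real ?k ^ 4)"
      unfolding abs_mult using lam_high(2)[OF k(2)] wk by (intro mult_mono) auto
    also have "\<dots> = 4" by simp
    finally have "\<bar>F u ?k - F v ?k\<bar> \<le> 6"
      using hk F_high[OF k(2), of u] F_high[OF k(2), of v] by (simp add: w_def right_diff_distrib)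
    then have "\<bar>T k\<bar> \<le> 2 * (2 / real ?k ^ 4) * 6"
      unfolding T_def abs_mult using wk by (intro mult_mono) auto
    also have "\<dots> \<le> 100 * (1 / real ?k ^ 4)" by (simp add: divide_right_mono)
    also have "\<dots> \<le> 100 * (1 / (real ?k)\<^sup>2)" by (intro mult_left_mono divide_left_mono power_increasing) auto
    finally show ?thesis .
  qed
  then show "\<bar>T k\<bar> \<le> 100 * (1 / (real (k + 2))\<^sup>2)" .
  show sT: "summable T"
    by (rule summable_comparison_test'[OF summable_mult[OF sum_inverse_sq_shift2(1)], of 0])
      (use abs in \<open>simp only: real_norm_def\<close>)
  have le: "T k \<le> - 12 * (coord w (k + 2))\<^sup>2 + A * (1 / (real (k + 2))\<^sup>2)" for k
  proof -
    let ?k = "k + 2" and ?c = "coord w (k + 2)"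
    have k: "1 \<le> real ?k" "2 \<le> ?k" "0 < real ?k" by auto
    have k4: "16 \<le> real ?k ^ 4"
    proof -
      have "2 ^ 4 \<le> real ?k ^ 4" by (intro power_mono) auto
      then show ?thesis by simp
    qed
    have cy: "\<bar>?c\<bar> \<le> ?y" by (rule coord_le_sqrt_Yp) simp
    define q where "q = 1 / (real ?k)\<^sup>2"
    have q: "0 \<le> q" "1 / real ?k ^ 3 \<le> q"
      unfolding q_def by (auto intro!: divide_left_mono power_increasing)
    have "\<bar>h u ?k - h v ?k\<bar> \<le> K * (C ^ 3 * ?x / real ?k ^ 3 + C * real ?k * wconv ?k w)"
      using hk_diff[OF C(1) sc(8) u v k(2)] by (simp add: w_def)
    also have "\<dots> \<le> K * (C ^ 3 * ?x * q + C * real ?k * (2 * Z * ?y))"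
    proof (intro mult_left_mono add_mono wconv_le_Yp)
      show "C ^ 3 * ?x / real ?k ^ 3 \<le> C ^ 3 * ?x * q"
        using mult_left_mono[OF q(2), of "C ^ 3 * ?x"] C by simp
    qed (use C K_pos in auto)
    finally have hd: "\<bar>h u ?k - h v ?k\<bar> \<le> K * (C ^ 3 * ?x * q + C * real ?k * (2 * Z * ?y))" .
    have "2 * ?c * (h u ?k - h v ?k) \<le> 2 * (\<bar>?c\<bar> * \<bar>h u ?k - h v ?k\<bar>)"
      using abs_ge_self[of "?c * (h u ?k - h v ?k)"] by (simp add: abs_mult)
    also have "\<dots> \<le> 2 * (\<bar>?c\<bar> * (K * (C ^ 3 * ?x * q + C * real ?k * (2 * Z * ?y))))"
      using hd by (intro mult_left_mono) auto
    also have "\<dots> = K * C ^ 3 * q * (2 * (?x * \<bar>?c\<bar>)) + 2 * K * C * Z * (2 * ((real ?k * \<bar>?c\<bar>) * ?y))"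
      by (simp add: algebra_simps)
    also have "\<dots> \<le> K * C ^ 3 * q * ((coord w 1)\<^sup>2 + Yp w) + 2 * K * C * Z * (real ?k ^ 4 * ?c\<^sup>2 + Yp w * q)"
    proof (intro add_mono mult_left_mono)
      have "2 * (?x * \<bar>?c\<bar>) \<le> 2 * (?x * ?y)" using cy by (intro mult_left_mono) auto
      also have "\<dots> \<le> ?x\<^sup>2 + ?y\<^sup>2" by (rule two_mult_le)
      finally show "2 * (?x * \<bar>?c\<bar>) \<le> (coord w 1)\<^sup>2 + Yp w" by (simp add: Yp_nonneg)
      \<comment> \<open>The loss k \<bar>w_k\<bar> y is split as (k^2 \<bar>w_k\<bar>) (y / k): the
        first square is absorbed by the damping and the second is summable over k.\<close>
      have "2 * ((real ?k * \<bar>?c\<bar>) * ?y) = 2 * (((real ?k)\<^sup>2 * \<bar>?c\<bar>) * (?y / real ?k))"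
        using k by (simp add: power2_eq_square)
      also have "\<dots> \<le> ((real ?k)\<^sup>2 * \<bar>?c\<bar>)\<^sup>2 + (?y / real ?k)\<^sup>2" by (rule two_mult_le)
      also have "\<dots> = real ?k ^ 4 * ?c\<^sup>2 + Yp w * q"
        unfolding power_mult_distrib power_divide y2 q_def by (simp add: power4_eq_xxxx power2_eq_square)
      finally show "2 * ((real ?k * \<bar>?c\<bar>) * ?y) \<le> real ?k ^ 4 * ?c\<^sup>2 + Yp w * q" .
    qed (use C K_pos Z_ge q in auto)
    finally have 1: "2 * ?c * (h u ?k - h v ?k) \<le> 2 * K * C * Z * (real ?k ^ 4 * ?c\<^sup>2) + A * q"
      by (simp add: A_def algebra_simps)
    have "2 * K * C * Z * (real ?k ^ 4 * ?c\<^sup>2) \<le> 1 / 4 * (real ?k ^ 4 * ?c\<^sup>2)"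
      using sc by (intro mult_right_mono) auto
    moreover have "2 * ?c * (lam ?k (1 - \<nu>) * ?c) \<le> - (real ?k ^ 4 * ?c\<^sup>2)"
      using mult_right_mono[OF lam_high(1)[OF k(2)], of "2 * ?c\<^sup>2"] by (simp add: power2_eq_square algebra_simps)
    moreover have "12 * ?c\<^sup>2 \<le> 3 / 4 * (real ?k ^ 4 * ?c\<^sup>2)"
      using mult_right_mono[OF k4, of "?c\<^sup>2"] by (simp add: mult.commute)
    moreover have "T k = 2 * ?c * (lam ?k (1 - \<nu>) * ?c) + 2 * ?c * (h u ?k - h v ?k)"
      unfolding T_def F_high[OF k(2)] by (simp add: w_def algebra_simps)
    ultimately show ?thesis using 1 unfolding q_def by linarith
  qed
  have sw: "summable (\<lambda>k. - 12 * (coord w (k + 2))\<^sup>2)"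
    by (intro summable_mult summable_coord_shift_sq)
  have "suminf T \<le> (\<Sum>k. - 12 * (coord w (k + 2))\<^sup>2 + A * (1 / (real (k + 2))\<^sup>2))"
    by (intro suminf_le le sT summable_add sw summable_mult sum_inverse_sq_shift2)
  also have "\<dots> = (\<Sum>k. - 12 * (coord w (k + 2))\<^sup>2) + (\<Sum>k. A * (1 / (real (k + 2))\<^sup>2))"
    by (intro suminf_add[symmetric] sw summable_mult sum_inverse_sq_shift2)
  also have "\<dots> = - 12 * Yp w + A * (\<Sum>k. 1 / (real (k + 2))\<^sup>2)"
    unfolding Yp_def by (simp only: suminf_mult[OF summable_coord_shift_sq] suminf_mult[OF sum_inverse_sq_shift2(1)])
  also have "\<dots> \<le> - 12 * Yp w + A * Z"
    using C K_pos Z_ge Yp_nonneg[of w] sum_inverse_sq_shift2(2)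
    by (intro add_left_mono mult_left_mono) (auto simp: A_def)
  also have "A * Z = K * C ^ 3 * Z * ((coord w 1)\<^sup>2 + Yp w) + 2 * K * C * Z\<^sup>2 * Yp w"
    by (simp add: A_def power2_eq_square algebra_simps)
  also have "- 12 * Yp w + (K * C ^ 3 * Z * ((coord w 1)\<^sup>2 + Yp w) + 2 * K * C * Z\<^sup>2 * Yp w) \<le>
      - 12 * Yp w + (\<theta> C * ((coord w 1)\<^sup>2 + Yp w) + 4 * Yp w)"
  proof (intro add_left_mono add_mono mult_right_mono)
    have "K * C ^ 3 * Z \<le> K * C ^ 3 * (2 * (1 + Z))" using K_pos C Z_ge by (intro mult_left_mono) auto
    also have "\<dots> = \<theta> C" by (simp add: \<theta>_def)
    finally show "K * C ^ 3 * Z \<le> \<theta> C" .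
  qed (use sc Yp_nonneg in auto)
  finally show "suminf T \<le> - 8 * Yp w + \<theta> C * ((coord w 1)\<^sup>2 + Yp w)" by simp
qed

text \<open>Factoring the difference of cubes isolates the divided difference m of \<nu> x -
  \<kappa> x^3; only the difference of h_1 is left to be estimated.\<close>

lemma energy_1:
  assumes C: "0 < C" "C \<le> C0" and u: "u \<in> S_box 4 C" and v: "v \<in> S_box 4 C"
  defines "w \<equiv> u - v"
  defines "m \<equiv> \<nu> - \<kappa> * ((coord u 1)\<^sup>2 + coord u 1 * coord v 1 + (coord v 1)\<^sup>2)"
  shows "\<bar>2 * coord w 1 * (F u 1 - F v 1) - 2 * m * (coord w 1)\<^sup>2\<bar> \<le> \<theta> C * ((coord w 1)\<^sup>2 + Yp w)"
proof -
  note sc = small_consequences[OF C]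
  let ?x = "\<bar>coord w 1\<bar>" and ?y = "sqrt (Yp w)"
  have "2 * coord w 1 * (F u 1 - F v 1) - 2 * m * (coord w 1)\<^sup>2 = 2 * coord w 1 * (h u 1 - h v 1)"
    unfolding F_1 by (simp add: w_def m_def power2_eq_square power3_eq_cube algebra_simps)
  then have "\<bar>2 * coord w 1 * (F u 1 - F v 1) - 2 * m * (coord w 1)\<^sup>2\<bar> = 2 * (?x * \<bar>h u 1 - h v 1\<bar>)"
    by (simp add: abs_mult)
  also have "\<dots> \<le> 2 * (?x * (K * (C ^ 3 * (?x + Z * ?y))))"
  proof (intro mult_left_mono)
    have "\<bar>h u 1 - h v 1\<bar> \<le> K * (C ^ 3 * (?x + wstar w))"
      using h1_diff[OF C(1) sc(8) u v] by (simp add: w_def)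
    also have "\<dots> \<le> K * (C ^ 3 * (?x + Z * ?y))"
      using K_pos C by (intro mult_left_mono add_left_mono wstar_le_Yp) auto
    finally show "\<bar>h u 1 - h v 1\<bar> \<le> K * (C ^ 3 * (?x + Z * ?y))" .
  qed auto
  also have "\<dots> = K * C ^ 3 * (2 * ?x\<^sup>2 + Z * (2 * (?x * ?y)))"
    by (simp add: power2_eq_square algebra_simps)
  also have "\<dots> \<le> K * C ^ 3 * (2 * (?x\<^sup>2 + ?y\<^sup>2) + Z * (2 * (?x\<^sup>2 + ?y\<^sup>2)))"
  proof (intro mult_left_mono add_mono)
    have "0 \<le> ?x * ?y" using Yp_nonneg by simp
    then have "?x * ?y \<le> 2 * (?x * ?y)" by linarith
    then show "?x * ?y \<le> ?x\<^sup>2 + ?y\<^sup>2" by (rule order_trans[OF _ two_mult_le])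
  qed (use K_pos C Z_ge in auto)
  also have "\<dots> = \<theta> C * (?x\<^sup>2 + ?y\<^sup>2)" by (simp add: \<theta>_def algebra_simps)
  finally show ?thesis by (simp add: Yp_nonneg)
qed

end

text \<open>The derivative may be that of an infinite sum, known only to exist, so the integrating
  factor is combined with the mean value theorem instead of an integration.\<close>

lemma gronwall_le:
  fixes f :: "real \<Rightarrow> real"
  assumes D: "\<And>t. 0 \<le> t \<Longrightarrow> t \<le> T \<Longrightarrow> (f has_real_derivative D t) (at t within {0..T})"
    and le: "\<And>t. 0 \<le> t \<Longrightarrow> t \<le> T \<Longrightarrow> D t \<le> a * f t" and T: "0 \<le> T"
  shows "f T \<le> exp (a * T) * f 0"
proof (cases "T = 0")
  case False
  then have T0: "0 < T" using T by simp
  define g where "g t = exp (- a * t) * f t" for t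
  have g: "(g has_real_derivative exp (- a * t) * (D t - a * f t)) (at t within {0..T})" if "0 \<le> t" "t \<le> T" for t
    unfolding g_def by (rule derivative_eq_intros D that refl)+ (simp add: algebra_simps)
  have "continuous_on {0..T} g"
    using g DERIV_continuous unfolding continuous_on_eq_continuous_within by fastforce
  moreover have "(g has_derivative (\<lambda>h. exp (- a * t) * (D t - a * f t) * h)) (at t)" if "0 < t" "t < T" for t
    using g[of t] that at_within_interior[of t "{0..T}"] by (simp add: has_field_derivative_def)
  ultimately obtain \<xi> where \<xi>: "0 < \<xi>" "\<xi> < T" "g T - g 0 = exp (- a * \<xi>) * (D \<xi> - a * f \<xi>) * (T - 0)"
    using mvt[OF T0, of g "\<lambda>t h. exp (- a * t) * (D t - a * f t) * h"] by blast
  have "exp (- a * \<xi>) * (D \<xi> - a * f \<xi>) * (T - 0) \<le> 0"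
    using le[of \<xi>] \<xi> by (intro mult_nonpos_nonneg mult_nonneg_nonpos) auto
  then have "exp (- a * T) * f T \<le> f 0" using \<xi>(3) by (simp add: g_def)
  then have "exp (a * T) * (exp (- a * T) * f T) \<le> exp (a * T) * f 0" by (intro mult_left_mono) auto
  moreover have "exp (a * T) * (exp (- a * T) * f T) = f T"
    by (simp flip: mult.assoc exp_add)
  ultimately show ?thesis by metis
qed simp

lemma gronwall_ge:
  fixes f :: "real \<Rightarrow> real"
  assumes D: "\<And>t. 0 \<le> t \<Longrightarrow> t \<le> T \<Longrightarrow> (f has_real_derivative D t) (at t within {0..T})"
    and le: "\<And>t. 0 \<le> t \<Longrightarrow> t \<le> T \<Longrightarrow> a * f t \<le> D t" and T: "0 \<le> T"
  shows "exp (a * T) * f 0 \<le> f T"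
  using gronwall_le[of T "\<lambda>t. - f t" "\<lambda>t. - D t" a] assms by (auto intro!: DERIV_minus)

lemma cube_diff_le:
  fixes x y :: real
  assumes "\<bar>x\<bar> \<le> 1 / 2" "\<bar>y\<bar> \<le> 1 / 2" shows "\<bar>x ^ 3 - y ^ 3\<bar> \<le> \<bar>x - y\<bar>"
proof -
  have a: "\<bar>a * b\<bar> \<le> 1 / 2 * (1 / 2)" if "\<bar>a\<bar> \<le> 1 / 2" "\<bar>b\<bar> \<le> 1 / 2" for a b :: real
    unfolding abs_mult using that by (intro mult_mono) auto
  have "\<bar>x * x + x * y + y * y\<bar> \<le> 1"
    using a[OF assms(1) assms(1)] a[OF assms] a[OF assms(2) assms(2)] by linarith
  then have "\<bar>x - y\<bar> * \<bar>x * x + x * y + y * y\<bar> \<le> \<bar>x - y\<bar> * 1" by (intro mult_left_mono) auto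
  moreover have "x ^ 3 - y ^ 3 = (x - y) * (x * x + x * y + y * y)"
    by (simp add: power3_eq_cube algebra_simps)
  ultimately show ?thesis by (simp add: abs_mult)
qed

section \<open>Global existence in trapping boxes\<close>

context ks_dyn
begin

interpretation sbox 4 by unfold_locales simp

lemma nonlinear_lipschitz:
  assumes x: "x \<in> nf_dom" and y: "y \<in> nf_dom" and k: "1 \<le> k"
  shows "\<bar>(F x k - lam k (1 - \<nu>) * coord x k) - (F y k - lam k (1 - \<nu>) * coord y k)\<bar> \<le> (L + 1) * real k * norm (x - y)"
proof -
  have h: "\<bar>h x k - h y k\<bar> \<le> L * real k * norm (x - y)" by (rule h_lip[OF assms])
  have n: "norm (x - y) \<le> real k * norm (x - y)" using k mult_right_mono[of 1 "real k" "norm (x - y)"] by simp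
  have c: "\<bar>(if k = 1 then - \<kappa> * coord x 1 ^ 3 else 0) - (if k = 1 then - \<kappa> * coord y 1 ^ 3 else 0)\<bar> \<le> norm (x - y)"
  proof (cases "k = 1")
    case True
    have "\<bar>\<kappa> * (coord y 1 ^ 3 - coord x 1 ^ 3)\<bar> \<le> 1 * \<bar>coord y 1 - coord x 1\<bar>"
      unfolding abs_mult using \<kappa>_bounds nf_domD[OF x] nf_domD[OF y] by (intro mult_mono cube_diff_le) auto
    also have "\<dots> \<le> norm (x - y)" using abs_coord_le_norm[of "x - y" 1] by (simp add: abs_minus_commute)
    finally show ?thesis using True by (simp add: right_diff_distrib)
  qed simp
  show ?thesis unfolding F_eq using h n c by (simp add: distrib_right) 
qed

lemma lam_upper: "1 \<le> k \<Longrightarrow> 1 / 4 * real k ^ 4 - 1 \<le> - lam k (1 - \<nu>)"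
proof (cases "k = 1")
  case True then show ?thesis using \<nu>_le unfolding True lam_1_\<nu> by simp
next
  case False
  moreover assume "1 \<le> k"
  ultimately have "2 \<le> k" by simp
  from lam_high(1)[OF this] show ?thesis using zero_le_power[of "real k" 4] by linarith
qed

text \<open>The offset 1 admits the first mode, whose rate - \<nu> may be negative, under a lower
  bound proportional to k^4.\<close>

sublocale damped_system nf_dom F "\<lambda>k. - lam k (1 - \<nu>)" "1 / 4" 1 "L + 1"
  by unfold_locales (use L_pos lam_upper nonlinear_lipschitz in auto)

lemma zero_in_dom: "0 \<in> nf_dom"
  by (simp add: nf_dom_def)

lemma F_0: "F 0 k = 0"
  unfolding F_eq h_0 by simp

text \<open>Transfers the existence result for inward-pointing boxes to F; uniqueness identifies the
  solution with the semiflow.\<close>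

lemma box_flow:
  assumes lr: "\<And>k. k \<ge> 1 \<Longrightarrow> l k \<le> r k"
    and B: "\<And>k. k \<ge> 1 \<Longrightarrow> \<bar>l k\<bar> \<le> B / real k" "\<And>k. k \<ge> 1 \<Longrightarrow> \<bar>r k\<bar> \<le> B / real k"
    and dom: "ell2_box l r \<subseteq> nf_dom"
    and in_r: "\<And>x k. x \<in> ell2_box l r \<Longrightarrow> k \<ge> 1 \<Longrightarrow> coord x k = r k \<Longrightarrow> F x k \<le> 0"
    and in_l: "\<And>x k. x \<in> ell2_box l r \<Longrightarrow> k \<ge> 1 \<Longrightarrow> coord x k = l k \<Longrightarrow> 0 \<le> F x k"
    and p: "p \<in> ell2_box l r"
  shows "exit_time p = \<infinity>" "0 \<le> t \<Longrightarrow> flow t p \<in> ell2_box l r"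
proof -
  \<comment> \<open>\<open>inward_box\<close> demands a positive rate in every mode, so the first
    mode is given the artificial rate 1 and the same term is added to the nonlinearity.\<close>
  define d where "d k = (if k = 1 then 1 else - lam k (1 - \<nu>))" for k
  have d_lam: "\<bar>d k + lam k (1 - \<nu>)\<bar> \<le> 2" for k
  proof (cases "k = 1")
    case True
    show ?thesis unfolding True lam_1_\<nu> d_def using \<nu>_le by simp
  qed (simp add: d_def)
  have lip: "\<bar>(F x k + d k * coord x k) - (F y k + d k * coord y k)\<bar> \<le> (L + 3) * real k * norm (x - y)"
    if "x \<in> nf_dom" "y \<in> nf_dom" "1 \<le> k" for x y k
  proof -
    have "(F x k + d k * coord x k) - (F y k + d k * coord y k) =
        ((F x k - lam k (1 - \<nu>) * coord x k) - (F y k - lam k (1 - \<nu>) * coord y k))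
        + (d k + lam k (1 - \<nu>)) * coord (x - y) k" by (simp add: algebra_simps)
    also have "\<bar>\<dots>\<bar> \<le> (L + 1) * real k * norm (x - y) + 2 * norm (x - y)"
    proof (rule order_trans[OF abs_triangle_ineq], intro add_mono nonlinear_lipschitz[OF that])
      show "\<bar>(d k + lam k (1 - \<nu>)) * coord (x - y) k\<bar> \<le> 2 * norm (x - y)"
        unfolding abs_mult by (intro mult_mono d_lam abs_coord_le_norm) auto
    qed
    also have "2 * norm (x - y) \<le> 2 * real k * norm (x - y)" using that by (intro mult_right_mono) auto
    finally show ?thesis by (simp add: algebra_simps)
  qed
  interpret B: inward_box l r d "\<lambda>x k. F x k + d k * coord x k" "1 / 2" B "L + 3"
  proof
    fix k :: nat assume k: "1 \<le> k"
    show "1 / 2 * real k ^ 4 \<le> d k"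
    proof (cases "k = 1")
      case False
      then show ?thesis using lam_high(1)[of k] k by (simp add: d_def)
    qed (simp add: d_def)
    fix x assume x: "x \<in> ell2_box l r"
    then have xd: "x \<in> nf_dom" using dom by blast
    have "\<bar>F x k + d k * coord x k\<bar> \<le> (L + 3) * real k * norm x"
      using lip[OF xd zero_in_dom k] by (simp add: F_0)
    also have "\<dots> \<le> (L + 3) * real k * 1" using xd L_pos by (intro mult_left_mono) (auto simp: nf_dom_def)
    finally show "\<bar>F x k + d k * coord x k\<bar> \<le> (L + 3) * real k" by simp
  qed (use L_pos lr B lip dom in_r in_l in \<open>auto simp: subset_iff\<close>)
  obtain u where u: "u 0 = p" "continuous_on {0..} u" "\<And>t. t \<ge> 0 \<Longrightarrow> u t \<in> ell2_box l r"
    "\<And>t k. t \<ge> 0 \<Longrightarrow> k \<ge> 1 \<Longrightarrow>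
      ((\<lambda>t. coord (u t) k) has_real_derivative (- d k * coord (u t) k + (F (u t) k + d k * coord (u t) k))) (at t within {0..})"
    using B.solution_exists[OF p] by blast
  have D: "{t. 0 \<le> t \<and> ereal t < \<infinity>} = {0..}" by auto
  have sol: "solution_on nf_dom F \<infinity> u"
    unfolding solution_on_def Let_def D using u dom by auto
  from solution_exit_time[OF _ sol u(1)] show "exit_time p = \<infinity>" by simp
  show "flow t p \<in> ell2_box l r" if "0 \<le> t"
    using solution_exit_time(2)[OF _ sol u(1) that] u(3)[OF that] by simp
qed

definition rad :: "real \<Rightarrow> nat \<Rightarrow> real" where "rad C k = (if k = 1 then sqrt 2 * C else C ^ 3 / real k ^ 4)"

lemma S_box_eq: "S_box 4 C = ell2_box (\<lambda>k. - rad C k) (rad C)"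
proof -
  have "b \<in> S_box 4 C \<longleftrightarrow> (\<forall>k\<ge>1. \<bar>coord b k\<bar> \<le> rad C k)" for b
  proof
    show "\<forall>k\<ge>1. \<bar>coord b k\<bar> \<le> rad C k" if "b \<in> S_box 4 C"
      using that by (auto simp: S_box_def rad_def powr_numeral)
    show "b \<in> S_box 4 C" if *: "\<forall>k\<ge>1. \<bar>coord b k\<bar> \<le> rad C k"
      unfolding S_box_def mem_Collect_eq
    proof (intro conjI allI impI)
      show "\<bar>coord b 1\<bar> \<le> sqrt 2 * C" using *[rule_format, of 1] by (simp add: rad_def)
      show "\<bar>coord b k\<bar> \<le> C ^ 3 / real k powr 4" if "2 \<le> k" for k
        using *[rule_format, of k] that by (simp add: rad_def powr_numeral)
    qed
  qed
  moreover have "\<bar>a\<bar> \<le> c \<longleftrightarrow> - c \<le> a \<and> a \<le> c" for a c :: real by auto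
  ultimately show ?thesis by (simp add: ell2_box_def set_eq_iff)
qed

lemma rad_bounds:
  assumes "0 < C" "C \<le> 1" "1 \<le> k" shows "0 < rad C k" "rad C k \<le> 2 * C / real k"
proof -
  show "0 < rad C k" using assms by (simp add: rad_def)
  show "rad C k \<le> 2 * C / real k"
  proof (cases "k = 1")
    case True
    have "sqrt 2 * C \<le> 2 * C" using assms sqrt2_less_2 by (intro mult_right_mono) auto
    then show ?thesis using True by (simp add: rad_def)
  next
    case False
    have "C ^ 3 / real k ^ 4 \<le> C / real k"
      using assms power_decreasing[of 1 3 C] by (intro frac_le) (auto intro: self_le_power)
    also have "\<dots> \<le> 2 * C / real k" using assms by (intro divide_right_mono) auto
    finally show ?thesis using False by (simp add: rad_def)
  qed
qed

lemma summable_rad: assumes "0 < C" "C \<le> 1" shows "summable (\<lambda>k. (\<bar>- rad C k\<bar> + \<bar>rad C k\<bar>)\<^sup>2)"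
proof (rule summable_comparison_test'[of "\<lambda>k. 16 * C\<^sup>2 * (1 / real k ^ 2)" 1])
  show "summable (\<lambda>k. 16 * C\<^sup>2 * (1 / real k ^ 2))"
    by (intro summable_mult) (use inverse_power_summable[of 2, where 'a = real] in \<open>simp add: divide_inverse\<close>)
  fix k :: nat assume k: "1 \<le> k"
  have "(\<bar>- rad C k\<bar> + \<bar>rad C k\<bar>)\<^sup>2 \<le> (2 * (2 * C / real k))\<^sup>2"
    using rad_bounds[OF assms k] by (intro power_mono) auto
  then show "norm ((\<bar>- rad C k\<bar> + \<bar>rad C k\<bar>)\<^sup>2) \<le> 16 * C\<^sup>2 * (1 / real k ^ 2)"
    by (simp add: power_divide power_mult_distrib)
qed

lemma S_box_mono: assumes "0 < C" "C \<le> C'" shows "S_box 4 C \<subseteq> S_box 4 C'"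
proof -
  have "sqrt 2 * C \<le> sqrt 2 * C'" using assms by (intro mult_left_mono) auto
  moreover have "C ^ 3 / real k powr 4 \<le> C' ^ 3 / real k powr 4" for k
    using assms by (intro divide_right_mono power_mono) auto
  ultimately show ?thesis unfolding S_box_def by (fastforce intro: order_trans)
qed

text \<open>On the face the damping contributes at most - C^3/2, because k^4 cancels against the
  width of the box, while h_k contributes at most C^3/64. The sign \<sigma> treats opposite faces
  together.\<close>

lemma high_face:
  assumes C: "0 < C" "C \<le> C0" and x: "x \<in> S_box 4 C" and k: "2 \<le> k" and \<sigma>: "\<sigma> \<in> {1, -1}"
    and face: "\<sigma> * coord x k = C ^ 3 / real k ^ 4"
  shows "\<sigma> * F x k \<le> 0"
proof -
  note sc = small_consequences[OF C]
  have k4: "0 < real k ^ 4" using k by simp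
  have "\<sigma> * F x k = lam k (1 - \<nu>) * (\<sigma> * coord x k) + \<sigma> * h x k"
    unfolding F_high[OF k] by (simp add: algebra_simps)
  also have "lam k (1 - \<nu>) * (\<sigma> * coord x k) \<le> - (real k ^ 4 / 2) * (C ^ 3 / real k ^ 4)"
    unfolding face using lam_high(1)[OF k] C by (intro mult_right_mono) auto
  also have "\<dots> = - (C ^ 3 / 2)" using k by simp
  also have "\<sigma> * h x k \<le> K * C ^ 4 / (real k)\<^sup>2"
    using hk_bound2[OF C(1) sc(8) x k] \<sigma> by auto
  also have "\<dots> \<le> K * C ^ 4 / 1"
    using K_pos C k by (intro divide_left_mono) (auto simp: power_le_one_iff)
  also have "\<dots> = (K * C) * C ^ 3" by (simp add: power_numeral_reduce)
  also have "\<dots> \<le> 1 / 64 * C ^ 3" using sc C by (intro mult_right_mono) auto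
  finally have "\<sigma> * F x k \<le> - (C ^ 3 / 2) + 1 / 64 * C ^ 3" by simp
  moreover have "0 \<le> C ^ 3" using C by simp
  ultimately show ?thesis by linarith
qed

text \<open>With \<nu> \<le> \<kappa> C^2 the truncated field is at most - \<kappa> y (y^2 - C^2),
  which from y = 11/10 C on is below - 63/1000 C^3 and beats the error C^3/64. The threshold lies
  below the face sqrt 2 C; this margin is what later shrinks the box around full
  trajectories.\<close>

lemma low_face:
  assumes C: "0 < C" "C \<le> C0" "\<nu> \<le> \<kappa> * C\<^sup>2" and x: "x \<in> S_box 4 C" and \<sigma>: "\<sigma> \<in> {1, -1}"
    and face: "11 / 10 * C \<le> \<sigma> * coord x 1"
  shows "\<sigma> * F x 1 \<le> - (C ^ 3 / 100)"
proof -
  note sc = small_consequences[OF C(1,2)]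
  define y where "y = \<sigma> * coord x 1"
  have \<sigma>3: "\<sigma> * coord x 1 ^ 3 = y ^ 3" using \<sigma> by (auto simp: y_def)
  have "\<sigma> * F x 1 = \<nu> * y - \<kappa> * y ^ 3 + \<sigma> * h x 1"
    unfolding F_1 \<sigma>3[symmetric] by (simp add: y_def algebra_simps)
  also have "\<nu> * y \<le> \<kappa> * C\<^sup>2 * y" using C face by (intro mult_right_mono) (auto simp: y_def)
  also have "\<kappa> * C\<^sup>2 * y - \<kappa> * y ^ 3 = - (\<kappa> * (y * (y\<^sup>2 - C\<^sup>2)))"
    by (simp add: power2_eq_square power3_eq_cube algebra_simps)
  also have "\<sigma> * h x 1 \<le> K * C ^ 5" using h1_bound[OF C(1) sc(8) x] \<sigma> by auto
  also have "K * C ^ 5 \<le> 1 / 64 * C ^ 3"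
  proof -
    have "K * C ^ 5 = (K * C) * C * C ^ 3" by (simp add: power_numeral_reduce)
    also have "\<dots> \<le> 1 / 64 * 1 * C ^ 3" using sc C K_pos by (intro mult_mono) auto
    finally show ?thesis by simp
  qed
  also have "- (\<kappa> * (y * (y\<^sup>2 - C\<^sup>2))) \<le> - (3 / 10 * (C * (21 / 100 * C\<^sup>2)))"
  proof -
    have "(11 / 10 * C)\<^sup>2 \<le> y\<^sup>2" using C face by (intro power_mono) (auto simp: y_def)
    then have "21 / 100 * C\<^sup>2 \<le> y\<^sup>2 - C\<^sup>2" by (simp add: power2_eq_square)
    then have "3 / 10 * (C * (21 / 100 * C\<^sup>2)) \<le> \<kappa> * (y * (y\<^sup>2 - C\<^sup>2))"
      using C face \<kappa>_bounds by (intro mult_mono) (auto simp: y_def)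
    then show ?thesis by simp
  qed
  finally have "\<sigma> * F x 1 \<le> - (3 / 10 * (C * (21 / 100 * C\<^sup>2))) + 1 / 64 * C ^ 3" by simp
  also have "\<dots> = - (63 / 1000 - 1 / 64) * C ^ 3" by (simp add: power2_eq_square power3_eq_cube)
  also have "\<dots> \<le> - (1 / 100) * C ^ 3" using C by (intro mult_right_mono) auto
  finally show ?thesis by simp
qed

lemma S_box_flow:
  assumes C: "0 < C" "C \<le> C0" "\<nu> \<le> \<kappa> * C\<^sup>2" and p: "p \<in> S_box 4 C"
  shows "exit_time p = \<infinity>" "0 \<le> t \<Longrightarrow> flow t p \<in> S_box 4 C"
proof -
  have C1: "C \<le> 1" "C \<le> 1 / 10" using C C0_le by auto
  have s2: "11 / 10 * C \<le> sqrt 2 * C"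
  proof (intro mult_right_mono)
    show "11 / 10 \<le> sqrt 2" by (rule real_le_rsqrt) (simp add: power2_eq_square)
  qed (use C in simp)
  have in_face: "\<sigma> * F x k \<le> 0" if x: "x \<in> S_box 4 C" and k: "1 \<le> k" and f: "\<sigma> * coord x k = rad C k" and \<sigma>: "\<sigma> \<in> {1, -1}" for x k \<sigma>
  proof (cases "k = 1")
    case True
    have "\<sigma> * F x 1 \<le> - (C ^ 3 / 100)"
      using f s2 True by (intro low_face[OF C x \<sigma>]) (simp add: rad_def)
    moreover have "0 \<le> C ^ 3" using C by simp
    ultimately show ?thesis unfolding True by linarith
  next
    case False
    then show ?thesis using f k by (intro high_face[OF C(1,2) x _ \<sigma>]) (auto simp: rad_def)
  qed
  have "ell2_box (\<lambda>k. - rad C k) (rad C) \<subseteq> nf_dom"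
    unfolding S_box_eq[symmetric] by (rule S_box_subset_dom[OF C(1) C1(2)])
  moreover have "F x k \<le> 0" if "x \<in> ell2_box (\<lambda>k. - rad C k) (rad C)" "1 \<le> k" "coord x k = rad C k" for x k
    using in_face[of x k 1] that unfolding S_box_eq[symmetric] by simp
  moreover have "0 \<le> F x k" if "x \<in> ell2_box (\<lambda>k. - rad C k) (rad C)" "1 \<le> k" "coord x k = - rad C k" for x k
    using in_face[of x k "-1"] that unfolding S_box_eq[symmetric] by simp
  moreover have "- rad C k \<le> rad C k" "\<bar>- rad C k\<bar> \<le> 2 * C / real k" "\<bar>rad C k\<bar> \<le> 2 * C / real k" if "1 \<le> k" for k
    using rad_bounds[OF C(1) C1(1) that] by auto
  ultimately show "exit_time p = \<infinity>" "0 \<le> t \<Longrightarrow> flow t p \<in> S_box 4 C"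
    using box_flow(1)[of "\<lambda>k. - rad C k" "rad C" "2 * C" p] box_flow(2)[of "\<lambda>k. - rad C k" "rad C" "2 * C" p t] p
    unfolding S_box_eq by blast+
qed

end

section \<open>Differences of solutions: cone condition, contraction and growth\<close>

context ks_dyn
begin

interpretation sbox 4 by unfold_locales simp

text \<open>The divided difference of \<nu> x - \<kappa> x^3 between the first coordinates of u and
  v.\<close>

definition slope :: "ell2 \<Rightarrow> ell2 \<Rightarrow> real" where
  "slope u v = \<nu> - \<kappa> * ((coord u 1)\<^sup>2 + coord u 1 * coord v 1 + (coord v 1)\<^sup>2)"

text \<open>\<open>Yp\<close> is an infinite sum, differentiated term by term: the bound 100/k^2
  from \<open>energy_perp\<close> gives uniform convergence of the derivatives by the Weierstrass
  test.\<close>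

lemma flow_energy:
  assumes C: "0 < C" "C \<le> C0"
    and p: "\<And>s. 0 \<le> s \<Longrightarrow> s \<le> T \<Longrightarrow> flow s p \<in> S_box 4 C" "ereal T < exit_time p"
    and q: "\<And>s. 0 \<le> s \<Longrightarrow> s \<le> T \<Longrightarrow> flow s q \<in> S_box 4 C" "ereal T < exit_time q"
    and T: "0 \<le> T"
  obtains DX DY where
    "\<And>t. 0 \<le> t \<Longrightarrow> t \<le> T \<Longrightarrow> ((\<lambda>t. (coord (flow t p - flow t q) 1)\<^sup>2) has_real_derivative DX t) (at t within {0..T})"
    "\<And>t. 0 \<le> t \<Longrightarrow> t \<le> T \<Longrightarrow> ((\<lambda>t. Yp (flow t p - flow t q)) has_real_derivative DY t) (at t within {0..T})"
    "\<And>t. 0 \<le> t \<Longrightarrow> t \<le> T \<Longrightarrow> DY t \<le> - 8 * Yp (flow t p - flow t q)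
      + \<theta> C * ((coord (flow t p - flow t q) 1)\<^sup>2 + Yp (flow t p - flow t q))"
    "\<And>t. 0 \<le> t \<Longrightarrow> t \<le> T \<Longrightarrow>
      \<bar>DX t - 2 * slope (flow t p) (flow t q) * (coord (flow t p - flow t q) 1)\<^sup>2\<bar> \<le>
      \<theta> C * ((coord (flow t p - flow t q) 1)\<^sup>2 + Yp (flow t p - flow t q))"
proof -
  define w where "w t = flow t p - flow t q" for t
  have der: "((\<lambda>t. (coord (w t) k)\<^sup>2) has_real_derivative 2 * coord (w t) k * (F (flow t p) k - F (flow t q) k)) (at t within {0..T})"
    if "0 \<le> t" "t \<le> T" "1 \<le> k" for t k
  proof -
    have "((\<lambda>t. coord (flow t p) k - coord (flow t q) k) has_real_derivative F (flow t p) k - F (flow t q) k) (at t within {0..T})"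
      by (intro DERIV_diff solution_on_seg(3)[OF flow_solution T] p q that)
    then have "((\<lambda>t. coord (w t) k) has_real_derivative F (flow t p) k - F (flow t q) k) (at t within {0..T})"
      by (simp add: w_def)
    from DERIV_power[OF this, of 2] show ?thesis by (simp add: mult_ac)
  qed
  define TT where "TT t k = 2 * coord (w t) (k + 2) * (F (flow t p) (k + 2) - F (flow t q) (k + 2))" for t k
  have en: "\<bar>TT t k\<bar> \<le> 100 * (1 / (real (k + 2))\<^sup>2)" "suminf (TT t) \<le> - 8 * Yp (w t) + \<theta> C * ((coord (w t) 1)\<^sup>2 + Yp (w t))"
    if "0 \<le> t" "t \<le> T" for t k
    using energy_perp[OF C p(1)[OF that] q(1)[OF that]] unfolding TT_def w_def by blast+
  have "\<exists>g. \<forall>t\<in>{0..T}. (\<lambda>k. (coord (w t) (k + 2))\<^sup>2) sums g t \<and> (g has_real_derivative suminf (TT t)) (at t within {0..T})"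
  proof (rule has_field_derivative_series)
    show "convex {0..T}" by simp
    show "((\<lambda>t. (coord (w t) (k + 2))\<^sup>2) has_real_derivative TT t k) (at t within {0..T})" if "t \<in> {0..T}" for k t
      using der[of t "k + 2"] that by (simp add: TT_def)
    show "uniform_limit {0..T} (\<lambda>n t. \<Sum>k<n. TT t k) (\<lambda>t. suminf (TT t)) sequentially"
      by (rule Weierstrass_m_test[OF _ summable_mult[OF sum_inverse_sq_shift2(1), of 100]]) (use en in auto)
    show "0 \<in> {0..T}" using T by simp
    show "summable (\<lambda>k. (coord (w 0) (k + 2))\<^sup>2)" by (rule summable_coord_shift_sq)
  qed
  then obtain g where g: "\<And>t. t \<in> {0..T} \<Longrightarrow> (\<lambda>k. (coord (w t) (k + 2))\<^sup>2) sums g t"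
    "\<And>t. t \<in> {0..T} \<Longrightarrow> (g has_real_derivative suminf (TT t)) (at t within {0..T})" by blast
  have gY: "g t = Yp (w t)" if "t \<in> {0..T}" for t using g(1)[OF that] by (simp add: Yp_def sums_iff)
  have dY: "((\<lambda>t. Yp (w t)) has_real_derivative suminf (TT t)) (at t within {0..T})" if "t \<in> {0..T}" for t
    by (rule has_field_derivative_transform_within[OF g(2)[OF that] zero_less_one that]) (use gY in auto)
  show ?thesis
  proof (rule that[of "\<lambda>t. 2 * coord (w t) 1 * (F (flow t p) 1 - F (flow t q) 1)" "\<lambda>t. suminf (TT t)"])
    fix t assume t: "0 \<le> t" "t \<le> T"
    show "((\<lambda>t. (coord (flow t p - flow t q) 1)\<^sup>2) has_real_derivative 2 * coord (w t) 1 * (F (flow t p) 1 - F (flow t q) 1)) (at t within {0..T})"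
      using der[OF t order_refl] unfolding w_def .
    show "((\<lambda>t. Yp (flow t p - flow t q)) has_real_derivative suminf (TT t)) (at t within {0..T})"
      using dY[of t] t unfolding w_def by simp
    show "suminf (TT t) \<le> - 8 * Yp (flow t p - flow t q) + \<theta> C * ((coord (flow t p - flow t q) 1)\<^sup>2 + Yp (flow t p - flow t q))"
      using en(2)[OF t] unfolding w_def .
    show "\<bar>2 * coord (w t) 1 * (F (flow t p) 1 - F (flow t q) 1) - 2 * slope (flow t p) (flow t q) * (coord (flow t p - flow t q) 1)\<^sup>2\<bar> \<le>
      \<theta> C * ((coord (flow t p - flow t q) 1)\<^sup>2 + Yp (flow t p - flow t q))"
      unfolding w_def slope_def by (rule energy_1[OF C p(1)[OF t] q(1)[OF t]])
  qed
qed

abbreviation "R \<equiv> S_box 4 C0"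
abbreviation "Q \<equiv> Qform {1}"

lemma \<nu>_le_C0: "\<nu> \<le> \<kappa> * C0\<^sup>2"
proof -
  have "3 / 10 * C0\<^sup>2 \<le> \<kappa> * C0\<^sup>2" using \<kappa>_bounds by (intro mult_right_mono) auto
  moreover have "0 \<le> C0\<^sup>2" by simp
  ultimately show ?thesis using \<nu>_small by linarith
qed

lemma R_flow: "p \<in> R \<Longrightarrow> exit_time p = \<infinity>" "p \<in> R \<Longrightarrow> 0 \<le> t \<Longrightarrow> flow t p \<in> R"
  using S_box_flow[OF C0_pos order_refl \<nu>_le_C0] by blast+

lemma R_exit: "p \<in> R \<Longrightarrow> ereal t < exit_time p"
  using R_flow(1) by simp

lemma R_flow_0: "p \<in> R \<Longrightarrow> flow 0 p = p"
  using R_flow(1) by (intro flow_0) simp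

lemma R_flow_add: "p \<in> R \<Longrightarrow> 0 \<le> s \<Longrightarrow> 0 \<le> t \<Longrightarrow> flow t (flow s p) = flow (t + s) p"
  using R_flow(1) by (intro flow_shift(2)) auto

text \<open>With X the square of the first coordinate and Y = Yp, the slope is at least - 1/10 and Y
  decays at rate almost 8, which gives Q' \<ge> - Q. Positivity of Q thus persists forwards and
  nonpositivity backwards.\<close>

lemma cone:
  assumes p: "p \<in> R" and q: "q \<in> R" and T: "0 \<le> T"
  shows "exp (- T) * Q (p - q) \<le> Q (flow T p - flow T q)"
proof -
  let ?w = "\<lambda>t. flow t p - flow t q"
  obtain DX DY where D:
    "\<And>t. 0 \<le> t \<Longrightarrow> t \<le> T \<Longrightarrow> ((\<lambda>t. (coord (?w t) 1)\<^sup>2) has_real_derivative DX t) (at t within {0..T})"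
    "\<And>t. 0 \<le> t \<Longrightarrow> t \<le> T \<Longrightarrow> ((\<lambda>t. Yp (?w t)) has_real_derivative DY t) (at t within {0..T})"
    and B: "\<And>t. 0 \<le> t \<Longrightarrow> t \<le> T \<Longrightarrow> DY t \<le> - 8 * Yp (?w t) + \<theta> C0 * ((coord (?w t) 1)\<^sup>2 + Yp (?w t))"
    "\<And>t. 0 \<le> t \<Longrightarrow> t \<le> T \<Longrightarrow> \<bar>DX t - 2 * slope (flow t p) (flow t q) * (coord (?w t) 1)\<^sup>2\<bar> \<le>
      \<theta> C0 * ((coord (?w t) 1)\<^sup>2 + Yp (?w t))"
    by (rule flow_energy[of C0 T p q]) (use C0_pos R_flow p q T R_exit in auto)
  note sc = small_consequences[OF C0_pos order_refl]
  have C0sq: "C0\<^sup>2 \<le> 1 / 100" using C0_pos C0_le power_mono[of C0 "1/10" 2] by (simp add: power2_eq_square)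
  have "exp (- 1 * T) * ((coord (?w 0) 1)\<^sup>2 - Yp (?w 0)) \<le> (coord (?w T) 1)\<^sup>2 - Yp (?w T)"
  proof (rule gronwall_ge[where D = "\<lambda>t. DX t - DY t"])
    fix t assume t: "0 \<le> t" "t \<le> T"
    show "((\<lambda>t. (coord (?w t) 1)\<^sup>2 - Yp (?w t)) has_real_derivative DX t - DY t) (at t within {0..T})"
      by (intro DERIV_diff D t)
    let ?X = "(coord (?w t) 1)\<^sup>2" and ?Y = "Yp (?w t)" and ?m = "slope (flow t p) (flow t q)"
    have XY: "0 \<le> ?X" "0 \<le> ?Y" by (auto simp: Yp_nonneg)
    have "\<bar>coord (flow t x) 1\<bar> \<le> sqrt 2 * C0" if "x \<in> R" for x
      using R_flow(2)[OF that t(1)] by (simp add: S_box_def)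
    then have x2: "\<bar>coord (flow t x) 1 * coord (flow t y) 1\<bar> \<le> 2 * C0\<^sup>2" if "x \<in> R" "y \<in> R" for x y
    proof -
      have "\<bar>coord (flow t x) 1\<bar> * \<bar>coord (flow t y) 1\<bar> \<le> (sqrt 2 * C0) * (sqrt 2 * C0)"
        using that \<open>\<And>x. x \<in> R \<Longrightarrow> \<bar>coord (flow t x) 1\<bar> \<le> sqrt 2 * C0\<close> C0_pos by (intro mult_mono) auto
      moreover have "(sqrt 2 * C0) * (sqrt 2 * C0) = 2 * C0\<^sup>2"
        by (simp add: power_mult_distrib flip: power2_eq_square)
      ultimately show ?thesis by (simp only: abs_mult)
    qed
    have "(coord (flow t p) 1)\<^sup>2 + coord (flow t p) 1 * coord (flow t q) 1 + (coord (flow t q) 1)\<^sup>2 \<le> 6 * C0\<^sup>2"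
      using x2[OF p p] x2[OF p q] x2[OF q q] by (simp add: power2_eq_square abs_le_iff)
    then have "\<kappa> * ((coord (flow t p) 1)\<^sup>2 + coord (flow t p) 1 * coord (flow t q) 1 + (coord (flow t q) 1)\<^sup>2) \<le> 4 / 10 * (6 * C0\<^sup>2)"
      using \<kappa>_bounds C0_pos by (intro order_trans[OF mult_left_mono mult_right_mono]) auto
    then have m: "- (1 / 10) \<le> ?m" unfolding slope_def using \<nu>_le C0sq by linarith
    have "2 * ?m * ?X \<ge> 2 * (- (1 / 10)) * ?X" using m XY by (intro mult_right_mono mult_left_mono) auto
    moreover have "\<theta> C0 * (?X + ?Y) \<le> 1 / 100 * (?X + ?Y)"
      using sc C0sq XY by (intro mult_right_mono) auto
    moreover have "- 1 * (X - Y) \<le> DX - DY"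
      if "2 * (- (1 / 10)) * X \<le> M" "S \<le> 1 / 100 * (X + Y)" "DY \<le> - 8 * Y + S" "\<bar>DX - M\<bar> \<le> S" "0 \<le> X" "0 \<le> Y"
      for DX DY X Y M S :: real using that by (simp add: abs_le_iff)
    ultimately show "- 1 * (?X - ?Y) \<le> DX t - DY t" using B[OF t] XY by blast
  qed (rule T)
  then show ?thesis unfolding Qform_1 using p q by (simp add: R_flow_0)
qed

text \<open>If Q is nonpositive at the end, \<open>cone\<close> makes it nonpositive on all of
  [0, T]. There X \<le> Y, so the coupling costs at most 2 Y of the damping 8 Y.\<close>

lemma cone_decay:
  assumes p: "p \<in> R" and q: "q \<in> R" and T: "0 \<le> T" and neg: "Q (flow T p - flow T q) \<le> 0"
  shows "Yp (flow T p - flow T q) \<le> exp (- 2 * T) * Yp (p - q)"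
proof -
  let ?w = "\<lambda>t. flow t p - flow t q"
  obtain DX DY where D:
    "\<And>t. 0 \<le> t \<Longrightarrow> t \<le> T \<Longrightarrow> ((\<lambda>t. Yp (?w t)) has_real_derivative DY t) (at t within {0..T})"
    and B: "\<And>t. 0 \<le> t \<Longrightarrow> t \<le> T \<Longrightarrow> DY t \<le> - 8 * Yp (?w t) + \<theta> C0 * ((coord (?w t) 1)\<^sup>2 + Yp (?w t))"
    by (rule flow_energy[of C0 T p q]) (use C0_pos R_flow p q T R_exit in auto)
  note sc = small_consequences[OF C0_pos order_refl]
  have "Yp (?w T) \<le> exp (- 2 * T) * Yp (?w 0)"
  proof (rule gronwall_le[OF D _ T])
    fix t assume t: "0 \<le> t" "t \<le> T"
    let ?X = "(coord (?w t) 1)\<^sup>2" and ?Y = "Yp (?w t)"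
    have XY: "0 \<le> ?X" "0 \<le> ?Y" by (auto simp: Yp_nonneg)
    have "exp (- (T - t)) * Q (?w t) \<le> Q (flow (T - t) (flow t p) - flow (T - t) (flow t q))"
      using t by (intro cone R_flow p q) auto
    then have "exp (- (T - t)) * Q (?w t) \<le> Q (?w T)" using t p q by (simp add: R_flow_add)
    then have "Q (?w t) \<le> 0" using neg by (smt (verit) exp_gt_zero mult_pos_pos)
    then have le: "?X \<le> ?Y" unfolding Qform_1 by simp
    have t1: "\<theta> C0 \<le> 1" using sc C0_pos power_le_one[of C0 2] by simp
    have "\<theta> C0 * (?X + ?Y) \<le> 1 * (?X + ?Y)" using t1 XY by (intro mult_right_mono) auto
    moreover have "D \<le> - 2 * Y" if "S \<le> 1 * (X + Y)" "D \<le> - 8 * Y + S" "X \<le> Y" "0 \<le> X" for D S X Y :: real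
    proof -
      have "0 \<le> Y" "S \<le> 2 * Y" using that by auto
      then show ?thesis using that(2) by linarith
    qed
    ultimately show "DY t \<le> - 2 * ?Y" using B[OF t] le XY by blast
  qed
  then show ?thesis using p q by (simp add: R_flow_0)
qed

lemma zero_flow: "exit_time 0 = \<infinity>" "0 \<le> t \<Longrightarrow> flow t 0 = 0"
proof -
  have sol: "solution_on nf_dom F \<infinity> (\<lambda>t. 0)"
    unfolding solution_on_def Let_def by (auto simp: F_0 zero_in_dom)
  from solution_exit_time(1)[OF _ sol] show "exit_time 0 = \<infinity>" by simp
  from solution_exit_time(2)[OF _ sol] show "0 \<le> t \<Longrightarrow> flow t 0 = 0" by simp
qed

lemma zero_in_S_box: "0 < C \<Longrightarrow> 0 \<in> S_box 4 C"
  by (simp add: S_box_def)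

text \<open>A slope of at most - a/2 gives X' \<le> - a X plus coupling; with \<theta> C \<le> a/4
  the sum X + Y decays at rate a/2, hence the norm at rate a/4. Applied around 0 for \<nu> < 0 and
  around the nonzero fixed points for \<nu> > 0.\<close>

lemma contraction:
  assumes C: "0 < C" "C \<le> C0"
    and p: "\<And>s. 0 \<le> s \<Longrightarrow> s \<le> T \<Longrightarrow> flow s p \<in> S_box 4 C" "ereal T < exit_time p"
    and q: "\<And>s. 0 \<le> s \<Longrightarrow> s \<le> T \<Longrightarrow> flow s q \<in> S_box 4 C" "ereal T < exit_time q"
    and T: "0 \<le> T" and a: "0 < a" "a \<le> 1" and \<theta>: "\<theta> C \<le> a / 4"
    and m: "\<And>s. 0 \<le> s \<Longrightarrow> s \<le> T \<Longrightarrow> slope (flow s p) (flow s q) \<le> - (a / 2)"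
  shows "norm (flow T p - flow T q) \<le> exp (- (a / 4) * T) * norm (p - q)"
proof -
  let ?w = "\<lambda>t. flow t p - flow t q"
  obtain DX DY where D:
    "\<And>t. 0 \<le> t \<Longrightarrow> t \<le> T \<Longrightarrow> ((\<lambda>t. (coord (?w t) 1)\<^sup>2) has_real_derivative DX t) (at t within {0..T})"
    "\<And>t. 0 \<le> t \<Longrightarrow> t \<le> T \<Longrightarrow> ((\<lambda>t. Yp (?w t)) has_real_derivative DY t) (at t within {0..T})"
    and B: "\<And>t. 0 \<le> t \<Longrightarrow> t \<le> T \<Longrightarrow> DY t \<le> - 8 * Yp (?w t) + \<theta> C * ((coord (?w t) 1)\<^sup>2 + Yp (?w t))"
    "\<And>t. 0 \<le> t \<Longrightarrow> t \<le> T \<Longrightarrow> \<bar>DX t - 2 * slope (flow t p) (flow t q) * (coord (?w t) 1)\<^sup>2\<bar> \<le>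
      \<theta> C * ((coord (?w t) 1)\<^sup>2 + Yp (?w t))"
    by (rule flow_energy[where C = C and T = T and p = p and q = q]) (use C p q T in auto)
  have "(coord (?w T) 1)\<^sup>2 + Yp (?w T) \<le> exp (- (a / 2) * T) * ((coord (?w 0) 1)\<^sup>2 + Yp (?w 0))"
  proof (rule gronwall_le[where D = "\<lambda>t. DX t + DY t"])
    fix t assume t: "0 \<le> t" "t \<le> T"
    show "((\<lambda>t. (coord (?w t) 1)\<^sup>2 + Yp (?w t)) has_real_derivative DX t + DY t) (at t within {0..T})"
      by (intro DERIV_add D t)
    let ?X = "(coord (?w t) 1)\<^sup>2" and ?Y = "Yp (?w t)" and ?m = "slope (flow t p) (flow t q)"
    have XY: "0 \<le> ?X" "0 \<le> ?Y" by (auto simp: Yp_nonneg)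
    have "2 * ?m * ?X \<le> 2 * (- (a / 2)) * ?X" using m[OF t] XY by (intro mult_right_mono mult_left_mono) auto
    moreover have "\<theta> C * (?X + ?Y) \<le> a / 4 * (?X + ?Y)" using \<theta> XY by (intro mult_right_mono) auto
    moreover have "a * ?Y \<le> 1 * ?Y" using a XY by (intro mult_right_mono) auto
    moreover have "DX + DY \<le> - (a / 2) * (X + Y)"
      if "2 * m * X \<le> 2 * (- (a / 2)) * X" "S \<le> a / 4 * (X + Y)" "a * Y \<le> 1 * Y"
        "DY \<le> - 8 * Y + S" "\<bar>DX - 2 * m * X\<bar> \<le> S" "0 \<le> Y" for DX DY X Y m S :: real
    proof -
      have "DX \<le> 2 * (- (a / 2)) * X + S" using that(1,5) by linarith
      then have "DX + DY \<le> 2 * (- (a / 2)) * X - 8 * Y + 2 * (a / 4 * (X + Y))" using that(2,4) by linarith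
      also have "\<dots> = - (a / 2) * X + (a * Y) / 2 - 8 * Y" by (simp add: algebra_simps)
      also have "\<dots> \<le> - (a / 2) * X - (a * Y) / 2" using that(3,6) by linarith
      also have "\<dots> = - (a / 2) * (X + Y)" by (simp add: field_simps)
      finally show ?thesis .
    qed
    ultimately show "DX t + DY t \<le> - (a / 2) * (?X + ?Y)" using B[OF t] XY by blast
  qed (rule T)
  then have "(norm (?w T))\<^sup>2 \<le> exp (- (a / 2) * T) * (norm (?w 0))\<^sup>2" by (simp only: norm_sq_Yp)
  also have "exp (- (a / 2) * T) = (exp (- (a / 4) * T))\<^sup>2" by (simp add: power2_eq_square flip: exp_add)
  finally have "(norm (?w T))\<^sup>2 \<le> (exp (- (a / 4) * T) * norm (?w 0))\<^sup>2" by (simp add: power_mult_distrib)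
  then have "norm (?w T) \<le> exp (- (a / 4) * T) * norm (?w 0)" by (rule power2_le_imp_le) simp
  moreover have "0 < exit_time p" "0 < exit_time q"
    using T p(2) q(2) by (auto simp: zero_ereal_def intro: le_less_trans[of _ "ereal T"])
  ultimately show ?thesis by (simp add: flow_0)
qed

text \<open>The solution is compared with the zero solution. Below the threshold C/sqrt 2 the slope
  is at least \<nu>/2, and inside the cone Y \<le> X, so the coupling is at most \<nu> X / 4 and X
  grows at rate at least \<nu>/2.\<close>

lemma growth:
  assumes C: "0 < C" "C \<le> C0" "\<nu> = \<kappa> * C\<^sup>2" and \<nu>: "0 < \<nu>"
    and p: "\<And>s. 0 \<le> s \<Longrightarrow> s \<le> T \<Longrightarrow> flow s p \<in> S_box 4 C"
    and M: "\<And>s. 0 \<le> s \<Longrightarrow> s \<le> T \<Longrightarrow> (coord (flow s p) 1)\<^sup>2 \<le> C\<^sup>2 / 2"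
    and pR: "p \<in> R" and Qp: "0 < Q p" and T: "0 \<le> T"
  shows "exp (\<nu> / 4 * T) * \<bar>coord p 1\<bar> \<le> \<bar>coord (flow T p) 1\<bar>"
proof -
  let ?w = "\<lambda>t. flow t p - flow t 0"
  have z: "flow s 0 \<in> S_box 4 C" if "0 \<le> s" for s using zero_flow(2)[OF that] zero_in_S_box[OF C(1)] by simp
  obtain DX where D:
    "\<And>t. 0 \<le> t \<Longrightarrow> t \<le> T \<Longrightarrow> ((\<lambda>t. (coord (?w t) 1)\<^sup>2) has_real_derivative DX t) (at t within {0..T})"
    and B: "\<And>t. 0 \<le> t \<Longrightarrow> t \<le> T \<Longrightarrow> \<bar>DX t - 2 * slope (flow t p) (flow t 0) * (coord (?w t) 1)\<^sup>2\<bar> \<le>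
      \<theta> C * ((coord (?w t) 1)\<^sup>2 + Yp (?w t))"
    by (rule flow_energy[where C = C and T = T and p = p and q = 0])
      (use C p R_exit[OF pR] z T zero_flow(1) in auto)
  have zR: "0 \<in> R" by (rule zero_in_S_box[OF C0_pos])
  have th: "\<theta> C \<le> \<nu> / 8"
  proof -
    have "\<theta> C \<le> C\<^sup>2 / 32" by (rule small_consequences[OF C(1,2)])
    also have "\<dots> \<le> \<kappa> * C\<^sup>2 / 8" using \<kappa>_bounds mult_right_mono[of "1/4" \<kappa> "C\<^sup>2"] by simp
    finally show ?thesis using C(3) by simp
  qed
  have "exp (\<nu> / 2 * T) * (coord (?w 0) 1)\<^sup>2 \<le> (coord (?w T) 1)\<^sup>2"
  proof (rule gronwall_ge[OF D _ T])
    fix t assume t: "0 \<le> t" "t \<le> T"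
    let ?X = "(coord (?w t) 1)\<^sup>2" and ?Y = "Yp (?w t)" and ?m = "slope (flow t p) (flow t 0)"
    have XY: "0 \<le> ?X" "0 \<le> ?Y" by (auto simp: Yp_nonneg)
    have "exp (- t) * Q (p - 0) \<le> Q (?w t)" by (rule cone[OF pR zR t(1)])
    moreover have "0 < exp (- t) * Q (p - 0)" using Qp by simp
    ultimately have "0 < Q (?w t)" by linarith
    then have YX: "?Y \<le> ?X" unfolding Qform_1 by simp
    have "\<kappa> * (coord (flow t p) 1)\<^sup>2 \<le> \<kappa> * (C\<^sup>2 / 2)" using M[OF t] \<kappa>_bounds by (intro mult_left_mono) auto
    then have "\<nu> / 2 \<le> ?m" unfolding slope_def using C(3) zero_flow(2)[OF t(1)] by simp
    then have "2 * (\<nu> / 2) * ?X \<le> 2 * ?m * ?X" using XY by (intro mult_right_mono mult_left_mono) auto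
    moreover have "\<theta> C * (?X + ?Y) \<le> \<nu> / 8 * (?X + ?X)" using th XY YX \<nu> by (intro mult_mono) auto
    moreover have "\<nu> / 2 * X \<le> DX"
      if "2 * (\<nu> / 2) * X \<le> M" "S \<le> \<nu> / 8 * (X + X)" "\<bar>DX - M\<bar> \<le> S" "0 \<le> X" for DX X M S :: real
    proof -
      have "0 \<le> \<nu> * X" using that(4) \<nu> by simp
      moreover have "2 * (\<nu> / 2) * X = \<nu> * X" "\<nu> / 8 * (X + X) = \<nu> * X / 4" "\<nu> / 2 * X = \<nu> * X / 2" by simp_all
      ultimately show ?thesis using that(1-3) by linarith
    qed
    ultimately show "\<nu> / 2 * ?X \<le> DX t" using B[OF t] XY by blast
  qed
  then have "exp (\<nu> / 2 * T) * (coord p 1)\<^sup>2 \<le> (coord (flow T p) 1)\<^sup>2"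
    using pR T by (simp add: zero_flow(2) R_flow_0)
  moreover have "exp (\<nu> / 2 * T) = (exp (\<nu> / 4 * T))\<^sup>2" by (simp add: power2_eq_square flip: exp_add)
  ultimately have "(exp (\<nu> / 4 * T) * \<bar>coord p 1\<bar>)\<^sup>2 \<le> \<bar>coord (flow T p) 1\<bar>\<^sup>2"
    by (simp add: power_mult_distrib)
  then show ?thesis by (rule power2_le_imp_le) simp
qed

end

section \<open>Full trajectories\<close>

text \<open>If f exceeded \<rho> at t0, the barrier lemma would keep it above \<rho> in the whole
  past, where it decreases at rate at least \<eta>; going back far enough violates the upper bound
  B.\<close>

lemma le_of_decrease_above:
  fixes f :: "real \<Rightarrow> real"
  assumes der: "\<And>t. (f has_real_derivative f' t) (at t)" and B: "\<And>t. f t \<le> B"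
    and dec: "\<And>t. \<rho> \<le> f t \<Longrightarrow> f' t \<le> - \<eta>" and \<eta>: "0 < \<eta>"
  shows "f t0 \<le> \<rho>"
proof (rule ccontr)
  assume "\<not> f t0 \<le> \<rho>"
  then have gt: "\<rho> < f t0" by simp
  have past: "\<rho> < f t" if t: "t \<le> t0" for t
  proof (rule ccontr)
    assume "\<not> \<rho> < f t"
    then have le: "f t \<le> \<rho>" by simp
    have "f (t + (t0 - t)) \<le> \<rho>"
    proof (rule barrier_le[of "\<lambda>s. f (t + s)"])
      have d: "((\<lambda>s. f (t + s)) has_real_derivative f' (t + s)) (at s within X)" for s X
        using DERIV_shift[of f "f' (t + s)" s t] der[of "t + s"] by (simp add: add.commute has_field_derivative_at_within)
      then show "continuous_on {0..} (\<lambda>s. f (t + s))" by (rule DERIV_continuous_on)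
      show "\<exists>D\<le>0. ((\<lambda>s. f (t + s)) has_real_derivative D) (at s within {0..})" if "\<rho> < f (t + s)" for s
        using dec[of "t + s"] that \<eta> d by (intro exI[of _ "f' (t + s)"]) auto
    qed (use le t in auto)
    then show False using gt by simp
  qed
  \<comment> \<open>Going back by this amount of time forces f t \<ge> B + \<eta>.\<close>
  define t where "t = t0 - (B - f t0 + \<eta>) / \<eta>"
  have t: "t < t0" using B[of t0] \<eta> by (simp add: t_def add_nonneg_pos)
  obtain \<xi> where \<xi>: "t < \<xi>" "\<xi> < t0" "f t0 - f t = (t0 - t) * f' \<xi>"
    using MVT2[OF t, of f f'] der by blast
  have "f' \<xi> \<le> - \<eta>" using past[of \<xi>] \<xi>(2) by (intro dec) simp
  then have "f t0 - f t \<le> (t0 - t) * (- \<eta>)" unfolding \<xi>(3) using t by (intro mult_left_mono) auto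
  also have "\<dots> = - (B - f t0 + \<eta>)" using \<eta> by (simp add: t_def)
  finally show False using B[of t] \<eta> by simp
qed

context ks_dyn
begin

interpretation sbox 4 by unfold_locales simp

abbreviation "full \<equiv> trajectory flow exit_time R UNIV"

lemma full_iff: "full z \<longleftrightarrow> range z \<subseteq> R \<and> (\<forall>s t. 0 \<le> s \<longrightarrow> flow s (z t) = z (t + s))"
  unfolding trajectory_def using R_exit by (auto simp: image_subset_iff)

lemma fullD: assumes "full z" shows "z t \<in> R" "0 \<le> s \<Longrightarrow> flow s (z t) = z (t + s)"
  using assms unfolding full_iff by auto

lemma full_shift: "full z \<Longrightarrow> full (\<lambda>t. z (t + a))"
  unfolding full_iff by (auto simp: algebra_simps)

lemma full_fixed: "u \<in> R \<Longrightarrow> (\<And>t. 0 \<le> t \<Longrightarrow> flow t u = u) \<Longrightarrow> full (\<lambda>_. u)"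
  unfolding full_iff by auto

lemma zero_in_R: "0 \<in> R" by (rule zero_in_S_box[OF C0_pos])

lemma full_zero: "full (\<lambda>_. 0)"
  by (intro full_fixed zero_in_R zero_flow)

text \<open>Starting the flow one time unit earlier makes the time in question interior, so the
  one-sided derivative becomes two-sided.\<close>

lemma full_deriv:
  assumes z: "full z" and k: "1 \<le> k"
  shows "((\<lambda>t. coord (z t) k) has_real_derivative F (z t) k) (at t)"
proof -
  have "((\<lambda>s. coord (flow s (z (t - 1))) k) has_real_derivative F (flow 1 (z (t - 1))) k) (at 1 within {0..2})"
    using solution_on_seg(3)[OF flow_solution[of "z (t - 1)"], of 2 1 k] R_exit[OF fullD(1)[OF z]] k by simp
  then have "((\<lambda>s. coord (flow s (z (t - 1))) k) has_real_derivative F (z t) k) (at 1)"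
    using at_within_interior[of "1::real" "{0..2}"] fullD(2)[OF z, of 1 "t - 1"] by simp
  then have "((\<lambda>s. coord (z (t - 1 + s)) k) has_real_derivative F (z t) k) (at 1)"
    by (rule has_field_derivative_transform_within[of _ _ _ _ 1])
      (use fullD(2)[OF z] in \<open>auto simp: dist_real_def\<close>)
  then show ?thesis using DERIV_shift[of "\<lambda>s. coord (z s) k" "F (z t) k" 1 "t - 1"]
    by (simp add: add.commute)
qed

text \<open>The decrease argument gives 11/10 C for the first coordinate and 7/10 of the width for
  the others. Both fit into the box of size 9/10 C, because 11/10 \<le> 9/10 sqrt 2 and 7/10 \<le>
  (9/10)^3.\<close>

lemma full_shrink:
  assumes z: "full z" and C: "0 < C" "C \<le> C0" "\<nu> \<le> \<kappa> * C\<^sup>2" and zC: "range z \<subseteq> S_box 4 C"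
  shows "range z \<subseteq> S_box 4 (9 / 10 * C)"
proof -
  note sc = small_consequences[OF C(1,2)]
  have C3: "0 < C ^ 3" using C by simp
  have zt: "z t \<in> S_box 4 C" for t using zC by auto
  have der: "((\<lambda>t. \<sigma> * coord (z t) k) has_real_derivative \<sigma> * F (z t) k) (at t)" if "1 \<le> k" for \<sigma> k t
    using full_deriv[OF z that] by (rule DERIV_cmult)
  have low: "\<sigma> * coord (z t) 1 \<le> 11 / 10 * C" if \<sigma>: "\<sigma> \<in> {1, -1}" for \<sigma> t
  proof (rule le_of_decrease_above[where f = "\<lambda>t. \<sigma> * coord (z t) 1" and f' = "\<lambda>t. \<sigma> * F (z t) 1"
        and \<eta> = "C ^ 3 / 100"])
    show "\<sigma> * coord (z t) 1 \<le> sqrt 2 * C" for t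
      using zt[of t] \<sigma> unfolding S_box_def by auto
    show "\<sigma> * F (z t) 1 \<le> - (C ^ 3 / 100)" if "11 / 10 * C \<le> \<sigma> * coord (z t) 1" for t
      by (rule low_face[OF C zt \<sigma> that])
  qed (use der C3 in auto)
  have high: "\<sigma> * coord (z t) k \<le> 7 / 10 * (C ^ 3 / real k ^ 4)" if \<sigma>: "\<sigma> \<in> {1, -1}" and k: "2 \<le> k" for \<sigma> k t
  proof (rule le_of_decrease_above[where f = "\<lambda>t. \<sigma> * coord (z t) k" and f' = "\<lambda>t. \<sigma> * F (z t) k"
        and \<eta> = "C ^ 3 / 100"])
    show "\<sigma> * coord (z t) k \<le> C ^ 3 / real k ^ 4" for t
      using S_box4[OF zt[of t] k] \<sigma> by auto
    show "\<sigma> * F (z t) k \<le> - (C ^ 3 / 100)" if f: "7 / 10 * (C ^ 3 / real k ^ 4) \<le> \<sigma> * coord (z t) k" for t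
    proof -
      have "\<sigma> * F (z t) k = lam k (1 - \<nu>) * (\<sigma> * coord (z t) k) + \<sigma> * h (z t) k"
        unfolding F_high[OF k] by (simp add: algebra_simps)
      also have "lam k (1 - \<nu>) * (\<sigma> * coord (z t) k) \<le> lam k (1 - \<nu>) * (7 / 10 * (C ^ 3 / real k ^ 4))"
        using lam_high(1)[OF k] zero_le_power[of "real k" 4] by (intro mult_left_mono_neg f) linarith
      also have "\<dots> \<le> - (real k ^ 4 / 2) * (7 / 10 * (C ^ 3 / real k ^ 4))"
        using lam_high(1)[OF k] C3 by (intro mult_right_mono) auto
      also have "\<dots> = - (7 / 20 * C ^ 3)" using k by simp
      also have "\<sigma> * h (z t) k \<le> K * C ^ 4 / (real k)\<^sup>2"
        using hk_bound2[OF C(1) sc(8) zt[of t] k] \<sigma> by auto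
      also have "\<dots> \<le> K * C ^ 4 / 1"
        using K_pos C k by (intro divide_left_mono) (auto simp: power_le_one_iff)
      also have "\<dots> = (K * C) * C ^ 3" by (simp add: power_numeral_reduce)
      also have "\<dots> \<le> 1 / 64 * C ^ 3" using sc C by (intro mult_right_mono) auto
      finally have "\<sigma> * F (z t) k \<le> - (7 / 20 * C ^ 3) + 1 / 64 * C ^ 3" by simp
      then show ?thesis using C3 by linarith
    qed
  qed (use der[of k] k C3 in auto)
  have "z t \<in> S_box 4 (9 / 10 * C)" for t
    unfolding S_box_def mem_Collect_eq
  proof (intro conjI allI impI)
    have "11 / 10 * C \<le> sqrt 2 * (9 / 10) * C"
    proof (intro mult_right_mono)
      have "11 / 9 \<le> sqrt 2" by (rule real_le_rsqrt) (simp add: power2_eq_square)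
      then show "11 / 10 \<le> sqrt 2 * (9 / 10)" by simp
    qed (use C in simp)
    then show "\<bar>coord (z t) 1\<bar> \<le> sqrt 2 * (9 / 10 * C)"
      using low[of 1 t] low[of "-1" t] by (simp add: abs_le_iff)
    fix k :: nat assume k: "2 \<le> k"
    have "7 / 10 * (C ^ 3 / real k ^ 4) \<le> (9 / 10) ^ 3 * (C ^ 3 / real k ^ 4)"
      using C3 by (intro mult_right_mono) (auto simp: power3_eq_cube)
    then show "\<bar>coord (z t) k\<bar> \<le> (9 / 10 * C) ^ 3 / real k powr 4"
      using high[of 1 k t] high[of "-1" k t] k by (simp add: abs_le_iff powr_numeral power_mult_distrib power_divide)
  qed
  then show ?thesis by auto
qed

text \<open>Shrinking may continue as long as \<nu> \<le> \<kappa> C^2; the maximum with c stops it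
  at an admissible size. The case c = 0 covers \<nu> \<le> 0, where the boxes shrink to the
  origin.\<close>

lemma full_shrink_iter:
  assumes z: "full z" and c: "0 \<le> c" "c \<le> C0" "\<nu> \<le> \<kappa> * c\<^sup>2"
  shows "range z \<subseteq> S_box 4 (max (C0 * (9 / 10) ^ n) c)"
proof (induction n)
  case 0
  show ?case using z c by (simp add: full_iff max_absorb1)
next
  case (Suc n)
  let ?C = "max (C0 * (9 / 10) ^ n) c"
  have "C0 * (9 / 10) ^ n \<le> C0 * 1" using C0_pos by (intro mult_left_mono power_le_one) auto
  moreover have "0 < C0 * (9 / 10) ^ n" using C0_pos by simp
  ultimately have C: "0 < ?C" "?C \<le> C0" using c by auto
  have "\<kappa> * c\<^sup>2 \<le> \<kappa> * ?C\<^sup>2" using \<kappa>_bounds c by (intro mult_left_mono power_mono) auto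
  then have "range z \<subseteq> S_box 4 (9 / 10 * ?C)" using c by (intro full_shrink z C Suc) linarith
  also have "\<dots> \<subseteq> S_box 4 (max (C0 * (9 / 10) ^ Suc n) c)" using C c by (intro S_box_mono) (auto simp: max_def)
  finally show ?case .
qed

lemma decay_seq: "(\<lambda>n. a * (9 / 10) ^ n) \<longlonglongrightarrow> (0::real)"
  using tendsto_mult_right_zero[OF LIMSEQ_realpow_zero[of "9/10 :: real"], of a] by simp

lemma full_in_box:
  assumes z: "full z" and c: "0 < c" "c \<le> C0" "\<nu> \<le> \<kappa> * c\<^sup>2"
  shows "range z \<subseteq> S_box 4 c"
proof -
  obtain n where "C0 * (9 / 10) ^ n < c"
    using order_tendstoD(2)[OF decay_seq c(1)] by (auto simp: eventually_sequentially)
  then show ?thesis using full_shrink_iter[OF z, of c n] c by (simp add: max_absorb2)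
qed

lemma full_eq_zero:
  assumes z: "full z" and "\<nu> \<le> 0" shows "z t = 0"
proof (rule ell2_eqI)
  fix k
  have *: "\<bar>coord (z t) k\<bar> \<le> 2 * C0 * (9 / 10) ^ n" if k: "1 \<le> k" for n
  proof -
    let ?C = "C0 * (9 / 10) ^ n"
    have "?C \<le> C0 * 1" using C0_pos by (intro mult_left_mono power_le_one) auto
    moreover have "0 < ?C" using C0_pos by simp
    ultimately have C: "0 < ?C" "?C \<le> 1" using C0_le by linarith+
    have "z t \<in> S_box 4 ?C" using full_shrink_iter[OF z, of 0 n] C0_pos assms(2) C by (auto simp: max_absorb1)
    then have "\<bar>coord (z t) k\<bar> \<le> rad ?C k" using k unfolding S_box_eq by (auto dest: ell2_boxD)
    also have "\<dots> \<le> 2 * ?C / real k" by (rule rad_bounds(2)[OF C k])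
    also have "\<dots> \<le> 2 * ?C / 1" using C k by (intro divide_left_mono) auto
    finally show ?thesis by simp
  qed
  have "\<bar>coord (z t) k\<bar> \<le> 0" if "1 \<le> k"
    using *[OF that] by (intro LIMSEQ_le_const[OF decay_seq]) auto
  then show "coord (z t) k = coord 0 k" by (cases "k = 0") auto
qed

lemma R_norm: assumes "p \<in> R" shows "norm p \<le> 1 / 2"
  using S_box_subset_dom[OF C0_pos C0_le] assms by (auto simp: nf_dom_def)

text \<open>Nonpositivity of Q extends to all earlier times. Starting the decay estimate at s - T,
  where \<open>Yp\<close> is at most 1, and letting T grow gives Yp = 0 at time s, and then Q \<le>
  0 kills the first coordinate. Later times follow by the semiflow.\<close>

lemma full_cone:
  assumes z: "full z" and z': "full z'" and neg: "Q (z a - z' a) \<le> 0"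
  shows "z = z'"
proof
  fix t
  have eq: "z s = z' s" if s: "s \<le> a" for s
  proof -
    have past: "Q (z r - z' r) \<le> 0" if "r \<le> a" for r
    proof -
      have "exp (- (a - r)) * Q (z r - z' r) \<le> Q (flow (a - r) (z r) - flow (a - r) (z' r))"
        using that by (intro cone fullD z z') auto
      also have "\<dots> \<le> 0" using that neg by (simp add: fullD(2)[OF z] fullD(2)[OF z'])
      finally show ?thesis by (simp add: mult_le_0_iff)
    qed
    have "Yp (z s - z' s) \<le> exp (- 2 * T)" if T: "0 \<le> T" for T
    proof -
      have "Yp (z s - z' s) \<le> exp (- 2 * T) * Yp (z (s - T) - z' (s - T))"
        using cone_decay[OF fullD(1)[OF z] fullD(1)[OF z'] T, of "s - T" "s - T"] past[OF s] T
        by (simp add: fullD(2)[OF z] fullD(2)[OF z'])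
      also have "Yp (z (s - T) - z' (s - T)) \<le> 1"
      proof -
        have "norm (z (s - T) - z' (s - T)) \<le> 1"
          using norm_triangle_ineq4[of "z (s - T)" "z' (s - T)"] R_norm[OF fullD(1)[OF z, of "s - T"]]
            R_norm[OF fullD(1)[OF z', of "s - T"]] by linarith
        then have "(norm (z (s - T) - z' (s - T)))\<^sup>2 \<le> 1" by (intro power_le_one) auto
        moreover have "0 \<le> (coord (z (s - T) - z' (s - T)) 1)\<^sup>2" by simp
        ultimately show ?thesis using norm_sq_Yp[of "z (s - T) - z' (s - T)"] by linarith
      qed
      finally show ?thesis by simp
    qed
    moreover have "((\<lambda>T. exp (- 2 * T)) \<longlongrightarrow> (0::real)) at_top" by real_asymp
    ultimately have "Yp (z s - z' s) \<le> 0"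
      by (intro tendsto_lowerbound) (auto intro: eventually_at_top_linorderI[of 0])
    then have "Yp (z s - z' s) = 0" using Yp_nonneg[of "z s - z' s"] by simp
    moreover have "(coord (z s - z' s) 1)\<^sup>2 = 0"
      using past[OF s] calculation unfolding Qform_1 by simp
    ultimately have "z s - z' s = 0" unfolding Yp_eq_0_iff[symmetric] by linarith
    then show ?thesis by simp
  qed
  show "z t = z' t"
  proof (cases "t \<le> a")
    case False
    then show ?thesis using eq[of a] fullD(2)[OF z, of "t - a" a] fullD(2)[OF z', of "t - a" a] by simp
  qed (rule eq)
qed

lemma full_coord_inj:
  assumes "full z" "full z'" "coord (z a) 1 = coord (z' a) 1"
  shows "z = z'"
  by (rule full_cone[OF assms(1,2), of a]) (unfold Qform_1, simp add: assms(3)[unfolded One_nat_def] Yp_nonneg)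

text \<open>Taking only the value at time 0 loses no points, since shifts of full trajectories are
  full trajectories.\<close>

definition attractor :: "ell2 set" where "attractor = {z 0 | z. full z}"

lemma full_range_attractor: assumes "full z" shows "range z \<subseteq> attractor"
proof
  fix x assume "x \<in> range z"
  then obtain a where "x = z a" by auto
  then show "x \<in> attractor" using full_shift[OF assms, of a] unfolding attractor_def
    by (intro CollectI exI[of _ "\<lambda>t. z (t + a)"]) simp
qed

lemma maximal_invariant_attractor: "maximal_invariant_set flow exit_time R attractor"
  unfolding maximal_invariant_set_def
proof (intro conjI allI impI)
  have "attractor \<subseteq> R" unfolding attractor_def using fullD(1) by auto
  then show "invariant_in flow exit_time R attractor"
    unfolding invariant_in_def using full_range_attractor by (auto simp: attractor_def)
  show "J \<subseteq> attractor" if "invariant_in flow exit_time R J" for J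
  proof
    fix x assume x: "x \<in> J"
    then have "\<exists>z. full z \<and> z 0 = x" using that unfolding invariant_in_def by blast
    then show "x \<in> attractor" unfolding attractor_def by blast
  qed
qed

lemma attractor_nonpos: "\<nu> \<le> 0 \<Longrightarrow> attractor = {0}"
  unfolding attractor_def using full_eq_zero full_zero by auto

end

section \<open>Fixed points and their hyperbolicity\<close>

lemma box_around_ell2_box:
  assumes "\<And>k. 1 \<le> k \<Longrightarrow> l k < coord z0 k \<and> coord z0 k < r k" "summable (\<lambda>k. (\<bar>l k\<bar> + \<bar>r k\<bar>)\<^sup>2)"
  shows "box_around z0 (ell2_box l r)"
  unfolding box_around_def
proof (rule exI[of _ l], rule exI[of _ r], intro conjI allI impI)
  show "l k < coord z0 k" "coord z0 k < r k" if "1 \<le> k" for k using assms(1)[OF that] by auto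
  show "summable (\<lambda>k. (x k)\<^sup>2)" if "\<forall>k\<ge>1. l k \<le> x k \<and> x k \<le> r k" for x
    using that by (intro summable_between[OF assms(2)]) auto
  show "ell2_box l r = {z. \<forall>k\<ge>1. l k \<le> coord z k \<and> coord z k \<le> r k}" by (rule ell2_box_def)
qed

context ks_dyn
begin

interpretation sbox 4 by unfold_locales simp

lemma zero_fixed: "fixed_point flow exit_time 0"
  unfolding fixed_point_def using zero_flow by auto

text \<open>With no expanding direction Q is minus the squared norm, the positive cone is empty and
  its conditions are vacuous; only exponential decay remains to be supplied.\<close>

lemma hyperbolic_attracting:
  assumes box: "box_around z0 V" and fp: "fixed_point flow exit_time z0" and \<omega>: "0 < \<omega>" and z0: "z0 \<in> V"
    and decay: "\<And>z t. 0 \<le> t \<Longrightarrow> ereal t < exit_time z \<Longrightarrow> (\<And>s. 0 \<le> s \<Longrightarrow> s \<le> t \<Longrightarrow> flow s z \<in> V) \<Longrightarrow>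
      norm (flow t z - z0) \<le> exp (- \<omega> * t) * norm (z - z0)"
  shows "hyperbolic_fixed_point flow exit_time z0"
  unfolding hyperbolic_fixed_point_def
proof (intro conjI fp exI[of _ V] exI[of _ "{}"] box)
  have Q0: "Qform {} w = - ((norm w)\<^sup>2)" for w by (simp add: Qform_def proj_empty)
  show "hyperbolic_wrt flow exit_time V {} z0"
    unfolding hyperbolic_wrt_def Let_def Q0 proj_empty
  proof (intro conjI)
    show "backward_invariant flow exit_time V {z \<in> V. - ((norm (z - z0))\<^sup>2) \<le> 0}"
      unfolding backward_invariant_def trajectory_def by (auto simp: image_subset_iff subset_iff)
    show "\<exists>A>0. \<exists>B>0. \<exists>\<omega>>0.
      (\<forall>z t. z \<in> {z \<in> V. 0 < - ((norm (z - z0))\<^sup>2)} \<and> 0 \<le> t \<and> ereal t < exit_time z \<and> (\<forall>s\<in>{0..t}. flow s z \<in> V) \<longrightarrow>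
        A * exp (\<omega> * t) * norm (0 :: ell2) \<le> norm (0 :: ell2)) \<and>
      (\<forall>z t. 0 \<le> t \<and> ereal t < exit_time z \<and> (\<forall>s\<in>{0..t}. flow s z \<in> {z \<in> V. - ((norm (z - z0))\<^sup>2) \<le> 0}) \<longrightarrow>
        norm (flow t z - z0 - 0) \<le> B * exp (- \<omega> * t) * norm (z - z0 - 0))"
      by (rule exI[of _ 1], simp, rule exI[of _ 1], simp, rule exI[of _ \<omega>]) (use \<omega> decay in auto)
  qed (use z0 in \<open>auto simp: forward_invariant_def\<close>)
qed auto

lemma S_box_around:
  assumes C: "0 < C" "C \<le> 1" and z: "z \<in> S_box 4 (9 / 10 * C)"
  shows "box_around z (S_box 4 C)"
  unfolding S_box_eq
proof (rule box_around_ell2_box[OF _ summable_rad[OF C]])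
  fix k :: nat assume k: "1 \<le> k"
  have "\<bar>coord z k\<bar> \<le> rad (9 / 10 * C) k" using z k unfolding S_box_eq by (auto dest: ell2_boxD)
  also have "\<dots> \<le> 9 / 10 * rad C k"
  proof (cases "k = 1")
    case False
    have "(9 / 10) ^ 3 * (C ^ 3 / real k ^ 4) \<le> 9 / 10 * (C ^ 3 / real k ^ 4)"
      using C by (intro mult_right_mono) (auto simp: power3_eq_cube)
    then show ?thesis using False by (simp add: rad_def power_mult_distrib power_divide)
  qed (simp add: rad_def)
  also have "\<dots> < 1 * rad C k" using rad_bounds(1)[OF C k] by (intro mult_strict_right_mono) auto
  finally show "- rad C k < coord z k \<and> coord z k < rad C k" by (simp add: abs_less_iff)
qed

lemma hyperbolic_zero_neg:
  assumes "\<nu> < 0" shows "hyperbolic_fixed_point flow exit_time 0"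
proof -
  \<comment> \<open>The box scales with the parameter: for this C the coupling is at most
    \<bar>\<nu>\<bar>/32, below the contraction rate. Hyperbolicity allows the neighbourhood to
    depend on \<nu>.\<close>
  define C where "C = sqrt \<bar>\<nu>\<bar>"
  have C2: "C\<^sup>2 = \<bar>\<nu>\<bar>" by (simp add: C_def)
  have C: "0 < C" "C \<le> C0"
  proof -
    show "0 < C" using assms by (simp add: C_def)
    have "C\<^sup>2 \<le> C0\<^sup>2" using \<nu>_small zero_le_power2[of C0] unfolding C2 by linarith
    then show "C \<le> C0" using C0_pos by (auto intro: power2_le_imp_le)
  qed
  have C1: "C \<le> 1" using C C0_le by simp
  show ?thesis
  proof (rule hyperbolic_attracting[OF S_box_around[OF C(1) C1] zero_fixed])
    show "0 \<in> S_box 4 (9 / 10 * C)" "0 \<in> S_box 4 C" using C by (auto intro!: zero_in_S_box)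
    show "0 < \<bar>\<nu>\<bar> / 4" using assms by simp
    fix z t assume t: "0 \<le> t" "ereal t < exit_time z" and N: "\<And>s. 0 \<le> s \<Longrightarrow> s \<le> t \<Longrightarrow> flow s z \<in> S_box 4 C"
    have "norm (flow t z - flow t 0) \<le> exp (- (\<bar>\<nu>\<bar> / 4) * t) * norm (z - 0)"
    proof (rule contraction[OF C _ t(2)])
      show "slope (flow s z) (flow s 0) \<le> - (\<bar>\<nu>\<bar> / 2)" if "0 \<le> s" for s
      proof -
        have "0 \<le> \<kappa> * (coord (flow s z) 1)\<^sup>2" using \<kappa>_bounds by simp
        then have "\<nu> - \<kappa> * (coord (flow s z) 1)\<^sup>2 \<le> - (\<bar>\<nu>\<bar> / 2)" using assms by linarith
        then show ?thesis using that by (simp add: slope_def zero_flow)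
      qed
      show "\<theta> C \<le> \<bar>\<nu>\<bar> / 4" using small_consequences(5)[OF C] unfolding C2 by simp
      show "flow s 0 \<in> S_box 4 C" if "0 \<le> s" for s using that C by (simp add: zero_flow zero_in_S_box)
    qed (use N t assms \<nu>_le zero_flow(1) in auto)
    then show "norm (flow t z - 0) \<le> exp (- (\<bar>\<nu>\<bar> / 4) * t) * norm (z - 0)"
      using t by (simp add: zero_flow)
  qed
qed

end

locale ks_pos = ks_dyn +
  assumes \<nu>_pos: "0 < \<nu>"
begin

interpretation sbox 4 by unfold_locales simp

text \<open>Amplitude of the nonzero equilibria of \<nu> x - \<kappa> x^3, and the smallest C with
  \<nu> \<le> \<kappa> C^2, hence the smallest box to which the trapping and shrinking arguments
  apply.\<close>

definition \<rho> :: real where "\<rho> = sqrt (\<nu> / \<kappa>)"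

lemma \<rho>_sq: "\<nu> = \<kappa> * \<rho>\<^sup>2"
  using \<kappa>_bounds \<nu>_pos by (simp add: \<rho>_def)

lemma \<rho>_pos: "0 < \<rho>"
  using \<kappa>_bounds \<nu>_pos by (simp add: \<rho>_def)

lemma \<rho>_le: "\<rho> \<le> C0"
proof -
  have "3 / 10 * \<rho>\<^sup>2 \<le> \<kappa> * \<rho>\<^sup>2" using \<kappa>_bounds by (intro mult_right_mono) auto
  then have "3 / 10 * \<rho>\<^sup>2 \<le> \<nu>" using \<rho>_sq by linarith
  then have "\<rho>\<^sup>2 \<le> C0\<^sup>2" using \<nu>_small zero_le_power2[of C0] by linarith
  then show ?thesis using C0_pos by (auto intro: power2_le_imp_le)
qed

lemma \<rho>_le_1: "\<rho> \<le> 1" using \<rho>_le C0_le by simp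

lemma \<rho>3_pos: "0 < \<rho> ^ 3" using \<rho>_pos by simp

lemma \<theta>_\<rho>: "\<theta> \<rho> \<le> \<nu> / 4"
proof -
  have "\<theta> \<rho> \<le> \<rho>\<^sup>2 / 32" by (rule small_consequences[OF \<rho>_pos \<rho>_le])
  also have "\<dots> \<le> \<kappa> * \<rho>\<^sup>2 / 4" using mult_right_mono[OF \<kappa>_bounds(1), of "\<rho>\<^sup>2"] zero_le_power2[of \<rho>] by linarith
  finally show ?thesis using \<rho>_sq by linarith
qed

text \<open>The region in which the slope against the zero solution is at least \<nu>/2.\<close>

definition middle :: "ell2 set" where "middle = {b \<in> S_box 4 \<rho>. (coord b 1)\<^sup>2 \<le> \<rho>\<^sup>2 / 2}"

lemma S_box_sub_R: "S_box 4 \<rho> \<subseteq> R"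
  by (rule S_box_mono[OF \<rho>_pos \<rho>_le])

lemma middle_eq: "middle = ell2_box (\<lambda>k. - (if k = 1 then \<rho> / sqrt 2 else rad \<rho> k)) (\<lambda>k. if k = 1 then \<rho> / sqrt 2 else rad \<rho> k)"
  (is "_ = ?B")
proof -
  have m: "(coord b 1)\<^sup>2 \<le> \<rho>\<^sup>2 / 2 \<longleftrightarrow> \<bar>coord b 1\<bar> \<le> \<rho> / sqrt 2" for b
    using abs_le_square_iff[of "coord b 1" "\<rho> / sqrt 2"] \<rho>_pos by (simp add: power_divide)
  have le: "\<rho> / sqrt 2 \<le> rad \<rho> 1" using \<rho>_pos by (simp add: rad_def divide_le_eq)
  have "b \<in> middle \<longleftrightarrow> b \<in> ?B" for b
  proof
    assume b: "b \<in> middle"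
    show "b \<in> ?B" unfolding ell2_box_def mem_Collect_eq
    proof (intro allI impI)
      fix k :: nat assume k: "1 \<le> k"
      show "- (if k = 1 then \<rho> / sqrt 2 else rad \<rho> k) \<le> coord b k \<and> coord b k \<le> (if k = 1 then \<rho> / sqrt 2 else rad \<rho> k)"
      proof (cases "k = 1")
        case True
        then show ?thesis using b unfolding middle_def mem_Collect_eq m by (simp add: abs_le_iff)
      next
        case False
        then show ?thesis using b ell2_boxD[of b "\<lambda>k. - rad \<rho> k" "rad \<rho>" k] k unfolding middle_def S_box_eq by simp
      qed
    qed
  next
    assume b: "b \<in> ?B"
    have b1: "\<bar>coord b 1\<bar> \<le> \<rho> / sqrt 2" using ell2_boxD[OF b, of 1] by (simp add: abs_le_iff)
    have "- rad \<rho> k \<le> coord b k \<and> coord b k \<le> rad \<rho> k" if k: "1 \<le> k" for k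
    proof (cases "k = 1")
      case True
      then show ?thesis using b1 le by (simp add: abs_le_iff)
    next
      case False
      then show ?thesis using ell2_boxD[OF b k] by simp
    qed
    then show "b \<in> middle" unfolding middle_def mem_Collect_eq m S_box_eq ell2_box_def using b1 by blast
  qed
  then show ?thesis by blast
qed

lemma middle_around_zero: "box_around 0 middle"
  unfolding middle_eq
proof (rule box_around_ell2_box)
  show "summable (\<lambda>k. (\<bar>- (if k = 1 then \<rho> / sqrt 2 else rad \<rho> k)\<bar> + \<bar>if k = 1 then \<rho> / sqrt 2 else rad \<rho> k\<bar>)\<^sup>2)"
    by (rule summable_comparison_test'[OF summable_rad[OF \<rho>_pos \<rho>_le_1], of 2]) simp
qed (use \<rho>_pos rad_bounds(1)[OF \<rho>_pos \<rho>_le_1] in auto)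

lemma middle_R: "p \<in> middle \<Longrightarrow> p \<in> R"
  unfolding middle_def using S_box_sub_R by blast

text \<open>One expanding direction. The invariance of both cones is \<open>cone\<close> against the
  zero solution, expansion is \<open>growth\<close>, and contraction is
  \<open>cone_decay\<close>.\<close>

lemma hyperbolic_zero_pos: "hyperbolic_fixed_point flow exit_time 0"
  unfolding hyperbolic_fixed_point_def
proof (intro conjI zero_fixed exI[of _ middle] exI[of _ "{1}"] middle_around_zero)
  let ?Qp = "{z \<in> middle. 0 < Q (z - 0)}" and ?Qm = "{z \<in> middle. Q (z - 0) \<le> 0}"
  have zm: "0 \<in> middle" using \<rho>_pos by (simp add: middle_def zero_in_S_box)
  have mono: "0 < Q (flow t z)" if "z \<in> middle" "0 < Q z" "0 \<le> t" for z t
  proof -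
    have "0 < exp (- t) * Q (z - 0)" using that by simp
    also have "\<dots> \<le> Q (flow t z - flow t 0)" using that middle_R by (intro cone zero_in_R)
    finally show ?thesis using that by (simp add: zero_flow)
  qed
  show "hyperbolic_wrt flow exit_time middle {1} 0"
    unfolding hyperbolic_wrt_def Let_def
  proof (intro conjI impI)
    have "1 \<le> sqrt 2" by simp
    then have "1 \<le> sqrt 2 * 2" by linarith
    then have "(\<rho> / 2) *\<^sub>R unit_vec 1 \<in> ?Qp"
      unfolding Qform_1 using \<rho>_pos by (simp add: middle_def S_box_def Yp_def power_divide coord_unit_vec)
    then show "?Qp \<noteq> {}" by blast
    have "Q (0 - 0) \<le> 0" unfolding Qform_1 by (simp add: Yp_def)
    then show "?Qm \<noteq> {}" using zm by blast
    show "forward_invariant flow exit_time middle ?Qp"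
      unfolding forward_invariant_def
    proof (intro allI impI)
      fix I z t assume *: "trajectory flow exit_time middle I z \<and> z 0 \<in> ?Qp \<and> 0 < t \<and> {0..t} \<subseteq> I"
      have "z s \<in> ?Qp" if "s \<in> {0..t}" for s
      proof -
        have I: "0 \<in> I" "s \<in> I" using * that by auto
        have tr: "z ` I \<subseteq> middle" "\<And>s t. 0 \<le> s \<Longrightarrow> t \<in> I \<Longrightarrow> t + s \<in> I \<Longrightarrow> flow s (z t) = z (t + s)"
          using * unfolding trajectory_def by blast+
        have "flow s (z 0) = z s" using tr(2)[of s 0] I that by simp
        moreover have "z s \<in> middle" using tr(1) I by blast
        ultimately show ?thesis using mono[of "z 0" s] * that by simp
      qed
      then show "z ` {0..t} \<subseteq> ?Qp" by blast
    qed
    show "backward_invariant flow exit_time middle ?Qm"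
      unfolding backward_invariant_def
    proof (intro allI impI)
      fix I z t assume *: "trajectory flow exit_time middle I z \<and> z 0 \<in> ?Qm \<and> t < 0 \<and> {t..0} \<subseteq> I"
      have "z s \<in> ?Qm" if "s \<in> {t..0}" for s
      proof -
        have I: "0 \<in> I" "s \<in> I" using * that by auto
        have tr: "z ` I \<subseteq> middle" "\<And>s t. 0 \<le> s \<Longrightarrow> t \<in> I \<Longrightarrow> t + s \<in> I \<Longrightarrow> flow s (z t) = z (t + s)"
          using * unfolding trajectory_def by blast+
        have "flow (- s) (z s) = z 0" using tr(2)[of "- s" s] I that by simp
        moreover have zs: "z s \<in> middle" using tr(1) I by blast
        ultimately have "\<not> 0 < Q (z s)" using mono[of "z s" "- s"] * that by auto
        then show ?thesis using zs by simp
      qed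
      then show "z ` {t..0} \<subseteq> ?Qm" by blast
    qed
    let ?P = "coord_proj {1}"
    \<comment> \<open>A single rate must serve both estimates, so the decay exp(- t) is weakened to
      the rate \<nu>/4 of the expansion.\<close>
    have "\<nu> / 4 \<le> 1" using \<nu>_le by simp
    have expand: "1 * exp (\<nu> / 4 * t) * norm (?P (z - 0)) \<le> norm (?P (flow t z - 0))"
      if "z \<in> ?Qp \<and> 0 \<le> t \<and> ereal t < exit_time z \<and> (\<forall>s\<in>{0..t}. flow s z \<in> middle)" for z t
      unfolding norm_proj_1 mult_1 diff_0_right
      using that middle_R by (intro growth[OF \<rho>_pos \<rho>_le \<rho>_sq \<nu>_pos]) (auto simp: middle_def)
    have contract: "norm (flow t z - 0 - ?P (flow t z - 0)) \<le> 1 * exp (- (\<nu> / 4) * t) * norm (z - 0 - ?P (z - 0))"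
      if *: "0 \<le> t \<and> ereal t < exit_time z \<and> (\<forall>s\<in>{0..t}. flow s z \<in> ?Qm)" for z t
    proof -
      have "0 < exit_time z" using * by (auto simp: zero_ereal_def intro: le_less_trans[of _ "ereal t"])
      then have "z \<in> middle" using bspec[of "{0..t}" "\<lambda>s. flow s z \<in> ?Qm" 0] * by (simp add: flow_0)
      then have "Yp (flow t z - flow t 0) \<le> exp (- 2 * t) * Yp (z - 0)"
        using * middle_R by (intro cone_decay zero_in_R) (auto simp: zero_flow)
      then have "Yp (flow t z - 0) \<le> exp (- 2 * t) * Yp (z - 0)" using * by (simp add: zero_flow)
      also have "exp (- 2 * t) = (exp (- t))\<^sup>2" by (simp add: power2_eq_square flip: exp_add)
      finally have "(norm (flow t z - 0 - ?P (flow t z - 0)))\<^sup>2 \<le> (exp (- t) * norm (z - 0 - ?P (z - 0)))\<^sup>2"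
        unfolding power_mult_distrib norm_perp_1 .
      then have "norm (flow t z - 0 - ?P (flow t z - 0)) \<le> exp (- t) * norm (z - 0 - ?P (z - 0))"
        by (rule power2_le_imp_le) simp
      also have "\<dots> \<le> exp (- (\<nu> / 4) * t) * norm (z - 0 - ?P (z - 0))"
        using * mult_right_mono[OF \<open>\<nu> / 4 \<le> 1\<close>, of t] by (intro mult_right_mono) auto
      finally show ?thesis by simp
    qed
    show "\<exists>A>0. \<exists>B>0. \<exists>\<omega>>0.
        (\<forall>z t. z \<in> ?Qp \<and> 0 \<le> t \<and> ereal t < exit_time z \<and> (\<forall>s\<in>{0..t}. flow s z \<in> middle) \<longrightarrow>
          A * exp (\<omega> * t) * norm (?P (z - 0)) \<le> norm (?P (flow t z - 0))) \<and>
        (\<forall>z t. 0 \<le> t \<and> ereal t < exit_time z \<and> (\<forall>s\<in>{0..t}. flow s z \<in> ?Qm) \<longrightarrow>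
          norm (flow t z - 0 - ?P (flow t z - 0)) \<le> B * exp (- \<omega> * t) * norm (z - 0 - ?P (z - 0)))"
      by (rule exI[of _ 1], rule conjI[OF zero_less_one], rule exI[of _ 1], rule conjI[OF zero_less_one],
          rule exI[of _ "\<nu> / 4"], intro conjI allI impI)
        (use \<nu>_pos in simp, rule expand, assumption, rule contract, assumption)
  qed
qed auto

end

section \<open>The two nonzero fixed points\<close>

context ks_pos
begin

interpretation sbox 4 by unfold_locales simp

definition outer :: "real \<Rightarrow> ell2 set" where "outer \<sigma> = {b \<in> S_box 4 \<rho>. \<rho> / sqrt 2 \<le> \<sigma> * coord b 1}"

definition lo :: "real \<Rightarrow> nat \<Rightarrow> real"
  where "lo \<sigma> k = (if k = 1 then (if \<sigma> = 1 then \<rho> / sqrt 2 else - (sqrt 2 * \<rho>)) else - rad \<rho> k)"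

definition hi :: "real \<Rightarrow> nat \<Rightarrow> real"
  where "hi \<sigma> k = (if k = 1 then (if \<sigma> = 1 then sqrt 2 * \<rho> else - (\<rho> / sqrt 2)) else rad \<rho> k)"

lemma inner_lt: "\<rho> / sqrt 2 < sqrt 2 * \<rho>"
  using \<rho>_pos by (simp add: divide_less_eq)

lemma outer_eq: assumes \<sigma>: "\<sigma> \<in> {1, -1}" shows "outer \<sigma> = ell2_box (lo \<sigma>) (hi \<sigma>)"
proof -
  have S: "b \<in> S_box 4 \<rho> \<longleftrightarrow> (\<forall>k\<ge>1. - rad \<rho> k \<le> coord b k \<and> coord b k \<le> rad \<rho> k)" for b
    unfolding S_box_eq ell2_box_def by simp
  have k: "(1 \<le> k \<longrightarrow> P k) \<longleftrightarrow> (k = 1 \<longrightarrow> P k) \<and> (2 \<le> k \<longrightarrow> P k)" for k :: nat and P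
    by (cases "k = 1") auto
  have "b \<in> outer \<sigma> \<longleftrightarrow> b \<in> ell2_box (lo \<sigma>) (hi \<sigma>)" for b
  proof -
    have "b \<in> outer \<sigma> \<longleftrightarrow> (- (sqrt 2 * \<rho>) \<le> coord b 1 \<and> coord b 1 \<le> sqrt 2 * \<rho> \<and> \<rho> / sqrt 2 \<le> \<sigma> * coord b 1) \<and>
        (\<forall>k\<ge>2. - rad \<rho> k \<le> coord b k \<and> coord b k \<le> rad \<rho> k)"
      unfolding outer_def mem_Collect_eq S k[of _ "\<lambda>k. - rad \<rho> k \<le> coord b k \<and> coord b k \<le> rad \<rho> k"] all_conj_distrib
      by (auto simp: rad_def)
    also have "(- (sqrt 2 * \<rho>) \<le> coord b 1 \<and> coord b 1 \<le> sqrt 2 * \<rho> \<and> \<rho> / sqrt 2 \<le> \<sigma> * coord b 1) \<longleftrightarrow>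
        lo \<sigma> 1 \<le> coord b 1 \<and> coord b 1 \<le> hi \<sigma> 1"
    proof -
      have "0 < \<rho> / sqrt 2" "0 < sqrt 2 * \<rho>" using \<rho>_pos by auto
      then show ?thesis using \<sigma> inner_lt by (cases "\<sigma> = 1") (simp_all only: lo_def hi_def, auto)
    qed
    also have "(\<forall>k\<ge>2. - rad \<rho> k \<le> coord b k \<and> coord b k \<le> rad \<rho> k) \<longleftrightarrow> (\<forall>k\<ge>2. lo \<sigma> k \<le> coord b k \<and> coord b k \<le> hi \<sigma> k)"
      by (simp add: lo_def hi_def)
    also have "(lo \<sigma> 1 \<le> coord b 1 \<and> coord b 1 \<le> hi \<sigma> 1) \<and> (\<forall>k\<ge>2. lo \<sigma> k \<le> coord b k \<and> coord b k \<le> hi \<sigma> k) \<longleftrightarrow>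
        b \<in> ell2_box (lo \<sigma>) (hi \<sigma>)"
      unfolding ell2_box_def mem_Collect_eq k[of _ "\<lambda>k. lo \<sigma> k \<le> coord b k \<and> coord b k \<le> hi \<sigma> k"] all_conj_distrib
      by auto
    finally show ?thesis .
  qed
  then show ?thesis by blast
qed

lemma outer_R: "p \<in> outer \<sigma> \<Longrightarrow> p \<in> R"
  unfolding outer_def using S_box_sub_R by blast

lemma summable_outer: "summable (\<lambda>k. (\<bar>lo \<sigma> k\<bar> + \<bar>hi \<sigma> k\<bar>)\<^sup>2)"
  by (rule summable_comparison_test'[OF summable_rad[OF \<rho>_pos \<rho>_le_1], of 2]) (simp add: lo_def hi_def)

lemma sqrt2_ge: "7 / 10 * \<rho> \<le> \<rho> / sqrt 2"
proof -
  have "sqrt 2 \<le> 10 / 7" by (rule real_le_lsqrt) (auto simp: power2_eq_square)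
  then have "\<rho> / (10 / 7) \<le> \<rho> / sqrt 2" using \<rho>_pos by (intro divide_left_mono) auto
  then show ?thesis by simp
qed

text \<open>At the threshold the truncated field equals \<kappa> \<rho>^2 y / 2, at least 21/200
  \<rho>^3, and the error \<rho>^3/64 cannot reverse it. The flow therefore crosses this face
  outwards from the middle, which makes \<open>outer\<close> forward invariant.\<close>

lemma inner_face:
  assumes x: "x \<in> S_box 4 \<rho>" and \<sigma>: "\<sigma> \<in> {1, -1}" and face: "\<sigma> * coord x 1 = \<rho> / sqrt 2"
  shows "0 < \<sigma> * F x 1"
proof -
  note sc = small_consequences[OF \<rho>_pos \<rho>_le]
  define y where "y = \<rho> / sqrt 2"
  have y2: "y\<^sup>2 = \<rho>\<^sup>2 / 2" by (simp add: y_def power_divide)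
  have \<sigma>3: "\<sigma> * coord x 1 ^ 3 = y ^ 3" using \<sigma> face[folded y_def, symmetric] by auto
  have "\<sigma> * F x 1 = \<nu> * (\<sigma> * coord x 1) - \<kappa> * (\<sigma> * coord x 1 ^ 3) + \<sigma> * h x 1"
    unfolding F_1 by (simp add: algebra_simps)
  also have "\<dots> = \<nu> * y - \<kappa> * y ^ 3 + \<sigma> * h x 1" unfolding \<sigma>3 face y_def ..
  also have "\<nu> * y - \<kappa> * y ^ 3 = \<kappa> * (\<rho>\<^sup>2 * y / 2)"
  proof -
    have "y ^ 3 = y * (\<rho>\<^sup>2 / 2)" using y2 by (simp add: power3_eq_cube power2_eq_square)
    then have "\<kappa> * y ^ 3 = \<kappa> * (\<rho>\<^sup>2 * y / 2)" by simp
    moreover have "\<nu> * y = \<kappa> * \<rho>\<^sup>2 * y" using arg_cong[OF \<rho>_sq, of "\<lambda>n. n * y"] .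
    moreover have "\<kappa> * \<rho>\<^sup>2 * y = \<kappa> * (\<rho>\<^sup>2 * y / 2) + \<kappa> * (\<rho>\<^sup>2 * y / 2)" by simp
    ultimately show ?thesis by linarith
  qed
  finally have e: "\<sigma> * F x 1 = \<kappa> * (\<rho>\<^sup>2 * y / 2) + \<sigma> * h x 1" .
  have "\<bar>h x 1\<bar> \<le> K * \<rho> ^ 5" by (rule h1_bound[OF \<rho>_pos sc(8) x])
  also have "K * \<rho> ^ 5 = (K * \<rho>) * \<rho> * \<rho> ^ 3" by (simp add: power_numeral_reduce)
  also have "\<dots> \<le> 1 / 64 * 1 * \<rho> ^ 3" using sc \<rho>_pos K_pos by (intro mult_mono) auto
  finally have "- (1 / 64 * \<rho> ^ 3) \<le> \<sigma> * h x 1" using \<sigma> by auto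
  moreover have "3 / 10 * (\<rho>\<^sup>2 * (7 / 10 * \<rho>) / 2) \<le> \<kappa> * (\<rho>\<^sup>2 * y / 2)"
    using \<kappa>_bounds sqrt2_ge \<rho>_pos unfolding y_def by (intro mult_mono divide_right_mono) auto
  moreover have "3 / 10 * (\<rho>\<^sup>2 * (7 / 10 * \<rho>) / 2) = 21 / 200 * \<rho> ^ 3" by (simp add: power2_eq_square power3_eq_cube)
  ultimately show ?thesis unfolding e using \<rho>3_pos by linarith
qed

lemma outer_flow:
  assumes \<sigma>: "\<sigma> \<in> {1, -1}" and p: "p \<in> outer \<sigma>" and t: "0 \<le> t"
  shows "flow t p \<in> outer \<sigma>"
proof -
  have sub: "x \<in> S_box 4 \<rho>" if "x \<in> ell2_box (lo \<sigma>) (hi \<sigma>)" for x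
    using that unfolding outer_eq[OF \<sigma>, symmetric] outer_def by simp
  have bnd: "\<bar>lo \<sigma> k\<bar> \<le> 2 * \<rho> / real k \<and> \<bar>hi \<sigma> k\<bar> \<le> 2 * \<rho> / real k \<and> lo \<sigma> k \<le> hi \<sigma> k" if k: "1 \<le> k" for k
  proof -
    have r: "rad \<rho> k \<le> 2 * \<rho> / real k" "0 < rad \<rho> k" using rad_bounds[OF \<rho>_pos \<rho>_le_1 k] by auto
    have "\<rho> / sqrt 2 \<le> 2 * \<rho>" "sqrt 2 * \<rho> \<le> 2 * \<rho>"
      using inner_lt mult_right_mono[of "sqrt 2" 2 \<rho>] sqrt2_less_2 \<rho>_pos by linarith+
    moreover have "0 < \<rho> / sqrt 2" "0 < sqrt 2 * \<rho>" using \<rho>_pos by auto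
    moreover have "\<bar>if \<sigma> = 1 then a else - b\<bar> \<le> c \<and> \<bar>if \<sigma> = 1 then b else - a\<bar> \<le> c \<and>
        (if \<sigma> = 1 then a else - b) \<le> (if \<sigma> = 1 then b else - a)"
      if "a \<le> c" "b \<le> c" "0 < a" "a < b" for a b c :: real using that by auto
    ultimately show ?thesis using r inner_lt
      by (cases "k = 1") (simp_all only: lo_def hi_def simp_thms if_True if_False of_nat_1 div_by_1, auto)
  qed
  have s2: "11 / 10 * \<rho> \<le> sqrt 2 * \<rho>"
    by (intro mult_right_mono real_le_rsqrt) (use \<rho>_pos in \<open>auto simp: power2_eq_square\<close>)
  have lowf: "\<tau> * F x 1 \<le> 0" if "x \<in> S_box 4 \<rho>" "\<tau> \<in> {1, -1}" "\<tau> * coord x 1 = sqrt 2 * \<rho>" for x \<tau>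
  proof -
    have "\<tau> * F x 1 \<le> - (\<rho> ^ 3 / 100)" using that s2 \<rho>_sq by (intro low_face \<rho>_pos \<rho>_le) auto
    then show ?thesis using \<rho>3_pos by linarith
  qed
  have inn: "F x k \<le> 0" if x: "x \<in> ell2_box (lo \<sigma>) (hi \<sigma>)" and k: "1 \<le> k" and f: "coord x k = hi \<sigma> k" for x k
  proof (cases "k = 1")
    case True
    show ?thesis
    proof (cases "\<sigma> = 1")
      case T: True
      then show ?thesis using lowf[OF sub[OF x], of 1] f True by (simp add: hi_def)
    next
      case F: False
      then show ?thesis using inner_face[OF sub[OF x] \<sigma>] \<sigma> f True by (simp add: hi_def)
    qed
  next
    case False
    then show ?thesis using high_face[OF \<rho>_pos \<rho>_le sub[OF x], of k 1] f k by (simp add: hi_def rad_def)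
  qed
  have inn': "0 \<le> F x k" if x: "x \<in> ell2_box (lo \<sigma>) (hi \<sigma>)" and k: "1 \<le> k" and f: "coord x k = lo \<sigma> k" for x k
  proof (cases "k = 1")
    case True
    show ?thesis
    proof (cases "\<sigma> = 1")
      case T: True
      then show ?thesis using inner_face[OF sub[OF x] \<sigma>] f True by (simp add: lo_def)
    next
      case F: False
      then show ?thesis using lowf[OF sub[OF x], of "-1"] f True by (simp add: lo_def)
    qed
  next
    case False
    then show ?thesis using high_face[OF \<rho>_pos \<rho>_le sub[OF x], of k "-1"] f k by (simp add: lo_def rad_def)
  qed
  have dom: "ell2_box (lo \<sigma>) (hi \<sigma>) \<subseteq> nf_dom"
    using sub S_box_subset_dom[OF \<rho>_pos] \<rho>_le C0_le by auto
  show ?thesis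
    unfolding outer_eq[OF \<sigma>]
    by (rule box_flow(2)[where B = "2 * \<rho>"]) (use bnd dom inn inn' p t outer_eq[OF \<sigma>] in auto)
qed

text \<open>For two points beyond the threshold on the same side, x^2 + x y + y^2 is at least 3/2
  \<rho>^2, so the slope is at most \<nu> - 3/2 \<nu>.\<close>

lemma outer_contraction:
  assumes \<sigma>: "\<sigma> \<in> {1, -1}" and p: "p \<in> outer \<sigma>" and q: "q \<in> outer \<sigma>" and t: "0 \<le> t"
  shows "norm (flow t p - flow t q) \<le> exp (- (\<nu> / 4) * t) * norm (p - q)"
proof (rule contraction[OF \<rho>_pos \<rho>_le])
  fix s assume s: "0 \<le> s" "s \<le> t"
  show "flow s p \<in> S_box 4 \<rho>" "flow s q \<in> S_box 4 \<rho>"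
    using outer_flow[OF \<sigma> p s(1)] outer_flow[OF \<sigma> q s(1)] by (auto simp: outer_def)
  define x y where "x = \<sigma> * coord (flow s p) 1" and "y = \<sigma> * coord (flow s q) 1"
  have xy: "\<rho> / sqrt 2 \<le> x" "\<rho> / sqrt 2 \<le> y"
    using outer_flow[OF \<sigma> p s(1)] outer_flow[OF \<sigma> q s(1)] by (auto simp: outer_def x_def y_def)
  have sq: "\<rho>\<^sup>2 / 2 \<le> a * b" if "\<rho> / sqrt 2 \<le> a" "\<rho> / sqrt 2 \<le> b" for a b
  proof -
    have "\<rho> / sqrt 2 * (\<rho> / sqrt 2) \<le> a * b" using that \<rho>_pos by (intro mult_mono) (auto intro: order_trans[rotated])
    then show ?thesis by (simp add: power2_eq_square)
  qed
  have e: "slope (flow s p) (flow s q) = \<nu> - \<kappa> * (x * x + x * y + y * y)"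
    using \<sigma> by (auto simp: slope_def x_def y_def power2_eq_square)
  have "\<kappa> * (3 / 2 * \<rho>\<^sup>2) \<le> \<kappa> * (x * x + x * y + y * y)"
    using sq[OF xy(1) xy(1)] sq[OF xy] sq[OF xy(2) xy(2)] \<kappa>_bounds by (intro mult_left_mono) auto
  moreover have "\<kappa> * (3 / 2 * \<rho>\<^sup>2) = 3 / 2 * \<nu>" using \<rho>_sq by simp
  ultimately show "slope (flow s p) (flow s q) \<le> - (\<nu> / 2)" unfolding e by linarith
qed (use p q outer_R R_exit t \<nu>_pos \<nu>_le \<theta>_\<rho> in auto)

text \<open>Obtained from the Banach fixed point theorem for the time-one map on
  \<open>outer\<close>; the same contraction later gives attraction.\<close>

definition steady :: "real \<Rightarrow> ell2" where "steady \<sigma> = (THE u. u \<in> outer \<sigma> \<and> flow 1 u = u)"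

lemma steady_unique:
  assumes \<sigma>: "\<sigma> \<in> {1, -1}" shows "\<exists>!u. u \<in> outer \<sigma> \<and> flow 1 u = u"
proof -
  have "compact (outer \<sigma>)" unfolding outer_eq[OF \<sigma>] by (rule compact_ell2_box[OF summable_outer])
  moreover have "(\<sigma> * \<rho>) *\<^sub>R unit_vec 1 \<in> outer \<sigma>"
  proof -
    have "1 \<le> sqrt 2" by simp
    then show ?thesis using \<sigma> \<rho>_pos by (auto simp: outer_def S_box_def coord_unit_vec divide_le_eq)
  qed
  moreover have "exp (- (\<nu> / 4)) < 1" using \<nu>_pos by simp
  ultimately have "\<exists>!u\<in>outer \<sigma>. flow 1 u = u"
    by (intro Banach_fix[of _ "exp (- (\<nu> / 4))"])
      (use outer_flow[OF \<sigma>] outer_contraction[OF \<sigma>, of _ _ 1] in \<open>auto simp: compact_imp_complete dist_norm\<close>)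
  then show ?thesis by blast
qed

lemma steady_outer: "\<sigma> \<in> {1, -1} \<Longrightarrow> steady \<sigma> \<in> outer \<sigma>"
  unfolding steady_def using theI'[OF steady_unique] by blast

text \<open>The time-t map commutes with the time-one map and preserves \<open>outer\<close>, so it
  sends the unique fixed point to itself.\<close>

lemma steady_flow:
  assumes \<sigma>: "\<sigma> \<in> {1, -1}" and t: "0 \<le> t" shows "flow t (steady \<sigma>) = steady \<sigma>"
proof -
  let ?u = "steady \<sigma>"
  have u: "?u \<in> outer \<sigma>" "flow 1 ?u = ?u" unfolding steady_def using theI'[OF steady_unique[OF \<sigma>]] by blast+
  have "flow 1 (flow t ?u) = flow t (flow 1 ?u)" using t outer_R[OF u(1)] by (simp add: R_flow_add add.commute)
  then have "flow t ?u \<in> outer \<sigma> \<and> flow 1 (flow t ?u) = flow t ?u" using outer_flow[OF \<sigma> u(1) t] u by simp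
  then show ?thesis using steady_unique[OF \<sigma>] u by blast
qed

lemma steady_R: "\<sigma> \<in> {1, -1} \<Longrightarrow> steady \<sigma> \<in> R"
  using steady_outer outer_R by blast

lemma steady_fixed: "\<sigma> \<in> {1, -1} \<Longrightarrow> fixed_point flow exit_time (steady \<sigma>)"
  unfolding fixed_point_def using steady_flow R_flow(1)[OF steady_R] by blast

lemma full_steady: "\<sigma> \<in> {1, -1} \<Longrightarrow> full (\<lambda>_. steady \<sigma>)"
  by (intro full_fixed steady_R steady_flow)

lemma steady_attracts:
  assumes "\<sigma> \<in> {1, -1}" "p \<in> outer \<sigma>" "0 \<le> t"
  shows "norm (flow t p - steady \<sigma>) \<le> exp (- (\<nu> / 4) * t) * norm (p - steady \<sigma>)"
  using outer_contraction[OF assms(1,2) steady_outer[OF assms(1)] assms(3)] steady_flow[OF assms(1,3)] by simp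

text \<open>The point must be interior to \<open>outer\<close>. It avoids the outer faces because
  constant trajectories lie in the box of size 9/10 \<rho>, and the inner face because the field
  vanishes at it but not there.\<close>

lemma hyperbolic_steady:
  assumes \<sigma>: "\<sigma> \<in> {1, -1}" shows "hyperbolic_fixed_point flow exit_time (steady \<sigma>)"
proof -
  let ?u = "steady \<sigma>"
  have 1: "?u \<in> S_box 4 (9 / 10 * \<rho>)"
    using full_shrink[OF full_steady[OF \<sigma>] \<rho>_pos \<rho>_le] steady_outer[OF \<sigma>] \<rho>_sq by (auto simp: outer_def)
  have "((\<lambda>t. coord ?u 1) has_real_derivative F ?u 1) (at 0)"
    using full_deriv[OF full_steady[OF \<sigma>], of 1 0] by simp
  then have F0: "F ?u 1 = 0" by (rule DERIV_unique) simp
  then have strict: "\<rho> / sqrt 2 < \<sigma> * coord ?u 1"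
    using inner_face[OF _ \<sigma>, of ?u] steady_outer[OF \<sigma>] by (fastforce simp: outer_def)
  have "box_around ?u (outer \<sigma>)"
    unfolding outer_eq[OF \<sigma>]
  proof (rule box_around_ell2_box[OF _ summable_outer])
    fix k :: nat assume k: "1 \<le> k"
    have r: "- rad \<rho> k < coord ?u k \<and> coord ?u k < rad \<rho> k"
    proof -
      have "\<bar>coord ?u k\<bar> \<le> rad (9 / 10 * \<rho>) k" using 1 k unfolding S_box_eq by (auto dest: ell2_boxD)
      also have "\<dots> < rad \<rho> k"
        using \<rho>_pos k power_strict_mono[of "9 / 10 * \<rho>" \<rho> 3] by (auto simp: rad_def divide_strict_right_mono)
      finally show ?thesis by (simp add: abs_less_iff)
    qed
    show "lo \<sigma> k < coord ?u k \<and> coord ?u k < hi \<sigma> k"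
      using r strict \<sigma> by (cases "k = 1") (auto simp: lo_def hi_def rad_def)
  qed
  then show ?thesis
  proof (rule hyperbolic_attracting[OF _ steady_fixed[OF \<sigma>]])
    show "0 < \<nu> / 4" using \<nu>_pos by simp
    fix z t assume t: "0 \<le> t" "ereal t < exit_time z" and V: "\<And>s. 0 \<le> s \<Longrightarrow> s \<le> t \<Longrightarrow> flow s z \<in> outer \<sigma>"
    have "0 < exit_time z" using t by (auto simp: zero_ereal_def intro: le_less_trans[of _ "ereal t"])
    then have "z \<in> outer \<sigma>" using V[of 0] t by (simp add: flow_0)
    then show "norm (flow t z - ?u) \<le> exp (- (\<nu> / 4) * t) * norm (z - ?u)" by (rule steady_attracts[OF \<sigma> _ t(1)])
  qed (rule steady_outer[OF \<sigma>])
qed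

end

section \<open>Connecting orbits\<close>

lemma compact_nest_t2:
  fixes P :: "nat \<Rightarrow> 'a::t2_space set"
  assumes P: "\<And>n. compact (P n)" "\<And>n. P n \<noteq> {}" and mono: "\<And>m n. m \<le> n \<Longrightarrow> P n \<subseteq> P m"
  shows "(\<Inter>n. P n) \<noteq> {}"
proof -
  have "P 0 \<inter> (\<Inter>n. P n) \<noteq> {}"
  proof (rule compact_imp_fip_image[OF P(1)])
    show "closed (P n)" for n by (rule compact_imp_closed[OF P(1)])
    fix N :: "nat set" assume N: "finite N"
    have "P (Max (insert 0 N)) \<subseteq> P 0 \<inter> (\<Inter>n\<in>N. P n)"
      using N by (intro le_infI INF_greatest mono) auto
    then show "P 0 \<inter> (\<Inter>n\<in>N. P n) \<noteq> {}" using P(2) by blast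
  qed
  then show ?thesis by blast
qed

context ks_pos
begin

interpretation sbox 4 by unfold_locales simp

abbreviation "W \<equiv> S_box 4 \<rho>"

lemma W_flow: "p \<in> W \<Longrightarrow> 0 \<le> t \<Longrightarrow> flow t p \<in> W"
  using S_box_flow(2)[OF \<rho>_pos \<rho>_le] \<rho>_sq by simp

lemma W_R: "p \<in> W \<Longrightarrow> p \<in> R"
  using S_box_sub_R by blast

lemma compact_W: "compact W"
  unfolding S_box_eq by (rule compact_ell2_box[OF summable_rad[OF \<rho>_pos \<rho>_le_1]])

lemma continuous_flow: "0 \<le> t \<Longrightarrow> continuous_on R (flow t)"
  by (rule lipschitz_on_continuous_on[of "2 * exp (\<gamma> * t)"], rule lipschitz_onI)
    (use flow_lipschitz[OF _ R_exit R_exit] in \<open>auto simp: dist_norm\<close>)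

definition image_W :: "nat \<Rightarrow> ell2 set" where "image_W n = flow (real n) ` W"

lemma image_W_props: "compact (image_W n)" "connected (image_W n)" "image_W n \<subseteq> W"
proof -
  have c: "continuous_on W (flow (real n))"
    using continuous_flow S_box_sub_R by (rule continuous_on_subset) simp
  show "compact (image_W n)" unfolding image_W_def by (rule compact_continuous_image[OF c compact_W])
  have "connected W" unfolding S_box_eq by (rule convex_connected[OF convex_ell2_box])
  then show "connected (image_W n)" unfolding image_W_def by (rule connected_continuous_image[OF c])
  show "image_W n \<subseteq> W" unfolding image_W_def using W_flow by auto
qed

lemma image_W_Suc: "flow 1 ` image_W n = image_W (Suc n)"
  unfolding image_W_def image_image by (intro image_cong refl) (simp add: R_flow_add W_R)

lemma image_W_mono: "m \<le> n \<Longrightarrow> image_W n \<subseteq> image_W m"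
proof (induction n rule: dec_induct)
  case (step n)
  have "image_W (Suc n) \<subseteq> image_W n"
  proof
    fix x assume "x \<in> image_W (Suc n)"
    then obtain w where w: "w \<in> W" "x = flow (real (Suc n)) w" by (auto simp: image_W_def)
    have "x = flow (real n) (flow 1 w)" using w by (simp add: R_flow_add W_R add.commute)
    then show "x \<in> image_W n" unfolding image_W_def using W_flow[OF w(1), of 1] by simp
  qed
  then show ?case using step by blast
qed simp

text \<open>The preimages of x under the time-one map inside the images form a decreasing sequence
  of nonempty compact sets; a common point lies in every image.\<close>

lemma image_W_preimage:
  assumes "x \<in> (\<Inter>n. image_W n)" shows "\<exists>y \<in> (\<Inter>n. image_W n). flow 1 y = x"
proof -
  define P where "P n = image_W n \<inter> {y \<in> W. flow 1 y = x}" for n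
  have "closed {y \<in> W. flow 1 y = x}"
  proof -
    have "continuous_on W (flow 1)" using continuous_flow S_box_sub_R by (rule continuous_on_subset) simp
    then show ?thesis
      by (intro continuous_closed_preimage_constant compact_imp_closed compact_W)
  qed
  then have "compact (P n)" for n unfolding P_def by (intro compact_Int_closed image_W_props)
  then have "(\<Inter>n. P n) \<noteq> {}"
  proof (rule compact_nest_t2)
    show "P n \<noteq> {}" for n
    proof -
      have "x \<in> flow 1 ` image_W n" unfolding image_W_Suc using assms by blast
      then show ?thesis unfolding P_def using image_W_props(3) by blast
    qed
    show "P n \<subseteq> P m" if "m \<le> n" for m n using image_W_mono[OF that] unfolding P_def by blast
  qed
  then show ?thesis unfolding P_def by blast
qed

text \<open>Dependent choice of time-one preimages gives a backward sequence, and the flow fills in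
  the times between.\<close>

lemma full_through:
  assumes x: "x \<in> (\<Inter>n. image_W n)" obtains z where "full z" "z 0 = x"
proof -
  define I where "I = (\<Inter>n. image_W n)"
  have "\<exists>q. \<forall>n. (q n \<in> I \<and> (n = 0 \<longrightarrow> q n = x)) \<and> flow 1 (q (Suc n)) = q n"
  proof (rule dependent_nat_choice)
    show "\<exists>y. y \<in> I \<and> ((0::nat) = 0 \<longrightarrow> y = x)" using x unfolding I_def by blast
    show "\<exists>y'. (y' \<in> I \<and> (Suc n = 0 \<longrightarrow> y' = x)) \<and> flow 1 y' = y" if "y \<in> I \<and> (n = 0 \<longrightarrow> y = x)" for y n
      using image_W_preimage[of y] that unfolding I_def by blast
  qed
  then obtain q where q: "\<And>n. q n \<in> I" "q 0 = x" "\<And>n. flow 1 (q (Suc n)) = q n" by blast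
  have qW: "q n \<in> W" for n using q(1)[of n] image_W_props(3) unfolding I_def by blast
  have qR: "q n \<in> R" for n using W_R[OF qW] .
  have step: "flow (real m) (q (n + m)) = q n" for m n
  proof (induction m)
    case 0 then show ?case by (simp add: R_flow_0 qR)
  next
    case (Suc m)
    have "flow (real (Suc m)) (q (n + Suc m)) = flow (real m) (flow 1 (q (Suc (n + m))))"
      by (simp add: R_flow_add qR add.commute)
    then show ?case using q(3)[of "n + m"] Suc by simp
  qed
  \<comment> \<open>Starting from the preimage at time - j with j \<ge> \<bar>t\<bar>, the flow runs
    for the nonnegative time t + j; any j with t + j \<ge> 0 gives the same value.\<close>
  define z where "z t = flow (t + real (nat \<lceil>\<bar>t\<bar>\<rceil>)) (q (nat \<lceil>\<bar>t\<bar>\<rceil>))" for t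
  have eq: "flow (t + real i) (q i) = flow (t + real j) (q j)" if "i \<le> j" "0 \<le> t + real i" for t i j
  proof -
    have "flow (t + real i) (q i) = flow (t + real i) (flow (real (j - i)) (q (i + (j - i))))"
      by (simp only: step)
    also have "\<dots> = flow (t + real j) (q j)" using that qR by (simp add: R_flow_add of_nat_diff)
    finally show ?thesis .
  qed
  have nn: "0 \<le> t + real (nat \<lceil>\<bar>t\<bar>\<rceil>)" for t by linarith
  have z: "z t = flow (t + real j) (q j)" if "0 \<le> t + real j" for t j
    unfolding z_def
  proof (cases "j \<le> nat \<lceil>\<bar>t\<bar>\<rceil>")
    case True
    then show "flow (t + real (nat \<lceil>\<bar>t\<bar>\<rceil>)) (q (nat \<lceil>\<bar>t\<bar>\<rceil>)) = flow (t + real j) (q j)" by (rule eq[OF _ that, symmetric])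
  next
    case False
    then have "nat \<lceil>\<bar>t\<bar>\<rceil> \<le> j" by (rule linorder_not_le[THEN iffD1, THEN less_imp_le])
    then show "flow (t + real (nat \<lceil>\<bar>t\<bar>\<rceil>)) (q (nat \<lceil>\<bar>t\<bar>\<rceil>)) = flow (t + real j) (q j)" using nn by (rule eq)
  qed
  have "full z"
    unfolding full_iff
  proof (intro conjI allI impI)
    show "range z \<subseteq> R" unfolding z_def using R_flow(2)[OF qR nn] by blast
    fix s t :: real assume s: "0 \<le> s"
    let ?j = "nat \<lceil>\<bar>t\<bar>\<rceil>"
    have "flow s (z t) = flow (s + (t + real ?j)) (q ?j)"
      unfolding z_def using s nn[of t] qR by (simp add: R_flow_add)
    also have "\<dots> = z (t + s)" using z[of "t + s" ?j] s nn[of t] by (simp add: algebra_simps)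
    finally show "flow s (z t) = z (t + s)" .
  qed
  moreover have "z 0 = x" using q(2) R_flow_0[OF qR[of 0]] by (simp add: z_def)
  ultimately show ?thesis by (rule that)
qed

lemma connecting_point:
  assumes \<sigma>: "\<sigma> \<in> {1, -1}"
  obtains z where "full z" "\<sigma> * coord (z 0) 1 = \<rho> / sqrt 2"
proof -
  define P where "P n = image_W n \<inter> {y. \<sigma> * coord y 1 = \<rho> / sqrt 2}" for n
  have "(\<Inter>n. P n) \<noteq> {}"
  proof (intro compact_nest_t2)
    show "compact (P n)" for n
      unfolding P_def
      by (intro compact_Int_closed image_W_props closed_Collect_eq continuous_intros)
    show "P n \<noteq> {}" for n
    proof -
      let ?f = "\<lambda>y. \<sigma> * coord y 1"
      have "connected (?f ` image_W n)"
        by (intro connected_continuous_image image_W_props continuous_intros)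
      moreover have "0 \<in> image_W n"
        unfolding image_W_def using zero_in_S_box[OF \<rho>_pos] zero_flow(2)[of "real n"] by (metis imageI of_nat_0_le_iff)
      then have "0 \<in> ?f ` image_W n" by force
      moreover have "steady \<sigma> \<in> image_W n"
        unfolding image_W_def using steady_outer[OF \<sigma>] steady_flow[OF \<sigma>, of "real n"] by (force simp: outer_def)
      then have "?f (steady \<sigma>) \<in> ?f ` image_W n" by blast
      moreover have "0 \<le> \<rho> / sqrt 2" "\<rho> / sqrt 2 \<le> ?f (steady \<sigma>)"
        using \<rho>_pos steady_outer[OF \<sigma>] by (auto simp: outer_def)
      ultimately have "\<rho> / sqrt 2 \<in> ?f ` image_W n" unfolding connected_iff_interval by blast
      then show ?thesis unfolding P_def by force
    qed
    show "P n \<subseteq> P m" if "m \<le> n" for m n using image_W_mono[OF that] unfolding P_def by blast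
  qed
  then obtain x where x: "x \<in> (\<Inter>n. image_W n)" "\<sigma> * coord x 1 = \<rho> / sqrt 2" unfolding P_def by blast
  from full_through[OF x(1)] x(2) that show ?thesis by metis
qed

lemma full_W: "full z \<Longrightarrow> z t \<in> W"
  using full_in_box[OF _ \<rho>_pos \<rho>_le eq_refl[OF \<rho>_sq]] by blast

text \<open>By the cone argument, a full trajectory with Q \<le> 0 at one time would coincide with
  the zero trajectory.\<close>

lemma full_Q: assumes z: "full z" and "z a \<noteq> 0" shows "0 < Q (z t)"
proof (rule ccontr)
  assume "\<not> 0 < Q (z t)"
  then have "z = (\<lambda>_. 0)" by (intro full_cone[OF z full_zero, of t]) simp
  then show False using assms(2) by simp
qed

lemma bound_to_zero:
  assumes "\<And>T. 0 \<le> T \<Longrightarrow> a \<le> exp (- (\<nu> / 4) * T) * (b::real)" shows "a \<le> 0"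
proof -
  have "((\<lambda>T. exp (- (\<nu> / 4) * T) * b) \<longlongrightarrow> 0) at_top" using \<nu>_pos by real_asymp
  then show ?thesis by (rule tendsto_lowerbound) (intro eventually_at_top_linorderI[of 0] assms, simp_all)
qed

text \<open>Contraction towards the fixed point has acted for an arbitrarily long time on a bounded
  distance.\<close>

lemma full_past_outer:
  assumes z: "full z" and \<sigma>: "\<sigma> \<in> {1, -1}" and out: "\<And>s. s \<le> t \<Longrightarrow> z s \<in> outer \<sigma>"
  shows "z t = steady \<sigma>"
proof -
  have "norm (z t - steady \<sigma>) \<le> exp (- (\<nu> / 4) * T) * 1" if T: "0 \<le> T" for T
  proof -
    have "norm (flow T (z (t - T)) - steady \<sigma>) \<le> exp (- (\<nu> / 4) * T) * norm (z (t - T) - steady \<sigma>)"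
      using T by (intro steady_attracts[OF \<sigma>] out) auto
    moreover have "norm (z (t - T) - steady \<sigma>) \<le> 1"
      using norm_triangle_ineq4[of "z (t - T)" "steady \<sigma>"] R_norm[OF fullD(1)[OF z, of "t - T"]] R_norm[OF steady_R[OF \<sigma>]]
      by linarith
    then have "exp (- (\<nu> / 4) * T) * norm (z (t - T) - steady \<sigma>) \<le> exp (- (\<nu> / 4) * T) * 1" by (intro mult_left_mono) auto
    moreover have "flow T (z (t - T)) = z t" using fullD(2)[OF z T, of "t - T"] by simp
    ultimately show ?thesis by (metis order_trans)
  qed
  then have "norm (z t - steady \<sigma>) \<le> 0" by (rule bound_to_zero)
  then show ?thesis by simp
qed

text \<open>Growth read backwards: the first coordinate is at most \<rho> at the end of a stay of
  length T in the middle, so it was exponentially small in T at the beginning.\<close>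

lemma full_growth:
  assumes z: "full z" and T: "0 \<le> T" and nz: "z t \<noteq> 0"
    and mid: "\<And>s. 0 \<le> s \<Longrightarrow> s \<le> T \<Longrightarrow> (coord (z (t + s)) 1)\<^sup>2 \<le> \<rho>\<^sup>2 / 2"
  shows "\<bar>coord (z t) 1\<bar> \<le> exp (- (\<nu> / 4) * T) * \<rho>"
proof -
  have "exp (\<nu> / 4 * T) * \<bar>coord (z t) 1\<bar> \<le> \<bar>coord (flow T (z t)) 1\<bar>"
    using T by (intro growth[OF \<rho>_pos \<rho>_le \<rho>_sq \<nu>_pos] full_Q[OF z nz] fullD(1)[OF z])
      (simp_all only: fullD(2)[OF z] full_W[OF z] mid)
  also have "\<dots> \<le> \<rho>"
  proof -
    have "(coord (z (t + T)) 1)\<^sup>2 \<le> \<rho>\<^sup>2" using mid[OF T order_refl] zero_le_power2[of \<rho>] by linarith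
    then show ?thesis using \<rho>_pos abs_le_square_iff[of "coord (z (t + T)) 1" \<rho>] T by (simp add: fullD(2)[OF z])
  qed
  finally have "exp (- (\<nu> / 4) * T) * (exp (\<nu> / 4 * T) * \<bar>coord (z t) 1\<bar>) \<le> exp (- (\<nu> / 4) * T) * \<rho>"
    by (intro mult_left_mono) auto
  moreover have "exp (- (\<nu> / 4) * T) * exp (\<nu> / 4 * T) = 1" by (simp flip: exp_add)
  ultimately show ?thesis by (metis mult.assoc mult_1)
qed

lemma inner_sq: "(\<rho> / sqrt 2)\<^sup>2 = \<rho>\<^sup>2 / 2"
  by (simp add: power_divide)

text \<open>Forwards, the orbit starts on the boundary of \<open>outer\<close>, where it is
  attracted. Backwards it remains in the middle, so the first coordinate tends to 0 by
  \<open>full_growth\<close>, and Q > 0 makes the remaining coordinates follow.\<close>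

lemma connecting_orbit:
  assumes z: "full z" and \<sigma>: "\<sigma> \<in> {1, -1}" and z0: "\<sigma> * coord (z 0) 1 = \<rho> / sqrt 2"
  shows "heteroclinic flow exit_time 0 (steady \<sigma>) z"
  unfolding heteroclinic_def
proof (intro conjI)
  have in_pos: "0 < \<rho> / sqrt 2" using \<rho>_pos by simp
  have outI: "z t \<in> outer \<tau>" if "\<rho> / sqrt 2 \<le> \<tau> * coord (z t) 1" for t \<tau>
    using that full_W[OF z] by (simp add: outer_def)
  have nz: "z 0 \<noteq> 0" using z0 in_pos by auto
  have znz: "z t \<noteq> 0" for t using full_Q[OF z nz, of t] unfolding Qform_1 by (auto simp: Yp_def)
  show "trajectory flow exit_time UNIV UNIV z" using z unfolding trajectory_def by auto
  show "(z \<longlongrightarrow> steady \<sigma>) at_top"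
  proof (rule Lim_transform_bound[where f = "\<lambda>t. z t - steady \<sigma>", THEN LIM_zero_cancel])
    show "\<forall>\<^sub>F t in at_top. norm (z t - steady \<sigma>) \<le> norm (exp (- (\<nu> / 4) * t) * norm (z 0 - steady \<sigma>))"
    proof (rule eventually_at_top_linorderI[of 0])
      fix t :: real assume t: "0 \<le> t"
      have "norm (flow t (z 0) - steady \<sigma>) \<le> exp (- (\<nu> / 4) * t) * norm (z 0 - steady \<sigma>)"
        using z0 t by (intro steady_attracts[OF \<sigma> outI]) auto
      then show "norm (z t - steady \<sigma>) \<le> norm (exp (- (\<nu> / 4) * t) * norm (z 0 - steady \<sigma>))"
        using t by (simp add: fullD(2)[OF z])
    qed
    show "((\<lambda>t. exp (- (\<nu> / 4) * t) * norm (z 0 - steady \<sigma>)) \<longlongrightarrow> 0) at_top" using \<nu>_pos by real_asymp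
  qed
  have stay: "z (t + s) \<in> outer \<tau>" if "z t \<in> outer \<tau>" "\<tau> \<in> {1, -1}" "0 \<le> s" for t s \<tau>
    using outer_flow[OF that(2,1,3)] that(3) by (simp add: fullD(2)[OF z])
  have past: "\<bar>coord (z t) 1\<bar> \<le> \<rho> / sqrt 2" if t: "t \<le> 0" for t
  proof -
    \<comment> \<open>An earlier time beyond the threshold would keep the orbit in
      \<open>outer\<close> up to time 0, but the derivative at time 0 is positive in direction
      \<sigma>, so just before 0 the orbit is outside.\<close>
    have "\<sigma> * coord (z t) 1 \<le> \<rho> / sqrt 2"
    proof (rule ccontr)
      assume "\<not> ?thesis"
      then have gt: "\<rho> / sqrt 2 < \<sigma> * coord (z t) 1" by simp
      then have t0: "t < 0" using t z0 by (cases "t = 0") auto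
      have "((\<lambda>t. \<sigma> * coord (z t) 1) has_real_derivative \<sigma> * F (z 0) 1) (at 0)"
        by (intro DERIV_cmult full_deriv[OF z]) simp
      moreover have "0 < \<sigma> * F (z 0) 1" by (rule inner_face[OF full_W[OF z] \<sigma> z0])
      ultimately obtain d where d: "0 < d" "\<And>e. 0 < e \<Longrightarrow> e < d \<Longrightarrow> \<sigma> * coord (z (0 - e)) 1 < \<sigma> * coord (z 0) 1"
        using DERIV_pos_inc_left[of "\<lambda>t. \<sigma> * coord (z t) 1"] by blast
      define e where "e = min (d / 2) (- t)"
      have e: "0 < e" "e < d" "t \<le> - e" using d t0 by (auto simp: e_def min_def)
      have "z (- e) \<in> outer \<sigma>" using stay[OF outI \<sigma>, of t "- e - t"] gt e by simp
      then show False using d(2)[OF e(1,2)] z0 by (simp add: outer_def)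
    qed
    \<comment> \<open>Beyond the opposite threshold the orbit would be trapped on the wrong side at
      time 0.\<close>
    moreover have "- \<sigma> * coord (z t) 1 \<le> \<rho> / sqrt 2"
    proof (rule ccontr)
      assume "\<not> ?thesis"
      then have "z t \<in> outer (- \<sigma>)" by (intro outI) simp
      from stay[OF this, of "- t"] have "z 0 \<in> outer (- \<sigma>)" using \<sigma> t by auto
      then show False using z0 in_pos by (auto simp: outer_def)
    qed
    ultimately show ?thesis using \<sigma> by (auto simp: abs_le_iff)
  qed
  show "(z \<longlongrightarrow> 0) at_bot"
  proof (rule Lim_transform_bound)
    show "\<forall>\<^sub>F t in at_bot. norm (z t) \<le> norm (2 * (exp (\<nu> / 4 * t) * \<rho>))"
    proof (rule eventually_at_bot_linorderI[of 0])
      fix t :: real assume t: "t \<le> 0"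
      let ?e = "exp (\<nu> / 4 * t) * \<rho>"
      have "\<bar>coord (z t) 1\<bar> \<le> exp (- (\<nu> / 4) * (- t)) * \<rho>"
      proof (rule full_growth[OF z _ znz])
        fix s assume "s \<le> - t"
        then have "\<bar>coord (z (t + s)) 1\<bar>\<^sup>2 \<le> (\<rho> / sqrt 2)\<^sup>2" by (intro power_mono past) auto
        then show "(coord (z (t + s)) 1)\<^sup>2 \<le> \<rho>\<^sup>2 / 2" unfolding inner_sq by simp
      qed (use t in simp)
      then have "\<bar>coord (z t) 1\<bar>\<^sup>2 \<le> ?e\<^sup>2" by (intro power_mono) auto
      moreover have "Yp (z t) \<le> \<bar>coord (z t) 1\<bar>\<^sup>2" using full_Q[OF z nz, of t] unfolding Qform_1 by simp
      ultimately have "(norm (z t))\<^sup>2 \<le> 2 * ?e\<^sup>2" unfolding norm_sq_Yp by simp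
      also have "\<dots> \<le> (2 * ?e)\<^sup>2" unfolding power_mult_distrib by (intro mult_right_mono) auto
      finally have "norm (z t) \<le> 2 * ?e" by (rule power2_le_imp_le) (use \<rho>_pos in auto)
      then show "norm (z t) \<le> norm (2 * ?e)" by simp
    qed
    show "((\<lambda>t. 2 * (exp (\<nu> / 4 * t) * \<rho>)) \<longlongrightarrow> 0) at_bot" using \<nu>_pos by real_asymp
  qed
qed

text \<open>If the first coordinate ever takes a threshold value, injectivity makes the trajectory a
  time shift of p or m. Otherwise the intermediate value theorem confines it to one of three
  regions: in the outer ones it is a fixed point, and in the middle one unlimited growth is possible
  only for 0.\<close>

lemma full_classify:
  assumes z: "full z" and p: "full p" "coord (p 0) 1 = \<rho> / sqrt 2" and m: "full m" "coord (m 0) 1 = - (\<rho> / sqrt 2)"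
  shows "z 0 \<in> {0, steady (-1), steady 1} \<union> range m \<union> range p"
proof (cases "z 0 = 0")
  case nz: False
  have in_pos: "0 < \<rho> / sqrt 2" using \<rho>_pos by simp
  have cont: "isCont (\<lambda>t. coord (z t) 1) t" for t by (rule DERIV_isCont[OF full_deriv[OF z]]) simp
  have pass: "\<exists>s. coord (z s) 1 = y" if "coord (z a) 1 \<le> y" "y \<le> coord (z b) 1" for a b y
  proof -
    have "connected (range (\<lambda>t. coord (z t) 1))"
      using cont by (intro connected_continuous_image) (auto simp: continuous_on_eq_continuous_at)
    then have "y \<in> range (\<lambda>t. coord (z t) 1)" using that unfolding connected_iff_interval by blast
    then show ?thesis by auto
  qed
  have "z 0 \<in> range w" if "full w" "coord (w 0) 1 = coord (z s) 1" for w s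
  proof -
    have "(\<lambda>t. z (t + s)) = w"
      by (rule full_coord_inj[of _ _ 0, OF full_shift[OF z] that(1)]) (simp only: that(2) add_0_left)
    then have "z 0 = w (- s)" by (auto dest: fun_cong[of _ _ "- s"])
    then show ?thesis by simp
  qed
  then consider "z 0 \<in> range p \<union> range m" | "\<And>s. coord (z s) 1 \<noteq> \<rho> / sqrt 2" "\<And>s. coord (z s) 1 \<noteq> - (\<rho> / sqrt 2)"
    using p m by (metis UnI1 UnI2)
  then show ?thesis
  proof cases
    case 2
    consider "coord (z 0) 1 < - (\<rho> / sqrt 2)" | "\<rho> / sqrt 2 < coord (z 0) 1" | "\<bar>coord (z 0) 1\<bar> < \<rho> / sqrt 2"
      using 2(1)[of 0] 2(2)[of 0] by linarith
    then show ?thesis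
    proof cases
      case 1
      have "coord (z s) 1 < - (\<rho> / sqrt 2)" for s
        using pass[of 0 "- (\<rho> / sqrt 2)" s] 2(2) 1 by force
      then have "\<rho> / sqrt 2 \<le> - 1 * coord (z s) 1" for s by (simp add: le_minus_iff less_imp_le)
      then have "z 0 = steady (-1)"
        by (intro full_past_outer[OF z]) (auto simp: outer_def full_W[OF z])
      then show ?thesis by simp
    next
      case right: 2
      have "\<rho> / sqrt 2 < coord (z s) 1" for s
        using pass[of s "\<rho> / sqrt 2" 0] 2(1) right by force
      then have "z 0 = steady 1"
        by (intro full_past_outer[OF z]) (auto simp: outer_def full_W[OF z] less_imp_le)
      then show ?thesis by simp
    next
      case 3
      have mid: "\<bar>coord (z s) 1\<bar> \<le> \<rho> / sqrt 2" for s
        using pass[of 0 "\<rho> / sqrt 2" s] pass[of s "- (\<rho> / sqrt 2)" 0] 2 3 in_pos by force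
      have "\<bar>coord (z 0) 1\<bar> \<le> exp (- (\<nu> / 4) * T) * \<rho>" if "0 \<le> T" for T
      proof (rule full_growth[OF z that nz])
        fix s
        have "\<bar>coord (z (0 + s)) 1\<bar>\<^sup>2 \<le> (\<rho> / sqrt 2)\<^sup>2" by (intro power_mono mid) auto
        then show "(coord (z (0 + s)) 1)\<^sup>2 \<le> \<rho>\<^sup>2 / 2" unfolding inner_sq by simp
      qed
      then have "\<bar>coord (z 0) 1\<bar> \<le> 0" by (rule bound_to_zero)
      then have "Q (z 0) \<le> 0" unfolding Qform_1 using Yp_nonneg by simp
      then show ?thesis using full_Q[OF z nz, of 0] by simp
    qed
  qed blast
qed simp

lemma pitchfork_orbits:
  obtains zm zp where
    "heteroclinic flow exit_time 0 (steady (-1)) zm" "heteroclinic flow exit_time 0 (steady 1) zp"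
    "maximal_invariant_set flow exit_time R ({0, steady (-1), steady 1} \<union> range zm \<union> range zp)"
proof -
  obtain zp where p: "full zp" "1 * coord (zp 0) 1 = \<rho> / sqrt 2" by (rule connecting_point[of 1]) auto
  obtain zm where m: "full zm" "-1 * coord (zm 0) 1 = \<rho> / sqrt 2" by (rule connecting_point[of "-1"]) auto
  have "{0, steady (-1), steady 1} \<union> range zm \<union> range zp \<subseteq> attractor"
    using full_range_attractor[OF p(1)] full_range_attractor[OF m(1)] full_range_attractor[OF full_zero]
      full_range_attractor[OF full_steady[of 1]] full_range_attractor[OF full_steady[of "-1"]] by simp
  moreover have "attractor \<subseteq> {0, steady (-1), steady 1} \<union> range zm \<union> range zp"
    unfolding attractor_def using full_classify[OF _ p(1) _ m(1)] p m by auto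
  ultimately have "attractor = {0, steady (-1), steady 1} \<union> range zm \<union> range zp" by blast
  with maximal_invariant_attractor have "maximal_invariant_set flow exit_time R ({0, steady (-1), steady 1} \<union> range zm \<union> range zp)"
    by simp
  then show ?thesis using connecting_orbit[OF p(1) _ p(2)] connecting_orbit[OF m(1) _ m(2)] by (intro that) auto
qed

lemma steady_distinct: "steady 1 \<noteq> 0" "steady (-1) \<noteq> 0" "steady (-1) \<noteq> steady 1"
proof -
  have "0 < \<rho> / sqrt 2" using \<rho>_pos by simp
  then have "0 < coord (steady 1) 1" "coord (steady (-1)) 1 < 0"
    using steady_outer[of 1] steady_outer[of "-1"] by (auto simp: outer_def)
  then show "steady 1 \<noteq> 0" "steady (-1) \<noteq> 0" "steady (-1) \<noteq> steady 1" by auto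
qed

end

section \<open>The bifurcation\<close>

lemma cuboid_0: "0 \<le> r \<Longrightarrow> cuboid 0 {0} c T r = T"
  by (auto simp: cuboid_def)

text \<open>The zero subspace and \<open>Euclidean_space 0\<close> are both single points, so the
  constant map serves as chart.\<close>

lemma cuboid_data_0:
  assumes "T \<noteq> {}" "compact T" shows "cuboid_data 0 {0} (\<lambda>_ _. 0) T"
  unfolding cuboid_data_def
proof (intro conjI assms exI[of _ "{}"])
  have "topspace (Euclidean_space 0) = {\<lambda>_. 0}" by (auto simp: topspace_Euclidean_space)
  moreover have "continuous_map (top_of_set {0 :: ell2}) (Euclidean_space 0) (\<lambda>_ _. 0)"
    using calculation by (intro continuous_map_const[THEN iffD2] disjI2) simp
  moreover have "continuous_map (Euclidean_space 0) (top_of_set {0 :: ell2}) (\<lambda>_. 0)"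
    by (intro continuous_map_const[THEN iffD2] disjI2) simp
  ultimately have "homeomorphic_maps (top_of_set {0 :: ell2}) (Euclidean_space 0) (\<lambda>_ _. 0) (\<lambda>_. 0)"
    unfolding homeomorphic_maps_def by simp
  then show "homeomorphic_map (top_of_set {0 :: ell2}) (Euclidean_space 0) (\<lambda>_ _. 0)"
    by (rule homeomorphic_maps_map[THEN iffD1, THEN conjunct1])
  show "T \<subseteq> orthogonal_comp {0}" by (auto simp: orthogonal_comp_def orthogonal_def)
qed (auto simp: independent_empty)

text \<open>Without unstable directions enlarging the ball changes nothing, so both cuboids are T:
  the exit condition holds vacuously because there are no points between them, and forward
  invariance gives the rest.\<close>

lemma isolating_cuboid_invariant:
  assumes "T \<noteq> {}" "compact T" "0 < \<epsilon>" "\<And>z. z \<in> T \<Longrightarrow> tmax z = \<infinity>" "\<And>z t. z \<in> T \<Longrightarrow> 0 \<le> t \<Longrightarrow> \<phi> t z \<in> T"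
  shows "isolating_cuboid \<phi> tmax \<epsilon> 0 {0} (\<lambda>_ _. 0) T"
proof -
  have "cuboid 0 {0} (\<lambda>_ _. 0) T 1 = T" "cuboid 0 {0} (\<lambda>_ _. 0) T (1 + \<epsilon>) = T"
    using assms(3) by (simp_all add: cuboid_0)
  then show ?thesis
    unfolding isolating_cuboid_def Let_def
    using assms by (auto simp: cuboid_data_0 intro!: exI[of _ 1])
qed

theorem theorem4p9:
  "\<exists>(\<sigma>s :: subst list) (U :: ell2 set) (h :: real \<Rightarrow> vfield) (\<mu>\<^sub>p :: real) (\<mu>\<^sub>m :: real).
     list_all nf_subst \<sigma>s \<and>
     open U \<and> 0 \<in> U \<and>
     (\<forall>\<mu> \<ge> 1/2.
        analytic_diffeo_on (nf_map \<sigma>s \<mu>) U \<and>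
        transforms_into (nf_map \<sigma>s \<mu>) U (KS_ladder \<mu>) (normalized_system h \<mu>)) \<and>
     (\<exists>s0. \<forall>s\<ge>s0. remainder_bounds s U h) \<and>
     1/2 < \<mu>\<^sub>p \<and> \<mu>\<^sub>p < 1 \<and> 1 < \<mu>\<^sub>m \<and>
     pitchfork U (\<lambda>\<nu>. normalized_system h (1 - \<nu>)) (lam 1 \<mu>\<^sub>m) (lam 1 \<mu>\<^sub>p)"
proof -
  interpret sbox 4 by unfold_locales simp
  obtain L where L: "0 < L" "\<And>\<mu> b b' k. 1 / 2 \<le> \<mu> \<Longrightarrow> b \<in> nf_dom \<Longrightarrow> b' \<in> nf_dom \<Longrightarrow> 1 \<le> k \<Longrightarrow>
    \<bar>remainder \<mu> b k - remainder \<mu> b' k\<bar> \<le> L * real k * norm (b - b')" by (rule remainder_lipschitz) blast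
  obtain K where K: "0 < K"
    "\<And>\<mu> C b. 1 / 2 \<le> \<mu> \<Longrightarrow> 0 < C \<Longrightarrow> C \<le> 1 / 4 \<Longrightarrow> b \<in> S_box 4 C \<Longrightarrow> \<bar>remainder \<mu> b 1\<bar> \<le> K * C ^ 5"
    "\<And>\<mu> C b k. 1 / 2 \<le> \<mu> \<Longrightarrow> 0 < C \<Longrightarrow> C \<le> 1 / 4 \<Longrightarrow> b \<in> S_box 4 C \<Longrightarrow> 2 \<le> k \<Longrightarrow>
      \<bar>remainder \<mu> b k\<bar> \<le> K * (C ^ 4 / real k powr (4 - 2))"
    "\<And>\<mu> C b b'. 1 / 2 \<le> \<mu> \<Longrightarrow> 0 < C \<Longrightarrow> C \<le> 1 / 4 \<Longrightarrow> b \<in> S_box 4 C \<Longrightarrow> b' \<in> S_box 4 C \<Longrightarrow>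
      \<bar>remainder \<mu> b 1 - remainder \<mu> b' 1\<bar> \<le> K * (C ^ 3 * (\<bar>coord b 1 - coord b' 1\<bar> + wstar (b - b')))"
    "\<And>\<mu> C b b' k. 1 / 2 \<le> \<mu> \<Longrightarrow> 0 < C \<Longrightarrow> C \<le> 1 / 4 \<Longrightarrow> b \<in> S_box 4 C \<Longrightarrow> b' \<in> S_box 4 C \<Longrightarrow> 2 \<le> k \<Longrightarrow>
      \<bar>remainder \<mu> b k - remainder \<mu> b' k\<bar> \<le>
        K * (C ^ 3 * \<bar>coord b 1 - coord b' 1\<bar> / real k ^ 3 + C * real k * wconv k (b - b'))"
    using remainder_estimates by blast
  \<comment> \<open>The first bound keeps the box inside \<open>nf_dom\<close>, the second is the
    smallness condition of \<open>ks_dyn\<close> solved for \<open>C0\<close>.\<close>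
  define C0 where "C0 = min (1 / 10) (1 / (64 * K * (1 + Z)\<^sup>2))"
  \<comment> \<open>Since \<kappa> \<ge> 3/10, \<nu> \<le> \<delta> forces \<rho> \<le>
    \<open>C0\<close>: one box, fixed in advance, contains all bifurcating solutions.\<close>
  define \<delta> where "\<delta> = C0\<^sup>2 / 10"
  have Zp: "0 < (1 + Z)\<^sup>2" using Z_ge by simp
  have C0: "0 < C0" "C0 \<le> 1 / 10" using K(1) Zp by (auto simp: C0_def)
  have "64 * K * (1 + Z)\<^sup>2 * C0 \<le> 64 * K * (1 + Z)\<^sup>2 * (1 / (64 * K * (1 + Z)\<^sup>2))"
    using K(1) Zp by (intro mult_left_mono) (auto simp: C0_def)
  then have small: "64 * K * C0 * (1 + Z)\<^sup>2 \<le> 1" using K(1) Zp by (simp add: mult_ac)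
  have "C0\<^sup>2 \<le> 1" using C0 by (intro power_le_one) auto
  then have \<delta>: "0 < \<delta>" "\<delta> \<le> 1 / 10" using C0 by (auto simp: \<delta>_def)
  have dyn: "ks_dyn \<nu> K L C0" if "\<nu> \<in> {- \<delta>..\<delta>}" for \<nu>
  proof
    have "1 / 2 \<le> 1 - \<nu>" using that \<delta> by auto
    then show "\<bar>remainder (1 - \<nu>) b k - remainder (1 - \<nu>) b' k\<bar> \<le> L * real k * norm (b - b')"
      if "b \<in> nf_dom" "b' \<in> nf_dom" "1 \<le> k" for b b' k using L(2) that by blast
    show "\<bar>\<nu>\<bar> \<le> C0\<^sup>2 / 10" using that by (auto simp: \<delta>_def)
  qed (use K L(1) C0 small that \<delta> in auto)
  \<comment> \<open>The semiflow depends only on the domain and the field, so a single family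
    indexed by \<nu> can be fixed before the locales for different parameters are
    interpreted.\<close>
  define flw where "flw \<nu> = damped_system.flow nf_dom (nf_field (1 - \<nu>))" for \<nu>
  define tm where "tm \<nu> = damped_system.exit_time nf_dom (nf_field (1 - \<nu>))" for \<nu>
  let ?R = "S_box 4 C0"
  have R: "cuboid 0 {0} (\<lambda>_ _. 0) ?R 1 = ?R" by (rule cuboid_0) simp
  have gen: "semiflow_of nf_dom (nf_field (1 - \<nu>)) (flw \<nu>) (tm \<nu>) \<and>
      isolating_cuboid (flw \<nu>) (tm \<nu>) 1 0 {0} (\<lambda>_ _. 0) ?R \<and> fixed_point (flw \<nu>) (tm \<nu>) 0"
    if \<nu>: "\<nu> \<in> {- \<delta>..\<delta>}" for \<nu>
  proof -
    interpret D: ks_dyn \<nu> K L C0 by (rule dyn[OF \<nu>])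
    have "compact ?R" unfolding D.S_box_eq using C0 by (intro compact_ell2_box D.summable_rad) auto
    then have "isolating_cuboid (flw \<nu>) (tm \<nu>) 1 0 {0} (\<lambda>_ _. 0) ?R"
      using D.zero_in_R D.R_flow unfolding flw_def tm_def by (intro isolating_cuboid_invariant) auto
    then show ?thesis using D.semiflow_of_flow D.zero_fixed unfolding flw_def tm_def by blast
  qed
  have nonpos: "(\<nu> < 0 \<longrightarrow> hyperbolic_fixed_point (flw \<nu>) (tm \<nu>) 0) \<and> maximal_invariant_set (flw \<nu>) (tm \<nu>) ?R {0}"
    if \<nu>: "\<nu> \<in> {- \<delta>..0}" for \<nu>
  proof -
    interpret D: ks_dyn \<nu> K L C0 by (rule dyn) (use \<nu> \<delta> in auto)
    have "D.attractor = {0}" using \<nu> by (intro D.attractor_nonpos) simp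
    then show ?thesis using D.hyperbolic_zero_neg D.maximal_invariant_attractor unfolding flw_def tm_def by simp
  qed
  have pos: "hyperbolic_fixed_point (flw \<nu>) (tm \<nu>) 0 \<and> (\<exists>um up zm zp.
      um \<in> ?R \<and> up \<in> ?R \<and> um \<noteq> 0 \<and> up \<noteq> 0 \<and> um \<noteq> up \<and>
      hyperbolic_fixed_point (flw \<nu>) (tm \<nu>) um \<and> hyperbolic_fixed_point (flw \<nu>) (tm \<nu>) up \<and>
      heteroclinic (flw \<nu>) (tm \<nu>) 0 um zm \<and> heteroclinic (flw \<nu>) (tm \<nu>) 0 up zp \<and>
      maximal_invariant_set (flw \<nu>) (tm \<nu>) ?R ({0, um, up} \<union> range zm \<union> range zp))"
    if \<nu>: "\<nu> \<in> {0<..\<delta>}" for \<nu>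
  proof -
    interpret D: ks_pos \<nu> K L C0
      by (intro ks_pos.intro ks_pos_axioms.intro dyn) (use \<nu> \<delta> in auto)
    obtain zm zp where z: "heteroclinic (flw \<nu>) (tm \<nu>) 0 (D.steady (-1)) zm"
      "heteroclinic (flw \<nu>) (tm \<nu>) 0 (D.steady 1) zp"
      "maximal_invariant_set (flw \<nu>) (tm \<nu>) ?R ({0, D.steady (-1), D.steady 1} \<union> range zm \<union> range zp)"
      using D.pitchfork_orbits unfolding flw_def tm_def by blast
    have s: "D.steady (-1) \<in> ?R" "D.steady 1 \<in> ?R" by (auto intro: D.steady_R)
    have hyp: "hyperbolic_fixed_point (flw \<nu>) (tm \<nu>) (D.steady (-1))" "hyperbolic_fixed_point (flw \<nu>) (tm \<nu>) (D.steady 1)"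
      unfolding flw_def tm_def by (auto intro: D.hyperbolic_steady)
    have "hyperbolic_fixed_point (flw \<nu>) (tm \<nu>) 0" unfolding flw_def tm_def by (rule D.hyperbolic_zero_pos)
    then show ?thesis using s hyp z D.steady_distinct by blast
  qed
  have "pitchfork nf_dom (\<lambda>\<nu>. nf_field (1 - \<nu>)) (- \<delta>) \<delta>"
    unfolding pitchfork_def
  proof (intro conjI exI)
    show "- \<delta> < 0" "0 < \<delta>" using \<delta> by auto
    show "\<forall>\<nu>\<in>{- \<delta>..\<delta>}. semiflow_of nf_dom (nf_field (1 - \<nu>)) (flw \<nu>) (tm \<nu>)" using gen by blast
    show "\<forall>\<nu>\<in>{- \<delta>..\<delta>}. isolating_cuboid (flw \<nu>) (tm \<nu>) 1 0 {0} (\<lambda>_ _. 0) ?R" using gen by blast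
    have hyp: "hyperbolic_fixed_point (flw \<nu>) (tm \<nu>) 0" if "\<nu> \<in> {- \<delta>..\<delta>} - {0}" for \<nu>
      using nonpos[of \<nu>] pos[of \<nu>] that by (cases "\<nu> < 0") auto
    have "0 \<in> ?R" using C0 by (simp add: S_box_def)
    then show "let R = cuboid 0 {0} (\<lambda>_ _. 0) ?R 1 in
        0 \<in> R \<and>
        (\<forall>\<nu>\<in>{- \<delta>..\<delta>}. fixed_point (flw \<nu>) (tm \<nu>) 0) \<and>
        (\<forall>\<nu>\<in>{- \<delta>..\<delta>} - {0}. hyperbolic_fixed_point (flw \<nu>) (tm \<nu>) 0) \<and>
        (\<forall>\<nu>\<in>{- \<delta>..0}. maximal_invariant_set (flw \<nu>) (tm \<nu>) R {0}) \<and>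
        (\<forall>\<nu>\<in>{0<..\<delta>}. \<exists>um up zm zp.
          um \<in> R \<and> up \<in> R \<and> um \<noteq> 0 \<and> up \<noteq> 0 \<and> um \<noteq> up \<and>
          hyperbolic_fixed_point (flw \<nu>) (tm \<nu>) um \<and>
          hyperbolic_fixed_point (flw \<nu>) (tm \<nu>) up \<and>
          heteroclinic (flw \<nu>) (tm \<nu>) 0 um zm \<and>
          heteroclinic (flw \<nu>) (tm \<nu>) 0 up zp \<and>
          maximal_invariant_set (flw \<nu>) (tm \<nu>) R ({0, um, up} \<union> range zm \<union> range zp))"
      unfolding Let_def R using gen hyp nonpos pos by blast
  qed simp
  \<comment> \<open>The value of \<open>lam 1\<close> at 1 + \<delta> is - \<delta> and at 1 -
    \<delta> it is \<delta>, so these two parameters are the ends of the interval.\<close>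
  then have pf: "pitchfork nf_dom (\<lambda>\<nu>. normalized_system remainder (1 - \<nu>)) (lam 1 (1 + \<delta>)) (lam 1 (1 - \<delta>))"
    by (simp add: normalized_remainder lam_Suc_0)
  have rb: "remainder_bounds s nf_dom remainder" if "4 \<le> s" for s
  proof -
    interpret S: sbox s by unfold_locales (rule that)
    show ?thesis by (rule S.remainder_bounds_remainder)
  qed
  show ?thesis
  proof (rule exI[of _ nf_list], rule exI[of _ nf_dom], rule exI[of _ remainder], rule exI[of _ "1 - \<delta>"],
      rule exI[of _ "1 + \<delta>"], intro conjI allI impI)
    show "\<exists>s0. \<forall>s\<ge>s0. remainder_bounds s nf_dom remainder" using rb by blast
    show "pitchfork nf_dom (\<lambda>\<nu>. normalized_system remainder (1 - \<nu>)) (lam 1 (1 + \<delta>)) (lam 1 (1 - \<delta>))" by (rule pf)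
  qed (use \<delta> nf_list_nf_subst analytic_diffeo_\<Phi> transforms_\<Phi> in \<open>auto simp: nf_dom_def\<close>)
qed

end
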